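(* Let $\mathcal{H}$ be a finite family of connected graphs. Then the following are equivalent. (i) There is a constant $b>0$ such that $\operatorname{def}(G)<b$ for every connected $\mathcal{H}$-free graph $G$. (ii) There is an even integer $n\ge 4$ such that $$\mathcal{H}\le\left\{K_{1,n},\ T_n,\ \check{K}_n^p : 1\le p\le \tfrac{n}{2}-1\right\}$$ or $$\mathcal{H}\le\left\{K_{1,n},\ F_n^1,\ F_n^2,\ F_n^3,\ F_n^4,\ \check{F}_n^p,\ \check{K}_n^p : 1\le p\le n-2\right\}.$$
   Context: All graphs are finite and simple, and graphs are considered up to isomorphism. For a graph $G$ with matching number $\nu(G)$ (the size of a maximum matching), the deficiency is $\operatorname{def}(G)=|V(G)|-2\nu(G)$. Write $H_1\prec H_2$ if $H_2$ contains an induced subgraph isomorphic to $H_1$. A graph $G$ is $\mathcal{H}$-free if $H\nprec G$ for every $H\in\mathcal{H}$. For families $\mathcal{H}_1,\mathcal{H}_2$ of graphs, $\mathcal{H}_1\le\mathcal{H}_2$ means that for every $H_2\in\mathcal{H}_2$ there is $H_1\in\mathcal{H}_1$ with $H_1\prec H_2$. $P_n$, $C_n$, $K_n$ denote the path, cycle and complete graph on $n$ vertices, and $K_{1,n}$ is the star with $n$ leaves. Attaching a path $P_n$ at a vertex $v$ of a graph means identifying an end of (a new copy of) $P_n$ with $v$ (so $n-1$ new vertices are added). - $T_n$ ($n\ge1$): the graph obtained by attaching two copies of $P_2$ at one end of a path $P_n$. This end of $P_n$ is the branch vertex of $T_n$; the other end of $P_n$ is called the end of $T_n$. In particular $T_1=P_3$,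 whose central vertex is both the branch vertex and the end. Attaching $T_p$ at a vertex $v$ of a graph means identifying the end of (a new copy of) $T_p$ with $v$. - $F_n^1$: the graph obtained by attaching $P_2$ at the central vertex of the path $P_{2n+1}$. - $F_n^2$: the graph obtained by attaching a copy of $P_n$ at each vertex of a triangle $K_3$. - $F_n^3$: the graph obtained by attaching a copy of $P_n$ at each of two fixed nonadjacent vertices of the cycle $C_4$. - $F_n^4$: the graph obtained from $F_n^3$ by adding an edge joining its only two vertices of degree $3$. - $\check{K}_n^p$: the graph obtained by attaching a copy of $T_p$ at each vertex of $K_n$. - $\check{F}_n^p$: the graph obtained from $K_3$ by attaching a copy of $T_p$ at one vertex and a copy of $P_n$ at each of the other two vertices. *)

theory Defs
  imports Complex_Main "Graph_Theory.Graph_Theory"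
begin

text \<open>
  A finite simple graph is a \<^locale>\<open>pair_graph\<close>: a finite, loopless, symmetric digraph without
  parallel arcs, so every edge \<open>uv\<close> is present as the two arcs \<open>(u, v)\<close> and \<open>(v, u)\<close>.
  Since graphs are considered up to isomorphism, vertices are taken to be natural numbers.
  \<^const>\<open>Digraph_Component.connected\<close> excludes the graph without vertices.
\<close>

type_synonym ngraph = "nat pair_pre_digraph"

definition conn_graph :: "'a pair_pre_digraph \<Rightarrow> bool" where
  "conn_graph G \<longleftrightarrow> pair_graph G \<and> Digraph_Component.connected (with_proj G)"


subsection \<open>Matchings and deficiency\<close>

definition uedges :: "'a pair_pre_digraph \<Rightarrow> 'a set set" where
  "uedges G = {{u, v} | u v. (u, v) \<in> parcs G}"

definition matching :: "'a pair_pre_digraph \<Rightarrow> 'a set set \<Rightarrow> bool" where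
  "matching G M \<longleftrightarrow> M \<subseteq> uedges G \<and> pairwise disjnt M"

definition matching_number :: "'a pair_pre_digraph \<Rightarrow> nat" where
  "matching_number G = Max (card ` {M. matching G M})"

definition deficiency :: "'a pair_pre_digraph \<Rightarrow> int" where
  "deficiency G = int (card (pverts G)) - 2 * int (matching_number G)"


subsection \<open>Forbidden induced subgraphs\<close>

definition induced_in :: "'a pair_pre_digraph \<Rightarrow> 'b pair_pre_digraph \<Rightarrow> bool"
    (infix \<open>\<prec>\<^sub>I\<close> 50) where
  "H1 \<prec>\<^sub>I H2 \<longleftrightarrow>
    (\<exists>S. induced_subgraph S (with_proj H2) \<and> digraph_iso (with_proj H1) S)"

definition free_of :: "'a pair_pre_digraph set \<Rightarrow> 'b pair_pre_digraph \<Rightarrow> bool" where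
  "free_of \<H> G \<longleftrightarrow> (\<forall>H\<in>\<H>. \<not> H \<prec>\<^sub>I G)"

definition family_le :: "'a pair_pre_digraph set \<Rightarrow> 'b pair_pre_digraph set \<Rightarrow> bool"
    (infix \<open>\<le>\<^sub>I\<close> 50) where
  "\<H>1 \<le>\<^sub>I \<H>2 \<longleftrightarrow> (\<forall>H2\<in>\<H>2. \<exists>H1\<in>\<H>1. H1 \<prec>\<^sub>I H2)"


subsection \<open>Basic graphs and attaching\<close>

definition ugraph :: "'a set \<Rightarrow> ('a \<times> 'a) set \<Rightarrow> 'a pair_pre_digraph" where
  "ugraph V E = \<lparr>pverts = V, parcs = E \<union> E\<inverse>\<rparr>"

definition path_graph :: "nat \<Rightarrow> ngraph" where
  "path_graph n = ugraph {..<n} {(i, Suc i) | i. Suc i < n}"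

definition cycle_graph :: "nat \<Rightarrow> ngraph" where
  "cycle_graph n = ugraph {..<n} {(i, Suc i mod n) | i. i < n}"

definition complete_graph :: "nat \<Rightarrow> ngraph" where
  "complete_graph n = ugraph {..<n} {(i, j). i < j \<and> j < n}"

definition star_graph :: "nat \<Rightarrow> ngraph" where
  "star_graph n = ugraph {..n} {(0, i) | i. 1 \<le> i \<and> i \<le> n}"

text \<open>
  \<open>attach G v H w\<close> identifies the vertex \<open>w\<close> of a new copy of \<open>H\<close> with the vertex \<open>v\<close> of \<open>G\<close>.
  The vertices of \<open>G\<close> keep their names and the other vertices of \<open>H\<close> are shifted above those
  of \<open>G\<close>, so further graphs can then be attached at vertices of the original \<open>G\<close>.
\<close>

definition attach :: "ngraph \<Rightarrow> nat \<Rightarrow> ngraph \<Rightarrow> nat \<Rightarrow> ngraph" where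
  "attach G v H w =
    (let f = (\<lambda>x. if x = w then v else Suc (Max (pverts G)) + x)
     in \<lparr>pverts = pverts G \<union> f ` pverts H, parcs = parcs G \<union> map_prod f f ` parcs H\<rparr>)"

definition attach_path :: "nat \<Rightarrow> nat \<Rightarrow> ngraph \<Rightarrow> ngraph" where
  "attach_path n v G = attach G v (path_graph n) 0"


subsection \<open>The special graphs\<close>

text \<open>The branch vertex of \<open>T_graph n\<close> is \<open>0\<close>, its end is \<open>n - 1\<close>.\<close>

definition T_graph :: "nat \<Rightarrow> ngraph" where
  "T_graph n = attach_path 2 0 (attach_path 2 0 (path_graph n))"

definition attach_T :: "nat \<Rightarrow> nat \<Rightarrow> ngraph \<Rightarrow> ngraph" where
  "attach_T p v G = attach G v (T_graph p) (p - 1)"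

definition F1_graph :: "nat \<Rightarrow> ngraph" where
  "F1_graph n = attach_path 2 n (path_graph (2 * n + 1))"

definition F2_graph :: "nat \<Rightarrow> ngraph" where
  "F2_graph n = attach_path n 2 (attach_path n 1 (attach_path n 0 (complete_graph 3)))"

definition F3_graph :: "nat \<Rightarrow> ngraph" where
  "F3_graph n = attach_path n 2 (attach_path n 0 (cycle_graph 4))"

text \<open>For \<open>n \<ge> 2\<close> the two vertices of degree 3 in \<open>F3_graph n\<close> are \<open>0\<close> and \<open>2\<close>.\<close>

definition F4_graph :: "nat \<Rightarrow> ngraph" where
  "F4_graph n = \<lparr>pverts = pverts (F3_graph n), parcs = parcs (F3_graph n) \<union> {(0, 2), (2, 0)}\<rparr>"

definition K_check :: "nat \<Rightarrow> nat \<Rightarrow> ngraph" where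
  "K_check n p = fold (attach_T p) [0..<n] (complete_graph n)"

definition F_check :: "nat \<Rightarrow> nat \<Rightarrow> ngraph" where
  "F_check n p = attach_path n 2 (attach_path n 1 (attach_T p 0 (complete_graph 3)))"

end

theory Submission
  imports Defs "HOL-Library.Ramsey" "HOL-Library.Countable"
begin

text \<open>
  Throughout, a fork is a copy of \<open>T\<^sub>p\<close>, that is, an induced path (the stem) whose last vertex has two further
  non-adjacent neighbours; a claw is a copy of \<open>K\<^bsub>1,3\<^esub>\<close>; a spider is a copy of \<open>K\<^sub>n\<close> with \<open>T\<^sub>q\<close> attached at every
  vertex, for some \<open>q \<ge> 1\<close>.

  \<^bold>\<open>From bounded deficiency to the patterns.\<close> If \<open>I\<close> is an independent set with all neighbours in \<open>S\<close>, then
  the deficiency is at least \<open>card I - card S\<close> (\<open>deficiency_lower\<close>). So stars and spiders have large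
  deficiency themselves, and so have long chains: copies of a small core, placed along a line at a large even
  distance. For an edge, a four-cycle, a four-cycle with a chord, and a triangle with an attached \<open>T\<^sub>p\<close> as core,
  each core raises the difference by one (\<open>deficient\<close>). By boundedness, a member of the family is contained in
  the chain. Being connected and small it lies near one core (\<open>emb_in_window\<close>), and the part of the chain near
  a core is \<open>F\<^sup>1\<close>, \<open>F\<^sup>3\<close>, \<open>F\<^sup>4\<close>, or a triangle with two arms and \<open>T\<^sub>p\<close>. If in the last case \<open>p\<close> is large,
  a small connected graph cannot meet both the triangle and the leaves of \<open>T\<^sub>p\<close>, so it is contained in \<open>T\<^sub>N\<close> or
  in \<open>F\<^sup>2\<close> (\<open>hits_T_or_F2\<close>). This is the origin of the two alternatives.

  \<^bold>\<open>From the patterns to bounded deficiency.\<close> Let \<open>G\<close> be connected without an induced \<open>K\<^bsub>1,n\<^esub>\<close> and with large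
  deficiency. By Gallai's lemma, the removal of some set \<open>S\<close> leaves many more than \<open>card S\<close> pairwise separated
  parts (\<open>barrier\<close>). Seen from a root, each part is entered from a vertex of \<open>S\<close>; a vertex cannot enter \<open>n\<close> parts,
  so many vertices enter two of them and are centres of claws (\<open>many_claws\<close>). By Ramsey's theorem there is a
  spider, or there are many pairwise anticomplete claws (\<open>anticomplete_claws\<close>). Moreover, many claws at bounded
  distance from one vertex \<open>r\<close> yield forks with end \<open>r\<close>, and these force a spider (\<open>rooted_forks\<close>).

  Without \<open>T\<^sub>n\<close> all forks are short, so there is a spider in any case, and its stems are too short to contain
  \<open>T\<^sub>n\<close>: it is one of the excluded patterns (\<open>bounded_by_T\<close>). In the second alternative long stems contain \<open>F\<^sup>2\<close>, so
  there is no spider, and three claws that are pairwise far apart can be chosen. They are impossible by \<open>no_claw\<close>: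
  if \<open>F\<^sup>1, \<dots>, F\<^sup>4\<close> and the triangles with two arms and an attached \<open>T\<^sub>q\<close> are excluded, then a geodesic that is
  touched by other vertices only in its middle part is not connected to any claw. Indeed, a vertex outside the
  geodesic can only be a hat (joined to two consecutive vertices) or a twin (joined to three), and
  rerouting the geodesic through such vertices leaves no room for a claw. Two of the three claws and a
  connection to the third one supply such a geodesic (\<open>no_three_far_claws\<close>).
\<close>

section \<open>Induced embeddings\<close>

definition emb :: "'a pair_pre_digraph \<Rightarrow> 'b pair_pre_digraph \<Rightarrow> ('a \<Rightarrow> 'b) \<Rightarrow> bool" where
  "emb H G f \<longleftrightarrow> inj_on f (pverts H) \<and> f ` pverts H \<subseteq> pverts G \<and>
     (\<forall>a\<in>pverts H. \<forall>b\<in>pverts H. (a, b) \<in> parcs H \<longleftrightarrow> (f a, f b) \<in> parcs G)"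

abbreviation adj :: "'a pair_pre_digraph \<Rightarrow> 'a \<Rightarrow> 'a \<Rightarrow> bool" where
  "adj G u v \<equiv> (u, v) \<in> parcs G"

lemma pair_graph_iff:
  "pair_graph G \<longleftrightarrow> finite (pverts G) \<and> parcs G \<subseteq> pverts G \<times> pverts G \<and> sym (parcs G)
     \<and> (\<forall>v. (v, v) \<notin> parcs G)"
proof
  assume "pair_graph G"
  then interpret pair_graph G .
  show "finite (pverts G) \<and> parcs G \<subseteq> pverts G \<times> pverts G \<and> sym (parcs G)
     \<and> (\<forall>v. (v, v) \<notin> parcs G)"
    using pair_finite_verts in_arcsD1 in_arcsD2 pair_sym_arcs pair_no_loops[of "(v, v)" for v]
    by (auto simp: symmetric_def)
next
  assume *: "finite (pverts G) \<and> parcs G \<subseteq> pverts G \<times> pverts G \<and> sym (parcs G)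
     \<and> (\<forall>v. (v, v) \<notin> parcs G)"
  have "finite (parcs G)" using * finite_subset[of "parcs G" "pverts G \<times> pverts G"] by auto
  with * show "pair_graph G"
    by unfold_locales (auto simp: symmetric_def)
qed

text \<open>
  Connectedness in terms of reflexive transitive closure: this is the only place where the walks
  of the digraph library enter.
\<close>

lemma conn_graph_iff:
  "conn_graph G \<longleftrightarrow> pair_graph G \<and> pverts G \<noteq> {} \<and>
     (\<forall>u\<in>pverts G. \<forall>v\<in>pverts G. (u, v) \<in> (parcs G)\<^sup>*)"
proof (cases "pair_graph G")
  case True
  then interpret pair_graph G .
  have s: "sym (parcs G)" and w: "parcs G \<subseteq> pverts G \<times> pverts G"
    using True by (auto simp: pair_graph_iff)
  have m: "parcs (mk_symmetric (with_proj G)) = parcs G"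
    using s by (auto simp: mk_symmetric_def sym_def)
  have v: "pverts (mk_symmetric (with_proj G)) = pverts G"
    by (auto simp: mk_symmetric_def)
  have r: "u \<rightarrow>\<^sup>*\<^bsub>with_proj G\<^esub> v \<longleftrightarrow> (u, v) \<in> (parcs G)\<^sup>*" if "u \<in> pverts G" "v \<in> pverts G" for u v
  proof
    assume "u \<rightarrow>\<^sup>*\<^bsub>with_proj G\<^esub> v"
    then show "(u, v) \<in> (parcs G)\<^sup>*"
      using rtrancl_on_rtranclI[of u v "pverts G" "parcs G"] by (simp add: reachable_def)
  next
    assume "(u, v) \<in> (parcs G)\<^sup>*"
    then have "(u, v) \<in> rtrancl_on (pverts G) (parcs G)"
    proof (induction rule: rtrancl_induct)
      case base
      then show ?case using that(1) by (rule rtrancl_on.intros)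
    next
      case (step y z)
      then show ?case using w by (metis SigmaD2 rtrancl_on.rtrancl_on_into_rtrancl_on subsetD)
    qed
    then show "u \<rightarrow>\<^sup>*\<^bsub>with_proj G\<^esub> v" by (simp add: reachable_def)
  qed
  show ?thesis
    using True r m v by (auto simp: conn_graph_def connected_def strongly_connected_def reachable_def)
qed (simp add: conn_graph_def)

text \<open>
  Induced subgraphs up to isomorphism are handled through embeddings that preserve and reflect
  adjacency; composition and restriction of such maps replace all reasoning about isomorphic copies.
\<close>

lemma induced_in_iff:
  assumes "pair_graph H" "pair_graph G"
  shows "H \<prec>\<^sub>I G \<longleftrightarrow> (\<exists>f. emb H G f)"
proof
  have wH: "parcs H \<subseteq> pverts H \<times> pverts H" using assms by (auto simp: pair_graph_iff)
  assume "H \<prec>\<^sub>I G"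
  then obtain S h where S: "induced_subgraph S (with_proj G)"
    and h: "pre_digraph.digraph_isomorphism (with_proj H) h" and SS: "S = app_iso h (with_proj H)"
    by (auto simp: induced_in_def digraph_iso_def)
  have th: "iso_tail h = fst" "iso_head h = snd"
    using S unfolding SS induced_subgraph_def subgraph_def compatible_def by auto
  have inj: "inj_on (iso_verts h) (pverts H)"
    and ar: "\<And>e. e \<in> parcs H \<Longrightarrow> iso_arcs h e = (iso_verts h (fst e), iso_verts h (snd e))"
    using h th unfolding pre_digraph.digraph_isomorphism_def by (auto simp: prod_eq_iff)
  have arcs: "iso_arcs h ` parcs H = {e \<in> parcs G. fst e \<in> iso_verts h ` pverts H \<and> snd e \<in> iso_verts h ` pverts H}"
    and vs: "iso_verts h ` pverts H \<subseteq> pverts G"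
    using S unfolding SS induced_subgraph_def subgraph_def by auto
  have "emb H G (iso_verts h)"
    unfolding emb_def
  proof (intro conjI ballI)
    fix a b assume ab: "a \<in> pverts H" "b \<in> pverts H"
    show "adj H a b \<longleftrightarrow> adj G (iso_verts h a) (iso_verts h b)"
    proof
      assume "adj H a b"
      then have "iso_arcs h (a, b) \<in> iso_arcs h ` parcs H" by blast
      then show "adj G (iso_verts h a) (iso_verts h b)" using ar[OF \<open>adj H a b\<close>] arcs by auto
    next
      assume "adj G (iso_verts h a) (iso_verts h b)"
      then have "(iso_verts h a, iso_verts h b) \<in> iso_arcs h ` parcs H"
        using ab arcs by auto
      then obtain e where e: "e \<in> parcs H" "iso_arcs h e = (iso_verts h a, iso_verts h b)"
        by (metis imageE)
      then have "fst e = a" "snd e = b"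
        using ar[OF e(1)] inj ab wH by (auto simp: inj_on_def)
      then show "adj H a b" using e by auto
    qed
  qed (use inj vs in auto)
  then show "\<exists>f. emb H G f" by blast
next
  assume "\<exists>f. emb H G f"
  then obtain f where f: "emb H G f" by blast
  define h where "h = \<lparr>iso_verts = f, iso_arcs = map_prod f f, iso_head = snd, iso_tail = fst\<rparr>"
  have wH: "parcs H \<subseteq> pverts H \<times> pverts H" using assms by (auto simp: pair_graph_iff)
  have wfH: "wf_digraph (with_proj H)" and wfG: "wf_digraph (with_proj G)"
    using assms unfolding wf_digraph_wp_iff pair_wf_digraph_def pair_graph_iff by auto
  have h: "pre_digraph.digraph_isomorphism (with_proj H) h"
    unfolding pre_digraph.digraph_isomorphism_def
  proof (intro conjI)
    have i: "inj_on f (pverts H)" using f by (simp add: emb_def)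
    then show "inj_on (iso_verts h) (verts (with_proj H))" by (simp add: h_def)
    show "inj_on (iso_arcs h) (arcs (with_proj H))"
      using inj_on_subset[OF map_prod_inj_on[OF i i] wH] by (simp add: h_def)
  qed (use wfH in \<open>auto simp: h_def\<close>)
  have "induced_subgraph (app_iso h (with_proj H)) (with_proj G)"
    unfolding induced_subgraph_def subgraph_def compatible_def
  proof (intro conjI)
    show "arcs (app_iso h (with_proj H)) = {e \<in> arcs (with_proj G).
      tail (with_proj G) e \<in> verts (app_iso h (with_proj H)) \<and> head (with_proj G) e \<in> verts (app_iso h (with_proj H))}"
    proof (intro set_eqI iffI)
      fix e assume "e \<in> arcs (app_iso h (with_proj H))"
      then obtain a b where "adj H a b" "e = (f a, f b)" by (auto simp: h_def)
      then show "e \<in> {e \<in> arcs (with_proj G).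
        tail (with_proj G) e \<in> verts (app_iso h (with_proj H)) \<and> head (with_proj G) e \<in> verts (app_iso h (with_proj H))}"
        using f wH by (auto simp: h_def emb_def)
    next
      fix e assume "e \<in> {e \<in> arcs (with_proj G).
        tail (with_proj G) e \<in> verts (app_iso h (with_proj H)) \<and> head (with_proj G) e \<in> verts (app_iso h (with_proj H))}"
      then obtain a b where "a \<in> pverts H" "b \<in> pverts H" "e = (f a, f b)" "adj G (f a) (f b)"
        by (cases e) (auto simp: h_def)
      moreover from this have "adj H a b" using f by (simp add: emb_def)
      ultimately show "e \<in> arcs (app_iso h (with_proj H))" by (force simp: h_def)
    qed
    then show "arcs (app_iso h (with_proj H)) \<subseteq> arcs (with_proj G)" by auto
    show "wf_digraph (app_iso h (with_proj H))"
      by unfold_locales (use wH in \<open>auto simp: h_def\<close>)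
  qed (use f wfG in \<open>auto simp: h_def emb_def\<close>)
  then show "H \<prec>\<^sub>I G"
    using h unfolding induced_in_def digraph_iso_def by blast
qed

lemma emb_trans: "emb A B f \<Longrightarrow> emb B C g \<Longrightarrow> emb A C (g \<circ> f)"
  unfolding emb_def by (auto simp: inj_on_def image_subset_iff)

text \<open>
  The form in which small graphs are recognised inside a pattern \<open>P\<close>: it is enough that the image
  of \<open>H\<close> in a big graph lies in the image of \<open>P\<close>.
\<close>

lemma emb_pullback:
  assumes "emb P G g" "emb H G f" "f ` pverts H \<subseteq> g ` pverts P"
  shows "\<exists>h. emb H P h"
proof -
  define h where "h x = inv_into (pverts P) g (f x)" for x
  have h: "h x \<in> pverts P" "g (h x) = f x" if "x \<in> pverts H" for x
    using assms(3) that by (auto simp: h_def inv_into_into f_inv_into_f image_subset_iff)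
  have "emb H P h"
    unfolding emb_def
  proof (intro conjI ballI)
    show "inj_on h (pverts H)"
      using assms(2) h by (metis emb_def inj_on_def)
    show "adj H a b \<longleftrightarrow> adj P (h a) (h b)" if "a \<in> pverts H" "b \<in> pverts H" for a b
      using assms(1,2) h that by (simp add: emb_def)
  qed (use h in auto)
  then show ?thesis by blast
qed

section \<open>Induced paths\<close>

lemma pg_sym: "pair_graph G \<Longrightarrow> adj G u v \<Longrightarrow> adj G v u"
  by (auto simp: pair_graph_iff sym_def)

lemma pg_sym_iff: "pair_graph G \<Longrightarrow> adj G u v \<longleftrightarrow> adj G v u"
  by (auto intro: pg_sym)

lemma pg_irrefl: "pair_graph G \<Longrightarrow> \<not> adj G v v"
  by (auto simp: pair_graph_iff)

lemma pg_verts: "pair_graph G \<Longrightarrow> adj G u v \<Longrightarrow> u \<in> pverts G \<and> v \<in> pverts G"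
  by (auto simp: pair_graph_iff)

definition anti :: "'a pair_pre_digraph \<Rightarrow> 'a set \<Rightarrow> 'a set \<Rightarrow> bool" where
  "anti G A B \<longleftrightarrow> (\<forall>a\<in>A. \<forall>b\<in>B. a \<noteq> b \<and> \<not> adj G a b)"

lemma anti_sym: "pair_graph G \<Longrightarrow> anti G A B \<Longrightarrow> anti G B A"
  by (auto simp: anti_def dest: pg_sym)

lemma anti_Un: "anti G (A \<union> B) C \<longleftrightarrow> anti G A C \<and> anti G B C"
  "anti G C (A \<union> B) \<longleftrightarrow> anti G C A \<and> anti G C B"
  "anti G {} C" "anti G C {}"
  by (auto simp: anti_def)

lemma anti_insert: "anti G (insert a A) C \<longleftrightarrow> (\<forall>c\<in>C. a \<noteq> c \<and> \<not> adj G a c) \<and> anti G A C"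
  "anti G C (insert a A) \<longleftrightarrow> (\<forall>c\<in>C. c \<noteq> a \<and> \<not> adj G c a) \<and> anti G C A"
  by (auto simp: anti_def)

lemma anti_mono: "anti G A B \<Longrightarrow> A' \<subseteq> A \<Longrightarrow> B' \<subseteq> B \<Longrightarrow> anti G A' B'"
  by (auto simp: anti_def)

definition ipath :: "'a pair_pre_digraph \<Rightarrow> 'a list \<Rightarrow> bool" where
  "ipath G xs \<longleftrightarrow> distinct xs \<and> set xs \<subseteq> pverts G \<and>
     (\<forall>i j. i < j \<and> j < length xs \<longrightarrow> (adj G (xs ! i) (xs ! j) \<longleftrightarrow> j = Suc i))"

lemma ipath_Nil [simp]: "ipath G []"
  by (simp add: ipath_def)

text \<open>
  Induced paths are lists, so that the patterns can be assembled by recursion. All conditions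
  between non-consecutive vertices are expressed by \<open>anti\<close>.
\<close>

lemma ipath_Cons:
  "ipath G (x # xs) \<longleftrightarrow> x \<in> pverts G \<and> ipath G xs \<and>
     (xs \<noteq> [] \<longrightarrow> adj G x (hd xs) \<and> x \<noteq> hd xs \<and> anti G {x} (set (tl xs)))"
proof (cases xs)
  case Nil
  then show ?thesis by (auto simp: ipath_def)
next
  case (Cons y ys)
  show ?thesis
  proof
    assume l: "ipath G (x # xs)"
    then have L: "adj G ((x # xs) ! i) ((x # xs) ! j) \<longleftrightarrow> j = Suc i" if "i < j" "j < length (x # xs)" for i j
      using that unfolding ipath_def by blast
    have "ipath G xs"
      unfolding ipath_def
    proof (intro conjI allI impI)
      fix i j assume "i < j \<and> j < length xs"
      then show "adj G (xs ! i) (xs ! j) \<longleftrightarrow> j = Suc i"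
        using L[of "Suc i" "Suc j"] by simp
    qed (use l in \<open>auto simp: ipath_def\<close>)
    moreover have "adj G x y" using L[of 0 1] Cons by simp
    moreover have "\<not> adj G x z" if "z \<in> set ys" for z
    proof -
      obtain k where "k < length ys" "ys ! k = z" using \<open>z \<in> set ys\<close> by (auto simp: in_set_conv_nth)
      then show ?thesis using L[of 0 "Suc (Suc k)"] Cons by simp
    qed
    ultimately show "x \<in> pverts G \<and> ipath G xs \<and>
     (xs \<noteq> [] \<longrightarrow> adj G x (hd xs) \<and> x \<noteq> hd xs \<and> anti G {x} (set (tl xs)))"
      using l Cons by (auto simp: ipath_def anti_def)
  next
    assume r: "x \<in> pverts G \<and> ipath G xs \<and>
     (xs \<noteq> [] \<longrightarrow> adj G x (hd xs) \<and> x \<noteq> hd xs \<and> anti G {x} (set (tl xs)))"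
    show "ipath G (x # xs)"
      unfolding ipath_def
    proof (intro conjI allI impI)
      fix i j assume ij: "i < j \<and> j < length (x # xs)"
      then obtain j' where j: "j = Suc j'" by (cases j) auto
      show "adj G ((x # xs) ! i) ((x # xs) ! j) \<longleftrightarrow> j = Suc i"
      proof (cases i)
        case 0
        show ?thesis
        proof (cases j')
          case (Suc k)
          then have "(x # xs) ! j \<in> set (tl xs)" using ij j Cons by auto
          then show ?thesis using r 0 Suc j Cons by (auto simp: anti_def)
        qed (use r 0 j Cons in auto)
      qed (use r ij j in \<open>auto simp: ipath_def\<close>)
    qed (use r Cons in \<open>auto simp: ipath_def anti_def\<close>)
  qed
qed

lemma ipath_append:
  assumes "xs \<noteq> []" "ys \<noteq> []"
  shows "ipath G (xs @ ys) \<longleftrightarrow> ipath G xs \<and> ipath G ys \<and> adj G (last xs) (hd ys) \<and> last xs \<noteq> hd ys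
      \<and> anti G (set (butlast xs)) (set ys) \<and> anti G {last xs} (set (tl ys))"
  using assms
proof (induction xs)
  case (Cons x xs)
  show ?case
  proof (cases "xs = []")
    case True
    then show ?thesis using Cons.prems by (auto simp: ipath_Cons anti_Un)
  next
    case False
    obtain x' xs' where xs: "xs = x' # xs'" using False by (cases xs) auto
    have bl: "set (butlast (x # xs)) = insert x (set (butlast xs))" using False by simp
    then show ?thesis
      using Cons.IH[OF False Cons.prems(2)] Cons.prems(2)
      unfolding bl ipath_Cons[of G x] append_Cons
      by (auto simp: xs anti_Un anti_insert)
  qed
qed simp

lemma ipath_rev:
  assumes "pair_graph G" "ipath G xs" shows "ipath G (rev xs)"
  unfolding ipath_def
proof (intro conjI allI impI)
  fix i j assume ij: "i < j \<and> j < length (rev xs)"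
  then have "length xs - Suc j < length xs - Suc i" "length xs - Suc i < length xs" by auto
  then have "adj G (xs ! (length xs - Suc j)) (xs ! (length xs - Suc i)) \<longleftrightarrow>
     length xs - Suc i = Suc (length xs - Suc j)"
    using assms(2) unfolding ipath_def by blast
  moreover have "length xs - Suc i = Suc (length xs - Suc j) \<longleftrightarrow> j = Suc i"
    using ij by auto
  ultimately show "adj G (rev xs ! i) (rev xs ! j) \<longleftrightarrow> j = Suc i"
    using ij assms(1) by (auto simp: rev_nth pg_sym_iff[of G "xs ! (length xs - Suc j)"])
qed (use assms in \<open>auto simp: ipath_def\<close>)

lemma ipath_appendD:
  assumes "ipath G (xs @ ys)" shows "ipath G xs" "ipath G ys"
  using assms by (cases "xs = []"; cases "ys = []"; simp add: ipath_append)+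

lemma ipath_take: "ipath G xs \<Longrightarrow> ipath G (take k xs)"
  by (metis append_take_drop_id ipath_appendD(1))

lemma ipath_drop: "ipath G xs \<Longrightarrow> ipath G (drop k xs)"
  by (metis append_take_drop_id ipath_appendD(2))

section \<open>Attaching graphs\<close>

lemma pverts_attach:
  "pverts (attach G v H w) = pverts G \<union> (\<lambda>x. if x = w then v else Suc (Max (pverts G)) + x) ` pverts H"
  by (simp add: attach_def Let_def)

text \<open>
  Embeddings of two graphs that agree on the attaching vertex can be glued, provided that their
  remaining images are disjoint and not joined by an edge. Every pattern of the theorem is built by
  attaching, so every recognition lemma below is an iteration of this one.
\<close>

lemma emb_attach:
  assumes G: "pair_graph G" and H: "pair_graph H" and X: "pair_graph X"
    and f: "emb G X f" and g: "emb H X g" and vw: "v \<in> pverts G" "w \<in> pverts H" "f v = g w"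
    and d: "f ` pverts G \<inter> g ` (pverts H - {w}) = {}"
    and an: "anti X (f ` (pverts G - {v})) (g ` (pverts H - {w}))"
  shows "\<exists>h. emb (attach G v H w) X h \<and> (\<forall>x\<in>pverts G. h x = f x) \<and>
     h ` pverts (attach G v H w) = f ` pverts G \<union> g ` pverts H"
proof -
  define M where "M = Suc (Max (pverts G))"
  define F where "F x = (if x = w then v else M + x)" for x
  have Ff: "F = (\<lambda>x. if x = w then v else Suc (Max (pverts G)) + x)"
    by (simp add: F_def M_def fun_eq_iff)
  define h where "h x = (if x \<in> pverts G then f x else g (x - M))" for x
  have M: "x < M" if "x \<in> pverts G" for x
    using that G unfolding M_def by (simp add: pair_graph_iff less_Suc_eq_le)
  have hf: "h x = f x" if "x \<in> pverts G" for x using that by (simp add: h_def)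
  have hF: "h (F y) = g y" if "y \<in> pverts H" for y
    using that vw M[of "M + y"] by (auto simp: F_def h_def)
  have V: "pverts (attach G v H w) = pverts G \<union> F ` pverts H"
    and A: "parcs (attach G v H w) = parcs G \<union> map_prod F F ` parcs H"
    unfolding Ff by (auto simp: attach_def Let_def)
  have Finj: "F x = F y \<longleftrightarrow> x = y" for x y
    using M[OF vw(1)] by (auto simp: F_def)
  have FG: "F y \<in> pverts G \<longleftrightarrow> y = w" for y
    using M[of "M + y"] vw by (auto simp: F_def)
  have img: "h ` pverts (attach G v H w) = f ` pverts G \<union> g ` pverts H"
    using hf hF unfolding V image_Un image_image by auto
  have GV: "adj G a b \<Longrightarrow> a \<in> pverts G \<and> b \<in> pverts G" for a b using pg_verts[OF G] .
  have HV: "adj H a b \<Longrightarrow> a \<in> pverts H \<and> b \<in> pverts H" for a b using pg_verts[OF H] .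
  have A1: "adj (attach G v H w) a b \<longleftrightarrow> adj G a b" if "a \<in> pverts G" "b \<in> pverts G" for a b
  proof -
    have "\<not> (a, b) \<in> map_prod F F ` parcs H"
    proof
      assume "(a, b) \<in> map_prod F F ` parcs H"
      then obtain x y where "adj H x y" "F x = a" "F y = b" by auto
      then show False using that FG pg_irrefl[OF H] by metis
    qed
    then show ?thesis by (simp add: A)
  qed
  have A2: "adj (attach G v H w) (F a) (F b) \<longleftrightarrow> adj H a b" if "a \<in> pverts H" "b \<in> pverts H" for a b
  proof -
    have "\<not> adj G (F a) (F b)"
      using GV FG pg_irrefl[OF G] by metis
    then show ?thesis using Finj by (auto simp: A)
  qed
  have A3: "\<not> adj (attach G v H w) a (F b)" "\<not> adj (attach G v H w) (F b) a"
    if "a \<in> pverts G" "a \<noteq> v" "b \<in> pverts H" "b \<noteq> w" for a b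
    using that FG GV by (auto simp: A) (metis F_def)+
  have X3: "\<not> adj X (f a) (g b)" "\<not> adj X (g b) (f a)" "f a \<noteq> g b"
    if "a \<in> pverts G" "a \<noteq> v" "b \<in> pverts H" "b \<noteq> w" for a b
    using an that pg_sym[OF X] unfolding anti_def by blast+
  have fv: "F w = v" by (simp add: F_def)
  have dec: "a \<in> pverts G \<or> (\<exists>y\<in>pverts H. y \<noteq> w \<and> a = F y)" if "a \<in> pverts (attach G v H w)" for a
    using that vw fv unfolding V by auto
  have "emb (attach G v H w) X h"
    unfolding emb_def
  proof (intro conjI ballI)
    show "h ` pverts (attach G v H w) \<subseteq> pverts X"
      unfolding img using f g by (auto simp: emb_def)
    show "inj_on h (pverts (attach G v H w))"
    proof (rule inj_onI)
      fix a b assume a: "a \<in> pverts (attach G v H w)" and b: "b \<in> pverts (attach G v H w)" and e: "h a = h b"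
      have fi: "inj_on f (pverts G)" "inj_on g (pverts H)" using f g by (auto simp: emb_def)
      from dec[OF a] dec[OF b] show "a = b"
      proof (elim disjE bexE conjE)
        assume "a \<in> pverts G" "b \<in> pverts G"
        then show ?thesis using e hf fi by (auto dest: inj_onD)
      next
        fix y assume "a \<in> pverts G" "y \<in> pverts H" "y \<noteq> w" "b = F y"
        then show ?thesis using e hf hF d by auto
      next
        fix y assume "b \<in> pverts G" "y \<in> pverts H" "y \<noteq> w" "a = F y"
        then show ?thesis using e hf hF d by (metis DiffI disjoint_iff imageI singletonD)
      next
        fix y z assume "z \<in> pverts H" "b = F z" "y \<in> pverts H" "a = F y"
        then show ?thesis using e hF fi by (metis inj_onD)
      qed
    qed
    fix a b assume a: "a \<in> pverts (attach G v H w)" and b: "b \<in> pverts (attach G v H w)"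
    have fe: "\<And>a b. a \<in> pverts G \<Longrightarrow> b \<in> pverts G \<Longrightarrow> adj G a b \<longleftrightarrow> adj X (f a) (f b)"
      "\<And>a b. a \<in> pverts H \<Longrightarrow> b \<in> pverts H \<Longrightarrow> adj H a b \<longleftrightarrow> adj X (g a) (g b)"
      using f g by (auto simp: emb_def)
    from dec[OF a] dec[OF b] show "adj (attach G v H w) a b \<longleftrightarrow> adj X (h a) (h b)"
    proof (elim disjE bexE conjE)
      assume "a \<in> pverts G" "b \<in> pverts G"
      then show ?thesis using hf A1 fe by auto
    next
      fix y assume *: "a \<in> pverts G" "y \<in> pverts H" "y \<noteq> w" "b = F y"
      show ?thesis
      proof (cases "a = v")
        case True
        then show ?thesis using * A2[OF vw(2), of y] fv hf hF fe(2)[OF vw(2), of y] vw by metis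
      next
        case False
        then show ?thesis using * A3 X3 hf hF by metis
      qed
    next
      fix y assume *: "b \<in> pverts G" "y \<in> pverts H" "y \<noteq> w" "a = F y"
      show ?thesis
      proof (cases "b = v")
        case True
        then show ?thesis using * A2[of y, OF _ vw(2)] fv hf hF fe(2)[of y, OF _ vw(2)] vw by metis
      next
        case False
        then show ?thesis using * A3 X3 hf hF by metis
      qed
    next
      fix y z assume "z \<in> pverts H" "b = F z" "y \<in> pverts H" "a = F y"
      then show ?thesis using A2 fe hF by simp
    qed
  qed
  then show ?thesis using hf img by blast
qed

lemma pair_graph_attach:
  assumes G: "pair_graph G" and H: "pair_graph H" and v: "v \<in> pverts G"
  shows "pair_graph (attach G v H w)"
proof -
  define M where "M = Suc (Max (pverts G))"
  define F where "F x = (if x = w then v else M + x)" for x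
  have Ff: "F = (\<lambda>x. if x = w then v else Suc (Max (pverts G)) + x)"
    by (simp add: F_def M_def fun_eq_iff)
  have V: "pverts (attach G v H w) = pverts G \<union> F ` pverts H"
    and A: "parcs (attach G v H w) = parcs G \<union> map_prod F F ` parcs H"
    unfolding Ff by (auto simp: attach_def Let_def)
  have M: "x < M" if "x \<in> pverts G" for x
    using that G unfolding M_def by (simp add: pair_graph_iff less_Suc_eq_le)
  have Finj: "F x = F y \<longleftrightarrow> x = y" for x y
    using M[OF v] by (auto simp: F_def)
  have "sym (parcs (attach G v H w))" unfolding A
    using G H by (intro sym_Un) (auto simp: pair_graph_iff sym_def)
  then show ?thesis using G H unfolding pair_graph_iff[of "attach G v H w"] V A
    by (auto simp: pair_graph_iff Finj)
qed

lemma pair_graph_ugraph: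
  "finite V \<Longrightarrow> E \<subseteq> V \<times> V \<Longrightarrow> (\<And>v. (v, v) \<notin> E) \<Longrightarrow> pair_graph (ugraph V E)"
  by (auto simp: pair_graph_iff ugraph_def sym_def)

lemma pair_graph_path: "pair_graph (path_graph n)"
  unfolding path_graph_def by (rule pair_graph_ugraph) auto

lemma pair_graph_complete: "pair_graph (complete_graph n)"
  unfolding complete_graph_def by (rule pair_graph_ugraph) auto

lemma pair_graph_cycle4: "pair_graph (cycle_graph 4)"
  unfolding cycle_graph_def by (rule pair_graph_ugraph) (auto, presburger)

lemma pair_graph_star: "pair_graph (star_graph n)"
  unfolding star_graph_def by (rule pair_graph_ugraph) auto

lemma pair_graph_attach_path: "pair_graph G \<Longrightarrow> v \<in> pverts G \<Longrightarrow> pair_graph (attach_path n v G)"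
  unfolding attach_path_def by (rule pair_graph_attach[OF _ pair_graph_path])

lemma pverts_attach_path: "v \<in> pverts G \<Longrightarrow> v \<in> pverts (attach_path n w G)"
  by (simp add: attach_path_def pverts_attach)

lemma pverts_path [simp]: "pverts (path_graph n) = {..<n}"
  by (simp add: path_graph_def ugraph_def)

lemma adj_path: "adj (path_graph n) i j \<longleftrightarrow> i < n \<and> j < n \<and> (j = Suc i \<or> i = Suc j)"
  by (auto simp: path_graph_def ugraph_def)

lemma emb_path:
  assumes "pair_graph X" "ipath X xs"
  shows "emb (path_graph (length xs)) X ((!) xs)"
  unfolding emb_def pverts_path
proof (intro conjI ballI)
  show "inj_on ((!) xs) {..<length xs}" using assms by (auto simp: ipath_def inj_on_def nth_eq_iff_index_eq)
  show "(!) xs ` {..<length xs} \<subseteq> pverts X" using assms by (auto simp: ipath_def)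
  fix i j assume ij: "i \<in> {..<length xs}" "j \<in> {..<length xs}"
  consider "i < j" | "i = j" | "j < i" by linarith
  then show "adj (path_graph (length xs)) i j \<longleftrightarrow> adj X (xs ! i) (xs ! j)"
  proof cases
    case 2
    then show ?thesis using pg_irrefl[OF assms(1)] by (simp add: adj_path)
  next
    case 1
    then show ?thesis using assms(2) ij by (auto simp: adj_path ipath_def)
  next
    case 3
    then have "adj X (xs ! j) (xs ! i) \<longleftrightarrow> i = Suc j" using assms(2) ij by (auto simp: ipath_def)
    then show ?thesis using 3 ij pg_sym_iff[OF assms(1)] by (auto simp: adj_path)
  qed
qed

lemma nth_image_set: "(!) xs ` {..<length xs} = set xs"
  by (auto simp: set_conv_nth)

lemma emb_attach_path:
  assumes G: "pair_graph G" and X: "pair_graph X" and f: "emb G X f" and v: "v \<in> pverts G"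
    and p: "ipath X (f v # xs)" and n: "n = Suc (length xs)"
    and an: "anti X (f ` (pverts G - {v})) (set xs)"
  shows "\<exists>h. emb (attach_path n v G) X h \<and> (\<forall>x\<in>pverts G. h x = f x) \<and>
     h ` pverts (attach_path n v G) = f ` pverts G \<union> set xs"
proof -
  let ?g = "(!) (f v # xs)"
  have g: "emb (path_graph n) X ?g" using emb_path[OF X p] n by simp
  have i0: "?g ` (pverts (path_graph n) - {0}) = set xs"
  proof -
    have "pverts (path_graph n) - {0} = Suc ` {..<length xs}"
      using n by (auto simp: image_iff) (metis Suc_less_eq lessThan_iff not0_implies_Suc)
    then show ?thesis by (simp only: image_image nth_Cons_Suc nth_image_set)
  qed
  have "f v \<notin> set xs" using p by (auto simp: ipath_def)
  then have d: "f ` pverts G \<inter> set xs = {}" using an by (auto simp: anti_def)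
  have "?g ` pverts (path_graph n) = insert (f v) (set xs)"
    using nth_image_set[of "f v # xs"] n by simp
  then have im: "f ` pverts G \<union> ?g ` pverts (path_graph n) = f ` pverts G \<union> set xs"
    using v by auto
  have "0 \<in> pverts (path_graph n)" "f v = ?g 0" using n by auto
  then show ?thesis
    using emb_attach[OF G pair_graph_path X f g v, of 0] an d unfolding i0 im attach_path_def by blast
qed

text \<open>
  A copy of \<open>T\<^sub>p\<close>, where \<open>p\<close> is the length of \<open>ws\<close>: the head of \<open>ws\<close> is the end of \<open>T\<^sub>p\<close>, the last
  element is its branch vertex, and \<open>a\<close> and \<open>b\<close> are the two leaves.
\<close>

definition fork :: "'a pair_pre_digraph \<Rightarrow> 'a list \<Rightarrow> 'a \<Rightarrow> 'a \<Rightarrow> bool" where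
  "fork G ws a b \<longleftrightarrow> ws \<noteq> [] \<and> ipath G (ws @ [a]) \<and> ipath G (ws @ [b]) \<and> a \<noteq> b \<and> \<not> adj G a b"

lemma emb_T:
  assumes X: "pair_graph X" and k: "fork X ws a b"
  shows "\<exists>h. emb (T_graph (length ws)) X h \<and> h (length ws - 1) = hd ws \<and>
     h ` pverts (T_graph (length ws)) = set ws \<union> {a, b}"
proof -
  let ?n = "length ws" let ?f = "(!) (rev ws)"
  have ne: "ws \<noteq> []" using k by (simp add: fork_def)
  have f: "emb (path_graph ?n) X ?f"
    using emb_path[OF X ipath_rev[OF X]] ipath_appendD(1) k by (metis fork_def length_rev)
  have img: "?f ` pverts (path_graph ?n) = set ws" using nth_image_set[of "rev ws"] by simp
  have f0: "?f 0 = last ws" using ne by (simp add: hd_rev flip: hd_conv_nth)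
  have img0: "?f ` (pverts (path_graph ?n) - {0}) = set (butlast ws)"
  proof -
    have "set (butlast ws) = set (tl (rev ws))" by (metis butlast_rev rev_rev_ident set_rev)
    also have "\<dots> = ?f ` (pverts (path_graph ?n) - {0})"
    proof -
      have "pverts (path_graph ?n) - {0} = Suc ` {..<?n - 1}"
        using ne by (auto simp: image_iff) (metis Suc_less_eq Suc_pred lessThan_iff length_greater_0_conv not0_implies_Suc)
      moreover have "?f (Suc i) = tl (rev ws) ! i" if "i < ?n - 1" for i
        using that by (simp add: nth_tl)
      ultimately show ?thesis using nth_image_set[of "tl (rev ws)"] by (simp add: image_image)
    qed
    finally show ?thesis by simp
  qed
  have v0: "0 \<in> pverts (path_graph ?n)" using ne by auto
  have ab: "adj X (last ws) a" "adj X (last ws) b" "anti X (set (butlast ws)) {a, b}"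
    "ipath X [last ws, a]" "ipath X [last ws, b]"
    using k ne pg_verts[OF X] unfolding fork_def
    by (auto simp: ipath_append ipath_Cons anti_insert anti_Un)
  have "\<exists>h. emb (attach_path 2 0 (path_graph ?n)) X h \<and> (\<forall>x\<in>pverts (path_graph ?n). h x = ?f x) \<and>
     h ` pverts (attach_path 2 0 (path_graph ?n)) = ?f ` pverts (path_graph ?n) \<union> set [a]"
    by (rule emb_attach_path[OF pair_graph_path X f v0])
      (use ab f0 img0 in \<open>auto simp: anti_insert\<close>)
  then obtain h where h: "emb (attach_path 2 0 (path_graph ?n)) X h"
    "\<And>x. x < ?n \<Longrightarrow> h x = ?f x" "h ` pverts (attach_path 2 0 (path_graph ?n)) = set ws \<union> {a}"
    using img by auto
  let ?G1 = "attach_path 2 0 (path_graph ?n)"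
  have v1: "0 \<in> pverts ?G1" using v0 by (rule pverts_attach_path)
  have h0: "h 0 = last ws" using h(2)[of 0] f0 ne by simp
  have "h ` (pverts ?G1 - {0}) = (set ws \<union> {a}) - {last ws}"
    using inj_on_image_set_diff[of h "pverts ?G1" "pverts ?G1" "{0}"] h v1 h0 by (auto simp: emb_def)
  moreover have "set ws = insert (last ws) (set (butlast ws))"
  proof -
    have "set ws = set (butlast ws @ [last ws])" using ne by simp
    then show ?thesis by (simp del: append_butlast_last_id)
  qed
  ultimately have "anti X (h ` (pverts ?G1 - {0})) {b}"
    using ab k by (auto simp: anti_def fork_def)
  then have "\<exists>h'. emb (attach_path 2 0 ?G1) X h' \<and> (\<forall>x\<in>pverts ?G1. h' x = h x) \<and>
     h' ` pverts (attach_path 2 0 ?G1) = h ` pverts ?G1 \<union> set [b]"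
    by (intro emb_attach_path[OF pair_graph_attach_path[OF pair_graph_path v0] X h(1) v1])
      (use ab h0 in auto)
  then obtain h' where h': "emb (T_graph ?n) X h'" "\<And>x. x \<in> pverts ?G1 \<Longrightarrow> h' x = h x"
     "h' ` pverts (T_graph ?n) = set ws \<union> {a, b}"
    using h(3) unfolding T_graph_def by (auto simp: insert_commute)
  have "?n - 1 \<in> pverts ?G1" using ne by (intro pverts_attach_path) auto
  then have "h' (?n - 1) = hd ws" using h'(2) h(2)[of "?n - 1"] ne by (simp add: rev_nth hd_conv_nth)
  then show ?thesis using h' by blast
qed

lemma pair_graph_T: "1 \<le> p \<Longrightarrow> pair_graph (T_graph p)"
  unfolding T_graph_def
  by (intro pair_graph_attach_path pair_graph_path pverts_attach_path) auto

lemma T_end: "1 \<le> p \<Longrightarrow> p - 1 \<in> pverts (T_graph p)"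
  unfolding T_graph_def by (intro pverts_attach_path) auto

lemma emb_attach_T:
  assumes G: "pair_graph G" and X: "pair_graph X" and f: "emb G X f" and v: "v \<in> pverts G"
    and k: "fork X (f v # us) a b" and p: "p = Suc (length us)"
    and an: "anti X (f ` (pverts G - {v})) (set us \<union> {a, b})"
  shows "\<exists>h. emb (attach_T p v G) X h \<and> (\<forall>x\<in>pverts G. h x = f x) \<and>
     h ` pverts (attach_T p v G) = f ` pverts G \<union> set us \<union> {a, b}"
proof -
  obtain g where g: "emb (T_graph p) X g" "g (p - 1) = f v"
    "g ` pverts (T_graph p) = insert (f v) (set us \<union> {a, b})"
    using emb_T[OF X k] p by auto
  have p1: "1 \<le> p" using p by simp
  have nin: "f v \<notin> set us \<union> {a, b}" using k by (auto simp: fork_def ipath_def)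
  have "g ` (pverts (T_graph p) - {p - 1}) = g ` pverts (T_graph p) - {f v}"
    using inj_on_image_set_diff[of g "pverts (T_graph p)" "pverts (T_graph p)" "{p - 1}"] g T_end[OF p1]
    by (auto simp: emb_def)
  then have i: "g ` (pverts (T_graph p) - {p - 1}) = set us \<union> {a, b}" using g(3) nin by auto
  have d: "f ` pverts G \<inter> (set us \<union> {a, b}) = {}" using an nin by (auto simp: anti_def)
  have im: "f ` pverts G \<union> g ` pverts (T_graph p) = f ` pverts G \<union> set us \<union> {a, b}"
    unfolding g(3) using v by auto
  show ?thesis
    using emb_attach[OF G pair_graph_T[OF p1] X f g(1) v T_end[OF p1] g(2)[symmetric]] an d
    unfolding i im attach_T_def by blast
qed

lemma pair_graph_attach_T: "1 \<le> p \<Longrightarrow> pair_graph G \<Longrightarrow> v \<in> pverts G \<Longrightarrow> pair_graph (attach_T p v G)"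
  unfolding attach_T_def by (intro pair_graph_attach pair_graph_T)

lemma pverts_attach_T: "v \<in> pverts G \<Longrightarrow> v \<in> pverts (attach_T p w G)"
  by (simp add: attach_T_def pverts_attach)

section \<open>Recognising the patterns\<close>

text \<open>
  A copy of the graph obtained by attaching \<open>T\<^sub>q\<close> at every vertex of \<open>K\<^sub>n\<close>: the heads of the stems
  form the clique.
\<close>

definition spider :: "'a pair_pre_digraph \<Rightarrow> nat \<Rightarrow> nat \<Rightarrow> (nat \<Rightarrow> 'a list) \<Rightarrow> (nat \<Rightarrow> 'a) \<Rightarrow> (nat \<Rightarrow> 'a) \<Rightarrow> bool"
  where "spider G n q ws a b \<longleftrightarrow>
     (\<forall>i<n. fork G (ws i) (a i) (b i) \<and> length (ws i) = q) \<and>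
     (\<forall>i<n. \<forall>j<n. i \<noteq> j \<longrightarrow> hd (ws i) \<noteq> hd (ws j) \<and> adj G (hd (ws i)) (hd (ws j)) \<and>
        anti G (set (tl (ws i)) \<union> {a i, b i}) (set (ws j) \<union> {a j, b j}))"

lemma pverts_complete [simp]: "pverts (complete_graph n) = {..<n}"
  by (simp add: complete_graph_def ugraph_def)

lemma adj_complete: "adj (complete_graph n) i j \<longleftrightarrow> i < n \<and> j < n \<and> i \<noteq> j"
  by (auto simp: complete_graph_def ugraph_def)

lemma emb_complete:
  assumes X: "pair_graph X" and "\<And>i. i < n \<Longrightarrow> h i \<in> pverts X"
    and "\<And>i j. i < n \<Longrightarrow> j < n \<Longrightarrow> i \<noteq> j \<Longrightarrow> h i \<noteq> h j \<and> adj X (h i) (h j)"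
  shows "emb (complete_graph n) X h"
  using assms pg_irrefl[OF X] unfolding emb_def
  by (auto simp: inj_on_def adj_complete)

lemma emb_K_check:
  assumes X: "pair_graph X" and s: "spider X n q ws a b" and q: "1 \<le> q"
  shows "\<exists>h. emb (K_check n q) X h \<and> h ` pverts (K_check n q) = (\<Union>i<n. set (ws i) \<union> {a i, b i})"
proof -
  define W where "W k = fold (attach_T q) [0..<k] (complete_graph n)" for k
  have fk: "fork X (ws i) (a i) (b i)" "length (ws i) = q" if "i < n" for i
    using s that by (auto simp: spider_def)
  have ne: "ws i = hd (ws i) # tl (ws i)" if "i < n" for i
    using fk[OF that] q by (cases "ws i") auto
  have iw: "ipath X (ws i)" if "i < n" for i
    using fk(1)[OF that] ipath_appendD(1) unfolding fork_def by blast
  have sw: "set (ws i) = insert (hd (ws i)) (set (tl (ws i)))" if "i < n" for i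
    using ne[OF that] by (metis list.simps(15))
  have hV: "hd (ws i) \<in> pverts X" if "i < n" for i
    using iw[OF that] sw[OF that] by (auto simp: ipath_def)
  have "k \<le> n \<Longrightarrow> pair_graph (W k) \<and> {..<n} \<subseteq> pverts (W k) \<and> (\<exists>h. emb (W k) X h \<and> (\<forall>i<n. h i = hd (ws i)) \<and>
     h ` pverts (W k) = (\<lambda>i. hd (ws i)) ` {..<n} \<union> (\<Union>i<k. set (tl (ws i)) \<union> {a i, b i}))" for k
  proof (induction k)
    case 0
    have "emb (complete_graph n) X (\<lambda>i. hd (ws i))"
      by (rule emb_complete[OF X]) (use s hV in \<open>auto simp: spider_def\<close>)
    then show ?case by (auto simp: W_def pair_graph_complete)
  next
    case (Suc k)
    then have kn: "k < n" by simp
    from Suc obtain h where IH: "pair_graph (W k)" "{..<n} \<subseteq> pverts (W k)" "emb (W k) X h"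
      "\<And>i. i < n \<Longrightarrow> h i = hd (ws i)"
      "h ` pverts (W k) = (\<lambda>i. hd (ws i)) ` {..<n} \<union> (\<Union>i<k. set (tl (ws i)) \<union> {a i, b i})" by auto
    have WS: "W (Suc k) = attach_T q k (W k)" by (simp add: W_def)
    have kW: "k \<in> pverts (W k)" using IH kn by auto
    have "h ` (pverts (W k) - {k}) = h ` pverts (W k) - {hd (ws k)}"
      using inj_on_image_set_diff[of h "pverts (W k)" "pverts (W k)" "{k}"] IH(3,4) kW kn by (auto simp: emb_def)
    also have "\<dots> \<subseteq> (\<Union>i\<in>{..<n}-{k}. set (ws i) \<union> {a i, b i})"
      unfolding IH(5) using sw kn by fastforce
    finally have sub: "h ` (pverts (W k) - {k}) \<subseteq> (\<Union>i\<in>{..<n}-{k}. set (ws i) \<union> {a i, b i})" .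
    have "anti X (set (tl (ws k)) \<union> {a k, b k}) (\<Union>i\<in>{..<n}-{k}. set (ws i) \<union> {a i, b i})"
      using s kn unfolding spider_def anti_def by blast
    then have an: "anti X (h ` (pverts (W k) - {k})) (set (tl (ws k)) \<union> {a k, b k})"
      using anti_sym[OF X] anti_mono sub by blast
    have fk': "fork X (h k # tl (ws k)) (a k) (b k)" using fk(1)[OF kn] ne[OF kn] IH(4)[OF kn] by simp
    have ql: "q = Suc (length (tl (ws k)))" using fk(2)[OF kn] q by simp
    obtain h' where h': "emb (W (Suc k)) X h'" "\<And>x. x \<in> pverts (W k) \<Longrightarrow> h' x = h x"
      "h' ` pverts (W (Suc k)) = h ` pverts (W k) \<union> set (tl (ws k)) \<union> {a k, b k}"
      using emb_attach_T[OF IH(1) X IH(3) kW fk' ql an] unfolding WS by blast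
    have "{..<n} \<subseteq> pverts (W (Suc k))" using IH(2) pverts_attach_T unfolding WS by blast
    moreover have "pair_graph (W (Suc k))" unfolding WS using pair_graph_attach_T[OF q IH(1) kW] .
    moreover have "h' ` pverts (W (Suc k)) = (\<lambda>i. hd (ws i)) ` {..<n} \<union> (\<Union>i<Suc k. set (tl (ws i)) \<union> {a i, b i})"
      unfolding h'(3) IH(5) lessThan_Suc by auto
    moreover have "\<forall>i<n. h' i = hd (ws i)" using h'(2) IH(2,4) by (metis lessThan_iff subsetD)
    ultimately show ?case using h'(1) by blast
  qed
  from this[of n] obtain h where h: "emb (W n) X h"
    "h ` pverts (W n) = (\<lambda>i. hd (ws i)) ` {..<n} \<union> (\<Union>i<n. set (tl (ws i)) \<union> {a i, b i})" by auto
  have "(\<lambda>i. hd (ws i)) ` {..<n} \<union> (\<Union>i<n. set (tl (ws i)) \<union> {a i, b i}) = (\<Union>i<n. set (ws i) \<union> {a i, b i})"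
    using sw by fastforce
  then show ?thesis using h by (auto simp: K_check_def W_def)
qed

lemma pair_graph_K_check: "1 \<le> q \<Longrightarrow> pair_graph (K_check n q)"
proof -
  assume q: "1 \<le> q"
  have "k \<le> n \<Longrightarrow> pair_graph (fold (attach_T q) [0..<k] (complete_graph n)) \<and>
     {..<n} \<subseteq> pverts (fold (attach_T q) [0..<k] (complete_graph n))" for k
  proof (induction k)
    case (Suc k)
    then show ?case using q by (auto intro!: pair_graph_attach_T dest: pverts_attach_T)
  qed (auto simp: pair_graph_complete)
  then show ?thesis unfolding K_check_def by blast
qed

lemma emb_F1:
  assumes X: "pair_graph X" and p: "ipath X (ls @ c # rs)" and n: "length ls = n" "length rs = n"
    and y: "adj X c y" "anti X {y} (set ls \<union> set rs)"
  shows "\<exists>h. emb (F1_graph n) X h \<and> h ` pverts (F1_graph n) = {c, y} \<union> set ls \<union> set rs"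
proof -
  let ?xs = "ls @ c # rs" let ?N = "2 * n + 1"
  have len: "length ?xs = ?N" using n by simp
  have f: "emb (path_graph ?N) X ((!) ?xs)" using emb_path[OF X p] len by simp
  have c: "?xs ! n = c" using n by (simp add: nth_append)
  have img: "(!) ?xs ` pverts (path_graph ?N) = set ?xs" using nth_image_set[of ?xs] len by simp
  have v: "n \<in> pverts (path_graph ?N)" by simp
  have "(!) ?xs ` (pverts (path_graph ?N) - {n}) = (!) ?xs ` pverts (path_graph ?N) - {c}"
    using inj_on_image_set_diff[of "(!) ?xs" "pverts (path_graph ?N)" "pverts (path_graph ?N)" "{n}"] f c
    by (auto simp: emb_def)
  then have "(!) ?xs ` (pverts (path_graph ?N) - {n}) \<subseteq> set ls \<union> set rs" using img by auto
  then have an: "anti X ((!) ?xs ` (pverts (path_graph ?N) - {n})) (set [y])"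
    using anti_mono[OF anti_sym[OF X y(2)]] by simp
  have "ipath X [?xs ! n, y]" unfolding c using y pg_verts[OF X y(1)] pg_irrefl[OF X]
    by (auto simp: ipath_Cons anti_Un)
  from emb_attach_path[OF pair_graph_path X f v this _ an, of 2]
  obtain h where "emb (attach_path 2 n (path_graph ?N)) X h"
    "h ` pverts (attach_path 2 n (path_graph ?N)) = set ?xs \<union> set [y]"
    unfolding img by auto
  then show ?thesis unfolding F1_graph_def by auto
qed

lemma pair_graph_F1: "pair_graph (F1_graph n)"
  unfolding F1_graph_def by (rule pair_graph_attach_path[OF pair_graph_path]) simp

text \<open>
  \<open>F\<^sup>2\<close>, \<open>F\<^sup>3\<close> and the graphs with one attached \<open>T\<^sub>q\<close> all end with two paths attached at distinct
  vertices of a graph that is already embedded.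
\<close>

lemma emb_attach_path2:
  assumes G: "pair_graph G" and X: "pair_graph X" and f: "emb G X f" and v: "v \<in> pverts G" "w \<in> pverts G"
    and vw: "v \<noteq> w"
    and p: "ipath X (f v # xs)" "ipath X (f w # ys)" and n: "n = Suc (length xs)" "n = Suc (length ys)"
    and an: "anti X (f ` (pverts G - {v})) (set xs)" "anti X (f ` (pverts G - {w})) (set ys)"
      "anti X (set xs) (set ys)"
  shows "\<exists>h. emb (attach_path n w (attach_path n v G)) X h \<and> (\<forall>x\<in>pverts G. h x = f x) \<and>
     h ` pverts (attach_path n w (attach_path n v G)) = f ` pverts G \<union> set xs \<union> set ys"
proof -
  let ?G = "attach_path n v G"
  obtain h where h: "emb ?G X h" "\<And>x. x \<in> pverts G \<Longrightarrow> h x = f x" "h ` pverts ?G = f ` pverts G \<union> set xs"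
    using emb_attach_path[OF G X f v(1) p(1) n(1) an(1)] by auto
  have w: "w \<in> pverts ?G" using v(2) by (rule pverts_attach_path)
  have "h ` (pverts ?G - {w}) = h ` pverts ?G - {f w}"
    using inj_on_image_set_diff[of h "pverts ?G" "pverts ?G" "{w}"] h(1,2) w v by (auto simp: emb_def)
  also have "\<dots> \<subseteq> f ` (pverts G - {w}) \<union> set xs" using h(3) by auto
  finally have sub: "h ` (pverts ?G - {w}) \<subseteq> f ` (pverts G - {w}) \<union> set xs" .
  have "anti X (f ` (pverts G - {w}) \<union> set xs) (set ys)" using an(2,3) by (simp add: anti_Un)
  then have an': "anti X (h ` (pverts ?G - {w})) (set ys)"
    by (rule anti_mono[OF _ sub subset_refl])
  have p': "ipath X (h w # ys)" using p(2) h(2) v(2) by simp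
  from emb_attach_path[OF pair_graph_attach_path[OF G v(1)] X h(1) w p' n(2) an']
  obtain h' where h': "emb (attach_path n w ?G) X h'" "\<forall>x\<in>pverts ?G. h' x = h x"
    "h' ` pverts (attach_path n w ?G) = h ` pverts ?G \<union> set ys"
    by (elim exE conjE)
  have "\<forall>x\<in>pverts G. h' x = f x" using h'(2) h(2) by (simp add: pverts_attach_path)
  then show ?thesis using h'(1,3) unfolding h(3) by (intro exI[of _ h'] conjI)
qed

lemma ipath_cong:
  assumes "\<And>u v. u \<in> set xs \<Longrightarrow> v \<in> set xs \<Longrightarrow> adj Y u v \<longleftrightarrow> adj X u v" "pverts Y = pverts X"
  shows "ipath Y xs \<longleftrightarrow> ipath X xs"
proof -
  have "adj Y (xs ! i) (xs ! j) \<longleftrightarrow> adj X (xs ! i) (xs ! j)" if "i < j" "j < length xs" for i j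
    using that by (intro assms(1)) auto
  then show ?thesis unfolding ipath_def assms(2) by auto
qed

lemma pverts_cycle4 [simp]: "pverts (cycle_graph 4) = {0, 1, 2, 3}"
  by (auto simp: cycle_graph_def ugraph_def)

lemma adj_cycle4: "adj (cycle_graph 4) i j \<longleftrightarrow>
   (i, j) \<in> {(0,1),(1,0),(1,2),(2,1),(2,3),(3,2),(3,0),(0,3)}"
proof -
  have *: "{k. k < 4} = {0, 1, 2, 3::nat}" by auto
  have "{(k, Suc k mod 4) | k. k < 4} = (\<lambda>k. (k, Suc k mod 4)) ` {k. k < 4}" by auto
  also have "\<dots> = {(0,1),(1,2),(2,3),(3,0)}" unfolding * by (simp flip: numeral_2_eq_2)
  finally have "parcs (cycle_graph 4) = {(0,1),(1,2),(2,3),(3,0)} \<union> {(0,1),(1,2),(2,3),(3,0)}\<inverse>"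
    unfolding cycle_graph_def ugraph_def by simp
  moreover have "{(0,1),(1,2),(2,3),(3,0)}\<inverse> = {(1,0),(2,1),(3::nat,2::nat),(0,3)}" by auto
  ultimately show ?thesis by (simp only: insert_iff Un_iff empty_iff simp_thms) argo
qed

lemma emb_F3:
  assumes X: "pair_graph X"
    and c4: "adj X a b" "adj X b c" "adj X c d" "adj X d a" "\<not> adj X a c" "\<not> adj X b d" "a \<noteq> c" "b \<noteq> d"
    and p: "ipath X (a # xs)" "ipath X (c # ys)" and n: "n = Suc (length xs)" "n = Suc (length ys)"
    and an: "anti X {b, c, d} (set xs)" "anti X {a, b, d} (set ys)" "anti X (set xs) (set ys)"
  shows "\<exists>h. emb (F3_graph n) X h \<and> h 0 = a \<and> h 2 = c \<and>
     h ` pverts (F3_graph n) = {a, b, c, d} \<union> set xs \<union> set ys"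
proof -
  define f where "f i = (if i = 0 then a else if i = 1 then b else if i = 2 then c else d)" for i :: nat
  have fs: "f 0 = a" "f 1 = b" "f (Suc 0) = b" "f 2 = c" "f 3 = d" by (auto simp: f_def)
  have ne: "a \<noteq> b" "b \<noteq> c" "c \<noteq> d" "d \<noteq> a" using c4 pg_irrefl[OF X] by auto
  have c4': "adj X b a" "adj X c b" "adj X d c" "adj X a d" "\<not> adj X c a" "\<not> adj X d b"
    using c4 pg_sym[OF X] by blast+
  have f: "emb (cycle_graph 4) X f"
    unfolding emb_def pverts_cycle4
  proof (intro conjI)
    show "\<forall>i\<in>{0, 1, 2, 3}. \<forall>j\<in>{0, 1, 2, 3}. adj (cycle_graph 4) i j \<longleftrightarrow> adj X (f i) (f j)"
      using c4 c4' pg_irrefl[OF X] by (simp add: adj_cycle4 fs)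
  qed (use ne c4 pg_verts[OF X c4(1)] pg_verts[OF X c4(3)] in \<open>auto simp: fs inj_on_def\<close>)
  have i: "{0, 1, 2, 3} - {0} = {1, 2, 3::nat}" "{0, 1, 2, 3} - {2} = {0, 1, 3::nat}" by auto
  have "\<exists>h. emb (attach_path n 2 (attach_path n 0 (cycle_graph 4))) X h \<and> (\<forall>x\<in>pverts (cycle_graph 4). h x = f x) \<and>
     h ` pverts (attach_path n 2 (attach_path n 0 (cycle_graph 4))) = f ` pverts (cycle_graph 4) \<union> set xs \<union> set ys"
    by (rule emb_attach_path2[OF pair_graph_cycle4 X f])
      (use p n an i[folded One_nat_def] in \<open>simp_all add: fs insert_commute del: One_nat_def\<close>)
  then show ?thesis unfolding F3_graph_def by (auto simp: fs)
qed

lemma F3_terminals: "0 \<in> pverts (F3_graph n)" "2 \<in> pverts (F3_graph n)"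
  unfolding F3_graph_def by (intro pverts_attach_path; simp)+

lemma pair_graph_F3: "pair_graph (F3_graph n)"
  unfolding F3_graph_def
  by (intro pair_graph_attach_path pair_graph_cycle4 pverts_attach_path) auto

lemma pair_graph_F4: "pair_graph (F4_graph n)"
  using pair_graph_F3[of n] F3_terminals[of n] unfolding F4_graph_def pair_graph_iff
  by (auto simp: sym_def)

text \<open>
  Deleting the chord from the host graph reduces this to the recognition of \<open>F\<^sup>3\<close>; the chord is then
  restored in both graphs.
\<close>

lemma emb_F4:
  assumes X: "pair_graph X"
    and c4: "adj X a b" "adj X b c" "adj X c d" "adj X d a" "adj X a c" "\<not> adj X b d" "b \<noteq> d"
    and p: "ipath X (a # xs)" "ipath X (c # ys)" and n: "n = Suc (length xs)" "n = Suc (length ys)"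
    and an: "anti X {b, c, d} (set xs)" "anti X {a, b, d} (set ys)" "anti X (set xs) (set ys)"
  shows "\<exists>h. emb (F4_graph n) X h \<and>
     h ` pverts (F4_graph n) = {a, b, c, d} \<union> set xs \<union> set ys"
proof -
  define Y where "Y = \<lparr>pverts = pverts X, parcs = parcs X - {(a, c), (c, a)}\<rparr>"
  have ac: "a \<noteq> c" using c4 pg_irrefl[OF X] by auto
  have Y: "pair_graph Y" using X by (auto simp: Y_def pair_graph_iff sym_def)
  have ca: "c \<notin> set xs" "a \<notin> set ys" using an by (auto simp: anti_def)
  have ne: "a \<noteq> b" "b \<noteq> c" "c \<noteq> d" "d \<noteq> a" using c4 pg_irrefl[OF X] by auto
  have "ipath Y (a # xs)" "ipath Y (c # ys)"
  proof -
    have "adj Y u v \<longleftrightarrow> adj X u v" if "u \<in> set (a # xs)" "v \<in> set (a # xs)" for u v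
      using that ca ac by (auto simp: Y_def)
    then show "ipath Y (a # xs)" using p(1) ipath_cong[of "a # xs" Y X] by (simp add: Y_def)
    have "adj Y u v \<longleftrightarrow> adj X u v" if "u \<in> set (c # ys)" "v \<in> set (c # ys)" for u v
      using that ca ac by (auto simp: Y_def)
    then show "ipath Y (c # ys)" using p(2) ipath_cong[of "c # ys" Y X] by (simp add: Y_def)
  qed
  moreover have "anti Y A B" if "anti X A B" for A B using that by (auto simp: anti_def Y_def)
  ultimately obtain h where h: "emb (F3_graph n) Y h" "h 0 = a" "h 2 = c"
     "h ` pverts (F3_graph n) = {a, b, c, d} \<union> set xs \<union> set ys"
    using emb_F3[OF Y, of a b c d xs ys n] c4 ne n an ac by (auto simp: Y_def)
  have "emb (F4_graph n) X h"
    unfolding emb_def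
  proof (intro conjI ballI)
    fix u v assume uv: "u \<in> pverts (F4_graph n)" "v \<in> pverts (F4_graph n)"
    then have uv': "u \<in> pverts (F3_graph n)" "v \<in> pverts (F3_graph n)" by (auto simp: F4_graph_def)
    have inj: "inj_on h (pverts (F3_graph n))" using h by (simp add: emb_def)
    have e: "h u = a \<longleftrightarrow> u = 0" "h u = c \<longleftrightarrow> u = 2" "h v = a \<longleftrightarrow> v = 0" "h v = c \<longleftrightarrow> v = 2"
      using inj uv' F3_terminals[of n] h(2,3) by (auto dest: inj_onD)
    have "adj (F3_graph n) u v \<longleftrightarrow> adj Y (h u) (h v)" using h(1) uv' by (simp add: emb_def)
    then show "adj (F4_graph n) u v \<longleftrightarrow> adj X (h u) (h v)"
      using e c4 pg_sym[OF X c4(5)] by (auto simp: F4_graph_def Y_def)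
  qed (use h(1) in \<open>auto simp: emb_def F4_graph_def Y_def\<close>)
  then show ?thesis using h(4) by (auto simp: F4_graph_def)
qed

lemma emb_triangle:
  assumes X: "pair_graph X" and t: "adj X u v" "adj X v w" "adj X u w"
  shows "emb (complete_graph 3) X (\<lambda>i. if i = 0 then u else if i = 1 then v else w)"
  using t pg_sym[OF X t(1)] pg_sym[OF X t(2)] pg_sym[OF X t(3)] pg_irrefl[OF X] pg_verts[OF X t(1)] pg_verts[OF X t(2)]
  by (intro emb_complete[OF X]) auto

lemma lessThan_3: "{..<3} = {0, 1, 2::nat}" by auto

lemma emb_F_check:
  assumes X: "pair_graph X" and t: "adj X u v" "adj X v w" "adj X u w"
    and k: "fork X (u # us) a b" and q: "q = Suc (length us)"
    and p: "ipath X (v # xs)" "ipath X (w # ys)" and n: "n = Suc (length xs)" "n = Suc (length ys)"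
    and an: "anti X {v, w} (set us \<union> {a, b})" "anti X ({u, w} \<union> set us \<union> {a, b}) (set xs)"
      "anti X ({u, v} \<union> set us \<union> {a, b}) (set ys)" "anti X (set xs) (set ys)"
  shows "\<exists>h. emb (F_check n q) X h \<and>
     h ` pverts (F_check n q) = {u, v, w} \<union> set us \<union> {a, b} \<union> set xs \<union> set ys"
proof -
  define f where "f i = (if i = 0 then u else if i = 1 then v else w)" for i :: nat
  have f: "emb (complete_graph 3) X f"
    unfolding f_def[abs_def] by (rule emb_triangle[OF X t])
  have fs: "f 0 = u" "f 1 = v" "f (Suc 0) = v" "f 2 = w" by (auto simp: f_def)
  have i3: "f ` pverts (complete_graph 3) = {u, v, w}" by (auto simp: lessThan_3 fs)
  let ?G = "attach_T q 0 (complete_graph 3)"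
  have i0: "f ` (pverts (complete_graph 3) - {0}) = {v, w}" by (auto simp: lessThan_3 fs)
  obtain h where h: "emb ?G X h" "\<forall>x\<in>pverts (complete_graph 3). h x = f x"
    "h ` pverts ?G = {u, v, w} \<union> set us \<union> {a, b}"
    using emb_attach_T[OF pair_graph_complete X f, of 0 us a b q] k q an(1) fs(1) i0 i3 by auto
  have hs: "h 0 = u" "h 1 = v" "h 2 = w" using h(2) fs by (auto simp: lessThan_3)
  have v012: "0 \<in> pverts ?G" "1 \<in> pverts ?G" "2 \<in> pverts ?G" by (rule pverts_attach_T, simp)+
  have d: "h ` (pverts ?G - {i}) = h ` pverts ?G - {h i}" if "i \<in> pverts ?G" for i
    using inj_on_image_set_diff[of h "pverts ?G" "pverts ?G" "{i}"] h(1) that by (auto simp: emb_def)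
  have G: "pair_graph ?G" using q by (intro pair_graph_attach_T pair_graph_complete) auto
  have "anti X (h ` (pverts ?G - {1})) (set xs)"
    unfolding d[OF v012(2)] h(3) hs by (rule anti_mono[OF an(2)]) auto
  moreover have "anti X (h ` (pverts ?G - {2})) (set ys)"
    unfolding d[OF v012(3)] h(3) hs by (rule anti_mono[OF an(3)]) auto
  ultimately have "\<exists>h'. emb (attach_path n 2 (attach_path n 1 ?G)) X h' \<and> (\<forall>x\<in>pverts ?G. h' x = h x) \<and>
     h' ` pverts (attach_path n 2 (attach_path n 1 ?G)) = h ` pverts ?G \<union> set xs \<union> set ys"
    by (intro emb_attach_path2[OF G X h(1) v012(2,3)]) (use p hs an(4) n in auto)
  then show ?thesis unfolding F_check_def h(3) by blast
qed

lemma pair_graph_F_check: "1 \<le> q \<Longrightarrow> pair_graph (F_check n q)"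
  unfolding F_check_def
  by (intro pair_graph_attach_path pair_graph_attach_T pair_graph_complete pverts_attach_path pverts_attach_T) auto

lemma emb_F2:
  assumes X: "pair_graph X" and t: "adj X u v" "adj X v w" "adj X u w"
    and p: "ipath X (u # zs)" "ipath X (v # xs)" "ipath X (w # ys)"
    and n: "n = Suc (length zs)" "n = Suc (length xs)" "n = Suc (length ys)"
    and an: "anti X {v, w} (set zs)" "anti X ({u, w} \<union> set zs) (set xs)"
      "anti X ({u, v} \<union> set zs) (set ys)" "anti X (set xs) (set ys)"
  shows "\<exists>h. emb (F2_graph n) X h \<and>
     h ` pverts (F2_graph n) = {u, v, w} \<union> set zs \<union> set xs \<union> set ys"
proof -
  define f where "f i = (if i = 0 then u else if i = 1 then v else w)" for i :: nat
  have f: "emb (complete_graph 3) X f"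
    unfolding f_def[abs_def] by (rule emb_triangle[OF X t])
  have fs: "f 0 = u" "f 1 = v" "f (Suc 0) = v" "f 2 = w" by (auto simp: f_def)
  have i3: "f ` pverts (complete_graph 3) = {u, v, w}" by (auto simp: lessThan_3 fs)
  let ?G = "attach_path n 0 (complete_graph 3)"
  have i0: "f ` (pverts (complete_graph 3) - {0}) = {v, w}" by (auto simp: lessThan_3 fs)
  obtain h where h: "emb ?G X h" "\<forall>x\<in>pverts (complete_graph 3). h x = f x"
    "h ` pverts ?G = {u, v, w} \<union> set zs"
    using emb_attach_path[OF pair_graph_complete X f, of 0 zs n] p(1) n(1) an(1) fs(1) i0 i3 by auto
  have hs: "h 0 = u" "h 1 = v" "h 2 = w" using h(2) fs by (auto simp: lessThan_3)
  have v012: "0 \<in> pverts ?G" "1 \<in> pverts ?G" "2 \<in> pverts ?G" by (rule pverts_attach_path, simp)+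
  have d: "h ` (pverts ?G - {i}) = h ` pverts ?G - {h i}" if "i \<in> pverts ?G" for i
    using inj_on_image_set_diff[of h "pverts ?G" "pverts ?G" "{i}"] h(1) that by (auto simp: emb_def)
  have G: "pair_graph ?G" by (intro pair_graph_attach_path pair_graph_complete) auto
  have "anti X (h ` (pverts ?G - {1})) (set xs)"
    unfolding d[OF v012(2)] h(3) hs by (rule anti_mono[OF an(2)]) auto
  moreover have "anti X (h ` (pverts ?G - {2})) (set ys)"
    unfolding d[OF v012(3)] h(3) hs by (rule anti_mono[OF an(3)]) auto
  ultimately have "\<exists>h'. emb (attach_path n 2 (attach_path n 1 ?G)) X h' \<and> (\<forall>x\<in>pverts ?G. h' x = h x) \<and>
     h' ` pverts (attach_path n 2 (attach_path n 1 ?G)) = h ` pverts ?G \<union> set xs \<union> set ys"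
    by (intro emb_attach_path2[OF G X h(1) v012(2,3)]) (use p hs an(4) n in auto)
  then show ?thesis unfolding F2_graph_def h(3) by blast
qed

lemma pair_graph_F2: "pair_graph (F2_graph n)"
  unfolding F2_graph_def
  by (intro pair_graph_attach_path pair_graph_complete pverts_attach_path) auto

lemma emb_star:
  assumes X: "pair_graph X" and A: "card A = n" "finite A" and c: "\<forall>a\<in>A. adj X c a"
    and ind: "\<forall>a\<in>A. \<forall>b\<in>A. \<not> adj X a b" and cX: "c \<in> pverts X"
  shows "\<exists>h. emb (star_graph n) X h \<and> h ` pverts (star_graph n) = insert c A"
proof -
  obtain g where g: "bij_betw g {1..n} A"
    using A by (metis ex_bij_betw_nat_finite_1)
  define h where "h i = (if i = 0 then c else g i)" for i
  have V: "pverts (star_graph n) = insert 0 {1..n}" by (auto simp: star_graph_def ugraph_def)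
  have E: "adj (star_graph n) i j \<longleftrightarrow> i \<le> n \<and> j \<le> n \<and> (i = 0 \<and> j > 0 \<or> j = 0 \<and> i > 0)" for i j
    by (auto simp: star_graph_def ugraph_def)
  have gA: "g i \<in> A" if "1 \<le> i" "i \<le> n" for i using g that by (auto simp: bij_betw_def)
  have cA: "c \<notin> A" using c pg_irrefl[OF X] by auto
  have hg: "h ` {1..n} = g ` {1..n}" "inj_on h {1..n} \<longleftrightarrow> inj_on g {1..n}"
    by (rule image_cong inj_on_cong; simp add: h_def)+
  then have hi: "h ` {1..n} = A" using g by (simp add: bij_betw_def)
  have "emb (star_graph n) X h"
    unfolding emb_def
  proof (intro conjI ballI)
    have "inj_on h {1..n}" using g hg by (simp add: bij_betw_def)
    then show "inj_on h (pverts (star_graph n))" using cA hi by (simp add: V h_def)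
    show "h ` pverts (star_graph n) \<subseteq> pverts X"
      using cX c pg_verts[OF X] hi by (auto simp: V h_def)
    fix i j assume ij: "i \<in> pverts (star_graph n)" "j \<in> pverts (star_graph n)"
    have cg: "adj X c (g k)" "adj X (g k) c" if "1 \<le> k" "k \<le> n" for k
      using c gA[OF that] pg_sym[OF X] by blast+
    have gg: "\<not> adj X (g k) (g l)" if "1 \<le> k" "k \<le> n" "1 \<le> l" "l \<le> n" for k l
      using ind gA that by blast
    show "adj (star_graph n) i j \<longleftrightarrow> adj X (h i) (h j)"
      using cg gg pg_irrefl[OF X] ij by (cases "i = 0"; cases "j = 0") (simp_all add: V E h_def)
  qed
  moreover have "h ` pverts (star_graph n) = insert c A" unfolding V image_insert hi by (simp add: h_def)
  ultimately show ?thesis by blast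
qed

section \<open>Matchings and barriers\<close>

definition mtch :: "'a pair_pre_digraph \<Rightarrow> 'a set \<Rightarrow> 'a set set \<Rightarrow> bool" where
  "mtch G W M \<longleftrightarrow> matching G M \<and> \<Union>M \<subseteq> W"

text \<open>
  The matching number of the subgraph induced by \<open>W\<close>, which allows vertices to be removed without
  changing the graph.
\<close>

definition nu :: "'a pair_pre_digraph \<Rightarrow> 'a set \<Rightarrow> nat" where
  "nu G W = Max (card ` {M. mtch G W M})"

lemma uedgesE:
  assumes "e \<in> uedges G" obtains u v where "e = {u, v}" "adj G u v"
  using assms by (auto simp: uedges_def)

lemma uedges_verts: "pair_graph G \<Longrightarrow> e \<in> uedges G \<Longrightarrow> e \<subseteq> pverts G"
  using pg_verts[of G] by (auto elim!: uedgesE)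

lemma mtch_edge:
  assumes "mtch G W M" "e \<in> M" obtains u v where "e = {u, v}" "adj G u v"
  using assms uedgesE[of e G] unfolding mtch_def matching_def by blast

lemma mtch_disj: "mtch G W M \<Longrightarrow> e \<in> M \<Longrightarrow> f \<in> M \<Longrightarrow> v \<in> e \<Longrightarrow> v \<in> f \<Longrightarrow> e = f"
  unfolding mtch_def matching_def pairwise_def disjnt_def by blast

lemma mtch_finite:
  assumes "pair_graph G" shows "finite {M. mtch G W M}"
proof -
  have "finite (uedges G)"
  proof -
    have "uedges G \<subseteq> Pow (pverts G)" using pg_verts[OF assms] by (auto simp: uedges_def)
    then show ?thesis using assms finite_subset by (auto simp: pair_graph_iff)
  qed
  then have "finite (Pow (uedges G))" by simp
  then show ?thesis by (rule rev_finite_subset) (auto simp: mtch_def matching_def)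
qed

lemma mtch_le_nu: "pair_graph G \<Longrightarrow> mtch G W M \<Longrightarrow> card M \<le> nu G W"
  unfolding nu_def using mtch_finite by (intro Max_ge) auto

lemma nu_attained:
  assumes "pair_graph G" obtains M where "mtch G W M" "card M = nu G W"
proof -
  have "mtch G W {}" by (simp add: mtch_def matching_def)
  then have "card ` {M. mtch G W M} \<noteq> {}" by auto
  then have "nu G W \<in> card ` {M. mtch G W M}"
    unfolding nu_def using mtch_finite[OF assms] by (intro Max_in) auto
  then show ?thesis using that by auto
qed

lemma matching_number_nu: "pair_graph G \<Longrightarrow> matching_number G = nu G (pverts G)"
proof -
  assume G: "pair_graph G"
  have "\<Union>M \<subseteq> pverts G" if "matching G M" for M
    using uedges_verts[OF G] that unfolding matching_def by blast
  then have "matching G M \<longleftrightarrow> mtch G (pverts G) M" for M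
    unfolding mtch_def by blast
  then show ?thesis by (simp add: matching_number_def nu_def)
qed

lemma card_covered:
  assumes G: "pair_graph G" and M: "mtch G W M"
  shows "finite (\<Union>M)" "card (\<Union>M) = 2 * card M" "finite M"
proof -
  have e: "card e = 2" "finite e" if "e \<in> M" for e
  proof -
    obtain u v where "e = {u, v}" "adj G u v"
      using mtch_edge[OF M \<open>e \<in> M\<close>] by blast
    moreover from this have "u \<noteq> v" using pg_irrefl[OF G] by auto
    ultimately show "card e = 2" "finite e" by auto
  qed
  have sub: "\<Union>M \<subseteq> pverts G" using M uedges_verts[OF G] unfolding mtch_def matching_def by blast
  then show f: "finite (\<Union>M)" using G finite_subset by (auto simp: pair_graph_iff)
  then show "finite M" by (rule finite_UnionD)
  have "card (\<Union>M) = (\<Sum>e\<in>M. card e)"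
    using M e(2) by (intro card_Union_disjoint) (simp_all add: mtch_def matching_def)
  then show "card (\<Union>M) = 2 * card M" using e by simp
qed

text \<open>
  The easy half of the Tutte-Berge formula: a matching can cover at most \<open>card S\<close> vertices of an
  independent set whose neighbours all lie in \<open>S\<close>.
\<close>

lemma deficiency_lower:
  assumes G: "pair_graph G" and IS: "I \<subseteq> pverts G" "S \<subseteq> pverts G" "I \<inter> S = {}"
    and nb: "\<And>u v. u \<in> I \<Longrightarrow> adj G u v \<Longrightarrow> v \<in> S"
  shows "int (card I) - int (card S) \<le> deficiency G"
proof -
  obtain M where M: "mtch G (pverts G) M" "card M = nu G (pverts G)" using nu_attained[OF G] .
  have fin: "finite (pverts G)" using G by (simp add: pair_graph_iff)
  have "\<forall>i\<in>I \<inter> \<Union>M. \<exists>s. s \<in> S \<and> {i, s} \<in> M"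
  proof
    fix i assume i: "i \<in> I \<inter> \<Union>M"
    then obtain e where e: "e \<in> M" "i \<in> e" by auto
    obtain u v where uv: "e = {u, v}" "adj G u v"
      using mtch_edge[OF M(1) e(1)] by blast
    show "\<exists>s. s \<in> S \<and> {i, s} \<in> M"
    proof (cases "i = u")
      case True
      then show ?thesis using nb[of u v] uv i e by blast
    next
      case False
      then have "i = v" using uv e by auto
      then show ?thesis using nb[of v u] pg_sym[OF G uv(2)] uv i e by (metis IntD1 insert_commute)
    qed
  qed
  then obtain p where p: "\<And>i. i \<in> I \<inter> \<Union>M \<Longrightarrow> p i \<in> S \<and> {i, p i} \<in> M" by metis
  have "inj_on p (I \<inter> \<Union>M)"
  proof (rule inj_onI)
    fix i j assume ij: "i \<in> I \<inter> \<Union>M" "j \<in> I \<inter> \<Union>M" "p i = p j"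
    then have "{i, p i} = {j, p i}"
      using p[OF ij(1)] p[OF ij(2)] mtch_disj[OF M(1), of "{i, p i}" "{j, p j}" "p i"] by simp
    then show "i = j" by (metis doubleton_eq_iff)
  qed
  then have c: "card (I \<inter> \<Union>M) \<le> card S"
    using p fin IS by (intro card_inj_on_le[of p]) (auto intro: finite_subset)
  have "card I = card (I \<inter> \<Union>M) + card (I - \<Union>M)"
    using fin IS finite_subset by (metis card_Int_Diff)
  moreover have "card (I - \<Union>M) \<le> card (pverts G - \<Union>M)"
    using fin IS by (intro card_mono) auto
  moreover have "card (pverts G - \<Union>M) = card (pverts G) - 2 * card M"
    using card_covered[OF G M(1)] M(1) by (simp add: card_Diff_subset mtch_def)
  moreover have "2 * card M \<le> card (pverts G)"
    using card_covered(2)[OF G M(1)] M(1) fin card_mono[of "pverts G" "\<Union>M"] by (simp add: mtch_def)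
  ultimately show ?thesis using c M(2) by (simp add: deficiency_def matching_number_nu[OF G])
qed

abbreviation maxm :: "'a pair_pre_digraph \<Rightarrow> 'a set \<Rightarrow> 'a set set \<Rightarrow> bool" where
  "maxm G W M \<equiv> mtch G W M \<and> card M = nu G W"

lemma mtch_insert:
  assumes "mtch G W M" "adj G x y" "x \<in> W" "y \<in> W" "x \<notin> \<Union>M" "y \<notin> \<Union>M"
  shows "mtch G W (insert {x, y} M)"
proof -
  have "{x, y} \<in> uedges G" using assms(2) by (auto simp: uedges_def)
  moreover have "pairwise disjnt (insert {x, y} M)"
    unfolding pairwise_insert
  proof (intro conjI allI impI)
    show "pairwise disjnt M" using assms(1) by (simp add: mtch_def matching_def)
    fix e assume "e \<in> M \<and> e \<noteq> {x, y}"
    then show "disjnt {x, y} e" "disjnt e {x, y}" using assms(5,6) unfolding disjnt_def by blast+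
  qed
  ultimately show ?thesis using assms(1,3,4) by (simp add: mtch_def matching_def)
qed

lemma maxm_adj_covered:
  assumes G: "pair_graph G" and M: "maxm G W M" and xy: "adj G x y" "x \<in> W" "y \<in> W" "x \<notin> \<Union>M"
  shows "y \<in> \<Union>M"
proof (rule ccontr)
  assume "y \<notin> \<Union>M"
  with M xy have "mtch G W (insert {x, y} M)" by (intro mtch_insert) simp_all
  then have "card (insert {x, y} M) \<le> nu G W" by (rule mtch_le_nu[OF G])
  moreover have "{x, y} \<notin> M" using xy by auto
  moreover have "finite M" using card_covered(3)[OF G] M by blast
  ultimately show False using M by simp
qed

text \<open>
  The exchange step in the proof of Gallai's lemma. Among the maximum matchings that miss \<open>t\<close>, one
  that shares as many edges as possible with \<open>M\<close> would cover both \<open>u\<close> and \<open>v\<close>; counting gives a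
  vertex \<open>x \<noteq> t\<close> covered by \<open>M\<close> only, and exchanging an edge at the partner of \<open>x\<close> increases the
  overlap.
\<close>

lemma gallai_exchange:
  assumes G: "pair_graph G" and M: "maxm G W M" "u \<notin> \<Union>M" "v \<notin> \<Union>M" "u \<noteq> v"
    and t: "maxm G W N0" "t \<notin> \<Union>N0"
  shows "\<exists>N. maxm G W N \<and> t \<notin> \<Union>N \<and> (u \<notin> \<Union>N \<or> v \<notin> \<Union>N)"
proof (rule ccontr)
  assume "\<not> ?thesis"
  then have cov: "\<And>N. maxm G W N \<Longrightarrow> t \<notin> \<Union>N \<Longrightarrow> u \<in> \<Union>N \<and> v \<in> \<Union>N" by blast
  let ?A = "{N. maxm G W N \<and> t \<notin> \<Union>N}"
  have finM: "finite M" using card_covered(3)[OF G] M by blast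
  have "\<exists>N. N \<in> ?A \<and> (\<forall>N'. N' \<in> ?A \<longrightarrow> card (M \<inter> N') \<le> card (M \<inter> N))"
    by (rule ex_has_greatest_nat[of _ N0 _ "Suc (card M)"]) (use t finM in \<open>auto simp: less_Suc_eq_le intro: card_mono\<close>)
  then obtain N where N: "maxm G W N" "t \<notin> \<Union>N"
    "\<And>N'. maxm G W N' \<Longrightarrow> t \<notin> \<Union>N' \<Longrightarrow> card (M \<inter> N') \<le> card (M \<inter> N)" by auto
  have fin: "finite (\<Union>M)" "finite (\<Union>N)" and c: "card (\<Union>M) = card (\<Union>N)"
    using card_covered[OF G conjunct1[OF M(1)]] card_covered[OF G conjunct1[OF N(1)]] M(1) N(1) by auto
  have "{u, v} \<subseteq> \<Union>N - \<Union>M" using cov[OF N(1,2)] M by blast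
  then have "2 \<le> card (\<Union>N - \<Union>M)" using card_mono[OF finite_Diff[OF fin(2)], of "{u, v}" "\<Union>M"] M(4) by simp
  also have "card (\<Union>N - \<Union>M) = card (\<Union>M - \<Union>N)"
    using c card_Int_Diff[OF fin(1), of "\<Union>N"] card_Int_Diff[OF fin(2), of "\<Union>M"]
    by (simp add: Int_commute)
  finally have "\<not> \<Union>M - \<Union>N \<subseteq> {t}"
    using card_mono[of "{t}" "\<Union>M - \<Union>N"] by auto
  then obtain x where x: "x \<in> \<Union>M" "x \<notin> \<Union>N" "x \<noteq> t" by blast
  then obtain e where e: "e \<in> M" "x \<in> e" by auto
  have eG: "e \<in> uedges G" and eW: "e \<subseteq> W" using M e by (auto simp: mtch_def matching_def)
  then obtain y where y: "e = {x, y}" "adj G x y"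
    using e(2) uedgesE pg_sym[OF G] by (metis insertE insert_commute singletonD)
  have yN: "y \<in> \<Union>N" using maxm_adj_covered[OF G N(1) y(2)] x eW y by auto
  then obtain f where f: "f \<in> N" "y \<in> f" by auto
  have yt: "y \<noteq> t" using yN N by auto
  have xy: "x \<noteq> y" using y pg_irrefl[OF G] by auto
  have fM: "f \<notin> M"
  proof
    assume "f \<in> M"
    then have "f = e" using mtch_disj[of G W M f e y] M(1) e f y by blast
    then show False using x e f by auto
  qed
  let ?N = "insert e (N - {f})"
  have yN': "y \<notin> \<Union>(N - {f})"
  proof
    assume "y \<in> \<Union>(N - {f})"
    then obtain f' where "f' \<in> N" "f' \<noteq> f" "y \<in> f'" by auto
    then show False using mtch_disj[of G W N f' f y] N(1) f by blast
  qed
  have N': "mtch G W (N - {f})" using N(1) unfolding mtch_def matching_def pairwise_def by auto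
  have "mtch G W ?N"
    unfolding y(1) by (rule mtch_insert[OF N' y(2)]) (use eW y x yN' in auto)
  moreover have "card ?N = nu G W"
  proof -
    have "e \<notin> N" using x e by auto
    moreover have "finite N" using card_covered(3)[OF G] N by blast
    ultimately show ?thesis using f N(1) by (simp add: card.insert_remove card_gt_0_iff) (metis Suc_pred card_gt_0_iff empty_iff)
  qed
  moreover have "t \<notin> \<Union>?N" using N(2) x yt y by auto
  ultimately have "card (M \<inter> ?N) \<le> card (M \<inter> N)" using N(3) by blast
  moreover have "M \<inter> ?N = insert e (M \<inter> N)" using e fM by auto
  moreover have "e \<notin> M \<inter> N" using x e by auto
  ultimately show False using finM by simp
qed

text \<open>
  A form of the hard half of the Tutte-Berge formula. Choose \<open>S\<close> as large as possible among the sets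
  whose removal raises the deficiency by at least \<open>card S\<close>. Then every remaining vertex is missed by
  some maximum matching, so by the exchange lemma "equal, or missed by no common maximum matching" is an
  equivalence relation \<open>R\<close>; adjacent vertices are related, and the vertices \<open>U\<close> missed by one maximum matching
  are pairwise unrelated. No components have to be formed: the classes of \<open>R\<close> are unions of
  components of \<open>G - S\<close>, and that is all that is needed.
\<close>

lemma barrier:
  assumes G: "pair_graph G"
  obtains S U R where "S \<subseteq> pverts G" "U \<subseteq> pverts G - S" "deficiency G + int (card S) \<le> int (card U)"
    "\<And>u v. R u v \<Longrightarrow> R v u" "\<And>u. R u u" 
    "\<And>u v w. u \<in> pverts G - S \<Longrightarrow> v \<in> pverts G - S \<Longrightarrow> w \<in> pverts G - S \<Longrightarrow> R u v \<Longrightarrow> R v w \<Longrightarrow> R u w"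
    "\<And>u v. u \<in> pverts G - S \<Longrightarrow> v \<in> pverts G - S \<Longrightarrow> adj G u v \<Longrightarrow> R u v"
    "\<And>u v. u \<in> U \<Longrightarrow> v \<in> U \<Longrightarrow> u \<noteq> v \<Longrightarrow> \<not> R u v"
proof -
  define V where "V = pverts G"
  have fin: "finite V" using G by (simp add: V_def pair_graph_iff)
  define df where "df W = int (card W) - 2 * int (nu G W)" for W
  have d: "deficiency G = df V" by (simp add: deficiency_def matching_number_nu[OF G] df_def V_def)
  let ?P = "\<lambda>S. S \<subseteq> V \<and> df V + int (card S) \<le> df (V - S)"
  have "\<exists>S. ?P S \<and> (\<forall>S'. ?P S' \<longrightarrow> card S' \<le> card S)"
    by (rule ex_has_greatest_nat[of _ "{}" _ "Suc (card V)"]) (use fin in \<open>auto simp: less_Suc_eq_le intro: card_mono\<close>)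
  then obtain S where S: "S \<subseteq> V" "df V + int (card S) \<le> df (V - S)"
    "\<And>S'. S' \<subseteq> V \<Longrightarrow> df V + int (card S') \<le> df (V - S') \<Longrightarrow> card S' \<le> card S" by auto
  define W where "W = V - S"
  have finW: "finite W" and finS: "finite S" using fin S(1) by (auto simp: W_def finite_subset)
  \<comment> \<open>if every maximum matching covered \<open>v\<close>, then \<open>S\<close> could be enlarged by \<open>v\<close>\<close>
  have miss: "\<exists>N. maxm G W N \<and> v \<notin> \<Union>N" if v: "v \<in> W" for v
  proof (rule ccontr)
    assume no: "\<not> ?thesis"
    obtain N where N: "mtch G (W - {v}) N" "card N = nu G (W - {v})" using nu_attained[OF G] .
    then have NW: "mtch G W N" "v \<notin> \<Union>N" by (auto simp: mtch_def)
    then have "card N \<noteq> nu G W" using no by blast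
    then have "nu G (W - {v}) < nu G W" using mtch_le_nu[OF G NW(1)] N(2) by simp
    moreover have "card W = Suc (card (W - {v}))" using finW v by (metis card_Suc_Diff1)
    ultimately have "df W + 1 \<le> df (W - {v})" by (simp add: df_def)
    moreover have "W - {v} = V - insert v S" by (auto simp: W_def)
    moreover have "card (insert v S) = Suc (card S)" using v finS by (simp add: W_def)
    ultimately have "card (insert v S) \<le> card S"
      using S(1,2) v by (intro S(3)) (auto simp: W_def)
    then show False using \<open>card (insert v S) = Suc (card S)\<close> by simp
  qed
  define R where "R u v \<longleftrightarrow> u = v \<or> \<not> (\<exists>N. maxm G W N \<and> u \<notin> \<Union>N \<and> v \<notin> \<Union>N)" for u v
  obtain M where M: "maxm G W M" using nu_attained[OF G] by metis
  define U where "U = W - \<Union>M"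
  have "card U = card W - card (\<Union>M)" unfolding U_def
    using M card_covered(1)[OF G] by (intro card_Diff_subset) (auto simp: mtch_def)
  moreover have "card (\<Union>M) \<le> card W" using M finW by (intro card_mono) (auto simp: mtch_def)
  ultimately have cU: "int (card U) = df W"
    using card_covered(2)[OF G, of W M] M by (simp add: df_def)
  show ?thesis
  proof (rule that[of S U R])
    show "R u w" if "u \<in> pverts G - S" "v \<in> pverts G - S" "w \<in> pverts G - S" "R u v" "R v w" for u v w
    proof (rule ccontr)
      assume "\<not> R u w"
      then obtain K where K: "maxm G W K" "u \<notin> \<Union>K" "w \<notin> \<Union>K" "u \<noteq> w" by (auto simp: R_def)
      have "v \<in> W" using that by (simp add: W_def V_def)
      then obtain N0 where N0: "maxm G W N0" "v \<notin> \<Union>N0" using miss by blast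
      from gallai_exchange[OF G K N0] obtain N where
        "maxm G W N" "v \<notin> \<Union>N" "u \<notin> \<Union>N \<or> w \<notin> \<Union>N" by blast
      then show False using that(4,5) \<open>\<not> R u w\<close> unfolding R_def by blast
    qed
    show "R u v" if "u \<in> pverts G - S" "v \<in> pverts G - S" "adj G u v" for u v
      using maxm_adj_covered[OF G _ that(3)] that(1,2) unfolding R_def W_def V_def by blast
    show "\<not> R u v" if "u \<in> U" "v \<in> U" "u \<noteq> v" for u v
      using that M unfolding R_def U_def by blast
    show "deficiency G + int (card S) \<le> int (card U)" using d cU S(2) by (simp add: W_def)
  qed (use S(1) in \<open>auto simp: R_def U_def W_def V_def\<close>)
qed

section \<open>Distances\<close>

text \<open>
  The distance from the set \<open>A\<close> along the relation \<open>E\<close>; for a vertex that cannot be reached it is an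
  unspecified number.
\<close>

definition dst :: "('a \<times> 'a) set \<Rightarrow> 'a set \<Rightarrow> 'a \<Rightarrow> nat" where
  "dst E A v = (LEAST k. \<exists>a\<in>A. (a, v) \<in> E ^^ k)"

lemma dst_attained:
  assumes "a \<in> A" "(a, v) \<in> E\<^sup>*"
  shows "\<exists>a\<in>A. (a, v) \<in> E ^^ dst E A v"
proof -
  have "\<exists>k. \<exists>a\<in>A. (a, v) \<in> E ^^ k" using assms by (meson rtrancl_imp_relpow)
  then show ?thesis unfolding dst_def by (rule LeastI_ex)
qed

lemma dst_le: "a \<in> A \<Longrightarrow> (a, v) \<in> E ^^ k \<Longrightarrow> dst E A v \<le> k"
  unfolding dst_def by (rule Least_le) auto

lemma dst_0: "v \<in> A \<Longrightarrow> dst E A v = 0"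
  using dst_le[of v A v 0 E] by simp

lemma dst_0D: "a \<in> A \<Longrightarrow> (a, v) \<in> E\<^sup>* \<Longrightarrow> dst E A v = 0 \<Longrightarrow> v \<in> A"
  using dst_attained[of a A v E] by auto

lemma dst_step: "a \<in> A \<Longrightarrow> (a, u) \<in> E\<^sup>* \<Longrightarrow> (u, v) \<in> E \<Longrightarrow> dst E A v \<le> Suc (dst E A u)"
  using dst_attained[of a A u E] by (meson dst_le relpow_Suc_I)

lemma dst_pred:
  assumes "a \<in> A" "(a, v) \<in> E\<^sup>*" "0 < dst E A v"
  shows "\<exists>a\<in>A. \<exists>u. (a, u) \<in> E\<^sup>* \<and> (u, v) \<in> E \<and> Suc (dst E A u) = dst E A v"
proof -
  obtain k where k: "dst E A v = Suc k" using assms(3) by (cases "dst E A v") auto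
  obtain b where b: "b \<in> A" "(b, v) \<in> E ^^ Suc k" using dst_attained[OF assms(1,2)] k by auto
  then obtain u where u: "(b, u) \<in> E ^^ k" "(u, v) \<in> E" by auto
  have bu: "(b, u) \<in> E\<^sup>*" using u(1) by (rule relpow_imp_rtrancl)
  have "dst E A u \<le> k" using dst_le b u by metis
  moreover have "dst E A v \<le> Suc (dst E A u)" using dst_step[OF b(1) bu u(2)] .
  ultimately show ?thesis using k b bu u by auto
qed

section \<open>Claws in graphs of large deficiency\<close>

text \<open>
  No induced \<open>K\<^bsub>1,n\<^esub>\<close>, as a bound on independent neighbourhoods.
\<close>

definition starfree :: "'a pair_pre_digraph \<Rightarrow> nat \<Rightarrow> bool" where
  "starfree G n \<longleftrightarrow> (\<forall>c A. finite A \<longrightarrow> (\<forall>a\<in>A. adj G c a) \<longrightarrow> (\<forall>a\<in>A. \<forall>b\<in>A. \<not> adj G a b) \<longrightarrow> card A < n)"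

lemma starfree_card:
  assumes "starfree G n" "finite A" "\<forall>a\<in>A. adj G c a" "\<forall>a\<in>A. \<forall>b\<in>A. \<not> adj G a b"
  shows "card A < n"
  using assms by (simp add: starfree_def)

text \<open>
  Fix a root \<open>u\<^sub>0 \<in> U\<close> and measure distances from it. In the class of every other element of \<open>U\<close>
  take a vertex closest to \<open>u\<^sub>0\<close>; its predecessor on a shortest path cannot be in the class and so
  lies in \<open>S\<close>. Vertices of different classes are non-adjacent, hence each \<open>s \<in> S\<close> is the predecessor
  for fewer than \<open>n\<close> classes, and as there are many more classes than elements of \<open>S\<close>, many \<open>s\<close> serve
  two classes \<open>x\<close> and \<open>t\<close>. Together with a predecessor \<open>y\<close> of \<open>s\<close> they form a claw, because \<open>y\<close> and
  \<open>x\<close>, \<open>t\<close> are two levels apart.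
\<close>

lemma many_claws:
  assumes G: "conn_graph G" and sf: "starfree G n" and d: "int (n * k) + 1 \<le> deficiency G"
  shows "\<exists>I x t y. finite I \<and> k \<le> card I \<and> (\<forall>s\<in>I. fork G [y s, s] (x s) (t s)) \<and>
    (\<forall>s\<in>I. \<forall>s'\<in>I. s \<noteq> s' \<longrightarrow> anti G {x s, t s} {x s', t s'})"
proof -
  have pg: "pair_graph G" and cn: "\<And>u v. u \<in> pverts G \<Longrightarrow> v \<in> pverts G \<Longrightarrow> (u, v) \<in> (parcs G)\<^sup>*"
    using G by (auto simp: conn_graph_iff)
  obtain S U R where S: "S \<subseteq> pverts G" and U: "U \<subseteq> pverts G - S"
    and cU: "deficiency G + int (card S) \<le> int (card U)"
    and Rs: "\<And>u v. R u v \<Longrightarrow> R v u" and Rr: "\<And>u. R u u" 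
    and Rt: "\<And>u v w. u \<in> pverts G - S \<Longrightarrow> v \<in> pverts G - S \<Longrightarrow> w \<in> pverts G - S \<Longrightarrow> R u v \<Longrightarrow> R v w \<Longrightarrow> R u w"
    and Ra: "\<And>u v. u \<in> pverts G - S \<Longrightarrow> v \<in> pverts G - S \<Longrightarrow> adj G u v \<Longrightarrow> R u v"
    and RU: "\<And>u v. u \<in> U \<Longrightarrow> v \<in> U \<Longrightarrow> u \<noteq> v \<Longrightarrow> \<not> R u v"
    using barrier[OF pg] by blast
  have fV: "finite (pverts G)" using pg by (simp add: pair_graph_iff)
  have fU: "finite U" and fS: "finite S" using S U fV by (auto intro: finite_subset)
  have "0 < card U"
    using cU d of_nat_0_le_iff[of "n * k", where 'a = int] of_nat_0_le_iff[of "card S", where 'a = int]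
    by linarith
  then obtain u0 where u0: "u0 \<in> U" by (auto simp: card_gt_0_iff)
  define \<delta> where "\<delta> = dst (parcs G) {u0}"
  have u0V: "u0 \<in> pverts G" "u0 \<notin> S" using u0 U by auto
  have lip: "\<delta> v \<le> Suc (\<delta> u)" if "adj G u v" for u v
    unfolding \<delta>_def using pg_verts[OF pg that] cn[OF u0V(1)] that by (intro dst_step) auto
  have pred: "\<exists>u. adj G u v \<and> Suc (\<delta> u) = \<delta> v" if "v \<in> pverts G" "v \<noteq> u0" for v
  proof -
    have "(u0, v) \<in> (parcs G)\<^sup>*" using cn u0V that by blast
    moreover from this have "0 < \<delta> v" using dst_0D[of u0 "{u0}" v] that unfolding \<delta>_def by blast
    ultimately show ?thesis using dst_pred[of u0 "{u0}" v "parcs G"] unfolding \<delta>_def by auto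
  qed
  have "\<forall>u\<in>U - {u0}. \<exists>x s. x \<in> pverts G - S \<and> R u x \<and> s \<in> S \<and> adj G s x \<and> Suc (\<delta> s) = \<delta> x"
  proof
    fix u assume u: "u \<in> U - {u0}"
    then have "u \<in> pverts G - S \<and> R u u" using U Rr by auto
    then obtain x where x: "x \<in> pverts G - S" "R u x"
      "\<And>v. v \<in> pverts G - S \<Longrightarrow> R u v \<Longrightarrow> \<delta> x \<le> \<delta> v"
      using ex_has_least_nat[of "\<lambda>x. x \<in> pverts G - S \<and> R u x" u \<delta>] by blast
    have "x \<noteq> u0" using RU u u0 x(2) by blast
    then obtain s where s: "adj G s x" "Suc (\<delta> s) = \<delta> x" using pred x(1) by blast
    have "s \<in> S"
    proof (rule ccontr)
      assume "s \<notin> S"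
      then have sV: "s \<in> pverts G - S" using pg_verts[OF pg s(1)] by auto
      then have "R u s" using Rt[of u x s] Ra[OF _ _ pg_sym[OF pg s(1)]] x u U by blast
      then show False using x(3)[OF sV] s(2) by simp
    qed
    then show "\<exists>x s. x \<in> pverts G - S \<and> R u x \<and> s \<in> S \<and> adj G s x \<and> Suc (\<delta> s) = \<delta> x"
      using x s by blast
  qed
  then obtain x p where xp: "\<And>u. u \<in> U - {u0} \<Longrightarrow> x u \<in> pverts G - S \<and> R u (x u) \<and> p u \<in> S \<and> adj G (p u) (x u) \<and> Suc (\<delta> (p u)) = \<delta> (x u)"
    by metis
  have sep: "x u \<noteq> x v \<and> \<not> adj G (x u) (x v)" if "u \<in> U - {u0}" "v \<in> U - {u0}" "u \<noteq> v" for u v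
  proof -
    have "\<not> R (x u) (x v)"
    proof
      assume "R (x u) (x v)"
      then have "R u v"
        using Rt[of u "x u" "x v"] Rt[of u "x v" v] Rs xp[OF that(1)] xp[OF that(2)] U that by blast
      then show False using RU that by blast
    qed
    then show ?thesis using Ra Rr xp[OF that(1)] xp[OF that(2)] by metis
  qed
  define F where "F s = {u \<in> U - {u0}. p u = s}" for s
  have fF: "finite (F s)" for s using fU by (simp add: F_def)
  have Fn: "card (F s) < n" for s
  proof -
    have "inj_on x (F s)" using sep by (auto simp: inj_on_def F_def)
    then have "card (F s) = card (x ` F s)" by (simp add: card_image)
    also have "\<dots> < n"
    proof -
      have "\<forall>a\<in>x ` F s. adj G s a" using xp by (auto simp: F_def)
      moreover have "\<forall>a\<in>x ` F s. \<forall>b\<in>x ` F s. \<not> adj G a b"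
      proof (intro ballI)
        fix v w assume "v \<in> x ` F s" "w \<in> x ` F s"
        then obtain u u' where "u \<in> U - {u0}" "u' \<in> U - {u0}" "v = x u" "w = x u'" by (auto simp: F_def)
        then show "\<not> adj G v w" using sep[of u u'] pg_irrefl[OF pg] by (cases "u = u'") auto
      qed
      ultimately show ?thesis using starfree_card[OF sf, of "x ` F s" s] fF[of s] by simp
    qed
    finally show ?thesis .
  qed
  define I where "I = {s \<in> S. 2 \<le> card (F s)}"
  have fI: "finite I" using fS by (simp add: I_def)
  have "card (U - {u0}) = (\<Sum>s\<in>S. card (F s))"
  proof -
    have "U - {u0} = (\<Union>s\<in>S. F s)" using xp by (auto simp: F_def)
    moreover have "card (\<Union>s\<in>S. F s) = (\<Sum>s\<in>S. card (F s))"
      by (intro card_UN_disjoint fS) (auto simp: F_def fU)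
    ultimately show ?thesis by simp
  qed
  also have "\<dots> \<le> (\<Sum>s\<in>S. 1 + (if s \<in> I then n else 0))"
    by (intro sum_mono) (use Fn in \<open>auto simp: I_def less_imp_le le_SucI not_le\<close>)
  also have "\<dots> = card S + n * card I"
  proof -
    have "S \<inter> I = I" by (auto simp: I_def)
    then have "(\<Sum>s\<in>S. if s \<in> I then n else 0) = n * card I"
      using sum.inter_restrict[OF fS, of "\<lambda>_. n" I] by (simp add: mult.commute)
    then show ?thesis by (simp only: sum.distrib card_eq_sum)
  qed
  finally have "card U - 1 \<le> card S + n * card I" using u0 fU by simp
  then have "int (card U) \<le> int (card S) + int (n * card I) + 1" by linarith
  then have "int (n * k) \<le> int (n * card I)" using cU d by simp
  then have "n * k \<le> n * card I" by (simp only: of_nat_le_iff)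
  moreover have "0 < n" using Fn[of u0] by simp
  ultimately have kI: "k \<le> card I" by simp
  have "\<forall>s\<in>I. \<exists>a b y. a \<in> U - {u0} \<and> b \<in> U - {u0} \<and> a \<noteq> b \<and> p a = s \<and> p b = s \<and> adj G y s \<and> Suc (\<delta> y) = \<delta> s"
  proof
    fix s assume s: "s \<in> I"
    then obtain a b where ab: "a \<in> F s" "b \<in> F s" "a \<noteq> b"
      using card_le_Suc0_iff_eq[OF fF[of s]] unfolding I_def by fastforce
    have "s \<in> pverts G" "s \<noteq> u0" using s S u0V by (auto simp: I_def)
    then obtain y where "adj G y s" "Suc (\<delta> y) = \<delta> s" using pred by blast
    then show "\<exists>a b y. a \<in> U - {u0} \<and> b \<in> U - {u0} \<and> a \<noteq> b \<and> p a = s \<and> p b = s \<and> adj G y s \<and> Suc (\<delta> y) = \<delta> s"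
      using ab by (auto simp: F_def)
  qed
  then obtain a b y where aby: "\<And>s. s \<in> I \<Longrightarrow> a s \<in> U - {u0} \<and> b s \<in> U - {u0} \<and> a s \<noteq> b s \<and> p (a s) = s \<and> p (b s) = s \<and> adj G (y s) s \<and> Suc (\<delta> (y s)) = \<delta> s"
    by metis
  have fk: "fork G [y s, s] (x (a s)) (x (b s))" if s: "s \<in> I" for s
  proof -
    note h = aby[OF s]
    have A: "adj G s (x (a s))" "\<delta> (x (a s)) = Suc (\<delta> s)" and B: "adj G s (x (b s))" "\<delta> (x (b s)) = Suc (\<delta> s)"
      using xp h by metis+
    have Y: "\<not> adj G (y s) (x (a s))" "\<not> adj G (y s) (x (b s))" "y s \<noteq> x (a s)" "y s \<noteq> x (b s)"
      using lip h A(2) B(2) by fastforce+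
    have "x (a s) \<noteq> x (b s)" "\<not> adj G (x (a s)) (x (b s))" using sep h by blast+
    then show ?thesis using A B Y h pg_verts[OF pg A(1)] pg_verts[OF pg B(1)] pg_verts[OF pg, of "y s" s] pg_irrefl[OF pg]
      by (auto simp: fork_def ipath_Cons anti_def)
  qed
  have "anti G {x (a s), x (b s)} {x (a s'), x (b s')}" if "s \<in> I" "s' \<in> I" "s \<noteq> s'" for s s'
  proof -
    have "x u \<noteq> x u' \<and> \<not> adj G (x u) (x u')" if "u \<in> {a s, b s}" "u' \<in> {a s', b s'}" for u u'
    proof (rule sep)
      show "u \<in> U - {u0}" "u' \<in> U - {u0}" using that aby[OF \<open>s \<in> I\<close>] aby[OF \<open>s' \<in> I\<close>] by auto
      have "p u = s" "p u' = s'" using that aby[OF \<open>s \<in> I\<close>] aby[OF \<open>s' \<in> I\<close>] by auto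
      then show "u \<noteq> u'" using \<open>s \<noteq> s'\<close> by auto
    qed
    then show ?thesis by (simp add: anti_def)
  qed
  then show ?thesis using fI kI fk
    by (intro exI[of _ I] exI[of _ "x \<circ> a"] exI[of _ "x \<circ> b"] exI[of _ y]) auto
qed

section \<open>Ramsey arguments for forks\<close>

text \<open>
  Ramsey's theorem for pairs \<open>i < j\<close> in an arbitrary finite set of numbers, transferred from two-element
  subsets of an initial segment by enumerating the set in increasing order.
\<close>

lemma pair_ramsey:
  assumes C: "finite C"
  shows "\<exists>N. \<forall>I::nat set. \<forall>f. finite I \<longrightarrow> N \<le> card I \<longrightarrow> (\<forall>i\<in>I. \<forall>j\<in>I. i < j \<longrightarrow> f i j \<in> C) \<longrightarrow>
     (\<exists>H\<subseteq>I. card H = m \<and> (\<exists>c. \<forall>i\<in>H. \<forall>j\<in>H. i < j \<longrightarrow> f i j = c))"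
proof -
  obtain enc where enc: "bij_betw enc C {..<card C}"
    using ex_bij_betw_finite_nat[OF C] by (auto simp: atLeast0LessThan)
  obtain N :: nat where N: "partn_lst {..<N} (replicate (card C) m) 2" using ramsey_full by blast
  show ?thesis
  proof (intro exI[of _ N] allI impI)
    fix I :: "nat set" and f
    assume I: "finite I" "N \<le> card I" and f: "\<forall>i\<in>I. \<forall>j\<in>I. i < j \<longrightarrow> f i j \<in> C"
    define e where "e k = sorted_list_of_set I ! k" for k
    have eI: "e k \<in> I" if "k < N" for k
    proof -
      have "k < length (sorted_list_of_set I)" using that I by simp
      then have "e k \<in> set (sorted_list_of_set I)" unfolding e_def by (rule nth_mem)
      then show ?thesis using I(1) by simp
    qed
    have em: "e k < e l" if "k < l" "l < N" for k l
      using that I strict_sorted_list_of_set[of I] unfolding e_def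
      by (intro sorted_wrt_nth_less[of "(<)"]) auto
    define g where "g X = enc (f (e (Min X)) (e (Max X)))" for X
    have "g \<in> nsets {..<N} 2 \<rightarrow> {..<length (replicate (card C) m)}"
    proof
      fix X assume "X \<in> nsets {..<N} 2"
      then obtain k l where kl: "X = {k, l}" "k < l" "l < N"
        unfolding ordered_nsets_2_eq by auto
      then have "f (e k) (e l) \<in> C" using f eI em by auto
      moreover have "Min X = k" "Max X = l" using kl by auto
      ultimately show "g X \<in> {..<length (replicate (card C) m)}"
        using enc by (auto simp: g_def bij_betw_def)
    qed
    then obtain i where i: "i < card C" "monochromatic {..<N} (replicate (card C) m ! i) 2 g i"
      using N unfolding partn_lst_def by auto
    then obtain H where H: "H \<in> nsets {..<N} m" "g ` nsets H 2 \<subseteq> {i}"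
      by (auto simp: monochromatic_def)
    have HN: "H \<subseteq> {..<N}" "card H = m" using H(1) by (auto simp: nsets_def)
    have inj: "inj_on e H"
      by (rule linorder_inj_onI) (use em HN in fastforce)+
    show "\<exists>H\<subseteq>I. card H = m \<and> (\<exists>c. \<forall>i\<in>H. \<forall>j\<in>H. i < j \<longrightarrow> f i j = c)"
    proof (intro exI conjI ballI impI)
      show "e ` H \<subseteq> I" using eI HN by auto
      show "card (e ` H) = m" using inj HN by (simp add: card_image)
      fix x y assume xy: "x \<in> e ` H" "y \<in> e ` H" "x < y"
      then obtain k l where kl: "x = e k" "y = e l" "k \<in> H" "l \<in> H" by auto
      have "k < l" using em[of l k] xy kl HN by (metis lessThan_iff linorder_neqE_nat order_less_asym subsetD)
      then have "{k, l} \<in> nsets H 2" using kl by auto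
      then have "g {k, l} = i" using H(2) by blast
      moreover have "Min {k, l} = k" "Max {k, l} = l" using \<open>k < l\<close> by auto
      ultimately have "enc (f x y) = i" using kl by (simp add: g_def)
      moreover have "f x y \<in> C" using f xy eI HN by auto
      ultimately show "f x y = inv_into C enc i" using enc by (auto simp: bij_betw_def)
    qed
  qed
qed

lemma starfreeD:
  assumes "starfree G n" "finite K" "n \<le> card K" "inj_on v K"
    "\<And>k. k \<in> K \<Longrightarrow> adj G c (v k)" "\<And>k l. k \<in> K \<Longrightarrow> l \<in> K \<Longrightarrow> \<not> adj G (v k) (v l)"
  shows False
proof -
  have "card (v ` K) < n"
    by (rule starfree_card[OF assms(1), of _ c]) (use assms in auto)
  then show False using assms card_image[of v K] by simp
qed

text \<open>
  In a sequence of copies of \<open>T\<^sub>p\<close>, given by \<open>V k\<close> on the positions \<open>0, \<dots>, p + 1\<close> (the leaves are \<open>p\<close>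
  and \<open>p + 1\<close>), suppose that coincidence and adjacency of \<open>V k \<alpha>\<close> and \<open>V l \<beta>\<close> for \<open>k < l\<close> depend on
  \<open>\<alpha>\<close> and \<open>\<beta>\<close> only. Call a position good if its vertices are distinct and non-adjacent in different
  copies. A good position has no contact to any position of another copy:
  a coincidence would make its vertices equal, and an adjacency would give a star. If some
  position is not good, let \<open>j\<close> be the last one: its vertices form a clique and everything behind is
  anticomplete, so the parts of the copies from \<open>j\<close> on form a spider. They cannot coincide, since one
  vertex would then be adjacent to all the good vertices at \<open>j + 1\<close>.
\<close>

lemma uniform_forks:
  fixes V :: "nat \<Rightarrow> nat \<Rightarrow> 'a"
  assumes pg: "pair_graph G" and sf: "starfree G n" and M: "m \<le> M" "n + 3 \<le> M"
    and eq: "\<And>k l \<alpha> \<beta>. k < l \<Longrightarrow> l < M \<Longrightarrow> \<alpha> < p + 2 \<Longrightarrow> \<beta> < p + 2 \<Longrightarrow> V k \<alpha> = V l \<beta> \<longleftrightarrow> eq \<alpha> \<beta>"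
    and ad: "\<And>k l \<alpha> \<beta>. k < l \<Longrightarrow> l < M \<Longrightarrow> \<alpha> < p + 2 \<Longrightarrow> \<beta> < p + 2 \<Longrightarrow> adj G (V k \<alpha>) (V l \<beta>) \<longleftrightarrow> ad \<alpha> \<beta>"
    and leaf: "\<And>\<alpha>. \<alpha> \<in> {p, p + 1} \<Longrightarrow> \<not> eq \<alpha> \<alpha> \<and> \<not> ad \<alpha> \<alpha>"
    and step: "\<And>k \<alpha>. k < M \<Longrightarrow> \<alpha> < p \<Longrightarrow> adj G (V k \<alpha>) (V k (Suc \<alpha>))"
  shows "(\<forall>\<alpha> < p + 2. \<forall>\<beta> < p + 2. \<not> eq \<alpha> \<beta> \<and> \<not> ad \<alpha> \<beta>) \<or>
     (\<exists>j<p. ad j j \<and> \<not> eq j j \<and> (\<forall>\<alpha> < p + 2. \<forall>\<beta> < p + 2. j \<le> \<alpha> \<longrightarrow> j \<le> \<beta> \<longrightarrow> (\<alpha>, \<beta>) \<noteq> (j, j) \<longrightarrow>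
        \<not> eq \<alpha> \<beta> \<and> \<not> ad \<alpha> \<beta>))"
proof -
  define good where "good \<alpha> \<longleftrightarrow> \<alpha> < p + 2 \<and> \<not> eq \<alpha> \<alpha> \<and> \<not> ad \<alpha> \<alpha>" for \<alpha>
  \<comment> \<open>a vertex adjacent to position \<open>\<beta>\<close> of \<open>n\<close> copies is the centre of a forbidden star\<close>
  have star: False
    if "good \<beta>" "K \<subseteq> {..<M}" "n \<le> card K" "\<And>k. k \<in> K \<Longrightarrow> adj G c (V k \<beta>)" for \<beta> K c
  proof -
    have \<beta>: "\<beta> < p + 2" "\<not> eq \<beta> \<beta>" "\<not> ad \<beta> \<beta>" using that(1) by (auto simp: good_def)
    have ne: "V k \<beta> \<noteq> V l \<beta> \<and> \<not> adj G (V k \<beta>) (V l \<beta>)" if "k < l" "l < M" for k l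
      using eq[OF that \<beta>(1) \<beta>(1)] ad[OF that \<beta>(1) \<beta>(1)] \<beta> by simp
    have "inj_on (\<lambda>k. V k \<beta>) K"
      using that(2) ne by (intro linorder_inj_onI) auto
    moreover have "\<not> adj G (V k \<beta>) (V l \<beta>)" if "k \<in> K" "l \<in> K" for k l
      using ne[of k l] ne[of l k] that \<open>K \<subseteq> {..<M}\<close> pg_irrefl[OF pg] pg_sym[OF pg]
      by (metis lessThan_iff linorder_neqE_nat subsetD)
    ultimately show False
      using starfreeD[OF sf, of K "\<lambda>k. V k \<beta>" c] that finite_subset by blast
  qed
  have noeq: "\<not> eq \<alpha> \<beta> \<and> \<not> eq \<beta> \<alpha>" if "\<alpha> < p + 2" "good \<beta>" for \<alpha> \<beta>
  proof -
    have \<beta>: "\<beta> < p + 2" "\<not> eq \<beta> \<beta>" using that(2) by (auto simp: good_def)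
    have "V 1 \<beta> \<noteq> V 2 \<beta>" "V 0 \<beta> \<noteq> V 1 \<beta>" using eq[OF _ _ \<beta>(1) \<beta>(1)] \<beta>(2) M by auto
    moreover have "V 0 \<alpha> = V 1 \<beta> \<longleftrightarrow> eq \<alpha> \<beta>" "V 0 \<alpha> = V 2 \<beta> \<longleftrightarrow> eq \<alpha> \<beta>"
      "V 0 \<beta> = V 2 \<alpha> \<longleftrightarrow> eq \<beta> \<alpha>" "V 1 \<beta> = V 2 \<alpha> \<longleftrightarrow> eq \<beta> \<alpha>"
      using eq that \<beta> M by auto
    ultimately show ?thesis by metis
  qed
  have noad: "\<not> ad \<alpha> \<beta> \<and> \<not> ad \<beta> \<alpha>" if "\<alpha> < p + 2" "good \<beta>" for \<alpha> \<beta>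
  proof -
    have \<beta>: "\<beta> < p + 2" using that(2) by (auto simp: good_def)
    have "\<not> ad \<alpha> \<beta>"
    proof
      assume "ad \<alpha> \<beta>"
      then have "adj G (V 0 \<alpha>) (V k \<beta>)" if "k \<in> {1..n}" for k
        using ad[of 0 k \<alpha> \<beta>] that \<open>\<alpha> < p + 2\<close> \<beta> M by auto
      moreover have "{1..n} \<subseteq> {..<M}" using M by (auto simp: subset_iff)
      ultimately show False using star[OF that(2), of "{1..n}" "V 0 \<alpha>"] by simp
    qed
    moreover have "\<not> ad \<beta> \<alpha>"
    proof
      assume "ad \<beta> \<alpha>"
      then have "adj G (V n \<alpha>) (V k \<beta>)" if "k \<in> {..<n}" for k
        using ad[of k n \<beta> \<alpha>] that \<open>\<alpha> < p + 2\<close> \<beta> M pg_sym[OF pg] by auto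
      moreover have "{..<n} \<subseteq> {..<M}" using M by auto
      ultimately show False using star[OF that(2), of "{..<n}" "V n \<alpha>"] by simp
    qed
    ultimately show ?thesis by simp
  qed
  show ?thesis
  proof (cases "\<forall>\<alpha> < p + 2. good \<alpha>")
    case True
    then have "\<not> eq \<alpha> \<beta> \<and> \<not> ad \<alpha> \<beta>" if "\<alpha> < p + 2" "\<beta> < p + 2" for \<alpha> \<beta>
      using noeq noad that by blast
    then show ?thesis by simp
  next
    case False
    define B where "B = {\<alpha>. \<alpha> < p + 2 \<and> \<not> good \<alpha>}"
    have B: "finite B" "B \<noteq> {}" using False by (auto simp: B_def)
    define j where "j = Max B"
    have jB: "j < p + 2" "\<not> good j" using Max_in[OF B] by (auto simp: j_def B_def)
    have "good p" "good (p + 1)" using leaf by (auto simp: good_def)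
    then have jp: "j < p" using jB by (metis One_nat_def Suc_1 add_Suc_right less_Suc_eq add_0_right)
    have up: "good \<alpha>" if "j < \<alpha>" "\<alpha> < p + 2" for \<alpha>
    proof (rule ccontr)
      assume "\<not> good \<alpha>"
      then have "\<alpha> \<le> j" unfolding j_def using that(2) B(1) by (intro Max_ge) (auto simp: B_def)
      then show False using that(1) by simp
    qed
    have rest: "\<not> eq \<alpha> \<beta> \<and> \<not> ad \<alpha> \<beta>" if "\<alpha> < p + 2" "\<beta> < p + 2" "j \<le> \<alpha>" "j \<le> \<beta>" "(\<alpha>, \<beta>) \<noteq> (j, j)" for \<alpha> \<beta>
    proof (cases "\<alpha> = j")
      case True
      then have "good \<beta>" using that up[of \<beta>] by auto
      then show ?thesis using noeq noad that by blast
    next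
      case False
      then have "good \<alpha>" using that up[of \<alpha>] by auto
      then show ?thesis using noeq noad that by blast
    qed
    have "\<not> eq j j"
    proof
      assume "eq j j"
      then have V0: "V k j = V 0 j" if "k < M" for k
        using eq[of 0 k j j] that jB(1) by (cases k) auto
      have A: "adj G (V 0 j) (V k (Suc j))" if "k \<in> {..<n}" for k
      proof -
        have "k < M" using that M by simp
        from step[OF this jp] show ?thesis unfolding V0[OF \<open>k < M\<close>] .
      qed
      have g: "good (Suc j)" using up jp by simp
      have "{..<n} \<subseteq> {..<M}" using M by auto
      then show False using star[OF g, of "{..<n}" "V 0 j"] A by simp
    qed
    moreover from this have "ad j j" using jB by (auto simp: good_def)
    ultimately show ?thesis using jp rest by blast
  qed
qed

text \<open>
  \<open>N\<close> copies of \<open>T\<^sub>p\<close> with pairwise anticomplete leaves force a spider or \<open>m\<close> copies that are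
  anticomplete altogether.
\<close>

definition forces_spider :: "nat \<Rightarrow> nat \<Rightarrow> nat \<Rightarrow> nat \<Rightarrow> bool" where
  "forces_spider n p m N \<longleftrightarrow> (\<forall>(G::ngraph) (I::nat set) ws a b. pair_graph G \<longrightarrow> starfree G n \<longrightarrow> finite I \<longrightarrow> N \<le> card I \<longrightarrow>
     (\<forall>s\<in>I. fork G (ws s) (a s) (b s) \<and> length (ws s) = p) \<longrightarrow>
     (\<forall>s\<in>I. \<forall>s'\<in>I. s \<noteq> s' \<longrightarrow> anti G {a s, b s} {a s', b s'}) \<longrightarrow>
     (\<exists>q ws' a' b'. 1 \<le> q \<and> spider G n q ws' a' b') \<or>
     (\<exists>J\<subseteq>I. card J = m \<and> (\<forall>s\<in>J. \<forall>s'\<in>J. s \<noteq> s' \<longrightarrow>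
        anti G (set (ws s) \<union> {a s, b s}) (set (ws s') \<union> {a s', b s'}))))"

lemma forces_spiderD:
  fixes G :: ngraph and I :: "nat set"
  assumes "forces_spider n p m N" "pair_graph G" "starfree G n" "finite I" "N \<le> card I"
    "\<forall>s\<in>I. fork G (ws s) (a s) (b s) \<and> length (ws s) = p"
    "\<forall>s\<in>I. \<forall>s'\<in>I. s \<noteq> s' \<longrightarrow> anti G {a s, b s} {a s', b s'}"
  shows "(\<exists>q ws' a' b'. 1 \<le> q \<and> spider G n q ws' a' b') \<or>
     (\<exists>J\<subseteq>I. card J = m \<and> (\<forall>s\<in>J. \<forall>s'\<in>J. s \<noteq> s' \<longrightarrow>
        anti G (set (ws s) \<union> {a s, b s}) (set (ws s') \<union> {a s', b s'})))"
  by (rule assms(1)[unfolded forces_spider_def, THEN spec[of _ G], THEN spec[of _ I], THEN spec[of _ ws],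
    THEN spec[of _ a], THEN spec[of _ b], THEN mp, OF assms(2), THEN mp, OF assms(3), THEN mp, OF assms(4),
    THEN mp, OF assms(5), THEN mp, OF assms(6), THEN mp, OF assms(7)])

text \<open>
  Colour a pair of copies by the set of coincidences and the set of adjacencies between their
  positions and apply Ramsey's theorem; a monochromatic family is uniform.
\<close>

lemma forks_ramsey: "\<exists>N. forces_spider n p m N"
proof -
  define P where "P = {..<p + 2} \<times> {..<p + 2}"
  have fin: "finite (Pow P \<times> Pow P)" by (simp add: P_def)
  define M where "M = m + n + 3"
  obtain N where N: "\<And>(I::nat set) (f::nat \<Rightarrow> nat \<Rightarrow> (nat \<times> nat) set \<times> (nat \<times> nat) set). finite I \<Longrightarrow> N \<le> card I \<Longrightarrow>
     (\<forall>i\<in>I. \<forall>j\<in>I. i < j \<longrightarrow> f i j \<in> Pow P \<times> Pow P) \<Longrightarrow>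
     (\<exists>H\<subseteq>I. card H = M \<and> (\<exists>c. \<forall>i\<in>H. \<forall>j\<in>H. i < j \<longrightarrow> f i j = c))"
    using pair_ramsey[OF fin, of M] by blast
  show ?thesis
    unfolding forces_spider_def
  proof (intro exI[of _ N] allI impI)
    fix G :: ngraph and I :: "nat set" and ws a b
    assume pg: "pair_graph G" and sf: "starfree G n" and I: "finite I" "N \<le> card I"
      and fk: "\<forall>s\<in>I. fork G (ws s) (a s) (b s) \<and> length (ws s) = p"
      and lf: "\<forall>s\<in>I. \<forall>s'\<in>I. s \<noteq> s' \<longrightarrow> anti G {a s, b s} {a s', b s'}"
    define us where "us s = ws s @ [a s, b s]" for s
    define f where "f i j = ({z \<in> P. us i ! fst z = us j ! snd z}, {z \<in> P. adj G (us i ! fst z) (us j ! snd z)})" for i j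
    have "\<forall>i\<in>I. \<forall>j\<in>I. i < j \<longrightarrow> f i j \<in> Pow P \<times> Pow P" by (auto simp: f_def)
    from N[OF I this] obtain H c where H: "H \<subseteq> I" "card H = M"
      and c': "\<forall>i\<in>H. \<forall>j\<in>H. i < j \<longrightarrow> f i j = c"
      by (elim exE conjE)
    have c: "f i j = c" if "i \<in> H" "j \<in> H" "i < j" for i j using c' that by blast
    have finH: "finite H" using H I finite_subset by blast
    define h where "h k = sorted_list_of_set H ! k" for k
    have hH: "h k \<in> H" if "k < M" for k
    proof -
      have "k < length (sorted_list_of_set H)" using that H by simp
      then have "h k \<in> set (sorted_list_of_set H)" unfolding h_def by (rule nth_mem)
      then show ?thesis using finH by simp
    qed
    have hm: "h k < h l" if "k < l" "l < M" for k l
      using that H strict_sorted_list_of_set[of H] unfolding h_def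
      by (intro sorted_wrt_nth_less[of "(<)"]) auto
    define V where "V k \<alpha> = us (h k) ! \<alpha>" for k \<alpha>
    define eq where "eq \<alpha> \<beta> \<longleftrightarrow> (\<alpha>, \<beta>) \<in> fst c" for \<alpha> \<beta>
    define ad where "ad \<alpha> \<beta> \<longleftrightarrow> (\<alpha>, \<beta>) \<in> snd c" for \<alpha> \<beta>
    have pat: "(V k \<alpha> = V l \<beta> \<longleftrightarrow> eq \<alpha> \<beta>) \<and> (adj G (V k \<alpha>) (V l \<beta>) \<longleftrightarrow> ad \<alpha> \<beta>)"
      if "k < l" "l < M" "\<alpha> < p + 2" "\<beta> < p + 2" for k l \<alpha> \<beta>
    proof -
      have "f (h k) (h l) = c" using c hH hm that by auto
      then show ?thesis using that by (auto simp: f_def eq_def ad_def V_def P_def)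
    qed
    have len: "length (ws (h k)) = p" "fork G (ws (h k)) (a (h k)) (b (h k))" if "k < M" for k
      using fk H hH[OF that] by auto
    have Vs: "V k p = a (h k)" "V k (Suc p) = b (h k)" "set (us (h k)) = V k ` {..<p + 2}" if "k < M" for k
    proof -
      show "V k p = a (h k)" "V k (Suc p) = b (h k)"
        using len[OF that] by (auto simp: V_def us_def nth_append)
      have "length (us (h k)) = p + 2" using len[OF that] by (simp add: us_def)
      then show "set (us (h k)) = V k ` {..<p + 2}"
        using nth_image_set[of "us (h k)"] by (simp add: V_def[abs_def])
    qed
    have leaf: "\<not> eq \<alpha> \<alpha> \<and> \<not> ad \<alpha> \<alpha>" if "\<alpha> \<in> {p, p + 1}" for \<alpha>
    proof -
      have h01: "h 0 \<in> I" "h 1 \<in> I" "h 0 \<noteq> h 1" using hH H hm[of 0 1] by (auto simp: M_def)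
      then have "anti G {V 0 p, V 0 (Suc p)} {V 1 p, V 1 (Suc p)}"
        using lf Vs(1,2) by (simp add: M_def)
      then show ?thesis using pat[of 0 1 \<alpha> \<alpha>] that by (auto simp: anti_def M_def)
    qed
    have step: "adj G (V k \<alpha>) (V k (Suc \<alpha>))" if "k < M" "\<alpha> < p" for k \<alpha>
    proof -
      have ip: "ipath G (ws (h k) @ [a (h k)])" using len[OF that(1)] by (simp add: fork_def)
      have "V k \<alpha> = (ws (h k) @ [a (h k)]) ! \<alpha>" "V k (Suc \<alpha>) = (ws (h k) @ [a (h k)]) ! Suc \<alpha>"
        using that(2) len[OF that(1)] by (auto simp: V_def us_def nth_append)
      then show ?thesis using ip that(2) len[OF that(1)] unfolding ipath_def by auto
    qed
    from uniform_forks[OF pg sf, of m M p V eq ad] pat leaf step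
    consider (indep) "\<And>\<alpha> \<beta>. \<alpha> < p + 2 \<Longrightarrow> \<beta> < p + 2 \<Longrightarrow> \<not> eq \<alpha> \<beta> \<and> \<not> ad \<alpha> \<beta>"
      | (clique) j where "j < p" "ad j j" "\<not> eq j j"
        "\<And>\<alpha> \<beta>. \<alpha> < p + 2 \<Longrightarrow> \<beta> < p + 2 \<Longrightarrow> j \<le> \<alpha> \<Longrightarrow> j \<le> \<beta> \<Longrightarrow> (\<alpha>, \<beta>) \<noteq> (j, j) \<Longrightarrow> \<not> eq \<alpha> \<beta> \<and> \<not> ad \<alpha> \<beta>"
      by (auto simp: M_def)
    then show "(\<exists>q ws' a' b'. 1 \<le> q \<and> spider G n q ws' a' b') \<or>
     (\<exists>J\<subseteq>I. card J = m \<and> (\<forall>s\<in>J. \<forall>s'\<in>J. s \<noteq> s' \<longrightarrow>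
        anti G (set (ws s) \<union> {a s, b s}) (set (ws s') \<union> {a s', b s'})))"
    proof cases
      case indep
      have an: "anti G (set (us (h k))) (set (us (h l)))" if "k < l" "l < M" for k l
        unfolding anti_def using Vs(3) that pat indep by auto
      then have an': "anti G (set (us (h k))) (set (us (h l)))" if "k \<noteq> l" "k < M" "l < M" for k l
        using that anti_sym[OF pg] by (metis linorder_neqE_nat)
      have mM: "k < M" if "k < m" for k using that by (simp add: M_def)
      have "inj_on h {..<m}" by (rule linorder_inj_onI) (use hm mM in \<open>auto simp: less_imp_neq\<close>)
      then have "card (h ` {..<m}) = m" by (simp add: card_image)
      moreover have "h ` {..<m} \<subseteq> I" using hH mM H by blast
      moreover have "\<forall>s\<in>h ` {..<m}. \<forall>s'\<in>h ` {..<m}. s \<noteq> s' \<longrightarrow>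
        anti G (set (ws s) \<union> {a s, b s}) (set (ws s') \<union> {a s', b s'})"
      proof (intro ballI impI)
        fix s s' assume "s \<in> h ` {..<m}" "s' \<in> h ` {..<m}" "s \<noteq> s'"
        then obtain k l where "k < m" "l < m" "s = h k" "s' = h l" "k \<noteq> l" by auto
        moreover have "set (us i) = set (ws i) \<union> {a i, b i}" for i by (auto simp: us_def)
        ultimately show "anti G (set (ws s) \<union> {a s, b s}) (set (ws s') \<union> {a s', b s'})"
          using an'[of k l] mM by simp
      qed
      ultimately show ?thesis by blast
    next
      case clique
      define ws' where "ws' k = drop j (ws (h k))" for k
      have w: "ws' k = V k j # tl (ws' k)" "set (tl (ws' k)) \<subseteq> V k ` {Suc j..<p + 2}"
        "set (ws' k) \<subseteq> V k ` {j..<p + 2}" if "k < M" for k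
      proof -
        have e: "ws' k = V k j # drop (Suc j) (ws (h k))"
          using len[OF that] clique(1) by (simp add: ws'_def V_def us_def nth_append Cons_nth_drop_Suc)
        then show "ws' k = V k j # tl (ws' k)" by simp
        have wV: "ws (h k) ! i = V k i" if "i < p" for i
          using len(1)[OF \<open>k < M\<close>] that by (simp add: V_def us_def nth_append)
        show tl: "set (tl (ws' k)) \<subseteq> V k ` {Suc j..<p + 2}"
        proof
          fix v assume "v \<in> set (tl (ws' k))"
          then have "v \<in> set (drop (Suc j) (ws (h k)))" unfolding e by simp
          then obtain i where i: "i < p - Suc j" "v = drop (Suc j) (ws (h k)) ! i"
            using len(1)[OF \<open>k < M\<close>] by (auto simp: in_set_conv_nth)
          then have "v = V k (Suc j + i)" using wV[of "Suc j + i"] len(1)[OF \<open>k < M\<close>] by simp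
          moreover have "Suc j + i \<in> {Suc j..<p + 2}" using i(1) by simp
          ultimately show "v \<in> V k ` {Suc j..<p + 2}" by blast
        qed
        have "set (ws' k) = insert (V k j) (set (tl (ws' k)))" unfolding e by simp
        moreover have "j \<in> {j..<p + 2}" "{Suc j..<p + 2} \<subseteq> {j..<p + 2}" using clique(1) by auto
        ultimately show "set (ws' k) \<subseteq> V k ` {j..<p + 2}" using tl by blast
      qed
      have ab: "{a (h k), b (h k)} \<subseteq> V k ` {Suc j..<p + 2}" if "k < M" for k
        using Vs(1,2)[OF that, symmetric] clique(1) by auto
      have no: "V k \<alpha> \<noteq> V l \<beta> \<and> \<not> adj G (V k \<alpha>) (V l \<beta>)"
        if "k \<noteq> l" "k < M" "l < M" "\<alpha> \<in> {Suc j..<p + 2}" "\<beta> \<in> {j..<p + 2}" for k l \<alpha> \<beta>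
      proof (cases "k < l")
        case True
        then show ?thesis using pat[of k l \<alpha> \<beta>] clique(4)[of \<alpha> \<beta>] that by auto
      next
        case False
        then show ?thesis using pat[of l k \<beta> \<alpha>] clique(4)[of \<beta> \<alpha>] that pg_sym_iff[OF pg, of "V k \<alpha>"] by auto
      qed
      have jj: "V k j \<noteq> V l j \<and> adj G (V k j) (V l j)" if "k \<noteq> l" "k < M" "l < M" for k l
      proof (cases "k < l")
        case True
        then show ?thesis using pat[of k l j j] clique that by auto
      next
        case False
        then show ?thesis using pat[of l k j j] clique that pg_sym[OF pg, of "V l j"] by auto
      qed
      have f1: "fork G (ws' k) ((a \<circ> h) k) ((b \<circ> h) k) \<and> length (ws' k) = p - j" if "k < n" for k
      proof
        have kM: "k < M" using that by (simp add: M_def)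
        have F: "ipath G (ws (h k) @ [a (h k)])" "ipath G (ws (h k) @ [b (h k)])" "length (ws (h k)) = p"
          "a (h k) \<noteq> b (h k)" "\<not> adj G (a (h k)) (b (h k))"
          using len[OF kM] by (auto simp: fork_def)
        show "fork G (ws' k) ((a \<circ> h) k) ((b \<circ> h) k)"
          using ipath_drop[OF F(1), of j] ipath_drop[OF F(2), of j] F(3-5) w(1)[OF kM] clique(1)
          by (auto simp: fork_def ws'_def)
        show "length (ws' k) = p - j" using F by (simp add: ws'_def)
      qed
      have f2: "hd (ws' k) \<noteq> hd (ws' l) \<and> adj G (hd (ws' k)) (hd (ws' l)) \<and>
        anti G (set (tl (ws' k)) \<union> {(a \<circ> h) k, (b \<circ> h) k}) (set (ws' l) \<union> {(a \<circ> h) l, (b \<circ> h) l})"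
        if "k < n" "l < n" "k \<noteq> l" for k l
      proof (intro conjI)
        have kM: "k < M" and lM: "l < M" using that by (simp_all add: M_def)
        have hds: "hd (ws' k) = V k j" "hd (ws' l) = V l j" using w(1) kM lM by (metis list.sel(1))+
        show "hd (ws' k) \<noteq> hd (ws' l)" "adj G (hd (ws' k)) (hd (ws' l))"
          unfolding hds using jj \<open>k \<noteq> l\<close> kM lM by auto
        have sub: "{Suc j..<p + 2} \<subseteq> {j..<p + 2}" by auto
        have s1: "set (tl (ws' k)) \<union> {(a \<circ> h) k, (b \<circ> h) k} \<subseteq> V k ` {Suc j..<p + 2}"
          using Un_least[OF w(2)[OF kM] ab[OF kM]] by simp
        have s2: "set (ws' l) \<union> {(a \<circ> h) l, (b \<circ> h) l} \<subseteq> V l ` {j..<p + 2}"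
          using Un_least[OF w(3)[OF lM] subset_trans[OF ab[OF lM] image_mono[OF sub]]] by simp
        have "anti G (V k ` {Suc j..<p + 2}) (V l ` {j..<p + 2})"
          unfolding anti_def
        proof (intro ballI)
          fix u v assume "u \<in> V k ` {Suc j..<p + 2}" "v \<in> V l ` {j..<p + 2}"
          then obtain \<alpha> \<beta> where "\<alpha> \<in> {Suc j..<p + 2}" "\<beta> \<in> {j..<p + 2}" "u = V k \<alpha>" "v = V l \<beta>"
            by (elim imageE)
          then show "u \<noteq> v \<and> \<not> adj G u v" using no[OF \<open>k \<noteq> l\<close> kM lM] by simp
        qed
        then show "anti G (set (tl (ws' k)) \<union> {(a \<circ> h) k, (b \<circ> h) k}) (set (ws' l) \<union> {(a \<circ> h) l, (b \<circ> h) l})"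
          using s1 s2 by (rule anti_mono)
      qed
      have "spider G n (p - j) ws' (a \<circ> h) (b \<circ> h)"
        unfolding spider_def using f1 f2 by simp
      moreover have "1 \<le> p - j" using clique(1) by simp
      ultimately show ?thesis by blast
    qed
  qed
qed

section \<open>Paths to a claw\<close>

definition claw :: "'a pair_pre_digraph \<Rightarrow> 'a \<Rightarrow> 'a \<Rightarrow> 'a \<Rightarrow> 'a \<Rightarrow> bool" where
  "claw G s x y z \<longleftrightarrow> adj G s x \<and> adj G s y \<and> adj G s z \<and> x \<noteq> y \<and> x \<noteq> z \<and> y \<noteq> z \<and>
     \<not> adj G x y \<and> \<not> adj G x z \<and> \<not> adj G y z"

lemma claw_perm:
  assumes "pair_graph G" "claw G s x y z"
  shows "claw G s y x z" "claw G s x z y" "claw G s y z x" "claw G s z x y" "claw G s z y x"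
  using assms unfolding claw_def by (auto dest: pg_sym)

lemma fork_claw: "pair_graph G \<Longrightarrow> fork G [y, s] x t \<Longrightarrow> claw G s x t y"
  by (auto simp: fork_def claw_def ipath_Cons anti_def dest: pg_sym)

lemma fork_appendI:
  assumes "ipath G us" "us \<noteq> []" "c = last us" "adj G c a" "adj G c b" "a \<noteq> b" "\<not> adj G a b"
    "anti G (set (butlast us)) {a, b}" "a \<in> pverts G" "b \<in> pverts G" "c \<noteq> a" "c \<noteq> b"
  shows "fork G us a b"
  using assms unfolding fork_def by (auto simp: ipath_append ipath_Cons anti_insert anti_Un)

text \<open>
  The ways in which an induced path can arrive at a claw, up to symmetry. In each of them a fork
  arises whose leaves are leaves of the claw.
\<close>

lemma claw_reach_aux:
  assumes G: "pair_graph G" and K: "claw G s x y z"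
    and us: "ipath G us" "us \<noteq> []" "c = last us" "set us \<inter> {s, x, y, z} = {}"
      "anti G (set (butlast us)) {s, x, y, z}"
  shows "adj G c x \<Longrightarrow> adj G c y \<Longrightarrow> fork G us x y"
    and "adj G c s \<Longrightarrow> \<not> adj G c x \<Longrightarrow> \<not> adj G c y \<Longrightarrow> fork G (us @ [s]) x y"
    and "\<not> adj G c s \<Longrightarrow> adj G c x \<Longrightarrow> \<not> adj G c y \<Longrightarrow> \<not> adj G c z \<Longrightarrow> fork G (us @ [x, s]) y z"
proof -
  have V: "s \<in> pverts G" "x \<in> pverts G" "y \<in> pverts G" "z \<in> pverts G"
    using K pg_verts[OF G] unfolding claw_def by blast+
  have k: "adj G s x" "adj G s y" "adj G s z" "adj G x s" "adj G y s" "adj G z s" "x \<noteq> y" "x \<noteq> z" "y \<noteq> z"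
    "\<not> adj G x y" "\<not> adj G x z" "\<not> adj G y z" "\<not> adj G y x" "\<not> adj G z x" "\<not> adj G z y"
    "s \<noteq> x" "s \<noteq> y" "s \<noteq> z"
    using K pg_sym[OF G] pg_irrefl[OF G] unfolding claw_def by blast+
  have c: "c \<in> set us" "c \<noteq> s" "c \<noteq> x" "c \<noteq> y" "c \<noteq> z" using us by auto
  have bl: "set (butlast us) \<subseteq> set us" by (auto dest: in_set_butlastD)
  have s1: "set us = insert c (set (butlast us))"
  proof -
    have "set us = set (butlast us @ [last us])" using us(2) by simp
    then show ?thesis unfolding us(3) by (simp del: append_butlast_last_id)
  qed
  show "fork G us x y" if "adj G c x" "adj G c y"
    by (rule fork_appendI[OF us(1,2,3)]) (use that k c us V in \<open>auto simp: anti_insert\<close>)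
  show "fork G (us @ [s]) x y" if "adj G c s" "\<not> adj G c x" "\<not> adj G c y"
  proof (rule fork_appendI[where c = s])
    show "ipath G (us @ [s])" using that us V c by (simp add: ipath_append ipath_Cons anti_insert anti_Un)
    show "anti G (set (butlast (us @ [s]))) {x, y}"
      using us(5) that c unfolding butlast_snoc s1 by (auto simp: anti_insert)
  qed (use that us k V in auto)
  show "fork G (us @ [x, s]) y z" if "\<not> adj G c s" "adj G c x" "\<not> adj G c y" "\<not> adj G c z"
  proof (rule fork_appendI[where c = s])
    show "ipath G (us @ [x, s])" using that us V c k by (simp add: ipath_append ipath_Cons anti_insert anti_Un)
    have "set (butlast (us @ [x, s])) = insert x (set us)" by (simp add: butlast_append)
    then show "anti G (set (butlast (us @ [x, s]))) {y, z}"
      using us(5) that c k by (auto simp: anti_insert s1)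
  qed (use that us k V in auto)
qed

text \<open>
  If the last vertex \<open>c\<close> of the path sees two leaves, the path itself is a stem; if it sees the centre
  and at most one leaf, the stem continues to the centre; if it sees a single leaf only, the stem
  continues through this leaf to the centre.
\<close>

lemma claw_reach:
  assumes G: "pair_graph G" and K: "claw G s x y z"
    and us: "ipath G us" "us \<noteq> []" "set us \<inter> {s, x, y, z} = {}"
      "anti G (set (butlast us)) {s, x, y, z}" and c: "c \<in> {s, x, y, z}" "adj G (last us) c"
  shows "\<exists>zs a b. fork G (us @ zs) a b \<and> length zs \<le> 2 \<and> set zs \<subseteq> {s, x, y, z} \<and> {a, b} \<subseteq> {x, y, z}"
proof -
  let ?c = "last us"
  note P = claw_perm[OF G K]
  note A = claw_reach_aux[OF G _ us(1,2) refl]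
  have e: "{s, y, x, z} = {s, x, y, z}" "{s, x, z, y} = {s, x, y, z}" "{s, y, z, x} = {s, x, y, z}"
    "{s, z, x, y} = {s, x, y, z}" "{s, z, y, x} = {s, x, y, z}" by auto
  consider "adj G ?c x" "adj G ?c y" | "adj G ?c x" "adj G ?c z" | "adj G ?c y" "adj G ?c z"
    | "adj G ?c s" "\<not> adj G ?c x" "\<not> adj G ?c y" | "adj G ?c s" "\<not> adj G ?c x" "\<not> adj G ?c z"
    | "adj G ?c s" "\<not> adj G ?c y" "\<not> adj G ?c z"
    | "\<not> adj G ?c s" "adj G ?c x" "\<not> adj G ?c y" "\<not> adj G ?c z"
    | "\<not> adj G ?c s" "adj G ?c y" "\<not> adj G ?c x" "\<not> adj G ?c z"
    | "\<not> adj G ?c s" "adj G ?c z" "\<not> adj G ?c x" "\<not> adj G ?c y"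
    using c by blast
  then show ?thesis
  proof cases
    case 1
    then show ?thesis using A(1)[OF K us(3,4)] by (intro exI[of _ "[]"] exI[of _ x] exI[of _ y]) simp
  next
    case 2
    then show ?thesis using A(1)[OF P(2)] us(3,4) e by (intro exI[of _ "[]"] exI[of _ x] exI[of _ z]) simp
  next
    case 3
    then show ?thesis using A(1)[OF P(3)] us(3,4) e by (intro exI[of _ "[]"] exI[of _ y] exI[of _ z]) simp
  next
    case 4
    then show ?thesis using A(2)[OF K us(3,4)] by (intro exI[of _ "[s]"] exI[of _ x] exI[of _ y]) simp
  next
    case 5
    then show ?thesis using A(2)[OF P(2)] us(3,4) e by (intro exI[of _ "[s]"] exI[of _ x] exI[of _ z]) simp
  next
    case 6
    then show ?thesis using A(2)[OF P(3)] us(3,4) e by (intro exI[of _ "[s]"] exI[of _ y] exI[of _ z]) simp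
  next
    case 7
    then show ?thesis using A(3)[OF K us(3,4)] by (intro exI[of _ "[x, s]"] exI[of _ y] exI[of _ z]) simp
  next
    case 8
    then show ?thesis using A(3)[OF P(1)] us(3,4) e by (intro exI[of _ "[y, s]"] exI[of _ x] exI[of _ z]) simp
  next
    case 9
    then show ?thesis using A(3)[OF P(4)] us(3,4) e by (intro exI[of _ "[z, s]"] exI[of _ x] exI[of _ y]) simp
  qed
qed

abbreviation arcs_in :: "'a pair_pre_digraph \<Rightarrow> 'a set \<Rightarrow> ('a \<times> 'a) set" where
  "arcs_in G W \<equiv> parcs G \<inter> W \<times> W"

lemma arcs_in_sym: "pair_graph G \<Longrightarrow> (u, v) \<in> (arcs_in G W)\<^sup>* \<Longrightarrow> (v, u) \<in> (arcs_in G W)\<^sup>*"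
  by (rule symD[OF sym_rtrancl]) (auto simp: sym_def dest: pg_sym)

definition linked :: "'a pair_pre_digraph \<Rightarrow> 'a set \<Rightarrow> bool" where
  "linked G W \<longleftrightarrow> W \<subseteq> pverts G \<and> (\<forall>u\<in>W. \<forall>v\<in>W. (u, v) \<in> (arcs_in G W)\<^sup>*)"

lemma linked_conn: "conn_graph G \<Longrightarrow> linked G (pverts G)"
proof -
  assume G: "conn_graph G"
  then have "arcs_in G (pverts G) = parcs G" by (auto simp: conn_graph_iff pair_graph_iff)
  then show ?thesis using G by (simp add: linked_def conn_graph_iff)
qed

lemma dst_lip:
  assumes G: "pair_graph G" and L: "linked G W" and A: "A \<noteq> {}" "A \<subseteq> W" and uv: "u \<in> W" "v \<in> W" "adj G u v"
  shows "dst (arcs_in G W) A v \<le> Suc (dst (arcs_in G W) A u)"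
proof -
  obtain a where a: "a \<in> A" using A by blast
  then have "(a, u) \<in> (arcs_in G W)\<^sup>*" using L A uv by (auto simp: linked_def)
  then show ?thesis using dst_step[OF a] uv by blast
qed

text \<open>
  The path is recorded without its end in \<open>A\<close>, and with the distance of each of its vertices.
\<close>

lemma shortest_path:
  assumes G: "pair_graph G" and L: "linked G W" and A: "A \<noteq> {}" "A \<subseteq> W"
  shows "v \<in> W \<Longrightarrow> v \<notin> A \<Longrightarrow> \<exists>us. us \<noteq> [] \<and> hd us = v \<and> ipath G us \<and> set us \<subseteq> W - A \<and>
     anti G (set (butlast us)) A \<and> (\<exists>c\<in>A. adj G (last us) c) \<and> length us = dst (arcs_in G W) A v \<and>
     (\<forall>i<length us. dst (arcs_in G W) A (us ! i) + i = dst (arcs_in G W) A v)"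
proof (induction "dst (arcs_in G W) A v" arbitrary: v)
  case 0
  obtain a where a: "a \<in> A" using A by blast
  then have "(a, v) \<in> (arcs_in G W)\<^sup>*" using L A 0 by (auto simp: linked_def)
  then show ?case using dst_0D[OF a] 0 by simp
next
  case (Suc d)
  let ?d = "dst (arcs_in G W) A"
  have lip: "?d v \<le> Suc (?d u)" if "u \<in> W" "v \<in> W" "adj G u v" for u v
    using dst_lip[OF G L A that] .
  obtain a where a: "a \<in> A" using A by blast
  then have av: "(a, v) \<in> (arcs_in G W)\<^sup>*" using L A Suc by (auto simp: linked_def)
  obtain b u where u: "b \<in> A" "(b, u) \<in> (arcs_in G W)\<^sup>*" "(u, v) \<in> arcs_in G W" "Suc (?d u) = ?d v"
    using dst_pred[OF a av] Suc(2) by auto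
  have uW: "u \<in> W" "adj G v u" "adj G u v" using u(3) pg_sym[OF G] by auto
  have du: "?d u = d" using u(4) Suc(2) by simp
  have vV: "v \<in> pverts G" "v \<noteq> u" using L Suc(3) u(4) by (auto simp: linked_def)
  show ?case
  proof (cases "u \<in> A")
    case True
    then have "d = 0" using du dst_0[of u A] by simp
    then show ?thesis using True uW Suc(2-4) vV
      by (intro exI[of _ "[v]"]) (auto simp: ipath_Cons anti_Un simp flip: Suc(2))
  next
    case False
    from Suc(1)[OF du[symmetric] uW(1) this]
    obtain us where us: "us \<noteq> []" "hd us = u" "ipath G us" "set us \<subseteq> W - A"
      "anti G (set (butlast us)) A" "\<exists>c\<in>A. adj G (last us) c" and us': "length us = ?d u"
      "\<forall>i<length us. ?d (us ! i) + i = ?d u"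
      by (elim exE conjE)
    have us7: "length us = d" using us'(1) du by simp
    have us8: "?d (us ! i) + i = d" if "i < length us" for i
      using us'(2) that du by simp
    obtain us' where us'': "us = u # us'" using us(1,2) by (cases us) auto
    have lt: "?d w < d" if w: "w \<in> set us'" for w
    proof -
      obtain i where i: "i < length us'" "us' ! i = w" using w by (auto simp: in_set_conv_nth)
      then have "?d w + Suc i = d" using us8[of "Suc i"] us'' by simp
      then show ?thesis by simp
    qed
    have "anti G {v} (set us')"
    proof -
      have "v \<noteq> w \<and> \<not> adj G v w" if w: "w \<in> set us'" for w
      proof
        show "v \<noteq> w" using lt[OF w] Suc(2) by auto
        show "\<not> adj G v w"
        proof
          assume "adj G v w"
          then have "?d v \<le> Suc (?d w)" using lip[of w v] pg_sym[OF G] w us(4) us'' Suc(3) by auto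
          then show False using lt[OF w] Suc(2) by simp
        qed
      qed
      then show ?thesis by (simp add: anti_def)
    qed
    then have ip: "ipath G (v # us)" using us(3) us'' uW vV by (simp add: ipath_Cons)
    have "d \<noteq> 0" using us(1) us7 by auto
    have "anti G {v} A"
    proof -
      have "\<not> adj G v c" if c: "c \<in> A" for c
      proof
        assume "adj G v c"
        then have "?d v \<le> Suc (?d c)" using lip[of c v] pg_sym[OF G] c A Suc(3) by auto
        then show False using dst_0[OF c] Suc(2) \<open>d \<noteq> 0\<close> by simp
      qed
      then show ?thesis using Suc(4) by (auto simp: anti_def)
    qed
    then have an: "anti G (set (butlast (v # us))) A" using us(1,5) by (auto simp: anti_insert anti_def)
    have ds: "?d ((v # us) ! i) + i = ?d v" if "i < length (v # us)" for i
      using that us8[of "i - 1"] Suc(2) by (cases i) auto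
    show ?thesis
      by (rule exI[of _ "v # us"]) (use ip an ds us us7 Suc(2-4) in auto)
  qed
qed

lemma pigeonhole:
  fixes f :: "'a \<Rightarrow> nat"
  assumes "finite I" "\<And>s. s \<in> I \<Longrightarrow> f s \<le> L" "Suc L * N \<le> card I"
  shows "\<exists>p\<le>L. N \<le> card {s \<in> I. f s = p}"
proof (rule ccontr)
  assume "\<not> ?thesis"
  then have lt: "card {s \<in> I. f s = p} < N" if "p \<le> L" for p using that not_le by blast
  have "I = (\<Union>p\<le>L. {s \<in> I. f s = p})" using assms(2) by auto
  then have "card I = card (\<Union>p\<le>L. {s \<in> I. f s = p})" by simp
  also have "\<dots> = (\<Sum>p\<le>L. card {s \<in> I. f s = p})"
    using assms(1) by (intro card_UN_disjoint) auto
  also have "\<dots> < (\<Sum>p\<le>L. N)" using lt by (intro sum_strict_mono) auto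
  finally show False using assms(3) by simp
qed

section \<open>Forks with a common end\<close>

definition forces_spider_rooted :: "nat \<Rightarrow> nat \<Rightarrow> nat \<Rightarrow> bool" where
  "forces_spider_rooted n L N \<longleftrightarrow> (\<forall>(G::ngraph) (I::nat set) ws a b r. pair_graph G \<longrightarrow> starfree G n \<longrightarrow> finite I \<longrightarrow> N \<le> card I \<longrightarrow>
     (\<forall>s\<in>I. fork G (ws s) (a s) (b s) \<and> length (ws s) \<le> L \<and> hd (ws s) = r) \<longrightarrow>
     (\<forall>s\<in>I. \<forall>s'\<in>I. s \<noteq> s' \<longrightarrow> anti G {a s, b s} {a s', b s'}) \<longrightarrow>
     (\<exists>q ws' a' b'. 1 \<le> q \<and> spider G n q ws' a' b'))"

lemma forces_spider_rootedD:
  fixes G :: ngraph and I :: "nat set"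
  assumes "forces_spider_rooted n L N" "pair_graph G" "starfree G n" "finite I" "N \<le> card I"
    "\<forall>s\<in>I. fork G (ws s) (a s) (b s) \<and> length (ws s) \<le> L \<and> hd (ws s) = r"
    "\<forall>s\<in>I. \<forall>s'\<in>I. s \<noteq> s' \<longrightarrow> anti G {a s, b s} {a s', b s'}"
  shows "\<exists>q ws' a' b'. 1 \<le> q \<and> spider G n q ws' a' b'"
  by (rule assms(1)[unfolded forces_spider_rooted_def, THEN spec[of _ G], THEN spec[of _ I], THEN spec[of _ ws],
    THEN spec[of _ a], THEN spec[of _ b], THEN spec[of _ r], THEN mp, OF assms(2), THEN mp, OF assms(3), THEN mp, OF assms(4),
    THEN mp, OF assms(5), THEN mp, OF assms(6), THEN mp, OF assms(7)])

text \<open>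
  Most of the forks can be assumed to have equal length. Two forks that share their end are not
  anticomplete, so of the two outcomes of the Ramsey argument only the spider remains.
\<close>

lemma rooted_forks: "\<exists>N. forces_spider_rooted n L N"
proof -
  obtain N where N: "\<And>p. forces_spider n p 2 (N p)"
    using choice[of "\<lambda>p N. forces_spider n p 2 N"] forks_ramsey by auto
  define M where "M = Max (N ` {..L})"
  have NM: "N p \<le> M" if "p \<le> L" for p using that by (simp add: M_def)
  show ?thesis
    unfolding forces_spider_rooted_def
  proof (rule exI[of _ "Suc L * M"], intro allI impI)
    fix G :: ngraph and I :: "nat set" and ws a b r
    assume pg: "pair_graph G" and sf: "starfree G n" and I: "finite I" "Suc L * M \<le> card I"
      and fk: "\<forall>s\<in>I. fork G (ws s) (a s) (b s) \<and> length (ws s) \<le> L \<and> hd (ws s) = r"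
      and lf: "\<forall>s\<in>I. \<forall>s'\<in>I. s \<noteq> s' \<longrightarrow> anti G {a s, b s} {a s', b s'}"
    obtain p where p: "p \<le> L" "M \<le> card {s \<in> I. length (ws s) = p}"
      using pigeonhole[OF I(1) _ I(2), of "\<lambda>s. length (ws s)"] fk by blast
    let ?I = "{s \<in> I. length (ws s) = p}"
    have c: "N p \<le> card ?I" using p NM le_trans by blast
    have no: "\<not> (\<exists>J\<subseteq>?I. card J = 2 \<and> (\<forall>s\<in>J. \<forall>s'\<in>J. s \<noteq> s' \<longrightarrow>
        anti G (set (ws s) \<union> {a s, b s}) (set (ws s') \<union> {a s', b s'})))"
    proof
      assume "\<exists>J\<subseteq>?I. card J = 2 \<and> (\<forall>s\<in>J. \<forall>s'\<in>J. s \<noteq> s' \<longrightarrow>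
        anti G (set (ws s) \<union> {a s, b s}) (set (ws s') \<union> {a s', b s'}))"
      then obtain J where J: "J \<subseteq> ?I" "card J = 2" and an: "\<forall>s\<in>J. \<forall>s'\<in>J. s \<noteq> s' \<longrightarrow>
        anti G (set (ws s) \<union> {a s, b s}) (set (ws s') \<union> {a s', b s'})"
        by (elim exE conjE)
      obtain s s' where ss: "J = {s, s'}" "s \<noteq> s'" using J(2) by (auto simp: card_2_iff)
      then have s: "s \<in> I" "s' \<in> I" using J(1) by auto
      have "anti G (set (ws s) \<union> {a s, b s}) (set (ws s') \<union> {a s', b s'})" using an ss by simp
      then have s3: "anti G (set (ws s)) (set (ws s'))" by (rule anti_mono) auto
      have "r \<in> set (ws s)" "r \<in> set (ws s')" using fk s(1,2) by (metis fork_def hd_in_set)+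
      then show False using s3 by (auto simp: anti_def)
    qed
    show "\<exists>q ws' a' b'. 1 \<le> q \<and> spider G n q ws' a' b'"
    proof -
      have 1: "finite ?I" using I(1) by simp
      have 2: "\<forall>s\<in>?I. fork G (ws s) (a s) (b s) \<and> length (ws s) = p" using fk by simp
      have 3: "\<forall>s\<in>?I. \<forall>s'\<in>?I. s \<noteq> s' \<longrightarrow> anti G {a s, b s} {a s', b s'}" using lf by simp
      show ?thesis
        by (rule disjE[OF forces_spiderD[OF N pg sf 1 c 2 3]], assumption, erule notE[OF no])
    qed
  qed
qed

section \<open>Anticomplete claws\<close>

definition claw_family :: "ngraph \<Rightarrow> nat set \<Rightarrow> (nat \<Rightarrow> nat) \<Rightarrow> (nat \<Rightarrow> nat) \<Rightarrow> (nat \<Rightarrow> nat) \<Rightarrow> bool" where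
  "claw_family G I x y z \<longleftrightarrow> finite I \<and> (\<forall>s\<in>I. claw G s (x s) (y s) (z s)) \<and>
       (\<forall>s\<in>I. \<forall>s'\<in>I. s \<noteq> s' \<longrightarrow> anti G {s, x s, y s, z s} {s', x s', y s', z s'})"

text \<open>
  The claws found in a graph of large deficiency have pairwise anticomplete pairs \<open>x\<close>, \<open>t\<close>. They are
  copies of \<open>T\<^sub>2\<close> with these leaves, so the Ramsey argument makes whole claws anticomplete.
\<close>

lemma anticomplete_claws:
  "\<exists>B::nat. \<forall>G::ngraph. conn_graph G \<longrightarrow> starfree G n \<longrightarrow> int B \<le> deficiency G \<longrightarrow>
     (\<exists>q ws a b. 1 \<le> q \<and> spider G n q ws a b) \<or> (\<exists>I x y z. card I = k \<and> claw_family G I x y z)"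
proof -
  obtain N where N: "forces_spider n 2 k N"
    using forks_ramsey by blast
  show ?thesis
  proof (intro exI[of _ "n * N + 1"] allI impI)
    fix G :: ngraph assume G: "conn_graph G" and sf: "starfree G n" and d: "int (n * N + 1) \<le> deficiency G"
    have pg: "pair_graph G" using G by (simp add: conn_graph_iff)
    from many_claws[OF G sf, of N] d obtain I x t y where I: "finite I" "N \<le> card I"
      "\<forall>s\<in>I. fork G [y s, s] (x s) (t s)" "\<forall>s\<in>I. \<forall>s'\<in>I. s \<noteq> s' \<longrightarrow> anti G {x s, t s} {x s', t s'}"
      by auto
    have I': "\<forall>s\<in>I. fork G [y s, s] (x s) (t s) \<and> length [y s, s] = 2" using I(3) by simp
    from forces_spiderD[OF N pg sf I(1,2) I' I(4)]
    consider "\<exists>q ws a b. 1 \<le> q \<and> spider G n q ws a b" |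
      J where "J \<subseteq> I" "card J = k" "\<forall>s\<in>J. \<forall>s'\<in>J. s \<noteq> s' \<longrightarrow>
        anti G (set [y s, s] \<union> {x s, t s}) (set [y s', s'] \<union> {x s', t s'})" by blast
    then show "(\<exists>q ws a b. 1 \<le> q \<and> spider G n q ws a b) \<or> (\<exists>I x y z. card I = k \<and> claw_family G I x y z)"
    proof cases
      case 2
      have "set [y s, s] \<union> {x s, t s} = {s, x s, t s, y s}" for s by auto
      with 2(3) have "\<forall>s\<in>J. \<forall>s'\<in>J. s \<noteq> s' \<longrightarrow> anti G {s, x s, t s, y s} {s', x s', t s', y s'}" by metis
      moreover have "\<forall>s\<in>J. claw G s (x s) (t s) (y s)" using 2(1) I(3) fork_claw[OF pg] by blast
      moreover have "finite J" using 2(1) I(1) finite_subset by blast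
      ultimately have "claw_family G J x t y" by (simp add: claw_family_def)
      then show ?thesis using 2(2) by blast
    qed blast
  qed
qed

text \<open>
  A shortest path from \<open>r\<close> to the claw, continued inside the claw.
\<close>

lemma claw_fork_from:
  assumes G: "conn_graph G" and K: "claw G s x y z" and r: "r \<in> pverts G" "r \<notin> {s, x, y, z}"
  shows "\<exists>ws a b. fork G ws a b \<and> hd ws = r \<and> {a, b} \<subseteq> {x, y, z} \<and>
     length ws \<le> dst (parcs G) {s} r + 2"
proof -
  have pg: "pair_graph G" using G by (simp add: conn_graph_iff)
  let ?K = "{s, x, y, z}"
  have KV: "?K \<subseteq> pverts G" using K pg_verts[OF pg] unfolding claw_def by blast
  have E: "arcs_in G (pverts G) = parcs G" using pg by (auto simp: pair_graph_iff)
  obtain us where us: "us \<noteq> []" "hd us = r" "ipath G us" "set us \<subseteq> pverts G - ?K"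
     "anti G (set (butlast us)) ?K" "\<exists>c\<in>?K. adj G (last us) c" "length us = dst (parcs G) ?K r"
    using shortest_path[OF pg linked_conn[OF G] _ KV r] unfolding E by blast
  have dis: "set us \<inter> ?K = {}" using us(4) by blast
  from us(6) obtain c where c: "c \<in> ?K" "adj G (last us) c" by (elim bexE)
  from claw_reach[OF pg K us(3,1) dis us(5) c]
  obtain zs a b where f: "fork G (us @ zs) a b" "length zs \<le> 2" "{a, b} \<subseteq> {x, y, z}"
    by (elim exE conjE)
  have "(s, r) \<in> (parcs G)\<^sup>*" using G r KV by (auto simp: conn_graph_iff)
  then have "\<exists>a\<in>{s}. (a, r) \<in> parcs G ^^ dst (parcs G) {s} r" by (intro dst_attained) auto
  then have "dst (parcs G) ?K r \<le> dst (parcs G) {s} r" by (intro dst_le[of s]) auto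
  then show ?thesis using f us(1,2,7) by (intro exI[of _ "us @ zs"]) auto
qed

section \<open>Bounded deficiency without long forks\<close>

lemma fork_T:
  assumes G: "pair_graph G" and f: "fork G ws a b" and n: "1 \<le> n" "n \<le> length ws"
  shows "\<exists>h. emb (T_graph n) G h"
proof -
  let ?w = "drop (length ws - n) ws"
  have "fork G ?w a b"
    using f n ipath_drop[of G "ws @ [a]" "length ws - n"] ipath_drop[of G "ws @ [b]" "length ws - n"]
    by (auto simp: fork_def)
  then show ?thesis using emb_T[OF G, of ?w a b] n by auto
qed

lemma spider_parts:
  assumes "spider G n q ws a b" "1 \<le> q" "i < n"
  shows "ws i = hd (ws i) # tl (ws i)" "ipath G (ws i @ [a i])" "ipath G (ws i @ [b i])" "length (ws i) = q"
    "set (ws i) = insert (hd (ws i)) (set (tl (ws i)))" "a i \<noteq> b i" "\<not> adj G (a i) (b i)"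
proof -
  have f: "fork G (ws i) (a i) (b i)" "length (ws i) = q" using assms by (auto simp: spider_def)
  then show e: "ws i = hd (ws i) # tl (ws i)" using assms(2) by (cases "ws i") auto
  show "set (ws i) = insert (hd (ws i)) (set (tl (ws i)))" by (subst e) simp
qed (use assms in \<open>auto simp: spider_def fork_def\<close>)

text \<open>
  One fork of the spider, prolonged through the clique and along the stem of a second one.
\<close>

lemma spider_T:
  assumes G: "pair_graph G" and s: "spider G m q ws a b" and q: "1 \<le> q" and n: "1 \<le> n" "n \<le> 2 * q + 1" and m: "2 \<le> m"
  shows "\<exists>h. emb (T_graph n) G h"
proof -
  have m01: "0 < m" "1 < m" using m by auto
  note S0 = spider_parts[OF s q m01(1)] and S1 = spider_parts[OF s q m01(2)]
  have an: "anti G (set (tl (ws 0)) \<union> {a 0, b 0}) (set (ws 1) \<union> {a 1, b 1})"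
    "anti G (set (tl (ws 1)) \<union> {a 1, b 1}) (set (ws 0) \<union> {a 0, b 0})"
    and hd: "hd (ws 1) \<noteq> hd (ws 0)" "adj G (hd (ws 1)) (hd (ws 0))"
    using s m01 by (auto simp: spider_def)
  let ?r = "rev (ws 1 @ [a 1])"
  have r: "ipath G ?r" "?r \<noteq> []" "last ?r = hd (ws 1)" using ipath_rev[OF G S1(2)] S1(1) by (auto simp: last_rev)
  have bl: "set (butlast ?r) = set (tl (ws 1)) \<union> {a 1}"
  proof -
    have "butlast ?r = rev (tl (ws 1 @ [a 1]))" by (simp add: butlast_rev)
    also have "tl (ws 1 @ [a 1]) = tl (ws 1) @ [a 1]" by (subst S1(1)) simp
    finally show ?thesis by auto
  qed
  have "ipath G (?r @ ws 0 @ [c])" if c: "c \<in> {a 0, b 0}" for c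
  proof -
    have 1: "ipath G (ws 0 @ [c])" using S0 c by auto
    have 2: "hd (ws 0 @ [c]) = hd (ws 0)" "tl (ws 0 @ [c]) = tl (ws 0) @ [c]"
      by (subst S0(1), simp)+
    have 3: "anti G (set (butlast ?r)) (set (ws 0 @ [c]))"
      unfolding bl by (rule anti_mono[OF an(2)]) (use c in auto)
    have "hd (ws 1) \<in> set (ws 1)" using S1(5) by blast
    then have "anti G {hd (ws 1)} (set (tl (ws 0)) \<union> {a 0, b 0})"
      by (intro anti_mono[OF anti_sym[OF G an(1)]]) auto
    then have 4: "anti G {hd (ws 1)} (set (tl (ws 0 @ [c])))"
      unfolding 2 by (rule anti_mono) (use c in auto)
    show ?thesis using ipath_append[OF r(2), of "ws 0 @ [c]" G] r(1,3) 1 2(1) 3 4 hd by simp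
  qed
  from this[of "a 0"] this[of "b 0"] have f: "fork G (?r @ ws 0) (a 0) (b 0)"
    using S0(6,7) r(2) by (simp add: fork_def)
  have "n \<le> length (?r @ ws 0)" using n(2) S0(4) S1(4) by simp
  then show ?thesis by (rule fork_T[OF G f n(1)])
qed

lemma spider_F2:
  assumes G: "pair_graph G" and s: "spider G m q ws a b" and q: "1 \<le> q" and n: "1 \<le> n" "n \<le> q + 1" and m: "3 \<le> m"
  shows "\<exists>h. emb (F2_graph n) G h"
proof -
  define zs where "zs i = take (n - 1) (tl (ws i) @ [a i])" for i
  have z: "ipath G (hd (ws i) # zs i)" "n = Suc (length (zs i))" "set (zs i) \<subseteq> set (tl (ws i)) \<union> {a i, b i}"
    if "i < 3" for i
  proof -
    have im: "i < m" using that m by simp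
    note S = spider_parts[OF s q im]
    have "take n (ws i @ [a i]) = hd (ws i) # zs i"
      unfolding zs_def by (subst S(1)) (use n in \<open>cases n; simp\<close>)
    then show "ipath G (hd (ws i) # zs i)" using ipath_take[OF S(2)] by metis
    show "n = Suc (length (zs i))" using S(4) n q by (simp add: zs_def)
    show "set (zs i) \<subseteq> set (tl (ws i)) \<union> {a i, b i}" unfolding zs_def by (auto dest: in_set_takeD)
  qed
  have an: "anti G (set (zs i)) (insert (hd (ws j)) (set (zs j)))" if "i < 3" "j < 3" "i \<noteq> j" for i j
  proof -
    have ij: "i < m" "j < m" using that m by auto
    have "anti G (set (tl (ws i)) \<union> {a i, b i}) (set (ws j) \<union> {a j, b j})"
      using s ij that by (auto simp: spider_def)
    then show ?thesis by (rule anti_mono) (use z(3) that spider_parts(5)[OF s q ij(2)] in auto)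
  qed
  have t: "adj G (hd (ws i)) (hd (ws j))" if "i < 3" "j < 3" "i \<noteq> j" for i j
    using s that m by (auto simp: spider_def)
  have an': "anti G (set (zs 0)) {hd (ws 1), hd (ws 2)}" "anti G (set (zs 1)) ({hd (ws 0), hd (ws 2)} \<union> set (zs 0))"
    "anti G (set (zs 2)) ({hd (ws 0), hd (ws 1)} \<union> set (zs 0))" "anti G (set (zs 1)) (set (zs 2))"
    using an[of 0 1] an[of 0 2] an[of 1 0] an[of 1 2] an[of 2 0] an[of 2 1] by (auto simp: anti_insert anti_Un)
  show ?thesis
    using emb_F2[OF G t[of 0 1] t[of 1 2] t[of 0 2] z(1)[of 0] z(1)[of 1] z(1)[of 2] z(2)[of 0] z(2)[of 1] z(2)[of 2]]
      an' anti_sym[OF G] by auto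
qed

lemma no_star_starfree:
  assumes G: "pair_graph G" and s: "\<not> (\<exists>h. emb (star_graph n) G h)" and n: "1 \<le> n"
  shows "starfree G n"
  unfolding starfree_def
proof (intro allI impI)
  fix c A assume A: "finite A" "\<forall>a\<in>A. adj G c a" "\<forall>a\<in>A. \<forall>b\<in>A. \<not> adj G a b"
  show "card A < n"
  proof (rule ccontr)
    assume "\<not> card A < n"
    then obtain B where B: "B \<subseteq> A" "card B = n" "finite B"
      by (meson not_less obtain_subset_with_card_n)
    then obtain v where "v \<in> B" using n by fastforce
    then have "c \<in> pverts G" using A B pg_verts[OF G] by blast
    then show False using emb_star[OF G B(2,3), of c] A B s by blast
  qed
qed

text \<open>
  A large deficiency gives many anticomplete claws, and from the centre \<open>r\<close> of one of them there are
  forks ending in the others. Without \<open>T\<^sub>n\<close> their lengths are at most \<open>n\<close>, so they force a spider. Its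
  stems have length less than \<open>n / 2\<close>, as otherwise two of them would contain \<open>T\<^sub>n\<close>; hence it is one of
  the excluded graphs.
\<close>

lemma bounded_by_T:
  assumes n: "4 \<le> n" "even n"
  shows "\<exists>B::nat. \<forall>G::ngraph. conn_graph G \<longrightarrow> \<not> (\<exists>h. emb (star_graph n) G h) \<longrightarrow> \<not> (\<exists>h. emb (T_graph n) G h) \<longrightarrow>
     (\<forall>p. 1 \<le> p \<and> p \<le> n div 2 - 1 \<longrightarrow> \<not> (\<exists>h. emb (K_check n p) G h)) \<longrightarrow> deficiency G < int B"
proof -
  obtain N where N: "forces_spider_rooted n n N"
    using rooted_forks by blast
  obtain B :: nat where B: "\<forall>G::ngraph. conn_graph G \<longrightarrow> starfree G n \<longrightarrow> int B \<le> deficiency G \<longrightarrow>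
     (\<exists>q ws a b. 1 \<le> q \<and> spider G n q ws a b) \<or> (\<exists>I x y z. card I = Suc N \<and> claw_family G I x y z)"
    using anticomplete_claws[of n "Suc N"] by (elim exE)
  show ?thesis
  proof (intro exI[of _ B] allI impI)
    fix G :: ngraph
    assume G: "conn_graph G" and st: "\<not> (\<exists>h. emb (star_graph n) G h)" and T: "\<not> (\<exists>h. emb (T_graph n) G h)"
      and K: "\<forall>p. 1 \<le> p \<and> p \<le> n div 2 - 1 \<longrightarrow> \<not> (\<exists>h. emb (K_check n p) G h)"
    have pg: "pair_graph G" using G by (simp add: conn_graph_iff)
    have sf: "starfree G n" using no_star_starfree[OF pg st] n by simp
    have nosp: "\<not> spider G n q ws a b" if "1 \<le> q" for q ws a b
    proof
      assume sp: "spider G n q ws a b"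
      show False
      proof (cases "q \<le> n div 2 - 1")
        case True
        then show False using emb_K_check[OF pg sp that] K that by blast
      next
        case False
        then have "n \<le> 2 * q + 1" using n by presburger
        then show False using spider_T[OF pg sp that] T n by auto
      qed
    qed
    show "deficiency G < int B"
    proof (rule ccontr)
      assume "\<not> deficiency G < int B"
      then obtain I x y z where I: "finite I" "card I = Suc N" and F: "claw_family G I x y z"
        using B[rule_format, OF G sf] nosp by (auto simp: claw_family_def)
      have cl: "claw G s (x s) (y s) (z s)" if "s \<in> I" for s using F that by (simp add: claw_family_def)
      have an: "anti G {s, x s, y s, z s} {s', x s', y s', z s'}" if "s \<in> I" "s' \<in> I" "s \<noteq> s'" for s s'
        using F that by (simp add: claw_family_def)
      obtain r where r: "r \<in> I" using I by fastforce
      have rV: "r \<in> pverts G" using cl[OF r] pg_verts[OF pg] unfolding claw_def by blast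
      have "\<forall>s\<in>I - {r}. \<exists>ws a b. fork G ws a b \<and> hd ws = r \<and> {a, b} \<subseteq> {x s, y s, z s}"
      proof
        fix s assume s: "s \<in> I - {r}"
        then have "r \<notin> {s, x s, y s, z s}" using an[of r s] r by (auto simp: anti_def)
        then show "\<exists>ws a b. fork G ws a b \<and> hd ws = r \<and> {a, b} \<subseteq> {x s, y s, z s}"
          using claw_fork_from[OF G cl rV, of s] s by blast
      qed
      then obtain ws a b where f: "\<And>s. s \<in> I - {r} \<Longrightarrow> fork G (ws s) (a s) (b s) \<and> hd (ws s) = r \<and> {a s, b s} \<subseteq> {x s, y s, z s}"
        by metis
      have "length (ws s) \<le> n" if "s \<in> I - {r}" for s
      proof (rule ccontr)
        assume "\<not> length (ws s) \<le> n"
        then show False using fork_T[OF pg, of "ws s" "a s" "b s" n] f[OF that] T n by auto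
      qed
      moreover have "anti G {a s, b s} {a s', b s'}" if "s \<in> I - {r}" "s' \<in> I - {r}" "s \<noteq> s'" for s s'
        by (rule anti_mono[OF an[of s s']]) (use that f[OF that(1)] f[OF that(2)] in auto)
      ultimately have "\<exists>q ws' a' b'. 1 \<le> q \<and> spider G n q ws' a' b'"
        using forces_spider_rootedD[OF N pg sf, of "I - {r}" ws a b r] f I r by simp
      then show False using nosp by blast
    qed
  qed
qed

section \<open>Geodesics in graphs without the F-patterns\<close>

definition avoids_F :: "'a pair_pre_digraph \<Rightarrow> nat \<Rightarrow> bool" where
  "avoids_F G n \<longleftrightarrow> \<not> (\<exists>h. emb (F1_graph n) G h) \<and> \<not> (\<exists>h. emb (F2_graph n) G h) \<and>
     \<not> (\<exists>h. emb (F3_graph n) G h) \<and> \<not> (\<exists>h. emb (F4_graph n) G h) \<and>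
     (\<forall>q. 1 \<le> q \<and> q \<le> n - 2 \<longrightarrow> \<not> (\<exists>h. emb (F_check n q) G h))"

lemma ipath_map:
  assumes "\<And>i. i < m \<Longrightarrow> f i \<in> pverts G"
    and "\<And>i j. i < j \<Longrightarrow> j < m \<Longrightarrow> f i \<noteq> f j \<and> (adj G (f i) (f j) \<longleftrightarrow> j = Suc i)"
  shows "ipath G (map f [0..<m])"
  unfolding ipath_def
proof (intro conjI allI impI)
  have "inj_on f {0..<m}" by (rule linorder_inj_onI) (use assms(2) in auto)
  then show "distinct (map f [0..<m])" by (simp add: distinct_map)
qed (use assms in auto)

text \<open>
  \<open>W\<close> is a set of vertices with a 1-Lipschitz function \<open>\<delta>\<close>, typically a distance. Lipschitz functions
  certify that paths are induced and bound the neighbourhood of a path, and unlike distances they are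
  preserved when the set of vertices shrinks.
\<close>

locale layered =
  fixes G :: "'a pair_pre_digraph" and W :: "'a set" and n :: nat and D :: int and \<delta> :: "'a \<Rightarrow> int"
  assumes pg: "pair_graph G" and WV: "W \<subseteq> pverts G" and n2: "4 \<le> n" and av: "avoids_F G n"
    and lip: "\<And>u v. u \<in> W \<Longrightarrow> v \<in> W \<Longrightarrow> adj G u v \<Longrightarrow> \<bar>\<delta> u - \<delta> v\<bar> \<le> 1"
begin

text \<open>
  A path with one vertex on each of the levels \<open>0, \<dots>, D\<close>. Vertices of \<open>W\<close> outside the path may touch it
  only in its middle part, so on both sides there is room for the long arms of the excluded graphs.
\<close>

definition geo :: "(int \<Rightarrow> 'a) \<Rightarrow> bool" where
  "geo p \<longleftrightarrow> 0 \<le> D \<and> (\<forall>k\<in>{0..D}. p k \<in> W \<and> \<delta> (p k) = k) \<and> (\<forall>k\<in>{0..<D}. adj G (p k) (p (k + 1))) \<and>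
     (\<forall>v\<in>W - p ` {0..D}. \<forall>k\<in>{0..D}. adj G v (p k) \<longrightarrow> int n + 3 \<le> k \<and> k \<le> D - (int n + 3))"

definition con :: "(int \<Rightarrow> 'a) \<Rightarrow> 'a \<Rightarrow> int set" where
  "con p v = {k\<in>{0..D}. adj G v (p k)}"

definition off :: "(int \<Rightarrow> 'a) \<Rightarrow> 'a \<Rightarrow> bool" where
  "off p v \<longleftrightarrow> v \<in> W \<and> v \<notin> p ` {0..D}"

abbreviation hat :: "(int \<Rightarrow> 'a) \<Rightarrow> int \<Rightarrow> 'a \<Rightarrow> bool" where
  "hat p k v \<equiv> off p v \<and> con p v = {k, k + 1}"

abbreviation twin :: "(int \<Rightarrow> 'a) \<Rightarrow> int \<Rightarrow> 'a \<Rightarrow> bool" where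
  "twin p k v \<equiv> off p v \<and> con p v = {k - 1, k, k + 1}"

abbreviation far :: "(int \<Rightarrow> 'a) \<Rightarrow> 'a \<Rightarrow> bool" where
  "far p v \<equiv> off p v \<and> con p v = {}"

lemma asym: "adj G u v \<longleftrightarrow> adj G v u"
  by (rule pg_sym_iff[OF pg])

lemma airr: "\<not> adj G u u"
  by (rule pg_irrefl[OF pg])

lemma geoD:
  assumes "geo p" "k \<in> {0..D}"
  shows "p k \<in> W" "\<delta> (p k) = k" "p k \<in> pverts G"
  using assms WV by (auto simp: geo_def)

lemma geo_inj: "geo p \<Longrightarrow> i \<in> {0..D} \<Longrightarrow> j \<in> {0..D} \<Longrightarrow> p i = p j \<longleftrightarrow> i = j"
  using geoD(2) by metis

lemma geo_adj:
  assumes p: "geo p" and ij: "i \<in> {0..D}" "j \<in> {0..D}"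
  shows "adj G (p i) (p j) \<longleftrightarrow> \<bar>i - j\<bar> = 1"
proof
  assume a: "adj G (p i) (p j)"
  then have "\<bar>i - j\<bar> \<le> 1" using lip[of "p i" "p j"] geoD[OF p] ij by auto
  moreover have "i \<noteq> j" using a airr by auto
  ultimately show "\<bar>i - j\<bar> = 1" by linarith
next
  assume "\<bar>i - j\<bar> = 1"
  then consider "j = i + 1" | "i = j + 1" by linarith
  then show "adj G (p i) (p j)"
  proof cases
    case 1
    then show ?thesis using p ij by (auto simp: geo_def)
  next
    case 2
    then have "adj G (p j) (p i)" using p ij by (auto simp: geo_def)
    then show ?thesis using asym by blast
  qed
qed

lemma con_range:
  assumes p: "geo p" and v: "off p v" and k: "k \<in> con p v"
  shows "int n + 3 \<le> k" "k \<le> D - (int n + 3)" "k \<in> {0..D}" "adj G v (p k)" "\<bar>\<delta> v - k\<bar> \<le> 1"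
proof -
  show kD: "k \<in> {0..D}" "adj G v (p k)" using k by (auto simp: con_def)
  then show "int n + 3 \<le> k" "k \<le> D - (int n + 3)" using p v by (auto simp: geo_def off_def)
  show "\<bar>\<delta> v - k\<bar> \<le> 1" using lip[of v "p k"] geoD[OF p kD(1)] kD v by (auto simp: off_def)
qed

lemma offW: "off p v \<Longrightarrow> v \<in> W" "off p v \<Longrightarrow> v \<in> pverts G"
  using WV by (auto simp: off_def)

lemma off_neq: "off p v \<Longrightarrow> k \<in> {0..D} \<Longrightarrow> v \<noteq> p k"
  by (auto simp: off_def)

definition dn :: "(int \<Rightarrow> 'a) \<Rightarrow> int \<Rightarrow> nat \<Rightarrow> 'a list" where
  "dn p a m = map (\<lambda>i. p (a - int i)) [0..<m]"

definition up :: "(int \<Rightarrow> 'a) \<Rightarrow> int \<Rightarrow> nat \<Rightarrow> 'a list" where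
  "up p b m = map (\<lambda>i. p (b + int i)) [0..<m]"

lemma dn_up_length [simp]: "length (dn p a m) = m" "length (up p b m) = m"
  by (simp_all add: dn_def up_def)

lemma dn_ipath: "geo p \<Longrightarrow> a \<le> D \<Longrightarrow> int m \<le> a + 1 \<Longrightarrow> ipath G (dn p a m)"
  unfolding dn_def
  by (intro ipath_map) (auto simp: geo_inj geo_adj intro: geoD(3))

lemma up_ipath: "geo p \<Longrightarrow> 0 \<le> b \<Longrightarrow> b + int m \<le> D + 1 \<Longrightarrow> ipath G (up p b m)"
  unfolding up_def
  by (intro ipath_map) (auto simp: geo_inj geo_adj intro: geoD(3))

lemma dn_set: "set (dn p a m) \<subseteq> p ` {a - int m + 1..a}"
  by (auto simp: dn_def intro!: imageI)

lemma up_set: "set (up p b m) \<subseteq> p ` {b..b + int m - 1}"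
  by (auto simp: up_def intro!: imageI)

lemma dn_Suc: "dn p a (Suc m) = p a # dn p (a - 1) m"
proof -
  have "[0..<Suc m] = 0 # map Suc [0..<m]" by (metis map_Suc_upt upt_conv_Cons zero_less_Suc)
  then show ?thesis by (simp add: dn_def o_def algebra_simps)
qed

lemma up_Suc: "up p b (Suc m) = p b # up p (b + 1) m"
proof -
  have "[0..<Suc m] = 0 # map Suc [0..<m]" by (metis map_Suc_upt upt_conv_Cons zero_less_Suc)
  then show ?thesis by (simp add: up_def o_def algebra_simps)
qed

lemma arm_anti:
  assumes v: "\<And>k. k \<in> {0..D} \<Longrightarrow> k \<in> K \<Longrightarrow> v \<noteq> p k \<and> \<not> adj G v (p k)"
    and s: "set xs \<subseteq> p ` K'" "K' \<subseteq> K \<inter> {0..D}"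
  shows "anti G {v} (set xs)"
proof -
  have "v \<noteq> w \<and> \<not> adj G v w" if w: "w \<in> set xs" for w
  proof -
    obtain k where "k \<in> K'" "w = p k" using w s(1) by blast
    then show ?thesis using v[of k] s(2) by blast
  qed
  then show ?thesis by (simp add: anti_def)
qed

lemma arms_anti:
  assumes p: "geo p" and s: "set xs \<subseteq> p ` {i..a}" "set ys \<subseteq> p ` {b..j}" "0 \<le> i" "j \<le> D" "a + 2 \<le> b"
  shows "anti G (set xs) (set ys)"
proof -
  have "u \<noteq> v \<and> \<not> adj G u v" if uv: "u \<in> set xs" "v \<in> set ys" for u v
  proof -
    obtain k l where kl: "k \<in> {i..a}" "l \<in> {b..j}" "u = p k" "v = p l" using uv s(1,2) by blast
    then have "k \<in> {0..D}" "l \<in> {0..D}" "\<bar>k - l\<bar> \<noteq> 1" "k \<noteq> l" using s(3-5) by auto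
    then show ?thesis using geo_inj[OF p] geo_adj[OF p] kl(3,4) by simp
  qed
  then show ?thesis by (simp add: anti_def)
qed

text \<open>
  A claw whose centre \<open>s\<close> lies on a path \<open>l\<close>, \<open>s\<close>, \<open>r\<close> that bypasses the middle of the geodesic: the third
  leaf \<open>e\<close> is then the pendant vertex of \<open>F\<^sup>1\<close>.
\<close>

lemma no_bypass:
  assumes p: "geo p" and ab: "int n - 1 \<le> a" "a + 2 \<le> b" "b \<le> D - (int n - 1)"
    and V: "s \<in> pverts G" "l \<in> pverts G" "r \<in> pverts G"
    and c: "claw G s l r e"
    and s: "\<And>k. k \<in> {0..D} \<Longrightarrow> k \<in> {..a} \<union> {b..} \<Longrightarrow> s \<noteq> p k \<and> \<not> adj G s (p k)"
    and e: "\<And>k. k \<in> {0..D} \<Longrightarrow> k \<in> {..a} \<union> {b..} \<Longrightarrow> e \<noteq> p k \<and> \<not> adj G e (p k)"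
    and l: "\<And>k. k \<in> {0..D} \<Longrightarrow> k \<in> {..a} \<union> {b..} \<Longrightarrow> l \<noteq> p k \<and> (adj G l (p k) \<longleftrightarrow> k = a)"
    and r: "\<And>k. k \<in> {0..D} \<Longrightarrow> k \<in> {..a} \<union> {b..} \<Longrightarrow> r \<noteq> p k \<and> (adj G r (p k) \<longleftrightarrow> k = b)"
  shows False
proof -
  obtain m where m: "n = Suc m" "1 \<le> m" using n2 by (cases n) auto
  obtain m' where m': "m = Suc m'" using m(2) by (cases m) auto
  let ?L = "dn p a m" and ?R = "up p b m"
  have L: "ipath G ?L" "?L = p a # dn p (a - 1) m'" using dn_ipath[OF p, of a m] ab m unfolding m' by (auto simp: dn_Suc)
  have R: "ipath G ?R" "?R = p b # up p (b + 1) m'" using up_ipath[OF p, of b m] ab m unfolding m' by (auto simp: up_Suc)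
  have sL: "set ?L \<subseteq> p ` {a - int m + 1..a}" "{a - int m + 1..a} \<subseteq> ({..a} \<union> {b..}) \<inter> {0..D}"
    and sR: "set ?R \<subseteq> p ` {b..b + int m - 1}" "{b..b + int m - 1} \<subseteq> ({..a} \<union> {b..}) \<inter> {0..D}"
    using dn_set up_set ab m by auto
  have tL: "set (tl ?L) \<subseteq> p ` {a - int m + 1..a - 1}" "{a - int m + 1..a - 1} \<subseteq> ({..a - 1} \<union> {b..}) \<inter> {0..D}"
    using dn_set[of p "a - 1" m'] ab m unfolding L(2) by (auto simp: m')
  have tR: "set (tl ?R) \<subseteq> p ` {b + 1..b + int m - 1}" "{b + 1..b + int m - 1} \<subseteq> ({..a} \<union> {b + 1..}) \<inter> {0..D}"
    using up_set[of p "b + 1" m'] ab m unfolding R(2) by (auto simp: m')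
  have aD: "a \<in> {0..D}" "b \<in> {0..D}" using ab n2 by auto
  note K = c[unfolded claw_def]
  have nlr: "s \<noteq> l" "s \<noteq> r" "s \<noteq> e" using K airr by auto
  have sl: "anti G {s} (set ?L)" "anti G {s} (set ?R)" "anti G {e} (set ?L)" "anti G {e} (set ?R)"
    using arm_anti[OF s sL] arm_anti[OF s sR] arm_anti[OF e sL] arm_anti[OF e sR] by auto
  have lt: "anti G {l} (set (tl ?L))"
  proof (rule arm_anti[OF _ tL])
    fix k assume "k \<in> {0..D}" "k \<in> {..a - 1} \<union> {b..}"
    then show "l \<noteq> p k \<and> \<not> adj G l (p k)" using l[of k] ab by auto
  qed
  have lR: "anti G {l} (set ?R)"
  proof (rule arm_anti[where K = "{b..}", OF _ sR(1)])
    fix k assume "k \<in> {0..D}" "k \<in> {b..}"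
    then show "l \<noteq> p k \<and> \<not> adj G l (p k)" using l[of k] ab by auto
  qed (use ab m in auto)
  have rt: "anti G {r} (set (tl ?R))"
  proof (rule arm_anti[OF _ tR])
    fix k assume "k \<in> {0..D}" "k \<in> {..a} \<union> {b + 1..}"
    then show "r \<noteq> p k \<and> \<not> adj G r (p k)" using r[of k] ab by auto
  qed
  have rL: "anti G {r} (set ?L)"
  proof (rule arm_anti[where K = "{..a}", OF _ sL(1)])
    fix k assume "k \<in> {0..D}" "k \<in> {..a}"
    then show "r \<noteq> p k \<and> \<not> adj G r (p k)" using r[of k] ab by auto
  qed (use ab m in auto)
  have LR: "anti G (set ?L) (set ?R)"
    by (rule arms_anti[OF p sL(1) sR(1)]) (use ab m in auto)
  have la: "adj G l (p a)" "l \<noteq> p a" "adj G r (p b)" "r \<noteq> p b" using l[OF aD(1)] r[OF aD(2)] by auto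
  have iL: "ipath G (l # ?L)" unfolding ipath_Cons using L lt la V by auto
  have iR: "ipath G (r # ?R)" unfolding ipath_Cons using R rt la V by auto
  have sR': "ipath G (s # r # ?R)" unfolding ipath_Cons[of G s] using iR V K nlr sl by auto
  have "ipath G (rev (l # ?L) @ s # r # ?R)"
  proof (subst ipath_append)
    have bl: "butlast (rev (l # ?L)) = rev ?L" "last (rev (l # ?L)) = l" by simp_all
    have "anti G (set ?L) {s, r}" using anti_sym[OF pg sl(1)] anti_sym[OF pg rL] by (auto simp: anti_def)
    then have 1: "anti G (set ?L) (set (s # r # ?R))" using LR by (auto simp: anti_def)
    have 2: "anti G {l} (set (r # ?R))" using lR K by (auto simp: anti_def)
    show "ipath G (rev (l # ?L)) \<and> ipath G (s # r # ?R) \<and> adj G (last (rev (l # ?L))) (hd (s # r # ?R)) \<and>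
      last (rev (l # ?L)) \<noteq> hd (s # r # ?R) \<and> anti G (set (butlast (rev (l # ?L)))) (set (s # r # ?R)) \<and>
      anti G {last (rev (l # ?L))} (set (tl (s # r # ?R)))"
      unfolding bl using ipath_rev[OF pg iL] sR' K nlr asym[of s l] 1 2 by simp
  qed simp_all
  moreover have "anti G {e} (set (rev (l # ?L)) \<union> set (r # ?R))"
  proof -
    have "anti G {e} {l, r}" using K asym[of e] by (auto simp: anti_def)
    then show ?thesis using sl(3,4) by (auto simp: anti_def)
  qed
  ultimately have "\<exists>h. emb (F1_graph n) G h"
    using emb_F1[OF pg, of "rev (l # ?L)" s "r # ?R" n e] K m by auto
  then show False using av by (simp add: avoids_F_def)
qed

lemma geo_tails:
  assumes p: "geo p" and k: "int n \<le> k" "k < j" "j \<le> D - int n"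
  shows "ipath G (p k # dn p (k - 1) (n - 1))" "ipath G (p j # up p (j + 1) (n - 1))"
    "set (dn p (k - 1) (n - 1)) \<subseteq> p ` {0..k - 1}" "set (up p (j + 1) (n - 1)) \<subseteq> p ` {j + 1..D}"
    "anti G (set (dn p (k - 1) (n - 1))) (set (up p (j + 1) (n - 1)))"
proof -
  have "dn p k n = p k # dn p (k - 1) (n - 1)" "up p j n = p j # up p (j + 1) (n - 1)"
    using dn_Suc[of p k "n - 1"] up_Suc[of p j "n - 1"] n2 by simp_all
  then show "ipath G (p k # dn p (k - 1) (n - 1))" "ipath G (p j # up p (j + 1) (n - 1))"
    using dn_ipath[OF p, of k n] up_ipath[OF p, of j n] k by simp_all
  show a: "set (dn p (k - 1) (n - 1)) \<subseteq> p ` {0..k - 1}"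
    by (rule subset_trans[OF dn_set]) (use k n2 in auto)
  show b: "set (up p (j + 1) (n - 1)) \<subseteq> p ` {j + 1..D}"
    by (rule subset_trans[OF up_set]) (use k n2 in auto)
  show "anti G (set (dn p (k - 1) (n - 1))) (set (up p (j + 1) (n - 1)))"
    by (rule arms_anti[OF p a b]) (use k in auto)
qed

lemma off_anti:
  assumes v: "off p v" and x: "set xs \<subseteq> p ` K" "K \<subseteq> {0..D}" "con p v \<inter> K = {}"
  shows "anti G {v} (set xs)"
proof -
  have "v \<noteq> w \<and> \<not> adj G v w" if w: "w \<in> set xs" for w
  proof -
    obtain k where "k \<in> K" "w = p k" using w x(1) by blast
    then have "k \<in> {0..D}" "k \<notin> con p v" using x(2,3) by blast+
    then show ?thesis using off_neq[OF v, of k] \<open>w = p k\<close> by (simp add: con_def)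
  qed
  then show ?thesis by (simp add: anti_def)
qed

lemma geo_anti:
  assumes p: "geo p" and k: "k \<in> {0..D}" and x: "set xs \<subseteq> p ` K" "K \<subseteq> {0..D}" "K \<inter> {k - 1, k, k + 1} = {}"
  shows "anti G {p k} (set xs)"
proof -
  have "p k \<noteq> w \<and> \<not> adj G (p k) w" if w: "w \<in> set xs" for w
  proof -
    obtain j where j: "j \<in> K" "w = p j" using w x(1) by blast
    then have "j \<in> {0..D}" "j \<noteq> k" "j \<noteq> k - 1" "j \<noteq> k + 1" using x(2,3) by blast+
    moreover from this have "\<bar>k - j\<bar> \<noteq> 1" by linarith
    ultimately show ?thesis using geo_inj[OF p k] geo_adj[OF p k] j(2) by simp
  qed
  then show ?thesis by (simp add: anti_def)
qed

text \<open>
  The contacts of \<open>v\<close> lie on three consecutive levels. A single contact gives \<open>F\<^sup>1\<close>, two contacts at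
  distance two give \<open>F\<^sup>3\<close>; what remains are triangles over an edge of the path (hats) and copies of a
  path vertex (twins).
\<close>

lemma con_type:
  assumes p: "geo p" and v: "off p v" and ne: "con p v \<noteq> {}"
  shows "(\<exists>k. hat p k v) \<or> (\<exists>k. twin p k v)"
proof -
  define d where "d = \<delta> v"
  have sub: "con p v \<subseteq> {d - 1, d, d + 1}" using con_range(5)[OF p v] by (force simp: d_def)
  have single: False if "con p v = {k}" for k
  proof -
    have k: "int n + 3 \<le> k" "k \<le> D - (int n + 3)" "adj G v (p k)" using con_range[OF p v, of k] that by auto
    have D: "k \<in> {0..D}" "k - 1 \<in> {0..D}" "k + 1 \<in> {0..D}" using k by auto
    have vk: "adj G v (p j) \<longleftrightarrow> j = k" if "j \<in> {0..D}" for j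
      using that \<open>con p v = {k}\<close> by (auto simp: con_def)
    have nv: "v \<noteq> p (k - 1)" "v \<noteq> p (k + 1)" using off_neq[OF v] D by auto
    have A: "adj G (p k) (p (k - 1))" "adj G (p k) (p (k + 1))" "\<not> adj G (p (k - 1)) (p (k + 1))"
      "p (k - 1) \<noteq> p (k + 1)" "adj G (p k) v" "\<not> adj G (p (k - 1)) v" "\<not> adj G (p (k + 1)) v"
      using D geo_adj[OF p] geo_inj[OF p] vk asym[of v] by simp_all
    show False
    proof (rule no_bypass[OF p, of "k - 2" "k + 2" "p k" "p (k - 1)" "p (k + 1)" v])
      show "claw G (p k) (p (k - 1)) (p (k + 1)) v"
        unfolding claw_def using A nv by simp
    qed (use k D geoD[OF p] geo_adj[OF p] geo_inj[OF p] off_neq[OF v] vk in auto)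
  qed
  have gap: False if c: "con p v = {d - 1, d + 1}"
  proof -
    have k: "int n + 3 \<le> d - 1" "d + 1 \<le> D - (int n + 3)" using con_range[OF p v, of "d - 1"] con_range[OF p v, of "d + 1"] c by simp_all
    have D: "d \<in> {0..D}" "d - 1 \<in> {0..D}" "d + 1 \<in> {0..D}" using k by auto
    have vk: "adj G v (p j) \<longleftrightarrow> j = d - 1 \<or> j = d + 1" if "j \<in> {0..D}" for j
      using that c unfolding con_def by blast
    have T: "int n \<le> d - 1" "d - 1 < d + 1" "d + 1 \<le> D - int n" using k by auto
    note t = geo_tails[OF p T]
    have L: "{0..d - 1 - 1} \<subseteq> {0..D}" and R: "{d + 1 + 1..D} \<subseteq> {0..D}" using k by auto
    have 1: "anti G {v, p (d + 1), p d} (set (dn p (d - 1 - 1) (n - 1)))"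
      using off_anti[OF v t(3) L] geo_anti[OF p D(3) t(3) L] geo_anti[OF p D(1) t(3) L]
      by (auto simp: c anti_def)
    have 2: "anti G {p (d - 1), v, p d} (set (up p (d + 1 + 1) (n - 1)))"
      using off_anti[OF v t(4) R] geo_anti[OF p D(2) t(4) R] geo_anti[OF p D(1) t(4) R]
      by (auto simp: c anti_def)
    have "\<exists>h. emb (F3_graph n) G h"
      using emb_F3[OF pg, of "p (d - 1)" v "p (d + 1)" "p d" "dn p (d - 1 - 1) (n - 1)" "up p (d + 1 + 1) (n - 1)" n]
        t 1 2 D vk asym[of _ v] geo_adj[OF p] geo_inj[OF p] off_neq[OF v] n2 by auto
    then show False using av by (simp add: avoids_F_def)
  qed
  have e: "{d, d + 1} = {d + 1, d}" by auto
  have cases: "con p v = {d - 1} \<or> con p v = {d} \<or> con p v = {d + 1} \<or> con p v = {d - 1, d} \<or> con p v = {d, d + 1} \<or>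
    con p v = {d - 1, d + 1} \<or> con p v = {d - 1, d, d + 1}"
    using sub ne by blast
  then have "con p v = {d - 1, d} \<or> con p v = {d, d + 1} \<or> con p v = {d - 1, d, d + 1}"
    using single gap by blast
  moreover have "hat p (d - 1) v" if "con p v = {d - 1, d}" using v that by simp
  ultimately show ?thesis using v by blast
qed

section \<open>Rerouting a geodesic\<close>

text \<open>
  The path may be rerouted in its middle part. A former path vertex that is now outside still has its
  contacts in the middle, because they come from contacts of the new vertices with the old path.
\<close>

lemma geo_change:
  assumes p: "geo p" and p': "\<And>k. k \<in> {0..D} \<Longrightarrow> p' k \<in> W \<and> \<delta> (p' k) = k"
    "\<And>k. k \<in> {0..<D} \<Longrightarrow> adj G (p' k) (p' (k + 1))"
    and same: "\<And>k. k \<in> {0..D} \<Longrightarrow> p' k \<noteq> p k \<Longrightarrow> int n + 3 \<le> k \<and> k \<le> D - (int n + 3)"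
  shows "geo p'"
proof -
  have D: "0 \<le> D" using p by (simp add: geo_def)
  have "int n + 3 \<le> k \<and> k \<le> D - (int n + 3)"
    if v: "v \<in> W" "v \<notin> p' ` {0..D}" and k: "k \<in> {0..D}" "adj G v (p' k)" for v k
  proof (cases "p' k = p k")
    case False
    then show ?thesis using same k by blast
  next
    case True
    show ?thesis
    proof (cases "v \<in> p ` {0..D}")
      case False
      then have "off p v" "k \<in> con p v" using v k True by (auto simp: off_def con_def)
      then show ?thesis using con_range[OF p] by blast
    next
      case True': True
      then obtain j where j: "j \<in> {0..D}" "v = p j" by blast
      then have jk: "\<bar>j - k\<bar> = 1" using geo_adj[OF p j(1) k(1)] k(2) True by simp
      have ne: "p' j \<noteq> p j" using v(2) j by (metis imageI)
      have "p' j \<notin> p ` {0..D}"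
      proof
        assume "p' j \<in> p ` {0..D}"
        then obtain i where "i \<in> {0..D}" "p' j = p i" by blast
        then have "i = j" using p'(1)[OF j(1)] geoD(2)[OF p] by metis
        then show False using ne \<open>p' j = p i\<close> by simp
      qed
      then have o: "off p (p' j)" using p'(1)[OF j(1)] by (simp add: off_def)
      have "adj G (p' j) (p' k)"
      proof -
        consider "k = j + 1" | "j = k + 1" using jk by linarith
        then show ?thesis
        proof cases
          case 1
          then show ?thesis using p'(2)[of j] j k by auto
        next
          case 2
          then show ?thesis using p'(2)[of k] j k asym by auto
        qed
      qed
      then have "k \<in> con p (p' j)" using k(1) True by (simp add: con_def)
      then show ?thesis using con_range[OF p o] by blast
    qed
  qed
  then show ?thesis using D p' by (auto simp: geo_def)
qed

lemma geo_replace: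
  assumes p: "geo p" and z: "off p z" and k: "k - 1 \<in> con p z" "k + 1 \<in> con p z"
  shows "geo (p(k := z))"
proof -
  have r: "int n + 3 \<le> k - 1" "k + 1 \<le> D - (int n + 3)" "\<delta> z = k" "adj G z (p (k - 1))" "adj G z (p (k + 1))"
    using con_range[OF p z k(1)] con_range[OF p z k(2)] by auto
  show ?thesis
  proof (rule geo_change[OF p])
    fix j assume j: "j \<in> {0..D}"
    show "(p(k := z)) j \<in> W \<and> \<delta> ((p(k := z)) j) = j" using geoD[OF p j] r z by (auto simp: off_def)
    show "int n + 3 \<le> j \<and> j \<le> D - (int n + 3)" if "(p(k := z)) j \<noteq> p j" using that r by (auto split: if_splits)
  next
    fix j assume j: "j \<in> {0..<D}"
    show "adj G ((p(k := z)) j) ((p(k := z)) (j + 1))"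
    proof -
      consider "j = k - 1" | "j = k" | "j \<noteq> k - 1" "j \<noteq> k" by blast
      then show ?thesis
        using r pg_sym[OF pg r(4)] geo_adj[OF p, of j "j + 1"] j by cases simp_all
    qed
  qed
qed

lemma geo_replace2:
  assumes p: "geo p" and s: "off p s" and z: "off p z" and k: "k \<in> con p s" "k + 3 \<in> con p z" and a: "adj G s z"
  shows "geo (p(k + 1 := s, k + 2 := z))"
proof -
  have r: "int n + 3 \<le> k" "k + 3 \<le> D - (int n + 3)" "adj G s (p k)" "adj G z (p (k + 3))"
    and d: "\<bar>\<delta> s - k\<bar> \<le> 1" "\<bar>\<delta> z - (k + 3)\<bar> \<le> 1"
    using con_range[OF p s k(1)] con_range[OF p z k(2)] by auto
  have "\<bar>\<delta> s - \<delta> z\<bar> \<le> 1" using lip[of s z] s z a by (simp add: off_def)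
  then have d': "\<delta> s = k + 1" "\<delta> z = k + 2" using d by linarith+
  let ?p = "p(k + 1 := s, k + 2 := z)"
  show ?thesis
  proof (rule geo_change[OF p])
    fix j assume j: "j \<in> {0..D}"
    show "?p j \<in> W \<and> \<delta> (?p j) = j" using geoD[OF p j] r d' s z by (auto simp: off_def)
    show "int n + 3 \<le> j \<and> j \<le> D - (int n + 3)" if "?p j \<noteq> p j" using that r by (auto split: if_splits)
  next
    fix j assume j: "j \<in> {0..<D}"
    consider "j = k" | "j = k + 1" | "j = k + 2" | "j \<noteq> k" "j \<noteq> k + 1" "j \<noteq> k + 2" by blast
    then show "adj G (?p j) (?p (j + 1))"
    proof cases
      case 1
      then show ?thesis using r pg_sym[OF pg r(3)] by simp
    next
      case 2
      then show ?thesis using a by (simp add: add.commute)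
    next
      case 3
      then show ?thesis using r by (simp add: add.commute)
    next
      case 4
      then show ?thesis using geo_adj[OF p, of j "j + 1"] j by simp
    qed
  qed
qed

lemma con_replace:
  assumes "k \<in> {0..D}"
  shows "con (p(k := z)) v = (if adj G v z then insert k (con p v) else con p v - {k})"
  using assms by (auto simp: con_def)

lemma off_replace: "off p v \<Longrightarrow> v \<noteq> z \<Longrightarrow> off (p(k := z)) v"
  by (auto simp: off_def split: if_splits)

text \<open>
  The contact sets that \<open>con_type\<close> excludes. The following lemmas obtain a contradiction by rerouting the
  path through one vertex, which turns the contacts of a second one into a set of this kind.
\<close>

lemma no_type:
  assumes p: "geo p" and v: "off p v" and c: "con p v = {i} \<or> con p v = {i - 1, i + 1}"
  shows False
proof -
  have ne: "con p v \<noteq> {}" using c by auto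
  from con_type[OF p v ne] obtain k where k: "con p v = {k, k + 1} \<or> con p v = {k - 1, k, k + 1}" by blast
  then have "k \<in> con p v" "k + 1 \<in> con p v" by auto
  then show False using c by auto
qed

lemma twins_adj:
  assumes p: "geo p" and z: "twin p k z" and v: "twin p k v" and ne: "v \<noteq> z"
  shows "adj G v z"
proof (rule ccontr)
  assume na: "\<not> adj G v z"
  have kD: "k \<in> {0..D}" using con_range(3)[OF p, of z k] z by simp
  have g: "geo (p(k := z))" using geo_replace[OF p, of z k] z by simp
  have "{k - 1, k, k + 1} - {k} = {k - 1, k + 1}" by auto
  then have "con (p(k := z)) v = {k - 1, k + 1}" using con_replace[OF kD, of p z v] na v by simp
  then show False using no_type[OF g off_replace[of p v z k], of k] v ne by simp
qed

lemma twin_hat_adj: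
  assumes p: "geo p" and z: "twin p k z" and v: "hat p (k - 1) v \<or> hat p k v"
  shows "adj G v z"
proof (rule ccontr)
  assume na: "\<not> adj G v z"
  have kD: "k \<in> {0..D}" using con_range(3)[OF p, of z k] z by simp
  have g: "geo (p(k := z))" using geo_replace[OF p, of z k] z by simp
  have ne: "v \<noteq> z"
  proof
    assume "v = z"
    then have "k - 1 \<in> con p v" "k + 1 \<in> con p v" using z by auto
    then show False using v by auto
  qed
  have ov: "off p v" using v by blast
  have "{k - 1, k - 1 + 1} - {k} = {k - 1}" "{k, k + 1} - {k} = {k + 1}" by auto
  then have "con (p(k := z)) v = {k - 1} \<or> con (p(k := z)) v = {k + 1}"
    using con_replace[OF kD, of p z v] na v by (elim disjE conjE) simp_all
  then show False using no_type[OF g off_replace[OF ov ne, of k], of "k - 1"] no_type[OF g off_replace[OF ov ne, of k], of "k + 1"]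
    by blast
qed

lemma ex_emb: "\<exists>h. P h \<and> Q h \<Longrightarrow> \<exists>h. P h"
  by blast

text \<open>
  Two non-adjacent hats over the same edge form \<open>F\<^sup>4\<close> with it.
\<close>

lemma hats_adj:
  assumes p: "geo p" and z: "hat p k z" and v: "hat p k v" and ne: "v \<noteq> z"
  shows "adj G v z"
proof (rule ccontr)
  assume na: "\<not> adj G v z"
  have na': "\<not> adj G z v" using na pg_sym[OF pg] by blast
  have k: "int n + 3 \<le> k" "k + 1 \<le> D - (int n + 3)" using con_range(1,2)[OF p, of z] z by auto
  have D: "k \<in> {0..D}" "k + 1 \<in> {0..D}" using k by auto
  have T: "int n \<le> k" "k < k + 1" "k + 1 \<le> D - int n" using k by auto
  note t = geo_tails[OF p T]
  have L: "{0..k - 1} \<subseteq> {0..D}" and R: "{k + 1 + 1..D} \<subseteq> {0..D}" using k by auto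
  have ad: "adj G z (p k)" "adj G z (p (k + 1))" "adj G v (p k)" "adj G v (p (k + 1))"
    using con_range(4)[OF p] z v by auto
  have 1: "anti G {z, p (k + 1), v} (set (dn p (k - 1) (n - 1)))"
    using off_anti[of p z, OF _ t(3) L] off_anti[of p v, OF _ t(3) L] geo_anti[OF p D(2) t(3) L] z v
    by (auto simp: anti_def)
  have 2: "anti G {p k, z, v} (set (up p (k + 1 + 1) (n - 1)))"
    using off_anti[of p z, OF _ t(4) R] off_anti[of p v, OF _ t(4) R] geo_anti[OF p D(1) t(4) R] z v
    by (auto simp: anti_def)
  have "\<exists>h. emb (F4_graph n) G h"
    by (rule ex_emb[OF emb_F4[OF pg, of "p k" z "p (k + 1)" v "dn p (k - 1) (n - 1)" "up p (k + 1 + 1) (n - 1)" n]])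
      (use t 1 2 ad ad[THEN pg_sym[OF pg]] geo_adj[OF p D] na na' ne n2 in auto)
  then show False using av by (simp add: avoids_F_def)
qed

lemma far_twin:
  assumes p: "geo p" and v: "far p v" and z: "twin p k z"
  shows "\<not> adj G v z"
proof
  assume a: "adj G v z"
  have kD: "k \<in> {0..D}" using con_range(3)[OF p, of z k] z by simp
  have g: "geo (p(k := z))" using geo_replace[OF p, of z k] z by simp
  have "con (p(k := z)) v = {k}" using con_replace[OF kD, of p z v] a v by simp
  moreover have "v \<noteq> z" using a airr by auto
  ultimately show False using no_type[OF g off_replace[of p v z k], of k] v by simp
qed

end

context layered
begin

section \<open>Claws connected to a geodesic\<close>

text \<open>
  For \<open>h = k\<close> and \<open>h = k - 1\<close> these are cliques; they serve to sort the neighbours of a claw centre.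
\<close>

definition side :: "(int \<Rightarrow> 'a) \<Rightarrow> int \<Rightarrow> int \<Rightarrow> 'a \<Rightarrow> bool" where
  "side p k h v \<longleftrightarrow> v = p k \<or> twin p k v \<or> hat p h v"

lemma side_clique:
  assumes p: "geo p" and h: "h = k \<or> h = k - 1" and uv: "side p k h u" "side p k h v"
  shows "u = v \<or> adj G u v"
proof -
  have T: "adj G w (p k)" if "twin p k w \<or> hat p h w" for w
  proof -
    have "con p w = {k - 1, k, k + 1} \<or> con p w = {h, h + 1}" using that by blast
    then have "k \<in> con p w" using h by (elim disjE) simp_all
    then show ?thesis by (simp add: con_def)
  qed
  have TT: "u = v \<or> adj G u v" if "twin p k u" "twin p k v"
    using twins_adj[OF p that(2,1)] by blast
  have HH: "u = v \<or> adj G u v" if "hat p h u" "hat p h v"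
    using hats_adj[OF p that(2,1)] by blast
  have h': "hat p (k - 1) w \<or> hat p k w" if w: "hat p h w" for w
    using h
  proof
    assume "h = k"
    then show ?thesis using w by simp
  next
    assume "h = k - 1"
    then have "hat p (k - 1) w" using w by simp
    then show ?thesis by blast
  qed
  have TH: "adj G u v" if "twin p k u" "hat p h v"
    using twin_hat_adj[OF p that(1) h'[OF that(2)]] asym by blast
  have HT: "adj G u v" if "hat p h u" "twin p k v"
    using twin_hat_adj[OF p that(2) h'[OF that(1)]] .
  consider "u = p k" | "v = p k" | "twin p k u \<or> hat p h u" "twin p k v \<or> hat p h v"
    using uv unfolding side_def by blast
  then show ?thesis
  proof cases
    case 1
    then show ?thesis using uv(2) T[of v] pg_sym[OF pg, of v u] unfolding side_def by blast
  next
    case 2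
    then show ?thesis using uv(1) T[of u] unfolding side_def by blast
  next
    case 3
    then show ?thesis using TT HH TH HT by blast
  qed
qed

text \<open>
  The neighbours of \<open>p i\<close> fall into three cliques \<open>L\<close>, \<open>M\<close>, \<open>R\<close> (left, twins of \<open>p i\<close>, right), so a claw
  must have a leaf in each of them. Non-adjacency to the middle leaf forces twins of \<open>p (i - 1)\<close> and
  \<open>p (i + 1)\<close>; after rerouting the path through both, the middle leaf has a single contact.
\<close>

lemma centre_on_path:
  assumes p: "geo p" and i: "i \<in> {0..D}" and c: "claw G (p i) x y z" and W: "x \<in> W" "y \<in> W" "z \<in> W"
  shows False
proof -
  define L where "L = side p (i - 1) (i - 1)"
  define M where "M v \<longleftrightarrow> twin p i v" for v
  define R where "R = side p (i + 1) i"
  have cls: "L v \<or> M v \<or> R v" if v: "v \<in> W" "adj G (p i) v" for v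
  proof (cases "v \<in> p ` {0..D}")
    case True
    then obtain j where j: "j \<in> {0..D}" "v = p j" by blast
    then have "\<bar>i - j\<bar> = 1" using geo_adj[OF p i j(1)] v(2) by simp
    then have "j = i - 1 \<or> j = i + 1" by linarith
    then show ?thesis using j unfolding L_def R_def side_def by blast
  next
    case False
    then have o: "off p v" using v by (simp add: off_def)
    have ic: "i \<in> con p v" using i v asym by (simp add: con_def)
    then obtain k where k: "hat p k v \<or> twin p k v" using con_type[OF p o] by blast
    then have "hat p i v \<or> hat p (i - 1) v \<or> twin p i v \<or> twin p (i - 1) v \<or> twin p (i + 1) v"
    proof
      assume h: "hat p k v"
      then have "k = i \<or> k = i - 1" using ic by auto
      then show ?thesis using h by blast
    next
      assume h: "twin p k v"
      then have "k = i \<or> k = i - 1 \<or> k = i + 1" using ic by auto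
      then show ?thesis using h by blast
    qed
    then show ?thesis unfolding L_def M_def R_def side_def by blast
  qed
  have pk: "adj G v (p k)" if "k \<in> con p v" for v k using that by (simp add: con_def)
  have Ladj: "u = v \<or> adj G u v" if "L u" "L v" for u v
    using side_clique[OF p, of "i - 1" "i - 1" u v] that unfolding L_def by simp
  have Radj: "u = v \<or> adj G u v" if "R u" "R v" for u v
    using side_clique[OF p, of i "i + 1" u v] that unfolding R_def by simp
  have Madj: "u = v \<or> adj G u v" if "M u" "M v" for u v
    using that twins_adj[OF p, of v i u] unfolding M_def by blast
  have fin: False if l: "L l" and m: "M m" and r: "R r" and n: "\<not> adj G l m" "\<not> adj G r m" "\<not> adj G l r" for l m r
  proof -
    have mc: "twin p i m" "adj G m (p (i - 1))" "adj G m (p (i + 1))" using m pk[of _ m] unfolding M_def by auto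
    have l': "twin p (i - 1) l"
      using l n(1) mc(2) twin_hat_adj[OF p mc(1), of l] asym[of l m] unfolding L_def side_def by metis
    have r': "twin p (i + 1) r"
      using r n(2) mc(3) twin_hat_adj[OF p mc(1), of r] asym[of r m] unfolding R_def side_def by metis
    \<comment> \<open>after rerouting through \<open>l\<close> and \<open>r\<close> only the contact with \<open>p i\<close> remains for \<open>m\<close>\<close>
    let ?q = "p(i - 1 := l)" and ?q' = "p(i - 1 := l, i + 1 := r)"
    have om: "off p m" using mc(1) by blast
    have D: "i - 1 \<in> {0..D}" "i + 1 \<in> {0..D}"
      using con_range(3)[OF p om, of "i - 1"] con_range(3)[OF p om, of "i + 1"] mc(1) by simp_all
    have g: "geo ?q" using geo_replace[OF p, of l "i - 1"] l' by simp
    have cl: "con p l = {i - 2, i - 1, i}" and cr: "con p r = {i, i + 1, i + 2}" and cm: "con p m = {i - 1, i, i + 1}"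
      using l' r' mc(1) by auto
    have "i + 1 \<in> con p m" "i + 1 \<notin> con p l" "i - 1 \<in> con p m" "i - 1 \<notin> con p r" "i + 2 \<in> con p r" "i + 2 \<notin> con p l"
      unfolding cl cr cm by simp_all
    then have ne: "m \<noteq> l" "m \<noteq> r" "r \<noteq> l" by auto
    have na: "\<not> adj G r l" "\<not> adj G m l" "\<not> adj G m r" using n asym by blast+
    have s: "{i, i + 1, i + 2} - {i - 1} = {i, i + 1, i + 2}" "{i - 1, i, i + 1} - {i - 1} = {i, i + 1}"
      "{i, i + 1} - {i + 1} = {i}" by auto
    have "con ?q r = {i, i + 1, i + 2}" using con_replace[OF D(1), of p l r] na(1) unfolding cr s by simp
    then have k: "i + 1 - 1 \<in> con ?q r" "i + 1 + 1 \<in> con ?q r" by simp_all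
    have "off p r" "off p m" using r' mc(1) by blast+
    then have o: "off ?q r" "off ?q' m" using off_replace ne by blast+
    have g': "geo ?q'" by (rule geo_replace[OF g o(1) k])
    have "con ?q m = {i, i + 1}" using con_replace[OF D(1), of p l m] na(2) unfolding cm s by simp
    then have "con ?q' m = {i}" using con_replace[OF D(2), of ?q r m] na(3) s(3) by simp
    then show False using no_type[OF g' o(2)] by blast
  qed
  have a: "adj G (p i) x" "adj G (p i) y" "adj G (p i) z" and n: "x \<noteq> y" "x \<noteq> z" "y \<noteq> z"
    "\<not> adj G x y" "\<not> adj G x z" "\<not> adj G y z" "\<not> adj G y x" "\<not> adj G z x" "\<not> adj G z y"
    using c asym unfolding claw_def by blast+
  note C = cls[OF W(1) a(1)] cls[OF W(2) a(2)] cls[OF W(3) a(3)]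
  have no: "\<not> (L x \<and> L y)" "\<not> (L x \<and> L z)" "\<not> (L y \<and> L z)" "\<not> (M x \<and> M y)" "\<not> (M x \<and> M z)"
    "\<not> (M y \<and> M z)" "\<not> (R x \<and> R y)" "\<not> (R x \<and> R z)" "\<not> (R y \<and> R z)"
    using Ladj Madj Radj n by blast+
  have f: "\<not> (L x \<and> M y \<and> R z)" "\<not> (L x \<and> M z \<and> R y)" "\<not> (L y \<and> M x \<and> R z)" "\<not> (L y \<and> M z \<and> R x)"
    "\<not> (L z \<and> M x \<and> R y)" "\<not> (L z \<and> M y \<and> R x)"
    using fin n by blast+
  show False using C no f by argo
qed

text \<open>
  A fork hanging from the path at a hat: the triangle formed by the hat and its edge carries the two
  halves of the path as arms and the fork as third leg. The result is one of the graphs with an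
  attached \<open>T\<^sub>q\<close> if the fork is short, and contains \<open>F\<^sup>2\<close> if it is long.
\<close>

lemma hat_fork:
  assumes p: "geo p" and w: "hat p i w" and f: "fork G (w # us) a b"
    and far: "\<And>v. v \<in> set us \<union> {a, b} \<Longrightarrow> far p v"
  shows False
proof -
  have k: "int n + 3 \<le> i" "i + 1 \<le> D - (int n + 3)" using con_range(1,2)[OF p, of w] w by auto
  have D: "i \<in> {0..D}" "i + 1 \<in> {0..D}" using k by auto
  have T: "int n \<le> i" "i < i + 1" "i + 1 \<le> D - int n" using k by auto
  note t = geo_tails[OF p T]
  have L: "{0..i - 1} \<subseteq> {0..D}" and R: "{i + 1 + 1..D} \<subseteq> {0..D}" using k by auto
  let ?xs = "dn p (i - 1) (n - 1)" and ?ys = "up p (i + 1 + 1) (n - 1)"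
  have ad: "adj G w (p i)" "adj G w (p (i + 1))" "adj G (p i) (p (i + 1))"
    using con_range(4)[OF p, of w] w geo_adj[OF p D] by auto
  have v: "anti G {v} (set ?xs)" "anti G {v} (set ?ys)" "anti G {p i, p (i + 1)} {v}" if "v \<in> set us \<union> {a, b}" for v
  proof -
    note fv = far[OF that]
    show "anti G {v} (set ?xs)" "anti G {v} (set ?ys)"
      using off_anti[of p v, OF _ t(3) L] off_anti[of p v, OF _ t(4) R] fv by auto
    have "\<not> adj G v (p i)" "\<not> adj G v (p (i + 1))" using fv D by (auto simp: con_def)
    then have "\<not> adj G (p i) v" "\<not> adj G (p (i + 1)) v" "v \<noteq> p i" "v \<noteq> p (i + 1)"
      using off_neq[of p v] fv D asym by blast+
    then show "anti G {p i, p (i + 1)} {v}" by (auto simp: anti_def)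
  qed
  have w': "anti G {w} (set ?xs)" "anti G {w} (set ?ys)"
    using off_anti[of p w, OF _ t(3) L] off_anti[of p w, OF _ t(4) R] w by auto
  have g: "anti G {p (i + 1)} (set ?xs)" "anti G {p i} (set ?ys)"
    using geo_anti[OF p D(2) t(3) L] geo_anti[OF p D(1) t(4) R] by auto
  have an1: "anti G {p i, p (i + 1)} (set us \<union> {a, b})" using v(3) unfolding anti_def by blast
  have an2: "anti G ({w, p (i + 1)} \<union> set us \<union> {a, b}) (set ?xs)" using v(1) w'(1) g(1) unfolding anti_def by blast
  have an3: "anti G ({w, p i} \<union> set us \<union> {a, b}) (set ?ys)" using v(2) w'(2) g(2) unfolding anti_def by blast
  have len: "n = Suc (length ?xs)" "n = Suc (length ?ys)" using n2 by simp_all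
  show False
  proof (cases "Suc (length us) \<le> n - 2")
    case True
    have "\<exists>h. emb (F_check n (Suc (length us))) G h"
      by (rule ex_emb[OF emb_F_check[OF pg ad(1,3,2) f refl t(1,2) len an1 an2 an3 t(5)]])
    then show False using av True by (simp add: avoids_F_def)
  next
    \<comment> \<open>a long stem provides the third leg of \<open>F\<^sup>2\<close>\<close>
    case False
    define zs where "zs = take (n - 1) (us @ [a])"
    have lz: "n = Suc (length zs)" using False n2 by (simp add: zs_def)
    have "take n ((w # us) @ [a]) = w # zs" using n2 by (cases n) (simp_all add: zs_def)
    then have iz: "ipath G (w # zs)" using ipath_take[of G "(w # us) @ [a]" n] f by (simp add: fork_def)
    have sz: "set zs \<subseteq> set us \<union> {a, b}" unfolding zs_def by (auto dest: in_set_takeD)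
    have b1: "anti G {p i, p (i + 1)} (set zs)" by (rule anti_mono[OF an1 subset_refl sz])
    have b2: "anti G ({w, p (i + 1)} \<union> set zs) (set ?xs)" by (rule anti_mono[OF an2 _ subset_refl]) (use sz in auto)
    have b3: "anti G ({w, p i} \<union> set zs) (set ?ys)" by (rule anti_mono[OF an3 _ subset_refl]) (use sz in auto)
    have "\<exists>h. emb (F2_graph n) G h"
      by (rule ex_emb[OF emb_F2[OF pg ad(1,3,2) iz t(1,2) lz len b1 b2 b3 t(5)]])
    then show False using av by (simp add: avoids_F_def)
  qed
qed

text \<open>
  The path is bypassed through \<open>s\<close> and \<open>v\<close>, and \<open>f\<close> is a pendant vertex at \<open>s\<close>.
\<close>

lemma far_attach_hat:
  assumes p: "geo p" and i: "hat p i s" and f: "far p f" "adj G s f" and v: "hat p (i - 1) v \<or> hat p (i + 1) v" "adj G s v" "\<not> adj G f v"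
  shows False
proof -
  have k: "int n + 3 \<le> i" "i + 1 \<le> D - (int n + 3)" using con_range(1,2)[OF p, of s] i by auto
  have D: "i \<in> {0..D}" "i + 1 \<in> {0..D}" using k by auto
  have sc: "adj G s (p k) \<longleftrightarrow> k = i \<or> k = i + 1" "\<not> adj G f (p k)" if "k \<in> {0..D}" for k
    using i f(1) that unfolding con_def by blast+
  have fp: "\<not> adj G (p i) f" "\<not> adj G (p (i + 1)) f" using sc(2) D asym by blast+
  have nf: "f \<noteq> p k" "s \<noteq> p k" "v \<noteq> p k" if "k \<in> {0..D}" for k using f(1) i v(1) off_neq that by blast+
  have fv: "f \<noteq> v" "\<not> adj G v f" using f(1) v(1,3) asym by auto
  have V: "s \<in> pverts G" "v \<in> pverts G" "p i \<in> pverts G" "p (i + 1) \<in> pverts G"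
    using i v offW(2) geoD(3)[OF p] D by auto
  from v(1) show False
  proof
    assume v1: "hat p (i - 1) v"
    have vc: "adj G v (p k) \<longleftrightarrow> k = i - 1 \<or> k = i" if "k \<in> {0..D}" for k
    proof -
      have e: "i - 1 + 1 = i" by simp
      show ?thesis using v1 that unfolding con_def e by blast
    qed
    have "claw G s v (p (i + 1)) f"
      unfolding claw_def using v(2) f(2) sc(1)[OF D(2)] nf[OF D(2)] fv fp(2) vc[OF D(2)] by auto
    then show False
    proof (rule no_bypass[OF p, of "i - 1" "i + 2", rotated 6])
      fix k assume kD: "k \<in> {0..D}" and "k \<in> {..i - 1} \<union> {i + 2..}"
      then have kr: "k \<le> i - 1 \<or> i + 2 \<le> k" by auto
      show "s \<noteq> p k \<and> \<not> adj G s (p k)" "f \<noteq> p k \<and> \<not> adj G f (p k)"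
        "v \<noteq> p k \<and> (adj G v (p k) \<longleftrightarrow> k = i - 1)"
        using nf[OF kD] sc[OF kD] vc[OF kD] kr by auto
      show "p (i + 1) \<noteq> p k \<and> (adj G (p (i + 1)) (p k) \<longleftrightarrow> k = i + 2)"
        using geo_adj[OF p D(2) kD] geo_inj[OF p D(2) kD] kr by auto
    qed (use k V in auto)
  next
    assume v1: "hat p (i + 1) v"
    have vc: "adj G v (p k) \<longleftrightarrow> k = i + 1 \<or> k = i + 2" if "k \<in> {0..D}" for k
    proof -
      have e: "i + 1 + 1 = i + 2" by simp
      show ?thesis using v1 that unfolding con_def e by blast
    qed
    have pv: "\<not> adj G (p i) v" "p i \<noteq> v" using vc[OF D(1)] asym[of v] nf(3)[OF D(1)] by auto
    have "claw G s (p i) v f"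
      unfolding claw_def using v(2) f(2) sc(1)[OF D(1)] nf[OF D(1)] fv fp(1) pv by auto
    then show False
    proof (rule no_bypass[OF p, of "i - 1" "i + 2", rotated 6])
      fix k assume kD: "k \<in> {0..D}" and "k \<in> {..i - 1} \<union> {i + 2..}"
      then have kr: "k \<le> i - 1 \<or> i + 2 \<le> k" by auto
      show "s \<noteq> p k \<and> \<not> adj G s (p k)" "f \<noteq> p k \<and> \<not> adj G f (p k)"
        "v \<noteq> p k \<and> (adj G v (p k) \<longleftrightarrow> k = i + 2)"
        using nf[OF kD] sc[OF kD] vc[OF kD] kr by auto
      show "p i \<noteq> p k \<and> (adj G (p i) (p k) \<longleftrightarrow> k = i - 1)"
        using geo_adj[OF p D(1) kD] geo_inj[OF p D(1) kD] kr by auto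
    qed (use k V in auto)
  qed
qed

text \<open>
  The leaves of a claw at a hat \<open>s\<close> over the edge \<open>p i\<close>, \<open>p (i + 1)\<close> are of four kinds: far from the path
  (\<open>F\<close>), on the left (\<open>A\<close>) or right (\<open>B\<close>) side, or hats over the same edge (\<open>Z\<close>). No kind can occur
  twice, and each combination of three kinds yields \<open>F\<^sup>1\<close> by a bypass, possibly after rerouting.
\<close>

lemma centre_hat:
  assumes p: "geo p" and i: "hat p i s" and c: "claw G s x y z" and W: "x \<in> W" "y \<in> W" "z \<in> W"
  shows False
proof -
  have k: "int n + 3 \<le> i" "i + 1 \<le> D - (int n + 3)" using con_range(1,2)[OF p, of s] i by auto
  have D: "i \<in> {0..D}" "i + 1 \<in> {0..D}" using k by auto
  have sW: "s \<in> W" "s \<in> pverts G" "off p s" using i offW by auto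
  have sp: "adj G s (p k) \<longleftrightarrow> k = i \<or> k = i + 1" if "k \<in> {0..D}" for k
    using i that unfolding con_def by blast
  have pk: "adj G v (p k)" if "k \<in> con p v" for v k using that by (simp add: con_def)
  define A where "A = side p i (i - 1)"
  define B where "B = side p (i + 1) (i + 1)"
  have a: "adj G s x" "adj G s y" "adj G s z" and n: "x \<noteq> y" "x \<noteq> z" "y \<noteq> z"
    "\<not> adj G x y" "\<not> adj G x z" "\<not> adj G y z" "\<not> adj G y x" "\<not> adj G z x" "\<not> adj G z y"
    using c asym unfolding claw_def by blast+
  \<comment> \<open>contacts of a leaf further away allow the geodesic to be rerouted through the centre\<close>
  have near: "m \<in> {i - 1..i + 2}" if v: "off p v" "adj G s v" "v \<in> {x, y, z}" and m: "m \<in> con p v" for v m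
  proof -
    have "\<bar>\<delta> s - i\<bar> \<le> 1" "\<bar>\<delta> s - (i + 1)\<bar> \<le> 1"
      using con_range(5)[OF p sW(3), of i] con_range(5)[OF p sW(3), of "i + 1"] i by simp_all
    moreover have "\<bar>\<delta> s - \<delta> v\<bar> \<le> 1" using lip sW(1) offW(1)[OF v(1)] v(2) by blast
    moreover have "\<bar>\<delta> v - m\<bar> \<le> 1" using con_range(5)[OF p v(1) m] .
    ultimately have "i - 2 \<le> m" "m \<le> i + 3" by linarith+
    moreover have "m \<noteq> i + 3"
    proof
      assume "m = i + 3"
      then have g: "geo (p(i + 1 := s, i + 2 := v))" using geo_replace2[OF p sW(3) v(1), of i] i m v(2) by simp
      have "(p(i + 1 := s, i + 2 := v)) (i + 1) = s" by simp
      then show False using centre_on_path[OF g D(2)] c W by simp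
    qed
    moreover have "m \<noteq> i - 2"
    proof
      assume "m = i - 2"
      then have g: "geo (p(i - 1 := v, i := s))"
        using geo_replace2[OF p v(1) sW(3), of "i - 2"] i m v(2) asym[of v s] by simp
      have "(p(i - 1 := v, i := s)) i = s" by simp
      then show False using centre_on_path[OF g D(1)] c W by simp
    qed
    ultimately show ?thesis by auto
  qed
  have cls: "far p v \<or> A v \<or> B v \<or> hat p i v" if v: "v \<in> {x, y, z}" for v
  proof -
    have vW: "v \<in> W" "adj G s v" using v W a by auto
    show ?thesis
    proof (cases "v \<in> p ` {0..D}")
      case True
      then obtain j where j: "j \<in> {0..D}" "v = p j" by blast
      then have "j = i \<or> j = i + 1" using sp[OF j(1)] vW(2) by simp
      then have "A v \<or> B v" unfolding A_def B_def side_def using j(2) by (elim disjE) simp_all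
      then show ?thesis by blast
    next
      case False
      then have o: "off p v" using vW by (simp add: off_def)
      show ?thesis
      proof (cases "con p v = {}")
        case True
        then show ?thesis using o by blast
      next
        case False
        then consider k where "hat p k v" | k where "twin p k v" using con_type[OF p o] by blast
        then show ?thesis
        proof cases
          case (1 k)
          then have "k \<in> {i - 1..i + 2}" "k + 1 \<in> {i - 1..i + 2}"
            using near[OF o vW(2) v, of k] near[OF o vW(2) v, of "k + 1"] by simp_all
          then have "k = i - 1 \<or> k = i \<or> k = i + 1" by auto
          then show ?thesis using 1 by (elim disjE) (simp_all add: A_def B_def side_def)
        next
          case (2 k)
          then have "k - 1 \<in> {i - 1..i + 2}" "k + 1 \<in> {i - 1..i + 2}"
            using near[OF o vW(2) v, of "k - 1"] near[OF o vW(2) v, of "k + 1"] by simp_all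
          then have "k = i \<or> k = i + 1" by auto
          then show ?thesis using 2 by (elim disjE) (simp_all add: A_def B_def side_def)
        qed
      qed
    qed
  qed
  have hA: "hat p (i - 1) v \<Longrightarrow> adj G v (p i)" "twin p i v \<Longrightarrow> adj G v (p i)" "twin p i v \<Longrightarrow> adj G v (p (i + 1))"
    "hat p (i + 1) v \<Longrightarrow> adj G v (p (i + 1))" "twin p (i + 1) v \<Longrightarrow> adj G v (p (i + 1))"
    "twin p (i + 1) v \<Longrightarrow> adj G v (p i)" "hat p i v \<Longrightarrow> adj G v (p i)" "hat p i v \<Longrightarrow> adj G v (p (i + 1))" for v
    using pk[of i v] pk[of "i + 1" v] by simp_all
  have e: "hat p i w \<Longrightarrow> hat p (i + 1 - 1) w" for w by simp
  have AA: "u = v \<or> adj G u v" if "A u" "A v" for u v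
    using side_clique[OF p, of "i - 1" i u v] that unfolding A_def by simp
  have BB: "u = v \<or> adj G u v" if "B u" "B v" for u v
    using side_clique[OF p, of "i + 1" "i + 1" u v] that unfolding B_def by simp
  have ZZ: "u = v \<or> adj G u v" if "hat p i u" "hat p i v" for u v
    using hats_adj[OF p, of v i u] that by blast
  have AZ: "hat p (i - 1) u" if "A u" "hat p i v" "\<not> adj G u v" for u v
    using that hA(7)[of v] twin_hat_adj[OF p, of u i v] asym[of u v] asym[of v "p i"] unfolding A_def side_def by blast
  have BZ: "hat p (i + 1) u" if "B u" "hat p i v" "\<not> adj G u v" for u v
    using that hA(8)[of v] twin_hat_adj[OF p, of u "i + 1" v] e[of v] asym[of u v] asym[of v "p (i + 1)"]
    unfolding B_def side_def by blast
  have FF: False if "far p u" "far p v" "u \<noteq> v" "\<not> adj G u v" "adj G s u" "adj G s v" for u v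
  proof -
    have "ipath G [s, u]" "ipath G [s, v]" using that sW offW(2) airr by (auto simp: ipath_Cons anti_def)
    then have "fork G [s] u v" using that by (simp add: fork_def)
    then show False using hat_fork[OF p i, of "[]" u v] that by auto
  qed
  have FA: False if "far p f" "hat p (i - 1) v \<or> hat p (i + 1) v" "\<not> adj G f v" "adj G s f" "adj G s v" for f v
    using far_attach_hat[OF p i that(1,4,2,5,3)] .
  have FAB: False if f: "far p f" "adj G s f" and u: "A u" "adj G s u" and v: "B v" "adj G s v"
    and m: "\<not> adj G f u" "\<not> adj G f v" "\<not> adj G u v" for f u v
  proof -
    have u1: "u = p i \<or> twin p i u" using FA[OF f(1) _ m(1) f(2) u(2)] u(1) unfolding A_def side_def by blast
    have v1: "v = p (i + 1) \<or> twin p (i + 1) v" using FA[OF f(1) _ m(2) f(2) v(2)] v(1) unfolding B_def side_def by blast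
    have "adj G (p i) (p (i + 1))" using geo_adj[OF p D] by simp
    then have ut: "twin p i u" and vt: "twin p (i + 1) v"
      using u1 v1 m(3) hA(3)[of u] hA(6)[of v] asym[of v "p i"] by blast+
    let ?q = "p(i := u)"
    have g: "geo ?q" using geo_replace[OF p, of u i] ut by simp
    have cs: "con p s = {i, i + 1}" and cu: "con p u = {i - 1, i, i + 1}" and cv: "con p v = {i, i + 1, i + 2}" and cf: "con p f = {}"
      using i ut vt f(1) by auto
    have "i - 1 \<in> con p u" "i - 1 \<notin> con p v" "i - 1 \<notin> con p s" unfolding cs cu cv by simp_all
    then have ne: "s \<noteq> u" "f \<noteq> u" "v \<noteq> u" using cf by auto
    have o: "off ?q s" "off ?q f" "off ?q v" using off_replace i f(1) vt ne by blast+
    have e: "insert i {i, i + 1} = {i, i + 1}" "{i, i + 1, i + 2} - {i} = {i + 1, i + 1 + 1}" by auto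
    have na: "\<not> adj G v u" using m(3) asym by blast
    have "con ?q s = {i, i + 1}" using con_replace[OF D(1), of p u s] u(2) unfolding cs e by simp
    then have s': "hat ?q i s" using o(1) by blast
    have "con ?q f = {}" using con_replace[OF D(1), of p u f] m(1) unfolding cf by simp
    then have f': "far ?q f" using o(2) by blast
    have "con ?q v = {i + 1, i + 1 + 1}" using con_replace[OF D(1), of p u v] na unfolding cv e by simp
    then have v': "hat ?q (i + 1) v" using o(3) by blast
    show False using far_attach_hat[OF g s' f' f(2) disjI2[OF v'] v(2) m(2)] .
  qed
  have ABZ: False if u: "A u" "adj G s u" and v: "B v" "adj G s v" and w: "hat p i w" "adj G s w"
    and m: "\<not> adj G u w" "\<not> adj G v w" "\<not> adj G u v" for u v w
  proof -
    have u1: "hat p (i - 1) u" using AZ u w m by blast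
    have v1: "hat p (i + 1) v" using BZ v w m by blast
    have c3: "adj G u (p k) \<longleftrightarrow> k = i - 1 \<or> k = i" "adj G v (p k) \<longleftrightarrow> k = i + 1 \<or> k = i + 2"
      "adj G w (p k) \<longleftrightarrow> k = i \<or> k = i + 1" if "k \<in> {0..D}" for k
    proof -
      have e: "i + 1 + 1 = i + 2" "i - 1 + 1 = i" by simp_all
      show "adj G u (p k) \<longleftrightarrow> k = i - 1 \<or> k = i" using u1 that unfolding con_def e by blast
      show "adj G v (p k) \<longleftrightarrow> k = i + 1 \<or> k = i + 2" using v1 that unfolding con_def e by blast
      show "adj G w (p k) \<longleftrightarrow> k = i \<or> k = i + 1" using w(1) that unfolding con_def by blast
    qed
    have nf: "u \<noteq> p k" "v \<noteq> p k" "w \<noteq> p k" "s \<noteq> p k" if "k \<in> {0..D}" for k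
      using u1 v1 w i off_neq that by blast+
    have ne: "u \<noteq> v" "u \<noteq> w" "v \<noteq> w"
    proof -
      show "u \<noteq> v" using c3(1,2)[OF D(1)] by auto
      show "u \<noteq> w" using c3(1,3)[OF D(2)] by auto
      show "v \<noteq> w" using c3(2,3)[OF D(1)] by auto
    qed
    have V: "u \<in> pverts G" "v \<in> pverts G" using u1 v1 offW(2) by auto
    have "claw G s u v w" unfolding claw_def using ne m u(2) v(2) w(2) by simp
    then show False
    proof (rule no_bypass[OF p, of "i - 1" "i + 2", rotated 6])
      fix k assume kD: "k \<in> {0..D}" and "k \<in> {..i - 1} \<union> {i + 2..}"
      then have kr: "k \<le> i - 1 \<or> i + 2 \<le> k" by auto
      show "s \<noteq> p k \<and> \<not> adj G s (p k)" "w \<noteq> p k \<and> \<not> adj G w (p k)"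
        "u \<noteq> p k \<and> (adj G u (p k) \<longleftrightarrow> k = i - 1)" "v \<noteq> p k \<and> (adj G v (p k) \<longleftrightarrow> k = i + 2)"
        using nf[OF kD] sp[OF kD] c3[OF kD] kr by auto
    qed (use k V sW in auto)
  qed
  have xyz: "x \<in> {x, y, z}" "y \<in> {x, y, z}" "z \<in> {x, y, z}" by auto
  note C = cls[OF xyz(1)] cls[OF xyz(2)] cls[OF xyz(3)]
  define F where "F v \<longleftrightarrow> far p v" for v
  define Z where "Z v \<longleftrightarrow> hat p i v" for v
  have C': "F x \<or> A x \<or> B x \<or> Z x" "F y \<or> A y \<or> B y \<or> Z y" "F z \<or> A z \<or> B z \<or> Z z"
    using C unfolding F_def Z_def by blast+
  have two: "\<not> (F u \<and> F v)" "\<not> (A u \<and> A v)" "\<not> (B u \<and> B v)" "\<not> (Z u \<and> Z v)"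
    if "u \<noteq> v" "\<not> adj G u v" "adj G s u" "adj G s v" for u v
    using FF[of u v] AA[of u v] BB[of u v] ZZ[of u v] that unfolding F_def Z_def by blast+
  have three: "\<not> (F u \<and> A v \<and> B w)" "\<not> (F u \<and> A v \<and> Z w)" "\<not> (F u \<and> B v \<and> Z w)" "\<not> (A u \<and> B v \<and> Z w)"
    if "\<not> adj G u v" "\<not> adj G u w" "\<not> adj G v w" "adj G s u" "adj G s v" "adj G s w" for u v w
  proof -
    show "\<not> (F u \<and> A v \<and> B w)" using FAB[of u v w] that unfolding F_def by blast
    show "\<not> (F u \<and> A v \<and> Z w)" using FA[of u v] AZ[of v w] that unfolding F_def Z_def by blast
    show "\<not> (F u \<and> B v \<and> Z w)" using FA[of u v] BZ[of v w] that unfolding F_def Z_def by blast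
    show "\<not> (A u \<and> B v \<and> Z w)" using ABZ[of u v w] that unfolding Z_def by blast
  qed
  show False
    using C' two[OF n(1,4) a(1,2)] two[OF n(2,5) a(1,3)] two[OF n(3,6) a(2,3)]
      three[OF n(4,5,6) a(1,2,3)] three[OF n(5,4,9) a(1,3,2)] three[OF n(7,6,5) a(2,1,3)]
      three[OF n(6,7,8) a(2,3,1)] three[OF n(8,9,4) a(3,1,2)] three[OF n(9,8,7) a(3,2,1)]
    by argo
qed

text \<open>
  The path is bypassed through \<open>v\<close>, \<open>s\<close>, \<open>w\<close>, and \<open>e\<close> is a pendant vertex at \<open>s\<close>.
\<close>

lemma hats_bypass:
  assumes p: "geo p" and s: "far p s" and c: "claw G s v w e" and v: "hat p i v" and w: "hat p j w" and ij: "i < j"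
    and e: "far p e \<or> (\<exists>m. i < m \<and> m < j \<and> hat p m e)"
  shows False
proof -
  have k: "int n + 3 \<le> i" "j + 1 \<le> D - (int n + 3)"
    using con_range(1,2)[OF p, of v] con_range(1,2)[OF p, of w] v w by auto
  have c3: "adj G v (p k) \<longleftrightarrow> k = i \<or> k = i + 1" "adj G w (p k) \<longleftrightarrow> k = j \<or> k = j + 1" "\<not> adj G s (p k)"
    if "k \<in> {0..D}" for k
  proof -
    show "adj G v (p k) \<longleftrightarrow> k = i \<or> k = i + 1" using v that unfolding con_def by blast
    show "adj G w (p k) \<longleftrightarrow> k = j \<or> k = j + 1" using w that unfolding con_def by blast
    show "\<not> adj G s (p k)" using s that unfolding con_def by blast
  qed
  have ec: "\<not> adj G e (p k)" if "k \<in> {0..D}" "k \<le> i \<or> j + 1 \<le> k" for k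
    using e
  proof
    assume "far p e"
    then show ?thesis using that(1) unfolding con_def by blast
  next
    assume "\<exists>m. i < m \<and> m < j \<and> hat p m e"
    then obtain m where m: "i < m" "m < j" "con p e = {m, m + 1}" by blast
    then have "k \<notin> con p e" using that(2) by auto
    then show ?thesis using that(1) by (simp add: con_def)
  qed
  have o: "off p e" using e by blast
  have nf: "v \<noteq> p k" "w \<noteq> p k" "s \<noteq> p k" "e \<noteq> p k" if "k \<in> {0..D}" for k
    using v w s o off_neq that by blast+
  have V: "s \<in> pverts G" "v \<in> pverts G" "w \<in> pverts G" using s v w offW(2) by auto
  show False
  proof (rule no_bypass[OF p _ _ _ V c, of i "j + 1"])
    fix k assume kD: "k \<in> {0..D}" and "k \<in> {..i} \<union> {j + 1..}"
    then have kr: "k \<le> i \<or> j + 1 \<le> k" by auto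
    show "s \<noteq> p k \<and> \<not> adj G s (p k)" "e \<noteq> p k \<and> \<not> adj G e (p k)"
      "v \<noteq> p k \<and> (adj G v (p k) \<longleftrightarrow> k = i)" "w \<noteq> p k \<and> (adj G w (p k) \<longleftrightarrow> k = j + 1)"
      using nf[OF kD] c3[OF kD] ec[OF kD kr] kr ij by auto
  qed (use k ij in auto)
qed

text \<open>
  If a leaf of the claw touches the path, then it is a hat, and the cases of one, two or three such
  leaves are settled by \<open>hat_fork\<close> and \<open>hats_bypass\<close>. Otherwise the claw is far from the path. A
  vertex \<open>w\<close> that touches the path and is as close to the claw as possible is a hat, and a shortest path
  from \<open>w\<close> to the claw makes a fork hanging from it.
\<close>

lemma centre_far:
  assumes p: "geo p" and s: "far p s" and c: "claw G s x y z" and W: "x \<in> W" "y \<in> W" "z \<in> W" and L: "linked G W"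
  shows False
proof -
  have V: "s \<in> pverts G" "x \<in> pverts G" "y \<in> pverts G" "z \<in> pverts G" using W WV s offW(2) by auto
  have kind: "far p v \<or> (\<exists>i. hat p i v)" if v: "v \<in> W" "adj G u v" "far p u" for u v
  proof -
    have "v \<notin> p ` {0..D}"
    proof
      assume "v \<in> p ` {0..D}"
      then obtain j where "j \<in> {0..D}" "v = p j" by blast
      then have "j \<in> con p u" using v by (simp add: con_def)
      then show False using v(3) by simp
    qed
    then have o: "off p v" using v by (simp add: off_def)
    show ?thesis
    proof (cases "con p v = {}")
      case False
      then show ?thesis using con_type[OF p o] far_twin[OF p v(3), of v] v(2) by blast
    qed (use o in blast)
  qed
  note K = claw_perm[OF pg c]
  have two: False if "claw G s v w e" "hat p i v" "hat p j w" "far p e" for v w e i j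
  proof -
    have nvw: "\<not> adj G w v" "w \<noteq> v" "v \<noteq> w" "\<not> adj G v w" using that(1) asym unfolding claw_def by blast+
    consider "i < j" | "j < i" | "i = j" by linarith
    then show False
    proof cases
      case 1
      then show False using hats_bypass[OF p s that(1,2,3)] that(4) by blast
    next
      case 2
      then show False using hats_bypass[OF p s claw_perm(1)[OF pg that(1)] that(3,2)] that(4) by blast
    next
      case 3
      then show False using hats_adj[OF p that(2), of w] that(3) nvw by blast
    qed
  qed
  have one: False if cl: "claw G s v a b" and v: "hat p i v" and ab: "far p a" "far p b" for v a b i
  proof -
    have kk: "adj G s v" "adj G s a" "adj G s b" "a \<noteq> b" "\<not> adj G a b" "\<not> adj G v a" "\<not> adj G v b" "v \<noteq> a" "v \<noteq> b"
      using cl unfolding claw_def by blast+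
    have VV: "v \<in> pverts G" "a \<in> pverts G" "b \<in> pverts G" using v ab offW(2) by auto
    have "fork G [v, s] a b"
      using kk VV V(1) asym[of v s] airr by (auto simp: fork_def ipath_Cons anti_def)
    then show False using hat_fork[OF p v, of "[s]" a b] s ab by auto
  qed
  have three: False if "claw G s u v w" "hat p i u" "hat p j v" "hat p k w" for u v w i j k
  proof -
    note P = claw_perm[OF pg that(1)]
    have ne: "i \<noteq> j" "i \<noteq> k" "j \<noteq> k"
      using hats_adj[OF p that(2), of v] hats_adj[OF p that(2), of w] hats_adj[OF p that(3), of w] that asym
      unfolding claw_def by metis+
    consider "i < j" "j < k" | "i < k" "k < j" | "j < i" "i < k" | "j < k" "k < i" | "k < i" "i < j" | "k < j" "j < i"
      using ne by linarith
    then show False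
    proof cases
      case 1
      then show False using hats_bypass[OF p s P(2) that(2,4)] that(3) by auto
    next
      case 2
      then show False using hats_bypass[OF p s that(1,2,3)] that(4) by auto
    next
      case 3
      then show False using hats_bypass[OF p s P(3) that(3,4)] that(2) by auto
    next
      case 4
      then show False using hats_bypass[OF p s P(1) that(3,2)] that(4) by auto
    next
      case 5
      then show False using hats_bypass[OF p s P(5) that(4,3)] that(2) by auto
    next
      case 6
      then show False using hats_bypass[OF p s P(4) that(4,2)] that(3) by auto
    qed
  qed
  have allfar: "far p x \<and> far p y \<and> far p z"
  proof -
    have a: "adj G s x" "adj G s y" "adj G s z" using c by (auto simp: claw_def)
    note t = kind[OF W(1) a(1) s] kind[OF W(2) a(2) s] kind[OF W(3) a(3) s]
    show ?thesis
      using t two[OF c] two[OF K(2)] two[OF K(3)] one[OF c] one[OF K(1)] one[OF K(4)] three[OF c] by blast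
  qed
  let ?K = "{s, x, y, z}"
  have Kfar: "far p v" if "v \<in> ?K" for v using that s allfar by blast
  \<comment> \<open>the closed neighbourhood of the path\<close>
  define S where "S = {v \<in> W. v \<in> p ` {0..D} \<or> con p v \<noteq> {}}"
  define d where "d = dst (arcs_in G W) ?K"
  have KW: "?K \<subseteq> W" "?K \<noteq> {}" using W s offW(1) by auto
  have "0 \<in> {0..D}" using p by (simp add: geo_def)
  then have "p 0 \<in> S" using geoD(1)[OF p] by (auto simp: S_def)
  then obtain w where w: "w \<in> S" "\<And>v. v \<in> S \<Longrightarrow> d w \<le> d v"
    using ex_has_least_nat[of "\<lambda>v. v \<in> S" "p 0" d] by blast
  have wW: "w \<in> W" using w(1) by (simp add: S_def)
  have farS: "v \<notin> S" if "far p v" for v using that by (auto simp: S_def off_def)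
  have wK: "w \<notin> ?K" using farS Kfar w(1) by blast
  obtain us where us: "us \<noteq> []" "hd us = w" "ipath G us" "set us \<subseteq> W - ?K" "anti G (set (butlast us)) ?K"
     "\<exists>c\<in>?K. adj G (last us) c" "length us = d w" "\<forall>i<length us. d (us ! i) + i = d w"
    using shortest_path[OF pg L KW(2,1) wW wK] unfolding d_def by blast
  obtain us' where us': "us = w # us'" using us(1,2) by (cases us) auto
  have tf: "far p v" if v: "v \<in> set us'" for v
  proof -
    obtain i where i: "i < length us'" "us' ! i = v" using v by (auto simp: in_set_conv_nth)
    then have "d v + Suc i = d w" using us(8)[rule_format, of "Suc i"] us' by simp
    then have "v \<notin> S" using w(2)[of v] by linarith
    then show ?thesis using v us(4) us' by (auto simp: S_def off_def)
  qed
  from us(6) obtain k where k: "k \<in> ?K" "adj G (last us) k" by (elim bexE)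
  have dis: "set us \<inter> ?K = {}" using us(4) by blast
  from claw_reach[OF pg c us(3,1) dis us(5) k]
  obtain zs a b where f: "fork G (us @ zs) a b" "set zs \<subseteq> ?K" "{a, b} \<subseteq> {x, y, z}"
    by (elim exE conjE)
  have "\<exists>u. far p u \<and> adj G u w"
  proof (cases us')
    case Nil
    then show ?thesis using k Kfar us' asym by auto
  next
    case (Cons u us'')
    then have "adj G w u" using us(3) us' by (simp add: ipath_Cons)
    then show ?thesis using tf[of u] Cons asym by auto
  qed
  then obtain u where u: "far p u" "adj G u w" by blast
  have "\<not> far p w" using farS w(1) by blast
  then obtain i where i: "hat p i w" using kind[OF wW u(2,1)] by blast
  have "fork G (w # (us' @ zs)) a b" using f(1) us' by simp
  moreover have "far p v" if "v \<in> set (us' @ zs) \<union> {a, b}" for v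
    using that tf Kfar f(2,3) by auto
  ultimately show False using hat_fork[OF p i] by blast
qed

text \<open>
  The key fact of the second alternative: with \<open>F\<^sup>1, \<dots>, F\<^sup>4\<close> and the attached \<open>T\<^sub>q\<close> excluded, no claw
  is connected to a path whose ends are far from everything else. A centre that is a twin is moved onto
  the path.
\<close>

theorem no_claw:
  assumes p: "geo p" and c: "claw G s x y z" and W: "s \<in> W" "x \<in> W" "y \<in> W" "z \<in> W" and L: "linked G W"
  shows False
proof (cases "s \<in> p ` {0..D}")
  case True
  then obtain i where "i \<in> {0..D}" "s = p i" by blast
  then show False using centre_on_path[OF p] c W by blast
next
  case False
  then have o: "off p s" using W by (simp add: off_def)
  show False
  proof (cases "con p s = {}")
    case True
    then show False using centre_far[OF p _ c W(2-4) L] o by blast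
  next
    case False
    then consider k where "hat p k s" | k where "twin p k s" using con_type[OF p o] by blast
    then show False
    proof cases
      case (1 k)
      then show False using centre_hat[OF p _ c W(2-4)] by blast
    next
      case (2 k)
      then have g: "geo (p(k := s))" using geo_replace[OF p o, of k] by simp
      have "k \<in> {0..D}" using con_range(3)[OF p o, of k] 2 by simp
      then show False using centre_on_path[OF g, of k x y z] c W by simp
    qed
  qed
qed

end

section \<open>A geodesic and a branch\<close>

lemma dist_path:
  assumes G: "pair_graph G" and L: "linked G W" and A: "A \<noteq> {}" "A \<subseteq> W"
  shows "v \<in> W \<Longrightarrow> \<exists>q::int\<Rightarrow>'a. q 0 \<in> A \<and> q (int (dst (arcs_in G W) A v)) = v \<and>
     (\<forall>k\<in>{0..int (dst (arcs_in G W) A v)}. q k \<in> W \<and> int (dst (arcs_in G W) A (q k)) = k) \<and>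
     (\<forall>k\<in>{0..<int (dst (arcs_in G W) A v)}. adj G (q k) (q (k + 1)))"
proof (induction "dst (arcs_in G W) A v" arbitrary: v)
  case 0
  obtain a where a: "a \<in> A" using A by blast
  then have "(a, v) \<in> (arcs_in G W)\<^sup>*" using L A 0 by (auto simp: linked_def)
  then have "v \<in> A" using dst_0D[OF a] 0(1) by simp
  then show ?case using 0 by (intro exI[of _ "\<lambda>_. v"]) simp
next
  case (Suc d)
  let ?d = "dst (arcs_in G W) A"
  obtain a where a: "a \<in> A" using A by blast
  then have av: "(a, v) \<in> (arcs_in G W)\<^sup>*" using L A Suc by (auto simp: linked_def)
  obtain u where u: "(u, v) \<in> arcs_in G W" "Suc (?d u) = ?d v"
    using dst_pred[OF a av] Suc(2) by auto
  have du: "d = ?d u" and uW: "u \<in> W" using u Suc(2) by auto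
  from Suc(1)[OF du uW] obtain q :: "int \<Rightarrow> 'a" where q: "q 0 \<in> A" "q (int (?d u)) = u"
    "\<forall>k\<in>{0..int (?d u)}. q k \<in> W \<and> int (?d (q k)) = k" "\<forall>k\<in>{0..<int (?d u)}. adj G (q k) (q (k + 1))"
    by (elim exE conjE)
  have vd: "int (?d v) = int d + 1" "int (?d u) = int d" using Suc(2) du by simp_all
  have dd: "?d v = Suc d" "?d u = d" using Suc(2) du by simp_all
  let ?q = "q(int d + 1 := v)"
  have q': "\<forall>k\<in>{0..int d}. q k \<in> W \<and> int (?d (q k)) = k" "\<forall>k\<in>{0..<int d}. adj G (q k) (q (k + 1))" "q (int d) = u"
    using q(2-4) unfolding vd(2) by blast+
  have "?q k \<in> W \<and> int (?d (?q k)) = k" if "k \<in> {0..int d + 1}" for k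
    using q'(1)[rule_format, of k] that Suc(3) vd(1) by (cases "k = int d + 1") auto
  moreover have "adj G (?q k) (?q (k + 1))" if "k \<in> {0..<int d + 1}" for k
    using q'(2)[rule_format, of k] that q'(3) u(1) by (cases "k = int d") auto
  ultimately show ?case unfolding vd(1) using q(1) by (intro exI[of _ ?q]) auto
qed

lemma linkedI:
  assumes "pair_graph G" "W \<subseteq> pverts G" "\<And>v. v \<in> W \<Longrightarrow> (r, v) \<in> (arcs_in G W)\<^sup>*"
  shows "linked G W"
  unfolding linked_def using assms arcs_in_sym[OF assms(1), of r _ W] by (meson rtrancl_trans)

lemma chain_reach:
  fixes q :: "int \<Rightarrow> 'a"
  assumes "\<And>k. 0 \<le> k \<Longrightarrow> k < m \<Longrightarrow> (q k, q (k + 1)) \<in> E"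
  shows "0 \<le> k \<Longrightarrow> k \<le> m \<Longrightarrow> (q 0, q k) \<in> E\<^sup>*"
proof (induction "nat k" arbitrary: k)
  case (Suc d)
  then have k: "0 \<le> k - 1" "k - 1 < m" "d = nat (k - 1)" by auto
  then have "(q 0, q (k - 1)) \<in> E\<^sup>*" using Suc(1)[of "k - 1"] by simp
  moreover have "(q (k - 1), q (k - 1 + 1)) \<in> E" using assms k by blast
  ultimately show ?case by simp
qed simp

lemma chain_lip:
  fixes q :: "int \<Rightarrow> 'a" and f :: "'a \<Rightarrow> int"
  assumes "\<And>k. 0 \<le> k \<Longrightarrow> k < m \<Longrightarrow> \<bar>f (q k) - f (q (k + 1))\<bar> \<le> 1"
  shows "0 \<le> k \<Longrightarrow> k \<le> m \<Longrightarrow> \<bar>f (q k) - f (q 0)\<bar> \<le> k"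
proof (induction "nat k" arbitrary: k)
  case (Suc d)
  then have k: "0 \<le> k - 1" "k - 1 < m" "d = nat (k - 1)" by auto
  then have "\<bar>f (q (k - 1)) - f (q 0)\<bar> \<le> k - 1" using Suc(1)[of "k - 1"] by simp
  moreover have "\<bar>f (q (k - 1)) - f (q k)\<bar> \<le> 1" using assms[of "k - 1"] k by simp
  ultimately show ?case by linarith
qed simp

text \<open>
  A geodesic \<open>p\<close> and a shortest path \<open>q\<close> leaving it at \<open>p i\<close>. In the applications \<open>\<delta>\<close> is the distance from
  one end of \<open>p\<close> and \<open>\<alpha>\<close> the distance from \<open>p\<close>; only their values on the paths and
  their Lipschitz property enter, so the situation can be reversed by replacing \<open>\<delta>\<close> by \<open>D - \<delta>\<close>.
\<close>

locale path_and_branch =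
  fixes G :: "'a pair_pre_digraph" and n :: nat and \<delta> \<alpha> :: "'a \<Rightarrow> int" and p q :: "int \<Rightarrow> 'a" and D m i :: int
  assumes pg: "pair_graph G" and n2: "4 \<le> n" and av: "avoids_F G n"
    and lip: "\<And>u v. adj G u v \<Longrightarrow> \<bar>\<delta> u - \<delta> v\<bar> \<le> 1 \<and> \<bar>\<alpha> u - \<alpha> v\<bar> \<le> 1"
    and p: "\<And>k. 0 \<le> k \<Longrightarrow> k \<le> D \<Longrightarrow> p k \<in> pverts G \<and> \<delta> (p k) = k \<and> \<alpha> (p k) = 0"
      "\<And>k. 0 \<le> k \<Longrightarrow> k < D \<Longrightarrow> adj G (p k) (p (k + 1))"
    and q: "\<And>k. 0 \<le> k \<Longrightarrow> k \<le> m \<Longrightarrow> q k \<in> pverts G \<and> \<alpha> (q k) = k"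
      "\<And>k. 0 \<le> k \<Longrightarrow> k < m \<Longrightarrow> adj G (q k) (q (k + 1))"
    and m0: "0 \<le> m" and q0: "q 0 = p i" and iD: "0 \<le> i" "i \<le> D"
begin

abbreviation "P \<equiv> p ` {0..D}"
abbreviation "Q \<equiv> q ` {0..m}"

text \<open>
  The sets \<open>W\<close> used below consist of both paths and a claw at one of their vertices.
\<close>

lemma linked_with_claw:
  assumes c: "claw G s x y z" and s: "s \<in> P \<union> Q"
  shows "linked G (P \<union> Q \<union> {x, y, z})"
proof (rule linkedI[OF pg, of _ "p 0"])
  let ?W = "P \<union> Q \<union> {x, y, z}"
  show "?W \<subseteq> pverts G" using p(1) q(1) c pg_verts[OF pg] unfolding claw_def by auto
  have P: "(p 0, p k) \<in> (arcs_in G ?W)\<^sup>*" if "0 \<le> k" "k \<le> D" for k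
    by (rule chain_reach[of D, OF _ that]) (use p(2) in auto)
  have "(q 0, q k) \<in> (arcs_in G ?W)\<^sup>*" if "0 \<le> k" "k \<le> m" for k
    by (rule chain_reach[of m, OF _ that]) (use q(2) in auto)
  then have Q: "(p 0, q k) \<in> (arcs_in G ?W)\<^sup>*" if "0 \<le> k" "k \<le> m" for k
    using P[OF iD] that unfolding q0 by (meson rtrancl_trans)
  have S: "(p 0, s) \<in> (arcs_in G ?W)\<^sup>*" using s P Q by auto
  have "(s, v) \<in> arcs_in G ?W" if "v \<in> {x, y, z}" for v
    using that c s unfolding claw_def by blast
  then have "(p 0, v) \<in> (arcs_in G ?W)\<^sup>*" if "v \<in> {x, y, z}" for v
    using S that by (meson rtrancl.rtrancl_into_rtrancl)
  then show "(p 0, v) \<in> (arcs_in G ?W)\<^sup>*" if "v \<in> ?W" for v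
    using that P Q by auto
qed

lemma branch_contact:
  assumes j: "0 \<le> j" "j \<le> m" and k: "0 \<le> k" "k \<le> D" and a: "adj G (q j) (p k)"
  shows "j \<le> 1" "\<bar>k - i\<bar> \<le> 2"
proof -
  have "\<bar>\<alpha> (q j) - \<alpha> (p k)\<bar> \<le> 1" using lip a by blast
  then show j1: "j \<le> 1" using q(1)[OF j] p(1)[OF k] by simp
  have "\<bar>\<delta> (q j) - k\<bar> \<le> 1" using lip[OF a] p(1)[OF k] by simp
  moreover have "\<bar>\<delta> (q j) - i\<bar> \<le> 1"
  proof (cases "j = 0")
    case True
    then show ?thesis using q0 p(1)[OF iD] by simp
  next
    case False
    then have "j = 1" "0 < m" using j1 j by auto
    then show ?thesis using q(2)[of 0] lip[of "q 0" "q 1"] q0 p(1)[OF iD] by auto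
  qed
  ultimately show "\<bar>k - i\<bar> \<le> 2" by linarith
qed

lemma branch_end_dist: "\<bar>\<delta> (q m) - i\<bar> \<le> m"
  using chain_lip[of m \<delta> q m] q(2) lip q0 p(1)[OF iD] m0 by simp

text \<open>
  If \<open>q\<close> leaves \<open>p\<close> in its middle part, the claw at the end of \<open>q\<close> is connected to the geodesic \<open>p\<close>,
  and all contacts with \<open>p\<close> are near \<open>p i\<close>: only \<open>q 0\<close> and \<open>q 1\<close> have neighbours on \<open>p\<close>, and a leaf of
  the claw has one only if \<open>m \<le> 2\<close>.
\<close>

lemma no_claw_at_branch_end:
  assumes c: "claw G (q m) x y z" and i: "int n + 8 \<le> i" "i \<le> D - (int n + 8)"
  shows False
proof -
  let ?W = "P \<union> Q \<union> {x, y, z}"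
  have V: "?W \<subseteq> pverts G" using p(1) q(1) c pg_verts[OF pg] unfolding claw_def by auto
  note glip = lip
  interpret layered G ?W n D \<delta>
    by (rule layered.intro) (use pg n2 av lip V in auto)
  have D: "0 \<le> D" using iD by simp
  have contact: "\<bar>k - i\<bar> \<le> 4" if v: "v \<in> ?W" "v \<notin> P" and k: "0 \<le> k" "k \<le> D" "adj G v (p k)" for v k
  proof (cases "v \<in> Q")
    case True
    then obtain j where "0 \<le> j" "j \<le> m" "v = q j" by auto
    then show ?thesis using branch_contact(2)[of j k] k by simp
  next
    case False
    then have vs: "adj G (q m) v" using v c unfolding claw_def by auto
    have "\<bar>\<alpha> v\<bar> \<le> 1" using glip[OF k(3)] p(1)[OF k(1,2)] by simp
    moreover have "\<bar>m - \<alpha> v\<bar> \<le> 1" using glip[OF vs] q(1)[OF m0 order_refl] by simp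
    ultimately have "m \<le> 2" by linarith
    moreover have "\<bar>\<delta> v - k\<bar> \<le> 1" using glip[OF k(3)] p(1)[OF k(1,2)] by simp
    moreover have "\<bar>\<delta> (q m) - \<delta> v\<bar> \<le> 1" using glip[OF vs] by simp
    ultimately show ?thesis using branch_end_dist by linarith
  qed
  have "geo p"
    unfolding geo_def
  proof (intro conjI ballI impI)
    fix v k assume v: "v \<in> ?W - P" and k: "k \<in> {0..D}" and a: "adj G v (p k)"
    have "\<bar>k - i\<bar> \<le> 4" using contact[of v k] v k a by auto
    then show "int n + 3 \<le> k" "k \<le> D - (int n + 3)" using i by linarith+
  qed (use D p in auto)
  moreover have "q m \<in> ?W" using m0 by auto
  moreover have "linked G ?W" by (rule linked_with_claw[OF c]) (use m0 in auto)
  ultimately show False using no_claw[OF _ c] by blast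
qed

text \<open>
  If \<open>q\<close> leaves \<open>p\<close> near its start, which carries a claw, measure distances from the end of \<open>q\<close> inside
  the union \<open>W\<close> of both paths and the claw. A shortest path \<open>r\<close> from the end of \<open>q\<close> to the end of \<open>p\<close> is
  a geodesic for this distance. It begins with almost all of \<open>q\<close> (\<open>lev\<close>) and ends with almost all of \<open>p\<close>
  (\<open>top\<close>), so vertices outside touch it only in its middle part, and the claw at \<open>p 0\<close> is connected to it.
\<close>

lemma no_claw_at_start:
  assumes c: "claw G (p 0) x y z" and i: "i < int n + 8" and Dm: "2 * int n + 16 \<le> D" "int n + 6 \<le> m"
  shows False
proof -
  let ?W = "P \<union> Q \<union> {x, y, z}"
  have D0: "0 \<le> D" using iD by simp
  have V: "?W \<subseteq> pverts G" using p(1) q(1) c pg_verts[OF pg] unfolding claw_def by auto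
  have L: "linked G ?W" by (rule linked_with_claw[OF c]) (use D0 in auto)
  let ?d = "dst (arcs_in G ?W) {q m}"
  have qW: "q k \<in> ?W" if "0 \<le> k" "k \<le> m" for k using that by auto
  have pW: "p k \<in> ?W" if "0 \<le> k" "k \<le> D" for k using that by auto
  have A: "{q m} \<noteq> {}" "{q m} \<subseteq> ?W" using qW m0 by auto
  have dlip: "?d v \<le> Suc (?d u)" if "u \<in> ?W" "v \<in> ?W" "adj G u v" for u v
    by (rule dst_lip[OF pg L A that])
  have pinj: "k = l" if "p k = p l" "0 \<le> k" "k \<le> D" "0 \<le> l" "l \<le> D" for k l
    using that p(1) by metis
  have leaf: "\<bar>\<alpha> v\<bar> \<le> 1 \<and> \<bar>\<delta> v\<bar> \<le> 1" if "v \<in> {x, y, z}" for v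
  proof -
    have "adj G (p 0) v" using that c unfolding claw_def by auto
    then show ?thesis using lip[of "p 0" v] p(1)[of 0] D0 by simp
  qed
  \<comment> \<open>far out, the branch and the geodesic have no neighbours but their own\<close>
  have qn: "v = q (j - 1) \<or> (v = q (j + 1) \<and> j < m)" if v: "v \<in> ?W" "adj G (q j) v" and j: "3 \<le> j" "j \<le> m" for v j
  proof -
    have a: "\<bar>j - \<alpha> v\<bar> \<le> 1" using lip[OF v(2)] q(1)[of j] j by simp
    then have "v \<notin> P" "v \<notin> {x, y, z}" using p(1) j leaf by fastforce+
    then obtain l where l: "0 \<le> l" "l \<le> m" "v = q l" using v(1) by auto
    have "l \<noteq> j" using v(2) l(3) pg_irrefl[OF pg] by auto
    moreover have "\<bar>j - l\<bar> \<le> 1" using a q(1) l by simp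
    ultimately have "l = j - 1 \<or> l = j + 1" by linarith
    then show ?thesis using l by auto
  qed
  have pn: "v = p (j - 1) \<or> (v = p (j + 1) \<and> j < D)" if v: "v \<in> ?W" "adj G (p j) v" and j: "int n + 11 \<le> j" "j \<le> D" for v j
  proof -
    have a: "\<bar>j - \<delta> v\<bar> \<le> 1" using lip[OF v(2)] p(1)[of j] j by simp
    have "v \<notin> {x, y, z}" using a j leaf by fastforce
    moreover have "v \<notin> Q"
    proof
      assume "v \<in> Q"
      then obtain l where "0 \<le> l" "l \<le> m" "v = q l" by auto
      then show False using branch_contact(2)[of l j] v(2) pg_sym[OF pg] j i by force
    qed
    ultimately obtain l where l: "0 \<le> l" "l \<le> D" "v = p l" using v(1) by auto
    have "l \<noteq> j" using v(2) l(3) pg_irrefl[OF pg] by auto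
    moreover have "\<bar>j - l\<bar> \<le> 1" using a p(1) l by simp
    ultimately have "l = j - 1 \<or> l = j + 1" by linarith
    then show ?thesis using l by auto
  qed
  have qd: "int (?d (q (m - k))) \<le> k" if "0 \<le> k" "k \<le> m" for k
    using that
  proof (induction "nat k" arbitrary: k)
    case 0
    then show ?case by (simp add: dst_0)
  next
    case (Suc e)
    then have k: "0 \<le> k - 1" "k - 1 \<le> m" "e = nat (k - 1)" by auto
    then have "int (?d (q (m - (k - 1)))) \<le> k - 1" using Suc(1)[of "k - 1"] by simp
    moreover have "adj G (q (m - (k - 1))) (q (m - k))"
      using q(2)[of "m - k"] Suc pg_sym[OF pg] by (auto simp: algebra_simps)
    then have "?d (q (m - k)) \<le> Suc (?d (q (m - (k - 1))))"
      using Suc by (intro dlip qW) auto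
    ultimately show ?case by linarith
  qed
  have reach: "(q m, v) \<in> (arcs_in G ?W)\<^sup>*" if "v \<in> ?W" for v
    by (rule L[unfolded linked_def, THEN conjunct2, THEN bspec, OF qW[OF m0 order_refl], THEN bspec, OF that])
  have lev: "v = q (m - k)" if "v \<in> ?W" "int (?d v) = k" "k \<le> m - 3" for v k
    using that
  proof (induction "nat k" arbitrary: k v)
    case 0
    have "(q m, v) \<in> (arcs_in G ?W)\<^sup>*" by (rule reach[OF 0(2)])
    moreover have "?d v = 0" using 0 by simp
    ultimately have "v = q m" using dst_0D[of "q m" "{q m}" v] by blast
    moreover have "k = 0" using 0 by linarith
    ultimately show ?case by simp
  next
    case (Suc e)
    then have k: "1 \<le> k" "e = nat (k - 1)" by auto
    have "0 < ?d v" using Suc(4) k by linarith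
    from dst_pred[OF _ reach[OF Suc(3)] this] obtain u where u: "(u, v) \<in> arcs_in G ?W" "Suc (?d u) = ?d v"
      by blast
    have uW: "u \<in> ?W" using u(1) by blast
    have ud: "int (?d u) = k - 1" using u(2) Suc(4) by linarith
    have km: "k - 1 \<le> m - 3" using Suc(5) by simp
    have uq: "u = q (m - (k - 1))" by (rule Suc(1)[OF k(2) uW ud km])
    have "v = q (m - (k - 1) - 1) \<or> (v = q (m - (k - 1) + 1) \<and> m - (k - 1) < m)"
      using qn[OF Suc(3), of "m - (k - 1)"] u(1) k Suc(5) unfolding uq by simp
    moreover have "v \<noteq> q (m - (k - 1) + 1)" if "m - (k - 1) < m"
    proof
      assume "v = q (m - (k - 1) + 1)"
      then have "v = q (m - (k - 2))" by (simp add: algebra_simps)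
      then show False using qd[of "k - 2"] that Suc(4,5) by simp
    qed
    ultimately show ?case by (auto simp: algebra_simps)
  qed
  from dist_path[OF pg L A pW[OF D0 order_refl]] obtain r :: "int \<Rightarrow> 'a" where r: "r 0 \<in> {q m}" "r (int (?d (p D))) = p D"
    "\<forall>k\<in>{0..int (?d (p D))}. r k \<in> ?W \<and> int (?d (r k)) = k"
    "\<forall>k\<in>{0..<int (?d (p D))}. adj G (r k) (r (k + 1))"
    by (elim exE conjE)
  define D' where "D' = int (?d (p D))"
  have r': "r 0 = q m" "r D' = p D" "\<And>k. 0 \<le> k \<Longrightarrow> k \<le> D' \<Longrightarrow> r k \<in> ?W \<and> int (?d (r k)) = k"
    "\<And>k. 0 \<le> k \<Longrightarrow> k < D' \<Longrightarrow> adj G (r k) (r (k + 1))" "0 \<le> D'"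
    using r by (auto simp: D'_def)
  have rinj: "k = l" if "r k = r l" "0 \<le> k" "k \<le> D'" "0 \<le> l" "l \<le> D'" for k l
    using that r'(3) by metis
  have qp: "q j \<noteq> p k" if "0 < j" "j \<le> m" "0 \<le> k" "k \<le> D" for j k
    using that p(1)[of k] q(1)[of j] by auto
  have D'm: "m - 2 \<le> D'"
  proof (rule ccontr)
    assume "\<not> m - 2 \<le> D'"
    then have "p D = q (m - D')" using lev[OF pW[of D], of D'] D0 by (simp add: D'_def)
    then show False using qp[of "m - D'" D] \<open>\<not> m - 2 \<le> D'\<close> r'(5) D0 by simp
  qed
  have top: "t \<le> D' \<and> r (D' - t) = p (D - t)" if "0 \<le> t" "t \<le> D - (int n + 11)" for t
    using that
  proof (induction "nat t" arbitrary: t rule: less_induct)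
    case less
    show ?case
    proof (cases "t = 0")
      case True
      then show ?thesis using r' by simp
    next
      case False
      then have t: "1 \<le> t" using less(2) by simp
      have IH: "t - 1 \<le> D'" "r (D' - (t - 1)) = p (D - (t - 1))" using less(1)[of "t - 1"] less(3) t by auto
      have "t - 1 \<noteq> D'"
      proof
        assume "t - 1 = D'"
        then have "q m = p (D - (t - 1))" using IH(2) r'(1) by simp
        then show False using qp[of m "D - (t - 1)"] less(3) t Dm by simp
      qed
      then have tD: "t \<le> D'" using IH(1) by simp
      have e: "D' - t + 1 = D' - (t - 1)" "D - (t - 1) - 1 = D - t" "D - (t - 1) + 1 = D - (t - 2)" by simp_all
      have "adj G (r (D' - t)) (r (D' - t + 1))" using r'(4)[of "D' - t"] tD t by simp
      then have "adj G (p (D - (t - 1))) (r (D' - t))" unfolding e(1) IH(2) by (rule pg_sym[OF pg])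
      then have "r (D' - t) = p (D - t) \<or> (r (D' - t) = p (D - (t - 2)) \<and> D - (t - 1) < D)"
        using pn[of "r (D' - t)" "D - (t - 1)"] r'(3)[of "D' - t"] tD less(3) t unfolding e by simp
      moreover have "r (D' - t) \<noteq> p (D - (t - 2))" if "D - (t - 1) < D"
      proof
        assume "r (D' - t) = p (D - (t - 2))"
        also have "\<dots> = r (D' - (t - 2))" using less(1)[of "t - 2"] that less(3) by simp
        finally have "D' - t = D' - (t - 2)" using rinj[of "D' - t" "D' - (t - 2)"] that tD t by simp
        then show False by simp
      qed
      ultimately show ?thesis using tD by blast
    qed
  qed
  interpret layered G ?W n D' "\<lambda>v. int (?d v)"
  proof (rule layered.intro)
    show "\<bar>int (?d u) - int (?d v)\<bar> \<le> 1" if "u \<in> ?W" "v \<in> ?W" "adj G u v" for u v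
      using dlip[OF that] dlip[OF that(2,1) pg_sym[OF pg that(3)]] by linarith
  qed (use pg n2 av V in auto)
  have "geo r"
    unfolding geo_def
  proof (intro conjI ballI impI)
    fix v k assume v: "v \<in> ?W - r ` {0..D'}" and k: "k \<in> {0..D'}" and a: "adj G v (r k)"
    have rk: "r k \<in> ?W" "int (?d (r k)) = k" using r'(3)[of k] k by auto
    have "m - 2 \<le> int (?d v)"
    proof (rule ccontr)
      assume l: "\<not> m - 2 \<le> int (?d v)"
      define e where "e = int (?d v)"
      have e: "0 \<le> e" "e \<le> m - 3" "e \<le> D'" using l D'm unfolding e_def by linarith+
      have "v = q (m - e)" by (rule lev) (use v e in \<open>simp_all add: e_def\<close>)
      moreover have "r e = q (m - e)" by (rule lev) (use r'(3)[OF e(1,3)] e(2) in simp_all)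
      ultimately have "v = r e" by simp
      then have "v \<in> r ` {0..D'}" using e by (intro image_eqI) simp_all
      then show False using v by blast
    qed
    moreover have "\<bar>int (?d v) - k\<bar> \<le> 1" using lip[of v "r k"] v rk a by simp
    ultimately show "int n + 3 \<le> k" using Dm by linarith
    show "k \<le> D' - (int n + 3)"
    proof (rule ccontr)
      assume "\<not> k \<le> D' - (int n + 3)"
      define t where "t = D' - k"
      have t: "0 \<le> t" "t < int n + 3" "k = D' - t" using k \<open>\<not> k \<le> D' - (int n + 3)\<close> by (auto simp: t_def)
      have rt: "r k = p (D - t)" using top[of t] t Dm by simp
      have "adj G (p (D - t)) v" using a rt pg_sym[OF pg] by simp
      then have "v = p (D - t - 1) \<or> (v = p (D - t + 1) \<and> D - t < D)"
        using v t Dm by (intro pn) auto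
      then show False
      proof
        assume "v = p (D - t - 1)"
        then have "v = r (D' - (t + 1))" "t + 1 \<le> D'" using top[of "t + 1"] t Dm by (simp_all add: algebra_simps)
        then show False using v t by auto
      next
        assume "v = p (D - t + 1) \<and> D - t < D"
        then have "v = p (D - (t - 1))" "1 \<le> t" by (simp_all add: algebra_simps)
        then have "v = r (D' - (t - 1))" "t - 1 \<le> D'" using top[of "t - 1"] t Dm by simp_all
        then show False using v \<open>1 \<le> t\<close> by auto
      qed
    qed
  qed (use r' in auto)
  moreover have "p 0 \<in> ?W" using pW D0 by simp
  ultimately show False using no_claw[OF _ c] L by blast
qed

end

section \<open>Three claws far apart\<close>

text \<open>
  Let \<open>p\<close> be a shortest path between two of the centres and \<open>q\<close> a shortest path from the third centre
  to \<open>p\<close>. If \<open>q\<close> meets \<open>p\<close> in its middle part, the third claw is impossible; if \<open>q\<close> meets \<open>p\<close> near one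
  of its ends, the claw at this end is impossible.
\<close>

lemma no_three_far_claws:
  assumes G: "conn_graph G" and n: "4 \<le> n" and av: "avoids_F G n"
    and a: "claw G a a1 a2 a3" and b: "claw G b b1 b2 b3" and c: "claw G c c1 c2 c3"
    and R: "2 * n + 20 \<le> dst (parcs G) {a} b" "2 * n + 20 \<le> dst (parcs G) {a} c" "2 * n + 20 \<le> dst (parcs G) {b} c"
  shows False
proof -
  have pg: "pair_graph G" using G by (simp add: conn_graph_iff)
  have E: "arcs_in G (pverts G) = parcs G" using pg by (auto simp: pair_graph_iff)
  note L = linked_conn[OF G]
  have V: "a \<in> pverts G" "b \<in> pverts G" "c \<in> pverts G"
    using a b c pg_verts[OF pg] unfolding claw_def by blast+
  have lip: "\<bar>int (dst (parcs G) A u) - int (dst (parcs G) A v)\<bar> \<le> 1"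
    if A: "A \<noteq> {}" "A \<subseteq> pverts G" and uv: "adj G u v" for A u v
    using dst_lip[OF pg L A, of u v] dst_lip[OF pg L A, of v u] pg_verts[OF pg uv] uv pg_sym[OF pg uv]
    unfolding E by linarith
  define D where "D = int (dst (parcs G) {a} b)"
  have A: "{a} \<noteq> {}" "{a} \<subseteq> pverts G" using V by auto
  from dist_path[OF pg L A V(2), unfolded E, folded D_def] obtain p :: "int \<Rightarrow> 'a" where p': "p 0 \<in> {a}" "p D = b"
    "\<forall>k\<in>{0..D}. p k \<in> pverts G \<and> int (dst (parcs G) {a} (p k)) = k" "\<forall>k\<in>{0..<D}. adj G (p k) (p (k + 1))"
    by (elim exE conjE)
  have p: "p 0 = a" "p D = b" "\<And>k. 0 \<le> k \<Longrightarrow> k \<le> D \<Longrightarrow> p k \<in> pverts G \<and> int (dst (parcs G) {a} (p k)) = k"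
    "\<And>k. 0 \<le> k \<Longrightarrow> k < D \<Longrightarrow> adj G (p k) (p (k + 1))"
    using p' by simp_all
  let ?P = "p ` {0..D}"
  have D0: "0 \<le> D" by (simp add: D_def)
  have P: "?P \<noteq> {}" "?P \<subseteq> pverts G" using p(3) D0 by auto
  define m where "m = int (dst (parcs G) ?P c)"
  from dist_path[OF pg L P V(3), unfolded E, folded m_def] obtain q :: "int \<Rightarrow> 'a" where q': "q 0 \<in> ?P" "q m = c"
    "\<forall>k\<in>{0..m}. q k \<in> pverts G \<and> int (dst (parcs G) ?P (q k)) = k" "\<forall>k\<in>{0..<m}. adj G (q k) (q (k + 1))"
    by (elim exE conjE)
  have q: "q 0 \<in> ?P" "q m = c" "\<And>k. 0 \<le> k \<Longrightarrow> k \<le> m \<Longrightarrow> q k \<in> pverts G \<and> int (dst (parcs G) ?P (q k)) = k"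
    "\<And>k. 0 \<le> k \<Longrightarrow> k < m \<Longrightarrow> adj G (q k) (q (k + 1))"
    using q' by simp_all
  obtain i where i: "0 \<le> i" "i \<le> D" "q 0 = p i" using q(1) by auto
  define \<delta> where "\<delta> v = int (dst (parcs G) {a} v)" for v
  define \<alpha> where "\<alpha> v = int (dst (parcs G) ?P v)" for v
  have \<alpha>p: "\<alpha> (p k) = 0" if "0 \<le> k" "k \<le> D" for k
    using dst_0[of "p k" ?P] that by (simp add: \<alpha>_def)
  have m0: "0 \<le> m" by (simp add: m_def)
  interpret fwd: path_and_branch G n \<delta> \<alpha> p q D m i
  proof (rule path_and_branch.intro)
    show "\<bar>\<delta> u - \<delta> v\<bar> \<le> 1 \<and> \<bar>\<alpha> u - \<alpha> v\<bar> \<le> 1" if "adj G u v" for u v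
      using lip[OF A that] lip[OF P that] by (simp add: \<delta>_def \<alpha>_def)
  qed (use pg n av p q i \<alpha>p m0 in \<open>auto simp: \<delta>_def \<alpha>_def\<close>)
  consider "i < int n + 8" | "int n + 8 \<le> i" "i \<le> D - (int n + 8)" | "D - (int n + 8) < i" by linarith
  then show False
  proof cases
    case 1
    have "\<delta> c \<le> i + m" using fwd.branch_end_dist q(2) by simp
    then have "int n + 6 \<le> m" using R(2) 1 by (simp add: \<delta>_def)
    then show False using fwd.no_claw_at_start[of a1 a2 a3] a p(1) 1 R(1) by (simp add: D_def)
  next
    case 2
    then show False using fwd.no_claw_at_branch_end[of c1 c2 c3] c q(2) by simp
  next
    case 3
    \<comment> \<open>the same situation, seen from the other end of the geodesic\<close>
    interpret rev: path_and_branch G n "\<lambda>v. D - \<delta> v" \<alpha> "\<lambda>k. p (D - k)" q D m "D - i"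
    proof (rule path_and_branch.intro)
      fix u v assume "adj G u v"
      then show "\<bar>(D - \<delta> u) - (D - \<delta> v)\<bar> \<le> 1 \<and> \<bar>\<alpha> u - \<alpha> v\<bar> \<le> 1" using fwd.lip[of u v] by linarith
    next
      fix k assume "0 \<le> k" "k < D"
      then show "adj G (p (D - k)) (p (D - (k + 1)))"
        using p(4)[of "D - (k + 1)"] pg_sym[OF pg] by (simp add: algebra_simps)
    qed (use pg n av p q i \<alpha>p m0 in \<open>auto simp: \<delta>_def \<alpha>_def\<close>)
    define \<beta> where "\<beta> v = int (dst (parcs G) {b} v)" for v
    have B: "{b} \<noteq> {}" "{b} \<subseteq> pverts G" using V by auto
    have "\<bar>\<beta> (p (D - (D - i))) - \<beta> (p (D - 0))\<bar> \<le> D - i"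
      by (rule chain_lip[of D \<beta> "\<lambda>k. p (D - k)"]) (use rev.p(2) lip[OF B] i in \<open>auto simp: \<beta>_def\<close>)
    moreover have "\<beta> b = 0" by (simp add: \<beta>_def dst_0)
    moreover have "\<bar>\<beta> (q m) - \<beta> (q 0)\<bar> \<le> m"
      by (rule chain_lip[of m \<beta> q]) (use q(4) lip[OF B] m0 in \<open>auto simp: \<beta>_def\<close>)
    ultimately have "\<beta> c \<le> (D - i) + m" using i(3) p(2) q(2) by simp
    then have "int n + 6 \<le> m" using R(3) 3 by (simp add: \<beta>_def)
    then show False using rev.no_claw_at_start[of b1 b2 b3] b p(2) 3 R(1) by (simp add: D_def)
  qed
qed

text \<open>
  A spider with stems of length at least \<open>n - 1\<close> contains \<open>F\<^sup>2\<close>, so there are no spiders at all. From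
  \<open>2 N + 3\<close> anticomplete claws three can be chosen with pairwise distances at least \<open>R\<close>: if \<open>N\<close> centres
  were close to one centre \<open>r\<close>, the forks from \<open>r\<close> to them would have bounded length and force a
  spider.
\<close>

lemma bounded_by_F:
  assumes n: "4 \<le> n"
  shows "\<exists>B::nat. \<forall>G::ngraph. conn_graph G \<longrightarrow> \<not> (\<exists>h. emb (star_graph n) G h) \<longrightarrow> avoids_F G n \<longrightarrow>
     (\<forall>p. 1 \<le> p \<and> p \<le> n - 2 \<longrightarrow> \<not> (\<exists>h. emb (K_check n p) G h)) \<longrightarrow> deficiency G < int B"
proof -
  \<comment> \<open>the distance needed to exclude three claws; a fork to a claw within distance \<open>R\<close> has length at most \<open>R + 2\<close>\<close>
  define R where "R = 2 * n + 20"
  obtain N where N: "forces_spider_rooted n (R + 2) N"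
    using rooted_forks by blast
  obtain B :: nat where B: "\<forall>G::ngraph. conn_graph G \<longrightarrow> starfree G n \<longrightarrow> int B \<le> deficiency G \<longrightarrow>
     (\<exists>q ws a b. 1 \<le> q \<and> spider G n q ws a b) \<or> (\<exists>I x y z. card I = 2 * N + 3 \<and> claw_family G I x y z)"
    using anticomplete_claws[of n "2 * N + 3"] by (elim exE)
  show ?thesis
  proof (rule exI[of _ B], intro allI impI)
    fix G :: ngraph
    assume G: "conn_graph G" and st: "\<not> (\<exists>h. emb (star_graph n) G h)" and av: "avoids_F G n"
      and K: "\<forall>p. 1 \<le> p \<and> p \<le> n - 2 \<longrightarrow> \<not> (\<exists>h. emb (K_check n p) G h)"
    have pg: "pair_graph G" using G by (simp add: conn_graph_iff)
    have sf: "starfree G n" using no_star_starfree[OF pg st] n by simp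
    have nosp: "\<not> spider G n q ws a b" if "1 \<le> q" for q ws a b
    proof
      assume sp: "spider G n q ws a b"
      show False
      proof (cases "q \<le> n - 2")
        case True
        then show False using emb_K_check[OF pg sp that] K that by blast
      next
        case False
        then have "\<exists>h. emb (F2_graph n) G h" using spider_F2[OF pg sp that, of n] n by simp
        then show False using av by (simp add: avoids_F_def)
      qed
    qed
    show "deficiency G < int B"
    proof (rule ccontr)
      assume "\<not> deficiency G < int B"
      then obtain I x y z where I: "finite I" "card I = 2 * N + 3" and F: "claw_family G I x y z"
        using B[rule_format, OF G sf] nosp by (auto simp: claw_family_def)
      have cl: "claw G s (x s) (y s) (z s)" if "s \<in> I" for s using F that by (simp add: claw_family_def)
      have an: "anti G {s, x s, y s, z s} {s', x s', y s', z s'}" if "s \<in> I" "s' \<in> I" "s \<noteq> s'" for s s'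
        using F that by (simp add: claw_family_def)
      define near where "near r = {s \<in> I - {r}. dst (parcs G) {s} r < R}" for r
      have nN: "card (near r) < N" if r: "r \<in> I" for r
      proof (rule ccontr)
        assume "\<not> card (near r) < N"
        then have big: "N \<le> card (near r)" by simp
        have rV: "r \<in> pverts G" using cl[OF r] pg_verts[OF pg] unfolding claw_def by blast
        have "\<forall>s\<in>near r. \<exists>ws a b. fork G ws a b \<and> hd ws = r \<and> {a, b} \<subseteq> {x s, y s, z s} \<and> length ws \<le> R + 2"
        proof
          fix s assume s: "s \<in> near r"
          then have s': "s \<in> I" "s \<noteq> r" "dst (parcs G) {s} r < R" by (auto simp: near_def)
          have "r \<notin> {s, x s, y s, z s}" using an[of r s] r s' by (auto simp: anti_def)
          from claw_fork_from[OF G cl[OF s'(1)] rV this]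
          obtain ws a b where "fork G ws a b" "hd ws = r" "{a, b} \<subseteq> {x s, y s, z s}"
            "length ws \<le> dst (parcs G) {s} r + 2" by (elim exE conjE)
          moreover from this have "length ws \<le> R + 2" using s'(3) by simp
          ultimately show "\<exists>ws a b. fork G ws a b \<and> hd ws = r \<and> {a, b} \<subseteq> {x s, y s, z s} \<and> length ws \<le> R + 2"
            by blast
        qed
        then obtain ws a b where f: "\<And>s. s \<in> near r \<Longrightarrow> fork G (ws s) (a s) (b s) \<and> hd (ws s) = r \<and>
           {a s, b s} \<subseteq> {x s, y s, z s} \<and> length (ws s) \<le> R + 2"
          by metis
        have "anti G {a s, b s} {a s', b s'}" if "s \<in> near r" "s' \<in> near r" "s \<noteq> s'" for s s'
          by (rule anti_mono[OF an[of s s']]) (use that f[OF that(1)] f[OF that(2)] in \<open>auto simp: near_def\<close>)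
        then have 2: "\<forall>s\<in>near r. \<forall>s'\<in>near r. s \<noteq> s' \<longrightarrow> anti G {a s, b s} {a s', b s'}" by blast
        have 1: "\<forall>s\<in>near r. fork G (ws s) (a s) (b s) \<and> length (ws s) \<le> R + 2 \<and> hd (ws s) = r"
          using f by blast
        have "finite (near r)" using I(1) by (simp add: near_def)
        from forces_spider_rootedD[OF N pg sf this big 1 2] show False using nosp by blast
      qed
      have fn: "finite (near r)" for r using I(1) by (simp add: near_def)
      obtain s1 where s1: "s1 \<in> I" using I by fastforce
      have "card (insert s1 (near s1)) < card I" using nN[OF s1] card_insert_le_m1[of "Suc N" "near s1" s1] I(2) by simp
      then have "\<not> I \<subseteq> insert s1 (near s1)" using card_mono[of "insert s1 (near s1)" I] fn by auto
      then obtain s2 where s2: "s2 \<in> I" "s2 \<notin> insert s1 (near s1)" by blast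
      have "card (insert s1 (near s1) \<union> insert s2 (near s2)) \<le> card (insert s1 (near s1)) + card (insert s2 (near s2))"
        by (rule card_Un_le)
      also have "\<dots> \<le> (card (near s1) + 1) + (card (near s2) + 1)"
        using fn by (intro add_mono) (simp_all add: card_insert_if)
      also have "\<dots> < card I" using nN[OF s1] nN[OF s2(1)] I(2) by simp
      finally have "\<not> I \<subseteq> insert s1 (near s1) \<union> insert s2 (near s2)"
        using card_mono[of "insert s1 (near s1) \<union> insert s2 (near s2)" I] fn by auto
      then obtain s3 where s3: "s3 \<in> I" "s3 \<notin> insert s1 (near s1)" "s3 \<notin> insert s2 (near s2)" by blast
      have "R \<le> dst (parcs G) {s2} s1" "R \<le> dst (parcs G) {s3} s1" "R \<le> dst (parcs G) {s3} s2"
        using s2 s3 by (auto simp: near_def)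
      then show False
        using no_three_far_claws[OF G n av cl[OF s3(1)] cl[OF s2(1)] cl[OF s1]] by (simp add: R_def)
    qed
  qed
qed

section \<open>Forcing members of the family\<close>

text \<open>
  Counterexamples are easiest to describe on pairs of numbers; they are transported to the natural
  numbers by an injection.
\<close>

definition relabel :: "('a \<Rightarrow> 'b) \<Rightarrow> 'a pair_pre_digraph \<Rightarrow> 'b pair_pre_digraph" where
  "relabel f G = \<lparr>pverts = f ` pverts G, parcs = map_prod f f ` parcs G\<rparr>"

lemma relabel_adj: "inj f \<Longrightarrow> adj (relabel f G) (f u) (f v) \<longleftrightarrow> adj G u v"
  by (auto simp: relabel_def inj_eq)

lemma relabel_pair_graph: "inj f \<Longrightarrow> pair_graph G \<Longrightarrow> pair_graph (relabel f G)"
  unfolding pair_graph_iff relabel_def sym_def by (auto simp: inj_eq)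

lemma relabel_conn:
  assumes f: "inj f" and G: "conn_graph G" shows "conn_graph (relabel f G)"
proof -
  have "(f u, f v) \<in> (parcs (relabel f G))\<^sup>*" if "(u, v) \<in> (parcs G)\<^sup>*" for u v
    using that
  proof (induction rule: rtrancl_induct)
    case (step y z)
    then show ?case using relabel_adj[OF f] by (meson rtrancl.rtrancl_into_rtrancl)
  qed simp
  then show ?thesis
    using G relabel_pair_graph[OF f] unfolding conn_graph_iff by (auto simp: relabel_def)
qed

lemma relabel_back:
  assumes f: "inj f" and e: "emb H (relabel f G) g"
  shows "\<exists>h. emb H G h"
proof -
  define h where "h x = inv f (g x)" for x
  have g: "g x = f (h x)" "h x \<in> pverts G" if "x \<in> pverts H" for x
  proof -
    have "g x \<in> f ` pverts G" using e that by (auto simp: emb_def relabel_def)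
    then obtain y where "y \<in> pverts G" "g x = f y" by blast
    then show "g x = f (h x)" "h x \<in> pverts G" using f by (simp_all add: h_def)
  qed
  have "emb H G h"
    unfolding emb_def
  proof (intro conjI ballI)
    show "inj_on h (pverts H)" using e g(1) by (metis emb_def inj_on_def)
    show "adj H a b \<longleftrightarrow> adj G (h a) (h b)" if "a \<in> pverts H" "b \<in> pverts H" for a b
      using e that g(1) relabel_adj[OF f] by (simp add: emb_def)
  qed (use g in auto)
  then show ?thesis by blast
qed

definition forces :: "ngraph set \<Rightarrow> real \<Rightarrow> bool" where
  "forces \<H> b \<longleftrightarrow> (\<forall>H\<in>\<H>. conn_graph H) \<and>
     (\<forall>G::ngraph. conn_graph G \<and> free_of \<H> G \<longrightarrow> of_int (deficiency G) < b)"

text \<open>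
  The way in which the boundedness hypothesis is used: a connected graph with visibly large deficiency
  contains a member of the family.
\<close>

lemma forces_hit:
  fixes G :: "'a::countable pair_pre_digraph"
  assumes F: "forces \<H> b" and G: "conn_graph G"
    and IS: "I \<subseteq> pverts G" "S \<subseteq> pverts G" "I \<inter> S = {}" "\<And>u v. u \<in> I \<Longrightarrow> adj G u v \<Longrightarrow> v \<in> S"
    and b: "b + real (card S) \<le> real (card I)"
  shows "\<exists>H\<in>\<H>. \<exists>h. emb H G h"
proof -
  define f :: "'a \<Rightarrow> nat" where "f = to_nat"
  have f: "inj f" by (simp add: f_def)
  let ?G = "relabel f G"
  have C: "conn_graph ?G" using relabel_conn[OF f G] .
  then have pg: "pair_graph ?G" by (simp add: conn_graph_iff)
  have "int (card (f ` I)) - int (card (f ` S)) \<le> deficiency ?G"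
  proof (rule deficiency_lower[OF pg])
    show "f ` I \<subseteq> pverts ?G" "f ` S \<subseteq> pverts ?G" using IS by (auto simp: relabel_def)
    show "f ` I \<inter> f ` S = {}" using IS(3) f by (simp flip: image_Int)
    fix u v assume "u \<in> f ` I" "adj ?G u v"
    then obtain u' v' where "u' \<in> I" "u = f u'" "v = f v'" by (auto simp: relabel_def)
    then show "v \<in> f ` S" using \<open>adj ?G u v\<close> relabel_adj[OF f] IS(4) by blast
  qed
  moreover have "card (f ` I) = card I" "card (f ` S) = card S"
    using f by (simp_all add: card_image inj_on_subset)
  ultimately have "b \<le> of_int (deficiency ?G)" using b by linarith
  then have "\<not> free_of \<H> ?G" using F C unfolding forces_def by (meson not_less)
  then obtain H where H: "H \<in> \<H>" "H \<prec>\<^sub>I ?G" by (auto simp: free_of_def)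
  have "pair_graph H" using F H(1) by (auto simp: forces_def conn_graph_iff)
  then obtain g where "emb H ?G g" using induced_in_iff pg H(2) by blast
  then show ?thesis using relabel_back[OF f] H(1) by blast
qed

lemma conn_graphI:
  assumes "pair_graph G" "r \<in> pverts G" "\<And>v. v \<in> pverts G \<Longrightarrow> (r, v) \<in> (parcs G)\<^sup>*"
  shows "conn_graph G"
proof -
  have "sym ((parcs G)\<^sup>*)" using assms(1) by (simp add: pair_graph_iff sym_rtrancl)
  then have bk: "(u, r) \<in> (parcs G)\<^sup>*" if "u \<in> pverts G" for u
    using assms(3)[OF that] by (rule symD)
  have "(u, v) \<in> (parcs G)\<^sup>*" if "u \<in> pverts G" "v \<in> pverts G" for u v
    using rtrancl_trans[OF bk[OF that(1)] assms(3)[OF that(2)]] .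
  then show ?thesis using assms(1,2) unfolding conn_graph_iff by auto
qed

text \<open>A discrete intermediate value theorem for the vertices of a connected graph.\<close>

lemma conn_interval:
  fixes f :: "'a \<Rightarrow> nat"
  assumes H: "conn_graph H" and lip: "\<And>u v. adj H u v \<Longrightarrow> f v \<le> Suc (f u)"
    and uv: "u \<in> pverts H" "v \<in> pverts H" and z: "f u \<le> z" "z \<le> f v"
  shows "\<exists>w\<in>pverts H. f w = z"
proof -
  have "(u, v) \<in> (parcs H)\<^sup>*" using H uv by (auto simp: conn_graph_iff)
  then show ?thesis using uv(1) z
  proof (induction rule: converse_rtrancl_induct)
    case base
    then show ?case using uv(2) by auto
  next
    case (step y x)
    have x: "x \<in> pverts H" using step(1) H pg_verts[of H y x] by (auto simp: conn_graph_iff)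
    show ?case
    proof (cases "f y = z")
      case True
      then show ?thesis using step by blast
    next
      case False
      then have "f x \<le> z" using lip[OF step(1)] step.prems by simp
      then show ?thesis using step.IH x step.prems by blast
    qed
  qed
qed

lemma conn_span:
  fixes f :: "'a \<Rightarrow> nat"
  assumes H: "conn_graph H" and lip: "\<And>u v. adj H u v \<Longrightarrow> f v \<le> Suc (f u)"
    and uv: "u \<in> pverts H" "v \<in> pverts H"
  shows "f v < f u + card (pverts H)"
proof (cases "f u \<le> f v")
  case True
  have fin: "finite (pverts H)" using H by (simp add: conn_graph_iff pair_graph_iff)
  have "{f u..f v} \<subseteq> f ` pverts H"
  proof
    fix z assume "z \<in> {f u..f v}"
    then have z: "f u \<le> z" "z \<le> f v" by simp_all
    have "\<exists>w\<in>pverts H. f w = z" by (rule conn_interval[where f = f, OF H lip uv z])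
    then show "z \<in> f ` pverts H" by blast
  qed
  then have "card {f u..f v} \<le> card (f ` pverts H)" using fin by (intro card_mono) auto
  also have "\<dots> \<le> card (pverts H)" using fin by (rule card_image_le)
  finally show ?thesis using True by simp
next
  case False
  have "0 < card (pverts H)" using uv H by (auto simp: card_gt_0_iff conn_graph_iff pair_graph_iff)
  then show ?thesis using False by simp
qed

section \<open>Chains of cores\<close>

text \<open>
  In \<open>chain C s t P w m\<close> the \<open>m\<close> copies of the core \<open>C\<close> sit at the multiples of \<open>P\<close> on a line; all
  other positions carry a single vertex. The terminals \<open>s\<close> and \<open>t\<close> of a copy are joined to the
  vertices on its left and right.
\<close>

definition port :: "nat \<Rightarrow> nat \<Rightarrow> nat \<Rightarrow> nat" where
  "port P s q = (if P dvd q then s else 0)"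

definition chain_verts :: "ngraph \<Rightarrow> nat \<Rightarrow> nat \<Rightarrow> nat \<Rightarrow> (nat \<times> nat) set" where
  "chain_verts C P w m = {(q, c). P - w \<le> q \<and> q \<le> m * P + w \<and> (if P dvd q then c \<in> pverts C else c = 0)}"

definition chain :: "ngraph \<Rightarrow> nat \<Rightarrow> nat \<Rightarrow> nat \<Rightarrow> nat \<Rightarrow> nat \<Rightarrow> (nat \<times> nat) pair_pre_digraph" where
  "chain C s t P w m = \<lparr>pverts = chain_verts C P w m,
     parcs = {((q, c), (q', c')) | q c q' c'. (q, c) \<in> chain_verts C P w m \<and> (q', c') \<in> chain_verts C P w m \<and>
       (q = q' \<and> P dvd q \<and> adj C c c' \<or> q' = Suc q \<and> c = port P t q \<and> c' = port P s q' \<or>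
        q = Suc q' \<and> c' = port P t q' \<and> c = port P s q)}\<rparr>"

text \<open>
  \<open>w\<close> is the length of the two ends of the chain and of the window that is considered around a core.
\<close>

locale chain_setting =
  fixes C :: ngraph and s t P w m :: nat
  assumes C: "conn_graph C" and st: "s \<in> pverts C" "t \<in> pverts C" and wP: "1 \<le> w" "w < P" and m1: "1 \<le> m"
begin

abbreviation "\<Gamma> \<equiv> chain C s t P w m"

lemma pgC: "pair_graph C"
  using C by (simp add: conn_graph_iff)

lemma verts: "(q, c) \<in> pverts \<Gamma> \<longleftrightarrow> P - w \<le> q \<and> q \<le> m * P + w \<and> (if P dvd q then c \<in> pverts C else c = 0)"
  by (simp add: chain_def chain_verts_def)

lemma chain_adj: "adj \<Gamma> (q, c) (q', c') \<longleftrightarrow> (q, c) \<in> pverts \<Gamma> \<and> (q', c') \<in> pverts \<Gamma> \<and>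
    (q = q' \<and> P dvd q \<and> adj C c c' \<or> q' = Suc q \<and> c = port P t q \<and> c' = port P s q' \<or>
     q = Suc q' \<and> c' = port P t q' \<and> c = port P s q)"
  by (auto simp: chain_def)

lemma pg: "pair_graph \<Gamma>"
  unfolding pair_graph_iff
proof (intro conjI allI)
  have "pverts \<Gamma> \<subseteq> {..m * P + w} \<times> (pverts C \<union> {0})" by (auto simp: verts split: if_splits)
  moreover have "finite ({..m * P + w} \<times> (pverts C \<union> {0}))" using pgC by (simp add: pair_graph_iff)
  ultimately show "finite (pverts \<Gamma>)" by (rule finite_subset)
  show "parcs \<Gamma> \<subseteq> pverts \<Gamma> \<times> pverts \<Gamma>" by (auto simp: chain_def)
  show "sym (parcs \<Gamma>)"
  proof (rule symI)
    fix u v assume "adj \<Gamma> u v"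
    then show "adj \<Gamma> v u" using pg_sym[OF pgC] by (cases u; cases v) (auto simp: chain_adj)
  qed
  fix v show "\<not> adj \<Gamma> v v" using pg_irrefl[OF pgC] by (cases v) (auto simp: chain_adj)
qed

lemma port_verts: "P - w \<le> q \<Longrightarrow> q \<le> m * P + w \<Longrightarrow> (q, port P s q) \<in> pverts \<Gamma> \<and> (q, port P t q) \<in> pverts \<Gamma>"
  using st by (simp add: verts port_def)

lemma conn: "conn_graph \<Gamma>"
proof (rule conn_graphI[OF pg])
  let ?r = "(P - w, port P s (P - w))"
  have mP: "P - w \<le> m * P + w" using m1 by (cases m) auto
  then show "?r \<in> pverts \<Gamma>" using port_verts by blast
  have core: "((q, c), (q, c')) \<in> (parcs \<Gamma>)\<^sup>*" if "(q, c) \<in> pverts \<Gamma>" "(q, c') \<in> pverts \<Gamma>" for q c c'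
  proof (cases "P dvd q")
    case True
    have "(c, c') \<in> (parcs C)\<^sup>*" using that True C by (simp add: verts conn_graph_iff)
    then show ?thesis
    proof (induction rule: rtrancl_induct)
      case (step y z)
      then have "adj \<Gamma> (q, y) (q, z)" using True that pg_verts[OF pgC] by (auto simp: chain_adj verts)
      then show ?case using step.IH by (meson rtrancl.rtrancl_into_rtrancl)
    qed simp
  next
    case False
    then show ?thesis using that by (simp add: verts)
  qed
  have "(?r, (q, port P s q)) \<in> (parcs \<Gamma>)\<^sup>*" if "P - w \<le> q" "q \<le> m * P + w" for q
    using that
  proof (induction q rule: dec_induct)
    case (step q)
    have 1: "((q, port P s q), (q, port P t q)) \<in> (parcs \<Gamma>)\<^sup>*"
      using core port_verts step by simp
    have 2: "adj \<Gamma> (q, port P t q) (Suc q, port P s (Suc q))"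
      using port_verts[of q] port_verts[of "Suc q"] step by (simp add: chain_adj)
    from step have "(?r, (q, port P s q)) \<in> (parcs \<Gamma>)\<^sup>*" by simp
    then show ?case using 1 2 by (meson rtrancl_trans rtrancl.rtrancl_into_rtrancl)
  qed simp
  then have *: "(?r, (q, port P s q)) \<in> (parcs \<Gamma>)\<^sup>*" if "P - w \<le> q" "q \<le> m * P + w" for q
    using that by blast
  fix v assume v: "v \<in> pverts \<Gamma>"
  obtain q c where qc: "v = (q, c)" by (cases v)
  then have r: "P - w \<le> q" "q \<le> m * P + w" using v by (auto simp: verts)
  show "(?r, v) \<in> (parcs \<Gamma>)\<^sup>*"
    using *[OF r] core[of q "port P s q" c] port_verts[OF r] v unfolding qc by (meson rtrancl_trans)
qed

text \<open>
  Inside each core, \<open>IC\<close> is an independent set with neighbourhood \<open>SC\<close>. If \<open>IC\<close> has one element more than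
  \<open>SC\<close>, the cores alone account for the deficiency. If the sizes agree and the terminals belong to \<open>SC\<close>,
  the vertices between two cores are added alternately to \<open>I\<close> and \<open>S\<close>; as the period is even, each such
  stretch starts and ends in \<open>I\<close> and gains one.
\<close>

lemma deficient:
  assumes IS: "IC \<subseteq> pverts C" "SC \<subseteq> pverts C" "IC \<inter> SC = {}" "\<And>c c'. c \<in> IC \<Longrightarrow> adj C c c' \<Longrightarrow> c' \<in> SC"
    and stI: "s \<notin> IC" "t \<notin> IC" and e: "even P"
    and cd: "card IC = Suc (card SC) \<or> (card IC = card SC \<and> s \<in> SC \<and> t \<in> SC)"
  shows "\<exists>I S. I \<subseteq> pverts \<Gamma> \<and> S \<subseteq> pverts \<Gamma> \<and> I \<inter> S = {} \<and> (\<forall>u\<in>I. \<forall>v. adj \<Gamma> u v \<longrightarrow> v \<in> S) \<and>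
     card S + (m - 1) \<le> card I"
proof -
  have P2: "2 \<le> P" using wP by simp
  define cores where "cores A = (\<lambda>(i, c). (i * P, c)) ` ({1..m} \<times> A)" for A :: "nat set"
  have inj: "inj_on (\<lambda>(i, c). (i * P, c)) ({1..m} \<times> A)" for A :: "nat set"
    using P2 by (auto simp: inj_on_def)
  have ccard: "card (cores A) = m * card A" for A
    unfolding cores_def using card_image[OF inj[of A]] by (simp add: card_cartesian_product)
  have csub: "cores A \<subseteq> pverts \<Gamma>" if "A \<subseteq> pverts C" for A
  proof
    fix v assume "v \<in> cores A"
    then obtain i c where ic: "1 \<le> i" "i \<le> m" "c \<in> A" "v = (i * P, c)" by (auto simp: cores_def)
    have "P \<le> i * P" "i * P \<le> m * P" using ic by simp_all
    then have "P - w \<le> i * P" "i * P \<le> m * P + w" by linarith+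
    moreover have "c \<in> pverts C" using ic(3) that by blast
    ultimately show "v \<in> pverts \<Gamma>" by (simp add: ic(4) verts)
  qed
  have cmem: "(q, c) \<in> cores A \<longleftrightarrow> P dvd q \<and> 1 \<le> q \<and> q \<le> m * P \<and> c \<in> A" for q c A
  proof
    assume "(q, c) \<in> cores A"
    then show "P dvd q \<and> 1 \<le> q \<and> q \<le> m * P \<and> c \<in> A" using P2 by (auto simp: cores_def)
  next
    assume r: "P dvd q \<and> 1 \<le> q \<and> q \<le> m * P \<and> c \<in> A"
    then obtain i where i: "q = i * P" by (metis dvd_div_mult_self)
    then have "1 \<le> i" "i \<le> m" using r P2 by (auto simp: Suc_leI intro: gr0I)
    then show "(q, c) \<in> cores A" using r i by (force simp: cores_def)
  qed
  have cq: "q \<le> m * P" "1 \<le> q" if "(q, c) \<in> pverts \<Gamma>" "P dvd q" for q c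
  proof -
    from that obtain i where i: "q = i * P" by (metis dvd_div_mult_self)
    have "i * P < (m + 1) * P" using that wP i by (simp add: verts)
    then have "i < m + 1" by (simp only: mult_less_cancel2)
    then show "q \<le> m * P" using i by simp
    have "P - w \<le> q" using that by (simp add: verts)
    then show "1 \<le> q" using wP by linarith
  qed
  from cd show ?thesis
  proof
    assume c1: "card IC = Suc (card SC)"
    show ?thesis
    proof (rule exI[of _ "cores IC"], rule exI[of _ "cores SC"], intro conjI ballI allI impI)
      show "cores IC \<inter> cores SC = {}" using IS(3) by (auto simp: cmem)
      fix u v assume u: "u \<in> cores IC" and a: "adj \<Gamma> u v"
      obtain q c q' c' where uv: "u = (q, c)" "v = (q', c')" by (cases u; cases v)
      have qc: "P dvd q" "c \<in> IC" using u by (auto simp: uv cmem)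
      then have "q' = q \<and> adj C c c'" using a stI unfolding uv chain_adj by (auto simp: port_def)
      then show "v \<in> cores SC" using u IS(4) by (auto simp: uv cmem)
    next
      show "card (cores SC) + (m - 1) \<le> card (cores IC)" by (simp add: ccard c1)
    qed (use csub IS in auto)
  next
    assume c2: "card IC = card SC \<and> s \<in> SC \<and> t \<in> SC"
    define Od where "Od = {q. P \<le> q \<and> q \<le> m * P \<and> odd q}"
    define Ev where "Ev = {q. P \<le> q \<and> q \<le> m * P \<and> even q \<and> \<not> P dvd q}"
    define I where "I = cores IC \<union> Od \<times> {0}"
    define S where "S = cores SC \<union> Ev \<times> {0}"
    have odn: "\<not> P dvd q" if "odd q" for q using that e by (meson dvd_trans)
    have fin: "finite Od" "finite Ev" by (auto simp: Od_def Ev_def)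
    have fC: "finite IC" "finite SC" using IS pgC finite_subset by (auto simp: pair_graph_iff)
    then have fc: "finite (cores IC)" "finite (cores SC)" by (auto simp: cores_def)
    have disj: "cores A \<inter> Od \<times> {0} = {}" "cores A \<inter> Ev \<times> {0} = {}" for A
      using odn by (auto simp: cmem Od_def Ev_def)
    have cI: "card I = m * card IC + card Od" "card S = m * card SC + card Ev"
      unfolding I_def S_def using fc fin disj by (simp_all add: card_Un_disjoint ccard card_cartesian_product)
    have "card Ev + (m - 1) \<le> card Od"
    proof -
      \<comment> \<open>each stretch begins with an odd position that does not follow an element of \<open>Ev\<close>\<close>
      let ?B = "(\<lambda>i. i * P + 1) ` {1..m - 1}"
      have iB: "inj_on (\<lambda>i. i * P + 1) {1..m - 1}" using P2 by (auto simp: inj_on_def)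
      have "?B \<subseteq> Od"
      proof
        fix q assume "q \<in> ?B"
        then obtain i where i: "1 \<le> i" "i \<le> m - 1" "q = i * P + 1" by auto
        have "(i + 1) * P \<le> m * P" using i m1 by (intro mult_right_mono) auto
        then have "q \<le> m * P" using P2 i(3) by (simp add: add_mult_distrib)
        moreover have "P \<le> i * P" using i by simp
        then have "P \<le> q" unfolding i(3) by linarith
        moreover have "odd q" using e i by simp
        ultimately show "q \<in> Od" unfolding Od_def mem_Collect_eq by blast
      qed
      moreover have "Suc ` Ev \<subseteq> Od"
      proof
        fix q assume "q \<in> Suc ` Ev"
        then obtain q' where q': "q = Suc q'" "P \<le> q'" "q' \<le> m * P" "even q'" "\<not> P dvd q'" by (auto simp: Ev_def)
        then have "q' \<noteq> m * P" by auto
        then show "q \<in> Od" using q' by (simp add: Od_def)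
      qed
      moreover have "Suc ` Ev \<inter> ?B = {}" by (auto simp: Ev_def)
      moreover have "card (Suc ` Ev) = card Ev" by (simp add: card_image)
      moreover have "card ?B = m - 1" using card_image[OF iB] by simp
      ultimately show ?thesis
        using card_mono[OF fin(1), of "Suc ` Ev \<union> ?B"] fin by (simp add: card_Un_disjoint)
    qed
    then have "card S + (m - 1) \<le> card I" using cI c2 by simp
    moreover have "I \<inter> S = {}"
      using IS(3) odn by (auto simp: I_def S_def cmem Od_def Ev_def)
    moreover have "I \<subseteq> pverts \<Gamma>" "S \<subseteq> pverts \<Gamma>"
      using csub[OF IS(1)] csub[OF IS(2)] odn by (auto simp: I_def S_def Od_def Ev_def verts)
    moreover have "\<forall>u\<in>I. \<forall>v. adj \<Gamma> u v \<longrightarrow> v \<in> S"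
    proof (intro ballI allI impI)
      fix u v assume u: "u \<in> I" and a: "adj \<Gamma> u v"
      obtain q c q' c' where uv: "u = (q, c)" "v = (q', c')" by (cases u; cases v)
      from u consider "(q, c) \<in> cores IC" | "q \<in> Od" "c = 0" unfolding I_def uv by blast
      then show "v \<in> S"
      proof cases
        case 1
        then have qc: "P dvd q" "c \<in> IC" by (auto simp: cmem)
        then have "q' = q \<and> adj C c c'" using a stI unfolding uv chain_adj by (auto simp: port_def)
        then show ?thesis using 1 IS(4) by (auto simp: uv cmem S_def)
      next
        case 2
        then have q: "odd q" "P \<le> q" "q \<le> m * P" "\<not> P dvd q" using odn by (auto simp: Od_def)
        have q': "q' = Suc q \<and> c' = port P s q' \<or> q = Suc q' \<and> c' = port P t q'" and vV: "(q', c') \<in> pverts \<Gamma>"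
          using a q(4) unfolding uv chain_adj by auto
        have ev: "even q'" using q' q(1) by auto
        have "q \<noteq> P" "q \<noteq> m * P" using q(4) by auto
        then have r: "P \<le> q'" "q' \<le> m * P" using q' q by auto
        show ?thesis
        proof (cases "P dvd q'")
          case True
          then have "c' \<in> SC" using q' c2 by (auto simp: port_def)
          then show ?thesis using True r P2 by (simp add: S_def uv cmem)
        next
          case False
          then have "c' = 0" using q' by (auto simp: port_def)
          then show ?thesis using False r ev by (simp add: S_def uv Ev_def)
        qed
      qed
    qed
    ultimately show ?thesis by - (rule exI[of _ I], rule exI[of _ S], simp)
  qed
qed

definition window :: "nat \<Rightarrow> (nat \<times> nat) set" where
  "window i = {v \<in> pverts \<Gamma>. i * P - w \<le> fst v \<and> fst v \<le> i * P + w}"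

lemma fst_lip: "adj \<Gamma> u v \<Longrightarrow> fst v \<le> Suc (fst u)"
  by (cases u; cases v) (auto simp: chain_adj)

text \<open>
  A connected graph spans fewer positions than it has vertices. Its rightmost position lies in the window
  of a first core \<open>i\<close>, beyond the window of core \<open>i - 1\<close>, and windows of consecutive cores overlap enough.
\<close>

lemma emb_in_window:
  assumes H: "conn_graph H" and f: "emb H \<Gamma> f" and h: "P + card (pverts H) \<le> 2 * w"
  shows "\<exists>i. 1 \<le> i \<and> i \<le> m \<and> f ` pverts H \<subseteq> window i"
proof -
  have fV: "f x \<in> pverts \<Gamma>" if "x \<in> pverts H" for x using f that by (auto simp: emb_def)
  have lip: "fst (f v) \<le> Suc (fst (f u))" if "adj H u v" for u v
  proof -
    have "u \<in> pverts H" "v \<in> pverts H" using pg_verts[of H u v] H that by (auto simp: conn_graph_iff)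
    then have "adj \<Gamma> (f u) (f v)" using f that by (simp add: emb_def)
    then show ?thesis by (rule fst_lip)
  qed
  have fin: "finite (pverts H)" "pverts H \<noteq> {}" using H by (auto simp: conn_graph_iff pair_graph_iff)
  define b where "b = Max ((\<lambda>x. fst (f x)) ` pverts H)"
  have "b \<in> (\<lambda>x. fst (f x)) ` pverts H" unfolding b_def using fin by (intro Max_in) auto
  then obtain x where x: "x \<in> pverts H" "b = fst (f x)" by blast
  have ub: "fst (f y) \<le> b" if "y \<in> pverts H" for y unfolding b_def using fin that by (intro Max_ge) auto
  have lb: "b < fst (f y) + card (pverts H)" if "y \<in> pverts H" for y
    using conn_span[OF H, of "\<lambda>x. fst (f x)" y x] lip that x by simp
  have lo: "P - w \<le> fst (f y)" if "y \<in> pverts H" for y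
    using fV[OF that] by (cases "f y") (simp add: verts)
  have bm: "b \<le> m * P + w" using fV[OF x(1)] unfolding x(2) by (cases "f x") (simp add: verts)
  define i where "i = (LEAST i. 1 \<le> i \<and> b \<le> i * P + w)"
  have i: "1 \<le> i" "b \<le> i * P + w" "i \<le> m"
    using LeastI[of "\<lambda>i. 1 \<le> i \<and> b \<le> i * P + w" m] Least_le[of "\<lambda>i. 1 \<le> i \<and> b \<le> i * P + w" m] m1 bm
    unfolding i_def by auto
  have "i * P - w \<le> fst (f y)" if y: "y \<in> pverts H" for y
  proof (cases "i = 1")
    case True
    then show ?thesis using lo[OF y] by simp
  next
    case False
    then have "1 \<le> i - 1" using i by simp
    moreover have "\<not> (1 \<le> i - 1 \<and> b \<le> (i - 1) * P + w)"
      using not_less_Least[of "i - 1" "\<lambda>i. 1 \<le> i \<and> b \<le> i * P + w"] i(1) unfolding i_def by simp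
    ultimately have "(i - 1) * P + w < b" by simp
    moreover have "(i - 1) * P + P = i * P" using i(1) by (cases i) auto
    ultimately show ?thesis using lb[OF y] h by simp
  qed
  then have "f ` pverts H \<subseteq> window i" using ub i(2) fV by (force simp: window_def)
  then show ?thesis using i by blast
qed

definition right :: "nat \<Rightarrow> (nat \<times> nat) list" where
  "right i = map (\<lambda>k. (i * P + Suc k, 0)) [0..<w]"

definition left :: "nat \<Rightarrow> (nat \<times> nat) list" where
  "left i = map (\<lambda>k. (i * P - Suc k, 0)) [0..<w]"

lemma ndvd: "1 \<le> k \<Longrightarrow> k \<le> w \<Longrightarrow> \<not> P dvd (i * P + k)" "1 \<le> i \<Longrightarrow> 1 \<le> k \<Longrightarrow> k \<le> w \<Longrightarrow> \<not> P dvd (i * P - k)"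
proof -
  assume k: "1 \<le> k" "k \<le> w"
  have nk: "\<not> P dvd k" using k wP by (simp add: nat_dvd_not_less)
  then show "\<not> P dvd (i * P + k)" by (simp add: dvd_add_right_iff)
  assume "1 \<le> i"
  then have "k \<le> i * P" using k wP by (cases i) auto
  then show "\<not> P dvd (i * P - k)" using nk by (metis dvd_triv_right dvd_diffD1)
qed

lemma window_range:
  assumes i: "1 \<le> i" "i \<le> m" and k: "k \<le> w"
  shows "P - w \<le> i * P + k" "i * P + k \<le> m * P + w" "P - w \<le> i * P - k" "i * P - k \<le> m * P + w" "w < i * P"
proof -
  have "P \<le> i * P" "i * P \<le> m * P" using i by simp_all
  then show "P - w \<le> i * P + k" "i * P + k \<le> m * P + w" "P - w \<le> i * P - k" "i * P - k \<le> m * P + w" "w < i * P"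
    using k wP by linarith+
qed

lemma right_verts: "1 \<le> i \<Longrightarrow> i \<le> m \<Longrightarrow> k < w \<Longrightarrow> (i * P + Suc k, 0) \<in> pverts \<Gamma>"
  using window_range[of i "Suc k"] ndvd(1)[of "Suc k" i] by (simp add: verts)

lemma left_verts: "1 \<le> i \<Longrightarrow> i \<le> m \<Longrightarrow> k < w \<Longrightarrow> (i * P - Suc k, 0) \<in> pverts \<Gamma>"
  using window_range[of i "Suc k"] ndvd(2)[of i "Suc k"] by (simp add: verts)

lemma core_verts: "1 \<le> i \<Longrightarrow> i \<le> m \<Longrightarrow> c \<in> pverts C \<Longrightarrow> (i * P, c) \<in> pverts \<Gamma>"
  using window_range[of i 0] by (simp add: verts)

lemma core_adj: "1 \<le> i \<Longrightarrow> i \<le> m \<Longrightarrow> c \<in> pverts C \<Longrightarrow> c' \<in> pverts C \<Longrightarrow> adj \<Gamma> (i * P, c) (i * P, c') \<longleftrightarrow> adj C c c'"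
  by (simp add: chain_adj core_verts)

lemma right_ipath:
  assumes i: "1 \<le> i" "i \<le> m" shows "ipath \<Gamma> ((i * P, t) # right i)"
proof -
  have r: "ipath \<Gamma> (right i)"
    unfolding right_def
  proof (rule ipath_map)
    fix k l assume kl: "k < l" "l < w"
    have "adj \<Gamma> (i * P + Suc k, 0) (i * P + Suc l, 0) \<longleftrightarrow> l = Suc k"
      unfolding chain_adj using right_verts[OF i] kl ndvd(1)[of "Suc k" i] ndvd(1)[of "Suc l" i]
      by (auto simp: port_def simp del: add_Suc_right)
    then show "(i * P + Suc k, 0) \<noteq> (i * P + Suc l, 0) \<and> (adj \<Gamma> (i * P + Suc k, 0) (i * P + Suc l, 0) \<longleftrightarrow> l = Suc k)"
      using kl by simp
  qed (use right_verts[OF i] in simp)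
  have hd: "right i = (i * P + 1, 0) # map (\<lambda>k. (i * P + Suc (Suc k), 0)) [0..<w - 1]"
    unfolding right_def using wP(1) by (intro nth_equalityI) (auto simp: nth_Cons split: nat.split)
  have a: "adj \<Gamma> (i * P, t) (i * P + 1, 0)"
    unfolding chain_adj using core_verts[OF i st(2)] right_verts[OF i, of 0] wP ndvd(1)[of 1 i] by (auto simp: port_def)
  have "\<not> adj \<Gamma> (i * P, t) (i * P + Suc (Suc k), 0)" for k by (simp add: chain_adj)
  then have "anti \<Gamma> {(i * P, t)} (set (tl (right i)))" unfolding hd by (auto simp: anti_def)
  then show ?thesis
    unfolding ipath_Cons using r a core_verts[OF i st(2)] by (simp add: hd)
qed

lemma left_ipath:
  assumes i: "1 \<le> i" "i \<le> m" shows "ipath \<Gamma> ((i * P, s) # left i)"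
proof -
  have wi: "w < i * P" using window_range(5)[OF i le0] .
  have r: "ipath \<Gamma> (left i)"
    unfolding left_def
  proof (rule ipath_map)
    fix k l assume kl: "k < l" "l < w"
    have "adj \<Gamma> (i * P - Suc k, 0) (i * P - Suc l, 0) \<longleftrightarrow> l = Suc k"
      unfolding chain_adj using left_verts[OF i] kl wi ndvd(2)[OF i(1), of "Suc k"] ndvd(2)[OF i(1), of "Suc l"]
      by (auto simp: port_def)
    then show "(i * P - Suc k, 0) \<noteq> (i * P - Suc l, 0) \<and> (adj \<Gamma> (i * P - Suc k, 0) (i * P - Suc l, 0) \<longleftrightarrow> l = Suc k)"
      using kl wi by simp
  qed (use left_verts[OF i] in simp)
  have hd: "left i = (i * P - 1, 0) # map (\<lambda>k. (i * P - Suc (Suc k), 0)) [0..<w - 1]"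
    unfolding left_def using wP(1) by (intro nth_equalityI) (auto simp: nth_Cons split: nat.split)
  have a: "adj \<Gamma> (i * P, s) (i * P - 1, 0)"
    unfolding chain_adj using core_verts[OF i st(1)] left_verts[OF i, of 0] wP wi ndvd(2)[OF i(1), of 1] by (auto simp: port_def)
  have "\<not> adj \<Gamma> (i * P, s) (i * P - Suc (Suc k), 0)" if "k < w - 1" for k using that wi by (auto simp: chain_adj)
  moreover have "i * P \<noteq> i * P - Suc (Suc k)" for k using wi by simp
  ultimately have "anti \<Gamma> {(i * P, s)} (set (tl (left i)))" unfolding hd by (auto simp: anti_def)
  moreover have "i * P \<noteq> i * P - Suc 0" using wi by linarith
  ultimately show ?thesis
    unfolding ipath_Cons using r a core_verts[OF i st(1)] wi by (simp add: hd)
qed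

lemma right_anti_core: "c \<noteq> t \<Longrightarrow> anti \<Gamma> {(i * P, c)} (set (right i))"
  by (auto simp: anti_def right_def chain_adj port_def)

lemma left_anti_core:
  assumes i: "1 \<le> i" "i \<le> m" and c: "c \<noteq> s" shows "anti \<Gamma> {(i * P, c)} (set (left i))"
  using window_range(5)[OF i le0] c by (auto simp: anti_def left_def chain_adj port_def)

lemma left_anti_right:
  assumes i: "1 \<le> i" "i \<le> m" shows "anti \<Gamma> (set (left i)) (set (right i))"
  using window_range(5)[OF i le0] by (auto simp: anti_def left_def right_def chain_adj)

text \<open>
  The window of a core is the core with two paths attached at its terminals.
\<close>

lemma window_eq:
  assumes i: "1 \<le> i" "i \<le> m"
  shows "window i \<subseteq> (\<lambda>c. (i * P, c)) ` pverts C \<union> set (left i) \<union> set (right i)"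
proof
  fix v assume v: "v \<in> window i"
  obtain q c where qc: "v = (q, c)" by (cases v)
  have r: "i * P - w \<le> q" "q \<le> i * P + w" and V: "(q, c) \<in> pverts \<Gamma>" using v by (auto simp: window_def qc)
  consider "q = i * P" | "i * P < q" | "q < i * P" by linarith
  then show "v \<in> (\<lambda>c. (i * P, c)) ` pverts C \<union> set (left i) \<union> set (right i)"
  proof cases
    case 1
    then show ?thesis using V by (auto simp: verts qc)
  next
    case 2
    define k where "k = q - i * P - 1"
    have k: "q = i * P + Suc k" "k < w" using 2 r by (auto simp: k_def)
    then have "c = 0" using V ndvd(1)[of "Suc k" i] by (simp add: verts)
    then show ?thesis using k qc by (auto simp: right_def)
  next
    case 3
    define k where "k = i * P - q - 1"
    have k: "q = i * P - Suc k" "k < w" using 3 r by (auto simp: k_def)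
    then have "c = 0" using V ndvd(2)[OF i(1), of "Suc k"] by (simp add: verts)
    then show ?thesis using k qc by (auto simp: left_def)
  qed
qed

lemma lengths [simp]: "length (left i) = w" "length (right i) = w"
  by (simp_all add: left_def right_def)

end

section \<open>Cores with attached paths\<close>

lemma ipath_join:
  assumes G: "pair_graph G" and l: "ipath G (c # ls)" and r: "ipath G (c # rs)" and a: "anti G (set ls) (set rs)"
  shows "ipath G (rev ls @ c # rs)"
proof (cases ls)
  case Nil
  then show ?thesis using r by simp
next
  case (Cons x xs)
  have il: "ipath G (rev ls)" using ipath_rev[OF G, of ls] l by (simp add: ipath_Cons)
  have x: "adj G x c" "x \<noteq> c" "anti G (set xs) {c}"
    using l pg_sym[OF G] anti_sym[OF G, of "{c}" "set xs"] by (auto simp: ipath_Cons Cons)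
  have "anti G (set xs) (set (c # rs))" using x(3) a by (auto simp: anti_def Cons)
  moreover have "anti G {x} (set rs)" using a by (auto simp: anti_def Cons)
  ultimately have "ipath G ((rev xs @ [x]) @ (c # rs))"
    using il r x by (subst ipath_append) (simp_all add: Cons)
  then show ?thesis by (simp add: Cons)
qed

context chain_setting
begin

lemma hit:
  assumes F: "forces \<H> b" and b: "b \<le> real (m - 1)" and h: "\<forall>H\<in>\<H>. P + card (pverts H) \<le> 2 * w"
    and IS: "IC \<subseteq> pverts C" "SC \<subseteq> pverts C" "IC \<inter> SC = {}" "\<And>c c'. c \<in> IC \<Longrightarrow> adj C c c' \<Longrightarrow> c' \<in> SC"
    and stI: "s \<notin> IC" "t \<notin> IC" and e: "even P"
    and cd: "card IC = Suc (card SC) \<or> (card IC = card SC \<and> s \<in> SC \<and> t \<in> SC)"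
  shows "\<exists>H\<in>\<H>. \<exists>f i. emb H \<Gamma> f \<and> 1 \<le> i \<and> i \<le> m \<and>
     f ` pverts H \<subseteq> Pair (i * P) ` pverts C \<union> set (left i) \<union> set (right i)"
proof -
  have "\<exists>I S. I \<subseteq> pverts \<Gamma> \<and> S \<subseteq> pverts \<Gamma> \<and> I \<inter> S = {} \<and> (\<forall>u\<in>I. \<forall>v. adj \<Gamma> u v \<longrightarrow> v \<in> S) \<and>
     card S + (m - 1) \<le> card I"
    by (rule deficient[OF IS(1-3) _ stI e cd]) (rule IS(4))
  then obtain I S where S: "I \<subseteq> pverts \<Gamma>" "S \<subseteq> pverts \<Gamma>" "I \<inter> S = {}"
    "\<forall>u\<in>I. \<forall>v. adj \<Gamma> u v \<longrightarrow> v \<in> S" "card S + (m - 1) \<le> card I"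
    by (elim exE conjE)
  have "b + real (card S) \<le> real (card I)" using S(5) b by linarith
  moreover have "v \<in> S" if "u \<in> I" "adj \<Gamma> u v" for u v using S(4) that by blast
  ultimately have "\<exists>H\<in>\<H>. \<exists>f. emb H \<Gamma> f" by (intro forces_hit[OF F conn S(1-3)])
  then obtain H f where H: "H \<in> \<H>" "emb H \<Gamma> f" by blast
  have cH: "conn_graph H" using F H(1) by (simp add: forces_def)
  obtain i where i: "1 \<le> i" "i \<le> m" "f ` pverts H \<subseteq> window i"
    using emb_in_window[OF cH H(2)] h H(1) by blast
  then have "f ` pverts H \<subseteq> Pair (i * P) ` pverts C \<union> set (left i) \<union> set (right i)"
    using window_eq[OF i(1,2)] by (meson subset_trans)
  then show ?thesis using H i by blast
qed

lemma ipath_core: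
  assumes i: "1 \<le> i" "i \<le> m" and p: "ipath C xs"
  shows "ipath \<Gamma> (map (Pair (i * P)) xs)"
  unfolding ipath_def
proof (intro conjI allI impI)
  show "distinct (map (Pair (i * P)) xs)" using p by (simp add: ipath_def distinct_map inj_on_def)
  show "set (map (Pair (i * P)) xs) \<subseteq> pverts \<Gamma>" using p core_verts[OF i] by (auto simp: ipath_def)
  fix k l assume kl: "k < l \<and> l < length (map (Pair (i * P)) xs)"
  then have "xs ! k \<in> pverts C" "xs ! l \<in> pverts C" using p by (auto simp: ipath_def)
  then show "adj \<Gamma> (map (Pair (i * P)) xs ! k) (map (Pair (i * P)) xs ! l) \<longleftrightarrow> l = Suc k"
    using kl p core_adj[OF i] by (simp add: ipath_def)
qed

lemma fork_core:
  assumes i: "1 \<le> i" "i \<le> m" and f: "fork C ws a b"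
  shows "fork \<Gamma> (map (Pair (i * P)) ws) (i * P, a) (i * P, b)"
proof -
  have "a \<in> pverts C" "b \<in> pverts C" using f by (auto simp: fork_def ipath_def)
  then show ?thesis
    using f ipath_core[OF i, of "ws @ [a]"] ipath_core[OF i, of "ws @ [b]"] core_adj[OF i] by (simp add: fork_def)
qed

lemma anti_core:
  assumes i: "1 \<le> i" "i \<le> m" and a: "anti C A B" and AB: "A \<subseteq> pverts C" "B \<subseteq> pverts C"
  shows "anti \<Gamma> (Pair (i * P) ` A) (Pair (i * P) ` B)"
  unfolding anti_def
proof (intro ballI)
  fix u v assume "u \<in> Pair (i * P) ` A" "v \<in> Pair (i * P) ` B"
  then obtain c c' where c: "c \<in> A" "c' \<in> B" "u = (i * P, c)" "v = (i * P, c')" by blast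
  then show "u \<noteq> v \<and> \<not> adj \<Gamma> u v"
    using a AB core_adj[OF i, of c c'] by (auto simp: anti_def subset_iff)
qed

lemma core_anti_left:
  assumes i: "1 \<le> i" "i \<le> m" and s: "s \<notin> A" shows "anti \<Gamma> (Pair (i * P) ` A) (set (left i))"
proof -
  have "anti \<Gamma> {(i * P, c)} (set (left i))" if "c \<in> A" for c
    by (rule left_anti_core[OF i]) (use that s in auto)
  then show ?thesis unfolding anti_def by blast
qed

lemma core_anti_right:
  assumes s: "t \<notin> A" shows "anti \<Gamma> (Pair (i * P) ` A) (set (right i))"
proof -
  have "anti \<Gamma> {(i * P, c)} (set (right i))" if "c \<in> A" for c
    by (rule right_anti_core) (use that s in auto)
  then show ?thesis unfolding anti_def by blast
qed

end

section \<open>Chains for the individual patterns\<close>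

text \<open>
  For the constant \<open>b\<close> and the sizes of the members of \<open>\<H>\<close>, the parameter \<open>N\<close> is chosen large. The same
  \<open>N\<close> also serves as the number of cores in the chains, whose period is \<open>N + 2\<close>.
\<close>

locale forcing_family =
  fixes \<H> :: "ngraph set" and b :: real and N :: nat
  assumes F: "forces \<H> b" and e: "even N" and b: "b + 1 \<le> real N"
    and h: "\<forall>H\<in>\<H>. card (pverts H) + 4 \<le> N" and N4: "4 \<le> N"
begin

lemma bN: "b \<le> real (N - 1)"
  using b N4 by simp

lemma emb_fits:
  assumes "emb H G f" "emb P G g" "f ` pverts H \<subseteq> g ` pverts P" shows "\<exists>h. emb H P h"
  using emb_pullback[OF assms(2,1,3)] .

lemma hits_F1: "\<exists>H\<in>\<H>. \<exists>h. emb H (F1_graph N) h"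
proof -
  let ?C = "path_graph 2"
  have C: "conn_graph ?C"
  proof (rule conn_graphI[OF pair_graph_path, of 0])
    fix v assume "v \<in> pverts ?C"
    moreover have "adj ?C 0 1" by (simp add: adj_path)
    ultimately show "(0, v) \<in> (parcs ?C)\<^sup>*" by (cases v) auto
  qed simp
  obtain P where P: "P = N + 2" by blast
  interpret chain_setting ?C 0 0 P N N
    by (rule chain_setting.intro) (use C N4 P in auto)
  have "\<exists>H\<in>\<H>. \<exists>f i. emb H \<Gamma> f \<and> 1 \<le> i \<and> i \<le> N \<and>
     f ` pverts H \<subseteq> Pair (i * P) ` pverts ?C \<union> set (left i) \<union> set (right i)"
  proof (rule hit[OF F bN, of "{1}" "{0}"])
    show "\<forall>H\<in>\<H>. P + card (pverts H) \<le> 2 * N" using h P by force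
  qed (use e P in \<open>auto simp: adj_path\<close>)
  then obtain H f i where H: "H \<in> \<H>" "emb H \<Gamma> f" and i: "1 \<le> i" "i \<le> N" and
     im: "f ` pverts H \<subseteq> Pair (i * P) ` pverts ?C \<union> set (left i) \<union> set (right i)" by blast
  have p: "ipath \<Gamma> (rev (left i) @ (i * P, 0) # right i)"
    by (rule ipath_join[OF pg left_ipath[OF i] right_ipath[OF i] left_anti_right[OF i]])
  have y: "adj \<Gamma> (i * P, 0) (i * P, 1)"
    using core_adj[OF i, of 0 1] by (simp add: adj_path)
  have a: "anti \<Gamma> {(i * P, 1)} (set (rev (left i)) \<union> set (right i))"
    using left_anti_core[OF i, of 1] right_anti_core[of 1 i] by (simp add: anti_Un)
  have "\<exists>g. emb (F1_graph N) \<Gamma> g \<and>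
     g ` pverts (F1_graph N) = {(i * P, 0), (i * P, 1)} \<union> set (rev (left i)) \<union> set (right i)"
    by (rule emb_F1[OF pg p _ _ y a]) simp_all
  then obtain g where g: "emb (F1_graph N) \<Gamma> g"
    "g ` pverts (F1_graph N) = {(i * P, 0), (i * P, 1)} \<union> set (rev (left i)) \<union> set (right i)"
    by (elim exE conjE)
  have "Pair (i * P) ` pverts ?C = {(i * P, 0), (i * P, 1)}"
    by (auto simp: image_iff less_2_cases_iff)
  then have "f ` pverts H \<subseteq> g ` pverts (F1_graph N)" using im unfolding g(2) set_rev by simp
  then show ?thesis using emb_fits[OF H(2) g(1)] H(1) by blast
qed

text \<open>
  \<open>F\<^sup>3\<close> and \<open>F\<^sup>4\<close> at once: the core is a four-cycle, with the chord between the terminals if \<open>\<phi>\<close>.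
\<close>

lemma hits_C4:
  assumes C: "conn_graph C" and V: "pverts C = {0, 1, 2, 3}"
    and E: "\<And>u v. adj C u v \<longleftrightarrow> adj (cycle_graph 4) u v \<or> \<phi> \<and> (u, v) \<in> {(0, 2), (2, 0)}"
  shows "\<exists>H\<in>\<H>. \<exists>h. emb H (if \<phi> then F4_graph N else F3_graph N) h"
proof -
  obtain P w where P: "P = N + 2" "N = Suc w" using N4 by (cases N) auto
  interpret chain_setting C 0 2 P w N
    by (rule chain_setting.intro) (use C V N4 P in auto)
  have "\<exists>H\<in>\<H>. \<exists>f i. emb H \<Gamma> f \<and> 1 \<le> i \<and> i \<le> N \<and>
     f ` pverts H \<subseteq> Pair (i * P) ` pverts C \<union> set (left i) \<union> set (right i)"
  proof (rule hit[OF F bN, of "{1, 3}" "{0, 2}"])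
    show "\<forall>H\<in>\<H>. P + card (pverts H) \<le> 2 * w" using h P by force
  qed (use e P in \<open>auto simp: E V adj_cycle4\<close>)
  then obtain H f i where H: "H \<in> \<H>" "emb H \<Gamma> f" and i: "1 \<le> i" "i \<le> N" and
     im: "f ` pverts H \<subseteq> Pair (i * P) ` pverts C \<union> set (left i) \<union> set (right i)" by blast
  define v where "v = (Pair (i * P) :: nat \<Rightarrow> nat \<times> nat)"
  have ad: "adj \<Gamma> (v c) (v c') \<longleftrightarrow> adj C c c'" if "c \<in> {0, 1, 2, 3}" "c' \<in> {0, 1, 2, 3}" for c c'
    unfolding v_def by (rule core_adj[OF i]) (use that V in auto)
  have c4: "adj \<Gamma> (v 0) (v 1)" "adj \<Gamma> (v 1) (v 2)" "adj \<Gamma> (v 2) (v 3)" "adj \<Gamma> (v 3) (v 0)"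
    "\<not> adj \<Gamma> (v 1) (v 3)" "adj \<Gamma> (v 0) (v 2) \<longleftrightarrow> \<phi>" "v 0 \<noteq> v 2" "v 1 \<noteq> v 3"
    by (simp_all add: ad E adj_cycle4) (simp_all add: v_def)
  have l: "N = Suc (length (left i))" "N = Suc (length (right i))" using P(2) by simp_all
  have an: "anti \<Gamma> {v 1, v 2, v 3} (set (left i))" "anti \<Gamma> {v 0, v 1, v 3} (set (right i))"
    using core_anti_left[OF i, of "{1, 2, 3}"] core_anti_right[of "{0, 1, 3}" i]
    unfolding v_def image_insert image_empty by (simp_all only: insert_iff) simp_all
  have li: "ipath \<Gamma> (v 0 # left i)" "ipath \<Gamma> (v 2 # right i)"
    unfolding v_def by (rule left_ipath[OF i], rule right_ipath[OF i])
  have "\<exists>g. emb (if \<phi> then F4_graph N else F3_graph N) \<Gamma> g \<and>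
     g ` pverts (if \<phi> then F4_graph N else F3_graph N) = {v 0, v 1, v 2, v 3} \<union> set (left i) \<union> set (right i)"
  proof (cases \<phi>)
    case True
    have "adj \<Gamma> (v 0) (v 2)" using True c4 by simp
    from emb_F4[OF pg c4(1-4) this c4(5,8) li l an left_anti_right[OF i]]
    show ?thesis using True by simp
  next
    case False
    have "\<not> adj \<Gamma> (v 0) (v 2)" using False c4 by simp
    from emb_F3[OF pg c4(1-4) this c4(5,7,8) li l an left_anti_right[OF i]]
    show ?thesis using False by auto
  qed
  then obtain g where g: "emb (if \<phi> then F4_graph N else F3_graph N) \<Gamma> g"
    "g ` pverts (if \<phi> then F4_graph N else F3_graph N) = {v 0, v 1, v 2, v 3} \<union> set (left i) \<union> set (right i)"
    by (elim exE conjE)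
  have "f ` pverts H \<subseteq> g ` pverts (if \<phi> then F4_graph N else F3_graph N)"
    using im unfolding g(2) V v_def image_insert image_empty .
  then show ?thesis using emb_fits[OF H(2) g(1)] H(1) by blast
qed

lemma conn_C4_chord: "conn_graph \<lparr>pverts = {0, 1, 2, 3}, parcs = parcs (cycle_graph 4) \<union> {e. \<phi> \<and> e \<in> {(0, 2), (2, 0)}}\<rparr>"
  (is "conn_graph ?C")
proof (rule conn_graphI[of _ 0])
  show "pair_graph ?C"
    using pair_graph_cycle4 unfolding pair_graph_iff by (auto simp: sym_def)
  fix v assume "v \<in> pverts ?C"
  then consider "v = 0" | "v = 1" | "v = 2" | "v = 3" by auto
  moreover have "(0, 1) \<in> (parcs ?C)\<^sup>*" "(0, 3) \<in> (parcs ?C)\<^sup>*" by (auto simp: adj_cycle4)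
  moreover have "adj ?C 1 2" by (simp add: adj_cycle4)
  ultimately show "(0, v) \<in> (parcs ?C)\<^sup>*" by cases (auto intro: rtrancl.rtrancl_into_rtrancl)
qed simp

lemma hits_F3: "\<exists>H\<in>\<H>. \<exists>h. emb H (F3_graph N) h"
  using hits_C4[OF conn_C4_chord[of False], of False] by simp

lemma hits_F4: "\<exists>H\<in>\<H>. \<exists>h. emb H (F4_graph N) h"
  using hits_C4[OF conn_C4_chord[of True], of True] by auto

end

text \<open>A stem \<open>0, \<dots>, p - 1\<close> with two leaves \<open>p\<close> and \<open>p + 1\<close> at \<open>p - 1\<close>.\<close>

definition stem_arc :: "nat \<Rightarrow> nat \<Rightarrow> nat \<Rightarrow> bool" where
  "stem_arc p k l \<longleftrightarrow> Suc k = l \<and> l \<le> p \<or> Suc k = p \<and> l = Suc p"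

lemma stem_fork:
  assumes p: "1 \<le> p" and V: "\<And>k. k < p + 2 \<Longrightarrow> g k \<in> pverts G" and inj: "inj g"
    and E: "\<And>k l. k < p + 2 \<Longrightarrow> l < p + 2 \<Longrightarrow> adj G (g k) (g l) \<longleftrightarrow> stem_arc p k l \<or> stem_arc p l k"
  shows "fork G (map g [0..<p]) (g p) (g (Suc p))"
proof -
  have "ipath G (map g [0..<Suc p])"
    by (rule ipath_map) (use p V E inj in \<open>auto simp: stem_arc_def inj_eq\<close>)
  then have 1: "ipath G (map g [0..<p] @ [g p])" by simp
  let ?f = "\<lambda>k. g (if k = p then Suc p else k)"
  have "ipath G (map ?f [0..<Suc p])"
    by (rule ipath_map) (use p V E inj in \<open>auto simp: stem_arc_def inj_eq\<close>)
  moreover have "map ?f [0..<p] = map g [0..<p]" by simp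
  ultimately have 2: "ipath G (map g [0..<p] @ [g (Suc p)])" by simp
  show ?thesis using 1 2 p E[of p "Suc p"] inj by (auto simp: fork_def stem_arc_def inj_eq)
qed

lemma stem_reach:
  assumes p: "1 \<le> p" and E: "\<And>k l. stem_arc p k l \<Longrightarrow> (g k, g l) \<in> R" and k: "k < p + 2"
  shows "(g 0, g k) \<in> R\<^sup>*"
proof -
  have s: "(g 0, g k) \<in> R\<^sup>*" if "k \<le> p" for k
    using that
  proof (induction k)
    case (Suc k)
    then have "(g k, g (Suc k)) \<in> R" by (intro E) (simp add: stem_arc_def)
    then show ?case using Suc by (auto intro: rtrancl.rtrancl_into_rtrancl)
  qed simp
  have "(g (p - 1), g (Suc p)) \<in> R" using p by (intro E) (simp add: stem_arc_def)
  then have "(g 0, g (Suc p)) \<in> R\<^sup>*" using s[of "p - 1"] by (auto intro: rtrancl.rtrancl_into_rtrancl)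
  moreover have "k \<le> p \<or> k = Suc p" using k by auto
  ultimately show ?thesis using s by blast
qed

text \<open>
  \<open>T\<^sub>p\<close> attached at the vertex \<open>0\<close> of the triangle \<open>0\<close>, \<open>p + 2\<close>, \<open>p + 3\<close>.
\<close>

definition tri_stem :: "nat \<Rightarrow> ngraph" where
  "tri_stem p = ugraph {..<p + 4} ({(k, l). stem_arc p k l} \<union> {(0, p + 2), (0, p + 3), (p + 2, p + 3)})"

lemma tri_stem_verts [simp]: "pverts (tri_stem p) = {..<p + 4}"
  by (simp add: tri_stem_def ugraph_def)

lemma tri_stem_adj: "adj (tri_stem p) k l \<longleftrightarrow> stem_arc p k l \<or> stem_arc p l k \<or>
    (k, l) \<in> {(0, p + 2), (0, p + 3), (p + 2, p + 3), (p + 2, 0), (p + 3, 0), (p + 3, p + 2)}"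
  unfolding tri_stem_def ugraph_def by auto

lemma tri_stem_conn:
  assumes p: "1 \<le> p" shows "conn_graph (tri_stem p)"
proof (rule conn_graphI[of _ 0])
  show "pair_graph (tri_stem p)"
    unfolding tri_stem_def by (rule pair_graph_ugraph) (auto simp: stem_arc_def)
  fix v assume "v \<in> pverts (tri_stem p)"
  then have "v < p + 2 \<or> v = p + 2 \<or> v = p + 3" by auto
  moreover have "(0, v) \<in> (parcs (tri_stem p))\<^sup>*" if "v < p + 2"
    using stem_reach[of p "\<lambda>k. k", OF p _ that] tri_stem_adj by blast
  moreover have "adj (tri_stem p) 0 (p + 2)" "adj (tri_stem p) 0 (p + 3)" by (simp_all add: tri_stem_adj)
  ultimately show "(0, v) \<in> (parcs (tri_stem p))\<^sup>*" by blast
qed simp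

lemma tri_stem_fork: "1 \<le> p \<Longrightarrow> fork (tri_stem p) [0..<p] p (Suc p)"
  using stem_fork[of p "\<lambda>k. k" "tri_stem p"] by (simp add: tri_stem_adj stem_arc_def)

context forcing_family
begin

lemma hits_tri_stem:
  assumes p: "1 \<le> p" and P: "P = N + 2" "N = Suc w"
  shows "\<exists>H\<in>\<H>. \<exists>f i. emb H (chain (tri_stem p) (p + 2) (p + 3) P w N) f \<and> 1 \<le> i \<and> i \<le> N \<and>
     f ` pverts H \<subseteq> Pair (i * P) ` {..<p + 4} \<union> set (chain_setting.left P w i) \<union> set (chain_setting.right P w i)"
proof -
  interpret chain_setting "tri_stem p" "p + 2" "p + 3" P w N
    by (rule chain_setting.intro) (use tri_stem_conn[OF p] N4 P in auto)
  show ?thesis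
  proof (rule hit[OF F bN, of "{p, Suc p}" "{p - 1}", unfolded tri_stem_verts])
    show "\<forall>H\<in>\<H>. P + card (pverts H) \<le> 2 * w" using h P by force
    show "c' \<in> {p - 1}" if "c \<in> {p, Suc p}" "adj (tri_stem p) c c'" for c c'
      using that p by (auto simp: tri_stem_adj stem_arc_def)
  qed (use e P p in auto)
qed

lemma hits_F_check:
  assumes p: "1 \<le> p" shows "\<exists>H\<in>\<H>. \<exists>h. emb H (F_check N p) h"
proof -
  obtain P w where P: "P = N + 2" "N = Suc w" using N4 by (cases N) auto
  interpret chain_setting "tri_stem p" "p + 2" "p + 3" P w N
    by (rule chain_setting.intro) (use tri_stem_conn[OF p] N4 P in auto)
  obtain H f i where H: "H \<in> \<H>" "emb H \<Gamma> f" and i: "1 \<le> i" "i \<le> N" and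
     im: "f ` pverts H \<subseteq> Pair (i * P) ` {..<p + 4} \<union> set (left i) \<union> set (right i)"
    using hits_tri_stem[OF p P] by blast
  define v where "v = (Pair (i * P) :: nat \<Rightarrow> nat \<times> nat)"
  have ad: "adj \<Gamma> (v c) (v c') \<longleftrightarrow> adj (tri_stem p) c c'" if "c < p + 4" "c' < p + 4" for c c'
    unfolding v_def by (rule core_adj[OF i]) (use that in auto)
  have t: "adj \<Gamma> (v 0) (v (p + 2))" "adj \<Gamma> (v (p + 2)) (v (p + 3))" "adj \<Gamma> (v 0) (v (p + 3))"
    by (subst ad, simp, simp, simp add: tri_stem_adj)+
  have up: "[0..<p] = 0 # [1..<p]" using p by (simp add: upt_conv_Cons)
  have fk: "fork \<Gamma> (v 0 # map v [1..<p]) (v p) (v (Suc p))"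
    using fork_core[OF i tri_stem_fork[OF p]] unfolding up v_def by simp
  have ips: "ipath \<Gamma> (v (p + 2) # left i)" "ipath \<Gamma> (v (p + 3) # right i)"
    unfolding v_def by (rule left_ipath[OF i], rule right_ipath[OF i])
  let ?S = "v ` ({1..<p} \<union> {p, Suc p})"
  have S: "?S = set (map v [1..<p]) \<union> {v p, v (Suc p)}" by auto
  have "anti (tri_stem p) {p + 2, p + 3} ({1..<p} \<union> {p, Suc p})"
    using p by (auto simp: anti_def tri_stem_adj stem_arc_def)
  then have "anti \<Gamma> (v ` {p + 2, p + 3}) ?S" unfolding v_def by (rule anti_core[OF i]) auto
  then have an: "anti \<Gamma> {v (p + 2), v (p + 3)} ?S" unfolding image_insert image_empty .
  have al: "anti \<Gamma> (v ` ({0, p + 3} \<union> ({1..<p} \<union> {p, Suc p}))) (set (left i))"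
    unfolding v_def by (rule core_anti_left[OF i]) auto
  have ar: "anti \<Gamma> (v ` ({0, p + 2} \<union> ({1..<p} \<union> {p, Suc p}))) (set (right i))"
    unfolding v_def by (rule core_anti_right) auto
  have "\<exists>g. emb (F_check N p) \<Gamma> g \<and>
     g ` pverts (F_check N p) = {v 0, v (p + 2), v (p + 3)} \<union> set (map v [1..<p]) \<union> {v p, v (Suc p)} \<union>
       set (left i) \<union> set (right i)"
  proof (rule emb_F_check[OF pg t fk _ ips])
    show "anti \<Gamma> {v (p + 2), v (p + 3)} (set (map v [1..<p]) \<union> {v p, v (Suc p)})" using an S by simp
    show "anti \<Gamma> ({v 0, v (p + 3)} \<union> set (map v [1..<p]) \<union> {v p, v (Suc p)}) (set (left i))"
      by (rule anti_mono[OF al]) auto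
    show "anti \<Gamma> ({v 0, v (p + 2)} \<union> set (map v [1..<p]) \<union> {v p, v (Suc p)}) (set (right i))"
      by (rule anti_mono[OF ar]) auto
  qed (use p P(2) left_anti_right[OF i] in auto)
  then obtain g where g: "emb (F_check N p) \<Gamma> g"
    "g ` pverts (F_check N p) = {v 0, v (p + 2), v (p + 3)} \<union> set (map v [1..<p]) \<union> {v p, v (Suc p)} \<union>
       set (left i) \<union> set (right i)" by (elim exE conjE)
  have "{..<p + 4} \<subseteq> {0, p + 2, p + 3} \<union> {1..<p} \<union> {p, Suc p}" by auto
  then have "v ` {..<p + 4} \<subseteq> v ` ({0, p + 2, p + 3} \<union> {1..<p} \<union> {p, Suc p})" by (rule image_mono)
  then have "v ` {..<p + 4} \<subseteq> g ` pverts (F_check N p)" by (rule subset_trans) (auto simp: g(2))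
  then have "v ` {..<p + 4} \<union> set (left i) \<union> set (right i) \<subseteq> g ` pverts (F_check N p)"
    unfolding g(2) by blast
  then have "f ` pverts H \<subseteq> g ` pverts (F_check N p)" using im[folded v_def] by (rule subset_trans[rotated])
  then show ?thesis using emb_fits[OF H(2) g(1)] H(1) by blast
qed

text \<open>
  The dichotomy behind the two alternatives of the theorem. If the stem at the triangle has length \<open>N\<close>,
  a connected graph of at most \<open>N - 4\<close> vertices in the window cannot meet both the triangle with its
  arms and the two leaves. Away from the leaves the window is \<open>F\<^sup>2\<close>, and away from the triangle it is
  \<open>T\<^sub>N\<close>.
\<close>

lemma hits_T_or_F2: "(\<exists>H\<in>\<H>. \<exists>h. emb H (T_graph N) h) \<or> (\<exists>H\<in>\<H>. \<exists>h. emb H (F2_graph N) h)"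
proof -
  obtain P w where P: "P = N + 2" "N = Suc w" using N4 by (cases N) auto
  have N1: "1 \<le> N" using N4 by simp
  interpret chain_setting "tri_stem N" "N + 2" "N + 3" P w N
    by (rule chain_setting.intro) (use tri_stem_conn[OF N1] N4 P in auto)
  obtain H f i where H: "H \<in> \<H>" "emb H \<Gamma> f" and i: "1 \<le> i" "i \<le> N" and
     im: "f ` pverts H \<subseteq> Pair (i * P) ` {..<N + 4} \<union> set (left i) \<union> set (right i)"
    using hits_tri_stem[OF N1 P] by blast
  define v where "v = (Pair (i * P) :: nat \<Rightarrow> nat \<times> nat)"
  have ad: "adj \<Gamma> (v c) (v c') \<longleftrightarrow> adj (tri_stem N) c c'" if "c < N + 4" "c' < N + 4" for c c'
    unfolding v_def by (rule core_adj[OF i]) (use that in auto)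
  have fk: "fork \<Gamma> (map v [0..<N]) (v N) (v (Suc N))"
    using fork_core[OF i tri_stem_fork[OF N1]] unfolding v_def by simp
  have cH: "conn_graph H" using F H(1) by (simp add: forces_def)
  \<comment> \<open>distance from the triangle along the stem of the \<open>i\<close>-th copy\<close>
  define \<rho> where "\<rho> u = (if fst u = i * P \<and> snd u \<le> Suc N then min N (snd u) else 0)" for u :: "nat \<times> nat"
  have stem: "min N c' \<le> Suc (min N c)" if "stem_arc N c c' \<or> stem_arc N c' c" for c c'
    using that unfolding stem_arc_def by auto
  have lip: "\<rho> y \<le> Suc (\<rho> x)" if a: "adj \<Gamma> x y" for x y
  proof -
    obtain q c q' c' where xy: "x = (q, c)" "y = (q', c')" by (cases x; cases y)
    show ?thesis
    proof (cases "q' = i * P \<and> c' \<le> Suc N \<and> c' \<noteq> 0")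
      case False
      then have "\<rho> y = 0" unfolding \<rho>_def xy by auto
      then show ?thesis by simp
    next
      case True
      then have "P dvd q'" by simp
      then have "q = q' \<and> adj (tri_stem N) c c'" using a True unfolding xy chain_adj port_def by auto
      moreover from this have sc: "stem_arc N c c' \<or> stem_arc N c' c" using True by (auto simp: tri_stem_adj)
      then have "c \<le> Suc N" by (auto simp: stem_arc_def)
      ultimately show ?thesis using True stem[OF sc] unfolding xy \<rho>_def by simp
    qed
  qed
  have pH: "pair_graph H" using cH by (simp add: conn_graph_iff)
  have span: "\<rho> (f y) < \<rho> (f x) + card (pverts H)" if "x \<in> pverts H" "y \<in> pverts H" for x y
  proof (rule conn_span[OF cH _ that, of "\<lambda>x. \<rho> (f x)"])
    fix a b assume "adj H a b"
    moreover from this have "a \<in> pverts H" "b \<in> pverts H" using pg_verts[OF pH] by blast+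
    ultimately have "adj \<Gamma> (f a) (f b)" using H(2) by (simp add: emb_def)
    then show "\<rho> (f b) \<le> Suc (\<rho> (f a))" by (rule lip)
  qed
  have cN: "card (pverts H) < N" using h H(1) by fastforce
  show ?thesis
  proof (cases "\<exists>x\<in>pverts H. \<rho> (f x) = 0")
    case True
    then obtain x where x: "x \<in> pverts H" "\<rho> (f x) = 0" by blast
    have lt: "\<rho> (f y) < N" if "y \<in> pverts H" for y using span[OF x(1) that] x(2) cN by simp
    have ips: "ipath \<Gamma> (v (N + 2) # left i)" "ipath \<Gamma> (v (N + 3) # right i)"
      unfolding v_def by (rule left_ipath[OF i], rule right_ipath[OF i])
    have up: "[0..<N] = 0 # [1..<N]" using N1 by (simp add: upt_conv_Cons)
    have iz: "ipath \<Gamma> (v 0 # map v [1..<N])"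
      using ipath_appendD(1)[of \<Gamma> "map v [0..<N]" "[v N]"] fk unfolding fork_def up by simp
    have t: "adj \<Gamma> (v 0) (v (N + 2))" "adj \<Gamma> (v (N + 2)) (v (N + 3))" "adj \<Gamma> (v 0) (v (N + 3))"
      by (subst ad, simp, simp, simp add: tri_stem_adj)+
    have "anti (tri_stem N) {N + 2, N + 3} {1..<N}"
      by (auto simp: anti_def tri_stem_adj stem_arc_def)
    then have "anti \<Gamma> (v ` {N + 2, N + 3}) (v ` {1..<N})" unfolding v_def by (rule anti_core[OF i]) auto
    then have an: "anti \<Gamma> {v (N + 2), v (N + 3)} (v ` {1..<N})" unfolding image_insert image_empty .
    have al: "anti \<Gamma> (v ` ({0, N + 3} \<union> {1..<N})) (set (left i))"
      unfolding v_def by (rule core_anti_left[OF i]) auto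
    have ar: "anti \<Gamma> (v ` ({0, N + 2} \<union> {1..<N})) (set (right i))"
      unfolding v_def by (rule core_anti_right) auto
    have "\<exists>g. emb (F2_graph N) \<Gamma> g \<and>
      g ` pverts (F2_graph N) = {v 0, v (N + 2), v (N + 3)} \<union> set (map v [1..<N]) \<union> set (left i) \<union> set (right i)"
    proof (rule emb_F2[OF pg t iz ips])
      show "anti \<Gamma> {v (N + 2), v (N + 3)} (set (map v [1..<N]))" using an by simp
      show "anti \<Gamma> ({v 0, v (N + 3)} \<union> set (map v [1..<N])) (set (left i))" by (rule anti_mono[OF al]) auto
      show "anti \<Gamma> ({v 0, v (N + 2)} \<union> set (map v [1..<N])) (set (right i))" by (rule anti_mono[OF ar]) auto
    qed (use P(2) left_anti_right[OF i] in auto)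
    then obtain g where g: "emb (F2_graph N) \<Gamma> g"
      "g ` pverts (F2_graph N) = {v 0, v (N + 2), v (N + 3)} \<union> set (map v [1..<N]) \<union> set (left i) \<union> set (right i)"
      by (elim exE conjE)
    have "f ` pverts H \<subseteq> g ` pverts (F2_graph N)"
    proof
      fix u assume u: "u \<in> f ` pverts H"
      then have r: "\<rho> u < N" using lt by blast
      consider "u \<in> set (left i) \<union> set (right i)" | c where "c < N + 4" "u = v c"
        using u im unfolding v_def by blast
      then show "u \<in> g ` pverts (F2_graph N)"
      proof cases
        case 2
        then have "\<not> (N \<le> c \<and> c \<le> Suc N)" using r by (auto simp: \<rho>_def v_def)
        then have "c \<in> {0, N + 2, N + 3} \<union> {1..<N}" using 2 by auto
        then show ?thesis unfolding g(2) 2(2) by auto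
      qed (simp add: g(2))
    qed
    then show ?thesis using emb_fits[OF H(2) g(1)] H(1) by blast
  next
    case False
    obtain g where g: "emb (T_graph N) \<Gamma> g" "g ` pverts (T_graph N) = set (map v [0..<N]) \<union> {v N, v (Suc N)}"
      using emb_T[OF pg fk] by auto
    have "f ` pverts H \<subseteq> g ` pverts (T_graph N)"
    proof
      fix u assume u: "u \<in> f ` pverts H"
      then have r: "\<rho> u \<noteq> 0" using False by auto
      then obtain c where "u = v c" "c \<le> Suc N" by (cases u) (auto simp: \<rho>_def v_def split: if_splits)
      moreover from this have "c \<in> {0..<N} \<union> {N, Suc N}" by auto
      ultimately show "u \<in> g ` pverts (T_graph N)" unfolding g(2) by auto
    qed
    then show ?thesis using emb_fits[OF H(2) g(1)] H(1) by blast
  qed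
qed

text \<open>
  \<open>T\<^sub>p\<close> attached at every vertex of \<open>K\<^sub>n\<close>, with vertex \<open>k\<close> of the \<open>i\<close>-th copy named \<open>(i, k)\<close>. This graph
  itself has large deficiency: the leaves form an independent set that is twice as large as the set of
  branch vertices.
\<close>

definition k_stems :: "nat \<Rightarrow> nat \<Rightarrow> (nat \<times> nat) pair_pre_digraph" where
  "k_stems n p = \<lparr>pverts = {..<n} \<times> {..<p + 2},
     parcs = {((i, k), (j, l)) | i k j l. i < n \<and> j < n \<and>
       (i = j \<and> (stem_arc p k l \<or> stem_arc p l k) \<or> i \<noteq> j \<and> k = 0 \<and> l = 0)}\<rparr>"

lemma k_stems_adj: "adj (k_stems n p) (i, k) (j, l) \<longleftrightarrow> i < n \<and> j < n \<and>
   (i = j \<and> (stem_arc p k l \<or> stem_arc p l k) \<or> i \<noteq> j \<and> k = 0 \<and> l = 0)"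
  by (simp add: k_stems_def)

lemma k_stems_conn:
  assumes p: "1 \<le> p" and n: "1 \<le> n" shows "conn_graph (k_stems n p)"
proof (rule conn_graphI[of _ "(0, 0)"])
  have sl: "k < p + 2 \<and> l < p + 2 \<and> k \<noteq> l" if "stem_arc p k l" for k l using that by (auto simp: stem_arc_def)
  show "pair_graph (k_stems n p)"
    unfolding pair_graph_iff k_stems_def by (auto simp: sym_def dest: sl)
  show "(0, 0) \<in> pverts (k_stems n p)" using n by (simp add: k_stems_def)
  fix v assume "v \<in> pverts (k_stems n p)"
  then obtain i k where v: "v = (i, k)" "i < n" "k < p + 2" by (auto simp: k_stems_def)
  have "((0, 0), (i, 0)) \<in> (parcs (k_stems n p))\<^sup>*"
  proof (cases "i = 0")
    case False
    then have "adj (k_stems n p) (0, 0) (i, 0)" using v by (simp add: k_stems_adj)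
    then show ?thesis by blast
  qed simp
  moreover have "((i, 0), (i, k)) \<in> (parcs (k_stems n p))\<^sup>*"
    by (rule stem_reach[OF p _ v(3)]) (simp add: k_stems_adj v)
  ultimately show "((0, 0), v) \<in> (parcs (k_stems n p))\<^sup>*" unfolding v(1) by (rule rtrancl_trans)
qed

lemma hits_K_check:
  assumes p: "1 \<le> p" shows "\<exists>H\<in>\<H>. \<exists>h. emb H (K_check N p) h"
proof -
  let ?G = "k_stems N p" let ?I = "{..<N} \<times> {p, Suc p}" let ?S = "{..<N} \<times> {p - 1}"
  have C: "conn_graph ?G" using k_stems_conn[OF p] N4 by simp
  then have pg: "pair_graph ?G" by (simp add: conn_graph_iff)
  have "\<exists>H\<in>\<H>. \<exists>h. emb H ?G h"
  proof (rule forces_hit[OF F C, of ?I ?S])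
    show "?I \<subseteq> pverts ?G" "?S \<subseteq> pverts ?G" "?I \<inter> ?S = {}" using p by (auto simp: k_stems_def)
    show "y \<in> ?S" if "x \<in> ?I" "adj ?G x y" for x y
      using that p by (cases x; cases y) (auto simp: k_stems_adj stem_arc_def)
    show "b + real (card ?S) \<le> real (card ?I)" using b by (simp add: card_cartesian_product)
  qed
  then obtain H f where H: "H \<in> \<H>" "emb H ?G f" by blast
  have fk: "fork ?G (map (Pair i) [0..<p]) (i, p) (i, Suc p)" if "i < N" for i
    by (rule stem_fork[OF p]) (use that in \<open>auto simp: k_stems_def inj_def\<close>)
  have hd: "hd (map (Pair i) [0..<p]) = (i, 0)" "tl (map (Pair i) [0..<p]) = map (Pair i) [1..<p]" for i :: nat
    using p by (simp_all add: upt_conv_Cons)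
  have "spider ?G N p (\<lambda>i. map (Pair i) [0..<p]) (\<lambda>i. (i, p)) (\<lambda>i. (i, Suc p))"
    unfolding spider_def hd
  proof (intro conjI allI impI)
    fix i j assume ij: "i < N" "j < N" "i \<noteq> j"
    show "anti ?G (set (map (Pair i) [1..<p]) \<union> {(i, p), (i, Suc p)}) (set (map (Pair j) [0..<p]) \<union> {(j, p), (j, Suc p)})"
      unfolding anti_def
    proof (intro ballI)
      fix x y assume "x \<in> set (map (Pair i) [1..<p]) \<union> {(i, p), (i, Suc p)}"
        "y \<in> set (map (Pair j) [0..<p]) \<union> {(j, p), (j, Suc p)}"
      then obtain k l where "x = (i, k)" "1 \<le> k" "y = (j, l)" using p by auto
      then show "x \<noteq> y \<and> \<not> adj ?G x y" using ij by (simp add: k_stems_adj)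
    qed
  qed (use fk in \<open>auto simp: k_stems_adj\<close>)
  from emb_K_check[OF pg this p] obtain g where g: "emb (K_check N p) ?G g"
    "g ` pverts (K_check N p) = (\<Union>i<N. set (map (Pair i) [0..<p]) \<union> {(i, p), (i, Suc p)})"
    by (elim exE conjE)
  have "f ` pverts H \<subseteq> pverts ?G" using H(2) by (simp add: emb_def)
  also have "\<dots> \<subseteq> g ` pverts (K_check N p)"
  proof
    fix v assume "v \<in> pverts ?G"
    then obtain i k where v: "v = (i, k)" "i < N" "k < p + 2" by (auto simp: k_stems_def)
    then have "k \<in> {0..<p} \<union> {p, Suc p}" by auto
    then show "v \<in> g ` pverts (K_check N p)" using v unfolding g(2) by auto
  qed
  finally show ?thesis using emb_fits[OF H(2) g(1)] H(1) by blast
qed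

lemma hits_star: "\<exists>H\<in>\<H>. \<exists>h. emb H (star_graph N) h"
proof (rule forces_hit[OF F, of _ "{1..N}" "{0}"])
  have a: "adj (star_graph N) i j \<longleftrightarrow> i \<le> N \<and> j \<le> N \<and> (i = 0 \<and> j > 0 \<or> j = 0 \<and> i > 0)" for i j
    by (auto simp: star_graph_def ugraph_def)
  show "conn_graph (star_graph N)"
  proof (rule conn_graphI[OF pair_graph_star, of 0])
    fix v assume "v \<in> pverts (star_graph N)"
    then have "v = 0 \<or> adj (star_graph N) 0 v" by (auto simp: star_graph_def ugraph_def)
    then show "(0, v) \<in> (parcs (star_graph N))\<^sup>*" by blast
  qed (simp add: star_graph_def ugraph_def)
  show "y \<in> {0}" if "x \<in> {1..N}" "adj (star_graph N) x y" for x y using that by (auto simp: a)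
  show "b + real (card {0::nat}) \<le> real (card {1..N})" using b by simp
qed (auto simp: star_graph_def ugraph_def)

end

section \<open>The equivalence\<close>

text \<open>
  A graph without the members of \<open>\<H>\<close> contains none of the patterns either, since every pattern contains
  a member of \<open>\<H>\<close>.
\<close>

lemma bounded_if_family_le:
  assumes H: "\<forall>H\<in>\<H>. conn_graph H" and P: "\<forall>P\<in>\<P>. pair_graph P" and le: "\<H> \<le>\<^sub>I \<P>"
    and B: "\<forall>G::ngraph. conn_graph G \<longrightarrow> (\<forall>P\<in>\<P>. \<not> (\<exists>h. emb P G h)) \<longrightarrow> deficiency G < int B"
  shows "\<exists>b::real. b > 0 \<and> (\<forall>G::ngraph. conn_graph G \<and> free_of \<H> G \<longrightarrow> of_int (deficiency G) < b)"
proof (intro exI conjI allI impI)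
  show "0 < real B + 1" by simp
  fix G :: ngraph assume G: "conn_graph G \<and> free_of \<H> G"
  then have pG: "pair_graph G" by (simp add: conn_graph_iff)
  have "\<not> (\<exists>h. emb P G h)" if PP: "P \<in> \<P>" for P
  proof
    assume "\<exists>h. emb P G h"
    then obtain h where h: "emb P G h" by blast
    obtain H where H': "H \<in> \<H>" "H \<prec>\<^sub>I P" using le PP by (auto simp: family_le_def)
    have pH: "pair_graph H" using H H'(1) by (simp add: conn_graph_iff)
    obtain f where "emb H P f" using H'(2) induced_in_iff[OF pH] P PP by blast
    then have "H \<prec>\<^sub>I G" using induced_in_iff[OF pH pG] emb_trans[OF _ h] by blast
    then show False using G H'(1) by (simp add: free_of_def)
  qed
  then have "deficiency G < int B" using B G by blast
  then have "real_of_int (deficiency G) < real_of_int (int B)" by (simp only: of_int_less_iff)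
  then show "real_of_int (deficiency G) < real B + 1" by simp
qed

theorem theorem1p6:
  fixes \<H> :: "ngraph set"
  assumes "finite \<H>"
    and "\<forall>H\<in>\<H>. conn_graph H"
  shows "(\<exists>b::real. b > 0 \<and>
            (\<forall>G::ngraph. conn_graph G \<and> free_of \<H> G \<longrightarrow> of_int (deficiency G) < b))
      \<longleftrightarrow>
         (\<exists>n::nat. n \<ge> 4 \<and> even n \<and>
            (\<H> \<le>\<^sub>I {star_graph n, T_graph n} \<union> {K_check n p | p. 1 \<le> p \<and> p \<le> n div 2 - 1}
           \<or> \<H> \<le>\<^sub>I {star_graph n, F1_graph n, F2_graph n, F3_graph n, F4_graph n}
                  \<union> {F_check n p | p. 1 \<le> p \<and> p \<le> n - 2}
                  \<union> {K_check n p | p. 1 \<le> p \<and> p \<le> n - 2}))"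
  (is "?bounded \<longleftrightarrow> ?families")
proof
  assume ?bounded
  then obtain b :: real where F: "forces \<H> b"
    using assms(2) by (auto simp: forces_def)
  define h where "h = Max (insert 0 ((\<lambda>H. card (pverts H)) ` \<H>))"
  have h: "\<forall>H\<in>\<H>. card (pverts H) \<le> h" unfolding h_def using assms(1) by (intro ballI Max_ge) auto
  define n where "n = 2 * (h + nat \<lceil>b\<rceil> + 4)"
  have "b \<le> real (nat \<lceil>b\<rceil>)" by (rule real_nat_ceiling_ge)
  then have "b + 1 \<le> real n" by (simp add: n_def)
  moreover have "4 \<le> n" "even n" "\<forall>H\<in>\<H>. card (pverts H) + 4 \<le> n" using h by (fastforce simp: n_def)+
  ultimately interpret forcing_family \<H> b n
    using F by (intro forcing_family.intro)
  have pH: "pair_graph H" if "H \<in> \<H>" for H using assms(2) that by (simp add: conn_graph_iff)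
  have hit: "\<exists>H\<in>\<H>. H \<prec>\<^sub>I P" if "\<exists>H\<in>\<H>. \<exists>h. emb H P h" "pair_graph P" for P :: ngraph
    using that induced_in_iff[OF pH that(2)] by blast
  have K: "\<exists>H\<in>\<H>. H \<prec>\<^sub>I K_check n p" if "1 \<le> p" for p
    by (rule hit[OF hits_K_check[OF that] pair_graph_K_check[OF that]])
  have Fc: "\<exists>H\<in>\<H>. H \<prec>\<^sub>I F_check n p" if "1 \<le> p" for p
    by (rule hit[OF hits_F_check[OF that] pair_graph_F_check[OF that]])
  have S: "\<exists>H\<in>\<H>. H \<prec>\<^sub>I star_graph n" by (rule hit[OF hits_star pair_graph_star])
  have "\<H> \<le>\<^sub>I {star_graph n, T_graph n} \<union> {K_check n p | p. 1 \<le> p \<and> p \<le> n div 2 - 1}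
           \<or> \<H> \<le>\<^sub>I {star_graph n, F1_graph n, F2_graph n, F3_graph n, F4_graph n}
                  \<union> {F_check n p | p. 1 \<le> p \<and> p \<le> n - 2}
                  \<union> {K_check n p | p. 1 \<le> p \<and> p \<le> n - 2}"
    using hits_T_or_F2
  proof
    assume "\<exists>H\<in>\<H>. \<exists>h. emb H (T_graph n) h"
    then have "\<exists>H\<in>\<H>. H \<prec>\<^sub>I T_graph n" using pair_graph_T N4 by (intro hit) simp_all
    then have "\<H> \<le>\<^sub>I {star_graph n, T_graph n} \<union> {K_check n p | p. 1 \<le> p \<and> p \<le> n div 2 - 1}"
      unfolding family_le_def using S K by auto
    then show ?thesis ..
  next
    assume "\<exists>H\<in>\<H>. \<exists>h. emb H (F2_graph n) h"
    then have "\<exists>H\<in>\<H>. H \<prec>\<^sub>I F2_graph n" using pair_graph_F2 by (rule hit)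
    moreover have "\<exists>H\<in>\<H>. H \<prec>\<^sub>I F1_graph n" by (rule hit[OF hits_F1 pair_graph_F1])
    moreover have "\<exists>H\<in>\<H>. H \<prec>\<^sub>I F3_graph n" by (rule hit[OF hits_F3 pair_graph_F3])
    moreover have "\<exists>H\<in>\<H>. H \<prec>\<^sub>I F4_graph n" by (rule hit[OF hits_F4 pair_graph_F4])
    ultimately have "\<H> \<le>\<^sub>I {star_graph n, F1_graph n, F2_graph n, F3_graph n, F4_graph n}
                  \<union> {F_check n p | p. 1 \<le> p \<and> p \<le> n - 2} \<union> {K_check n p | p. 1 \<le> p \<and> p \<le> n - 2}"
      unfolding family_le_def using S K Fc by auto
    then show ?thesis ..
  qed
  then show ?families using e N4 by (intro exI[of _ n]) simp
next
  assume ?families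
  then obtain n :: nat where n: "4 \<le> n" "even n" and le:
    "\<H> \<le>\<^sub>I {star_graph n, T_graph n} \<union> {K_check n p | p. 1 \<le> p \<and> p \<le> n div 2 - 1}
           \<or> \<H> \<le>\<^sub>I {star_graph n, F1_graph n, F2_graph n, F3_graph n, F4_graph n}
                  \<union> {F_check n p | p. 1 \<le> p \<and> p \<le> n - 2}
                  \<union> {K_check n p | p. 1 \<le> p \<and> p \<le> n - 2}" by (elim exE conjE)
  note pgs = pair_graph_star pair_graph_T pair_graph_F1 pair_graph_F2 pair_graph_F3 pair_graph_F4
    pair_graph_F_check pair_graph_K_check
  from le show ?bounded
  proof
    let ?P = "{star_graph n, T_graph n} \<union> {K_check n p | p. 1 \<le> p \<and> p \<le> n div 2 - 1}"
    assume le: "\<H> \<le>\<^sub>I ?P"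
    from bounded_by_T[OF n] obtain B :: nat where B: "\<forall>G::ngraph. conn_graph G \<longrightarrow> \<not> (\<exists>h. emb (star_graph n) G h) \<longrightarrow>
      \<not> (\<exists>h. emb (T_graph n) G h) \<longrightarrow>
      (\<forall>p. 1 \<le> p \<and> p \<le> n div 2 - 1 \<longrightarrow> \<not> (\<exists>h. emb (K_check n p) G h)) \<longrightarrow> deficiency G < int B" by (elim exE)
    show ?bounded
    proof (rule bounded_if_family_le[OF assms(2) _ le])
      show "\<forall>P\<in>?P. pair_graph P" using pgs n by auto
      show "\<forall>G::ngraph. conn_graph G \<longrightarrow> (\<forall>P\<in>?P. \<not> (\<exists>h. emb P G h)) \<longrightarrow> deficiency G < int B"
      proof (intro allI impI)
        fix G :: ngraph assume G: "conn_graph G" "\<forall>P\<in>?P. \<not> (\<exists>h. emb P G h)"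
        show "deficiency G < int B"
          by (rule B[rule_format, OF G(1)]) (use G(2) in blast)+
      qed
    qed
  next
    let ?P = "{star_graph n, F1_graph n, F2_graph n, F3_graph n, F4_graph n}
                  \<union> {F_check n p | p. 1 \<le> p \<and> p \<le> n - 2}
                  \<union> {K_check n p | p. 1 \<le> p \<and> p \<le> n - 2}"
    assume le: "\<H> \<le>\<^sub>I ?P"
    from bounded_by_F[OF n(1)] obtain B :: nat where B: "\<forall>G::ngraph. conn_graph G \<longrightarrow> \<not> (\<exists>h. emb (star_graph n) G h) \<longrightarrow>
      avoids_F G n \<longrightarrow>
      (\<forall>p. 1 \<le> p \<and> p \<le> n - 2 \<longrightarrow> \<not> (\<exists>h. emb (K_check n p) G h)) \<longrightarrow> deficiency G < int B" by (elim exE)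
    show ?bounded
    proof (rule bounded_if_family_le[OF assms(2) _ le])
      show "\<forall>P\<in>?P. pair_graph P" using pgs n by auto
      show "\<forall>G::ngraph. conn_graph G \<longrightarrow> (\<forall>P\<in>?P. \<not> (\<exists>h. emb P G h)) \<longrightarrow> deficiency G < int B"
      proof (intro allI impI)
        fix G :: ngraph assume G: "conn_graph G" "\<forall>P\<in>?P. \<not> (\<exists>h. emb P G h)"
        have "avoids_F G n" unfolding avoids_F_def using G(2) by (intro conjI allI impI) blast+
        then show "deficiency G < int B"
          by (intro B[rule_format, OF G(1)]) (use G(2) in blast)+
      qed
    qed
  qed
qed

end
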